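(* Let $\theta$ be an action of an inverse semigroup $S$ on a locally compact Hausdorff space $X$. Then there is an isomorphism of C*-algebras $$S\ltimes^{\mathrm{KS}}C_0(X)\;\cong\; C^*(S\ltimes X^{\mathrm{KS}})$$ which, for each $s\in S$ and $f\in C_c(X_{s^*s})$, maps $\delta_s\,f$ to the function $\varphi(\delta_s\,f)\in C_c([s,X^{\mathrm{KS}}_{s^*s}])\subset\mathcal C(S\ltimes X^{\mathrm{KS}})$ given by $\varphi(\delta_s\,f)([s,\tau])=f(\tau(s^*s))$ for all $\tau\in X^{\mathrm{KS}}_{s^*s}$.
   Context: An inverse semigroup is a semigroup $S$ in which every $s$ has a unique $s^*$ with $ss^*s=s$, $s^*ss^*=s^*$; $E(S)$ is its commutative subsemigroup of idempotents; $s\le t$ means $ts^*s=s$. An action $\theta$ of $S$ on a topological space $X$ is a semigroup homomorphism $s\mapsto\theta_s$ from $S$ to the inverse semigroup of partial bijections of $X$ (bijections between subsets, composed on the largest possible domain) such that, writing $X_e$ for the subset on which $\theta_e$ ($e\in E(S)$) is the identity (so $\theta_s$ is a bijection $X_{s^*s}\to X_{ss^*}$): each $X_e$ is open, each $\theta_s\colon X_{s^*s}\to X_{ss^*}$ is continuous, and $\bigcup_{e\in E(S)}X_e=X$. The space $X^{\mathrm{KS}}$: let $\widetilde{X_e}=X_e\sqcup\{\infty_e\}$ be the one-point compactification of $X_e$ (a point $\infty_e$ is added even when $X_e$ is compact). Let $\widetilde{X^{\mathrm{KS}}}$ be the set of $\tau\in\prod_{e\in E(S)}\widetilde{X_e}$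 such that (1) if $e_1\le e_2$ and $\tau(e_1)\ne\infty_{e_1}$, then $\tau(e_2)=\tau(e_1)$; (2) if $\tau(e_1)\neq\infty_{e_1}$ and $\tau(e_2)\neq\infty_{e_2}$, then $\tau(e_1e_2)\neq\infty_{e_1e_2}$; with the topology induced from the product topology. Set $X^{\mathrm{KS}}=\widetilde{X^{\mathrm{KS}}}\setminus\{\infty\}$, $\infty=(\infty_e)_e$; it is locally compact Hausdorff. $S$ acts on $X^{\mathrm{KS}}$ by $X^{\mathrm{KS}}_e=\{\tau\in X^{\mathrm{KS}}\mid\tau(e)\ne\infty_e\}$ and $\theta^{\mathrm{KS}}_s\colon X^{\mathrm{KS}}_{s^*s}\to X^{\mathrm{KS}}_{ss^*}$, $\theta^{\mathrm{KS}}_s(\tau)(e)=\theta_{es}(\tau(s^*es))$ if $\tau(s^*es)\neq\infty_{s^*es}$ and $\infty_e$ otherwise. Transformation groupoid: for an action $\theta$ of $S$ on a locally compact Hausdorff space $Z$, $S\ltimes Z$ is the set of classes $[s,z]$ of pairs $(s,z)$, $z\in Z_{s^*s}$, under $(s,z)\sim(t,w)$ iff $z=w$ and $se=te$, $z\in Z_e$ for some $e\in E(S)$; unit space $\{[e,z]\}\cong Z$, $d([s,z])=z$, $r([s,z])=\theta_s(z)$, $[t,\theta_s(z)][s,z]=[ts,z]$, $[s,z]^{-1}=[s^*,\theta_s(z)]$; basis of open sets $[s,U]=\{[s,z]\mid z\in U\}$, $U\subset Z_{s^*s}$ open. It is an étale groupoid (possibly non-Hausdorff). $S\ltimes X^{\mathrm{KS}}$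 is the KS-groupoid. Full groupoid C*-algebra: for an étale groupoid $G$ (unit space locally compact Hausdorff), $\mathcal C(G)$ is the linear span in $\mathbb C^G$ of all $C_c(U)$, $U\subset G$ open bisection (open subset on which $d$ and $r$ are injective), functions being extended by zero; it is a $*$-algebra with $f*g(\gamma)=\sum_{\beta\in G,\,d(\beta)=d(\gamma)}f(\gamma\beta^{-1})g(\beta)$, $f^*(\gamma)=\overline{f(\gamma^{-1})}$. $C^*(G)$ is the universal enveloping C*-algebra of $\mathcal C(G)$. Full KS-crossed product: $S$ acts on $A=C_0(X)$ via ideals $A_e=C_0(X_e)$ and $\alpha_s\colon C_0(X_{s^*s})\to C_0(X_{ss^*})$, $\alpha_s(f)=f\circ\theta_{s^*}$. Let $S\ltimes^{\mathrm{KS}}_{\mathrm{alg}}C_0(X)=\bigoplus_{s\in S}C_0(X_{s^*s})$ (algebraic direct sum), with $\delta_s\,f$ the element having $f\in C_0(X_{s^*s})$ in the $s$-th component and $0$ elsewhere; it is a $*$-algebra with $(\delta_s f)(\delta_t g)=\delta_{st}\,\alpha_{t^*}(f\alpha_t(g))$ and $(\delta_s f)^*=\delta_{s^*}\,\alpha_s(f^* )$. $S\ltimes^{\mathrm{KS}}C_0(X)$ is its universal enveloping C*-algebra. *)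

theory Defs
  imports "HOL-Analysis.Analysis"
begin

section \<open>Inverse semigroups and their actions\<close>

class inverse_semigroup = semigroup_mult +
  assumes ex1_inverse: "\<exists>!t. s * t * s = s \<and> t * s * t = t"

definition inv_star :: "'s::inverse_semigroup \<Rightarrow> 's"  ("_\<^sup>\<star>" [1000] 1000)
  where "s\<^sup>\<star> = (THE t. s * t * s = s \<and> t * s * t = t)"

definition idempotents :: "'s::inverse_semigroup set"
  where "idempotents = {e. e * e = e}"

definition natural_le :: "'s::inverse_semigroup \<Rightarrow> 's \<Rightarrow> bool"
  where "natural_le s t \<longleftrightarrow> t * s\<^sup>\<star> * s = s"

text \<open>Partial maps of \<open>X\<close> are modelled by \<open>'x \<rightharpoonup> 'x\<close>; \<open>\<circ>\<^sub>m\<close> is composition on the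
  largest possible domain.\<close>

definition partial_bijection :: "'x set \<Rightarrow> ('x \<rightharpoonup> 'x) \<Rightarrow> bool"
  where "partial_bijection X m \<longleftrightarrow> dom m \<subseteq> X \<and> ran m \<subseteq> X \<and> inj_on m (dom m)"

definition act_dom :: "('s::inverse_semigroup \<Rightarrow> 'x \<rightharpoonup> 'x) \<Rightarrow> 's \<Rightarrow> 'x set"
  where "act_dom \<theta> e = {x. \<theta> e x = Some x}"

definition is_action :: "'x topology \<Rightarrow> ('s::inverse_semigroup \<Rightarrow> 'x \<rightharpoonup> 'x) \<Rightarrow> bool"
  where "is_action X \<theta> \<longleftrightarrow>
    (\<forall>s. partial_bijection (topspace X) (\<theta> s)) \<and>
    (\<forall>s t. \<theta> (s * t) = \<theta> s \<circ>\<^sub>m \<theta> t) \<and>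
    (\<forall>e\<in>idempotents. openin X (act_dom \<theta> e)) \<and>
    (\<forall>s. continuous_map (subtopology X (act_dom \<theta> (s\<^sup>\<star> * s)))
                        (subtopology X (act_dom \<theta> (s * s\<^sup>\<star>))) (\<lambda>x. the (\<theta> s x))) \<and>
    (\<Union>e\<in>idempotents. act_dom \<theta> e) = topspace X"


section \<open>The space \<open>X\<^sup>K\<^sup>S\<close>\<close>

text \<open>The point \<open>\<infinity>\<^sub>e\<close> is \<open>None\<close>; the library's one-point compactification adds it also
  when the space is already compact.\<close>

definition KS_product :: "'x topology \<Rightarrow> ('s::inverse_semigroup \<Rightarrow> 'x \<rightharpoonup> 'x) \<Rightarrow> ('s \<Rightarrow> 'x option) topology"
  where "KS_product X \<theta> =
    product_topology (\<lambda>e. Alexandroff_compactification (subtopology X (act_dom \<theta> e))) idempotents"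

definition KS_tilde :: "'x topology \<Rightarrow> ('s::inverse_semigroup \<Rightarrow> 'x \<rightharpoonup> 'x) \<Rightarrow> ('s \<Rightarrow> 'x option) set"
  where "KS_tilde X \<theta> = {\<tau> \<in> topspace (KS_product X \<theta>).
    (\<forall>e1\<in>idempotents. \<forall>e2\<in>idempotents. natural_le e1 e2 \<and> \<tau> e1 \<noteq> None \<longrightarrow> \<tau> e2 = \<tau> e1) \<and>
    (\<forall>e1\<in>idempotents. \<forall>e2\<in>idempotents. \<tau> e1 \<noteq> None \<and> \<tau> e2 \<noteq> None \<longrightarrow> \<tau> (e1 * e2) \<noteq> None)}"

definition KS_infinity :: "'s::inverse_semigroup \<Rightarrow> 'x option"
  where "KS_infinity = (\<lambda>e\<in>idempotents. None)"

definition KS_space :: "'x topology \<Rightarrow> ('s::inverse_semigroup \<Rightarrow> 'x \<rightharpoonup> 'x) \<Rightarrow> ('s \<Rightarrow> 'x option) topology"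
  where "KS_space X \<theta> = subtopology (KS_product X \<theta>) (KS_tilde X \<theta> - {KS_infinity})"

definition KS_dom :: "'x topology \<Rightarrow> ('s::inverse_semigroup \<Rightarrow> 'x \<rightharpoonup> 'x) \<Rightarrow> 's \<Rightarrow> ('s \<Rightarrow> 'x option) set"
  where "KS_dom X \<theta> e = {\<tau> \<in> topspace (KS_space X \<theta>). \<tau> e \<noteq> None}"

definition KS_action :: "'x topology \<Rightarrow> ('s::inverse_semigroup \<Rightarrow> 'x \<rightharpoonup> 'x)
    \<Rightarrow> 's \<Rightarrow> ('s \<Rightarrow> 'x option) \<rightharpoonup> ('s \<Rightarrow> 'x option)"
  where "KS_action X \<theta> s \<tau> =
    (if \<tau> \<in> KS_dom X \<theta> (s\<^sup>\<star> * s)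
     then Some (\<lambda>e\<in>idempotents. case \<tau> (s\<^sup>\<star> * e * s) of None \<Rightarrow> None | Some x \<Rightarrow> \<theta> (e * s) x)
     else None)"


section \<open>Transformation groupoids\<close>

text \<open>The unit space is identified with a space of points of type \<open>'z\<close>, in which the
  domain and range maps take their values. The arrows are the points of the topology.\<close>

record ('g, 'z) top_groupoid =
  gtop :: "'g topology"
  gdom :: "'g \<Rightarrow> 'z"
  grng :: "'g \<Rightarrow> 'z"
  gmult :: "'g \<Rightarrow> 'g \<Rightarrow> 'g"
  ginv :: "'g \<Rightarrow> 'g"

definition germ_rel :: "('s::inverse_semigroup \<Rightarrow> 'z \<rightharpoonup> 'z) \<Rightarrow> (('s \<times> 'z) \<times> ('s \<times> 'z)) set"
  where "germ_rel \<theta> = {((s, z), (t, w)).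
    z \<in> act_dom \<theta> (s\<^sup>\<star> * s) \<and> w \<in> act_dom \<theta> (t\<^sup>\<star> * t) \<and>
    z = w \<and> (\<exists>e\<in>idempotents. s * e = t * e \<and> z \<in> act_dom \<theta> e)}"

definition germ :: "('s::inverse_semigroup \<Rightarrow> 'z \<rightharpoonup> 'z) \<Rightarrow> 's \<Rightarrow> 'z \<Rightarrow> ('s \<times> 'z) set"
  where "germ \<theta> s z = germ_rel \<theta> `` {(s, z)}"

definition transformation_groupoid ::
    "'z topology \<Rightarrow> ('s::inverse_semigroup \<Rightarrow> 'z \<rightharpoonup> 'z) \<Rightarrow> (('s \<times> 'z) set, 'z) top_groupoid"
  where "transformation_groupoid Z \<theta> = \<lparr>
    gtop = topology_generated_by {germ \<theta> s ` U | s U. openin Z U \<and> U \<subseteq> act_dom \<theta> (s\<^sup>\<star> * s)},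
    gdom = (\<lambda>\<gamma>. THE z. \<exists>s. (s, z) \<in> \<gamma>),
    grng = (\<lambda>\<gamma>. THE y. \<exists>s z. (s, z) \<in> \<gamma> \<and> \<theta> s z = Some y),
    gmult = (\<lambda>\<gamma> \<beta>. THE \<eta>. \<exists>t s z y. (s, z) \<in> \<beta> \<and> \<theta> s z = Some y \<and> (t, y) \<in> \<gamma> \<and> \<eta> = germ \<theta> (t * s) z),
    ginv = (\<lambda>\<gamma>. THE \<eta>. \<exists>s z y. (s, z) \<in> \<gamma> \<and> \<theta> s z = Some y \<and> \<eta> = germ \<theta> (s\<^sup>\<star>) y)\<rparr>"

definition KS_groupoid :: "'x topology \<Rightarrow> ('s::inverse_semigroup \<Rightarrow> 'x \<rightharpoonup> 'x)
    \<Rightarrow> (('s \<times> ('s \<Rightarrow> 'x option)) set, 's \<Rightarrow> 'x option) top_groupoid"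
  where "KS_groupoid X \<theta> = transformation_groupoid (KS_space X \<theta>) (KS_action X \<theta>)"


section \<open>*-algebras and C*-algebras\<close>

text \<open>Algebras are not assumed to be unital.\<close>

record 'a star_alg =
  acarrier :: "'a set"
  azero :: 'a
  aadd :: "'a \<Rightarrow> 'a \<Rightarrow> 'a"
  ascale :: "complex \<Rightarrow> 'a \<Rightarrow> 'a"
  amult :: "'a \<Rightarrow> 'a \<Rightarrow> 'a"
  astar :: "'a \<Rightarrow> 'a"

record 'a cstar_alg = "'a star_alg" +
  anorm :: "'a \<Rightarrow> real"

definition adiff :: "('a, 'm) star_alg_scheme \<Rightarrow> 'a \<Rightarrow> 'a \<Rightarrow> 'a"
  where "adiff A a b = aadd A a (ascale A (-1) b)"

locale star_algebra =
  fixes A :: "('a, 'm) star_alg_scheme"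
  assumes zero_closed: "azero A \<in> acarrier A"
    and add_closed: "\<lbrakk>a \<in> acarrier A; b \<in> acarrier A\<rbrakk> \<Longrightarrow> aadd A a b \<in> acarrier A"
    and scale_closed: "a \<in> acarrier A \<Longrightarrow> ascale A k a \<in> acarrier A"
    and mult_closed: "\<lbrakk>a \<in> acarrier A; b \<in> acarrier A\<rbrakk> \<Longrightarrow> amult A a b \<in> acarrier A"
    and star_closed: "a \<in> acarrier A \<Longrightarrow> astar A a \<in> acarrier A"
    and add_assoc: "\<lbrakk>a \<in> acarrier A; b \<in> acarrier A; c \<in> acarrier A\<rbrakk>
      \<Longrightarrow> aadd A (aadd A a b) c = aadd A a (aadd A b c)"
    and add_commute: "\<lbrakk>a \<in> acarrier A; b \<in> acarrier A\<rbrakk> \<Longrightarrow> aadd A a b = aadd A b a"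
    and add_zero: "a \<in> acarrier A \<Longrightarrow> aadd A a (azero A) = a"
    and diff_self: "a \<in> acarrier A \<Longrightarrow> adiff A a a = azero A"
    and scale_add_right: "\<lbrakk>a \<in> acarrier A; b \<in> acarrier A\<rbrakk>
      \<Longrightarrow> ascale A k (aadd A a b) = aadd A (ascale A k a) (ascale A k b)"
    and scale_add_left: "a \<in> acarrier A \<Longrightarrow> ascale A (k + l) a = aadd A (ascale A k a) (ascale A l a)"
    and scale_scale: "a \<in> acarrier A \<Longrightarrow> ascale A k (ascale A l a) = ascale A (k * l) a"
    and scale_one: "a \<in> acarrier A \<Longrightarrow> ascale A 1 a = a"
    and mult_assoc: "\<lbrakk>a \<in> acarrier A; b \<in> acarrier A; c \<in> acarrier A\<rbrakk>
      \<Longrightarrow> amult A (amult A a b) c = amult A a (amult A b c)"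
    and mult_add_left: "\<lbrakk>a \<in> acarrier A; b \<in> acarrier A; c \<in> acarrier A\<rbrakk>
      \<Longrightarrow> amult A (aadd A a b) c = aadd A (amult A a c) (amult A b c)"
    and mult_add_right: "\<lbrakk>a \<in> acarrier A; b \<in> acarrier A; c \<in> acarrier A\<rbrakk>
      \<Longrightarrow> amult A a (aadd A b c) = aadd A (amult A a b) (amult A a c)"
    and mult_scale_left: "\<lbrakk>a \<in> acarrier A; b \<in> acarrier A\<rbrakk>
      \<Longrightarrow> amult A (ascale A k a) b = ascale A k (amult A a b)"
    and mult_scale_right: "\<lbrakk>a \<in> acarrier A; b \<in> acarrier A\<rbrakk>
      \<Longrightarrow> amult A a (ascale A k b) = ascale A k (amult A a b)"
    and star_star: "a \<in> acarrier A \<Longrightarrow> astar A (astar A a) = a"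
    and star_add: "\<lbrakk>a \<in> acarrier A; b \<in> acarrier A\<rbrakk>
      \<Longrightarrow> astar A (aadd A a b) = aadd A (astar A a) (astar A b)"
    and star_scale: "a \<in> acarrier A \<Longrightarrow> astar A (ascale A k a) = ascale A (cnj k) (astar A a)"
    and star_mult: "\<lbrakk>a \<in> acarrier A; b \<in> acarrier A\<rbrakk>
      \<Longrightarrow> astar A (amult A a b) = amult A (astar A b) (astar A a)"

definition cstar_seminorm :: "('a, 'm) star_alg_scheme \<Rightarrow> ('a \<Rightarrow> real) \<Rightarrow> bool"
  where "cstar_seminorm A p \<longleftrightarrow>
    (\<forall>a\<in>acarrier A. 0 \<le> p a) \<and>
    (\<forall>a\<in>acarrier A. \<forall>b\<in>acarrier A. p (aadd A a b) \<le> p a + p b) \<and>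
    (\<forall>k. \<forall>a\<in>acarrier A. p (ascale A k a) = cmod k * p a) \<and>
    (\<forall>a\<in>acarrier A. \<forall>b\<in>acarrier A. p (amult A a b) \<le> p a * p b) \<and>
    (\<forall>a\<in>acarrier A. p (amult A (astar A a) a) = (p a)\<^sup>2)"

definition Cauchy_in :: "('a, 'm) star_alg_scheme \<Rightarrow> ('a \<Rightarrow> real) \<Rightarrow> (nat \<Rightarrow> 'a) \<Rightarrow> bool"
  where "Cauchy_in A p \<sigma> \<longleftrightarrow> (\<forall>n. \<sigma> n \<in> acarrier A) \<and>
    (\<forall>\<epsilon>>0. \<exists>N. \<forall>m\<ge>N. \<forall>n\<ge>N. p (adiff A (\<sigma> m) (\<sigma> n)) < \<epsilon>)"

locale cstar_algebra = star_algebra A for A :: "('a, 'm) cstar_alg_scheme" +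
  assumes norm_seminorm: "cstar_seminorm A (anorm A)"
    and norm_eq_zero: "\<lbrakk>a \<in> acarrier A; anorm A a = 0\<rbrakk> \<Longrightarrow> a = azero A"
    and complete: "Cauchy_in A (anorm A) \<sigma>
      \<Longrightarrow> \<exists>a\<in>acarrier A. (\<lambda>n. anorm A (adiff A (\<sigma> n) a)) \<longlonglongrightarrow> 0"

definition star_hom :: "('a, 'm) star_alg_scheme \<Rightarrow> ('b, 'n) star_alg_scheme \<Rightarrow> ('a \<Rightarrow> 'b) \<Rightarrow> bool"
  where "star_hom A B \<Phi> \<longleftrightarrow>
    (\<forall>a\<in>acarrier A. \<Phi> a \<in> acarrier B) \<and>
    (\<forall>a\<in>acarrier A. \<forall>b\<in>acarrier A. \<Phi> (aadd A a b) = aadd B (\<Phi> a) (\<Phi> b)) \<and>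
    (\<forall>k. \<forall>a\<in>acarrier A. \<Phi> (ascale A k a) = ascale B k (\<Phi> a)) \<and>
    (\<forall>a\<in>acarrier A. \<forall>b\<in>acarrier A. \<Phi> (amult A a b) = amult B (\<Phi> a) (\<Phi> b)) \<and>
    (\<forall>a\<in>acarrier A. \<Phi> (astar A a) = astar B (\<Phi> a))"

text \<open>Such a map is automatically isometric.\<close>

definition cstar_isomorphism ::
    "('a, 'm) cstar_alg_scheme \<Rightarrow> ('b, 'n) cstar_alg_scheme \<Rightarrow> ('a \<Rightarrow> 'b) \<Rightarrow> bool"
  where "cstar_isomorphism A B \<Phi> \<longleftrightarrow>
    cstar_algebra A \<and> cstar_algebra B \<and> star_hom A B \<Phi> \<and> bij_betw \<Phi> (acarrier A) (acarrier B)"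


section \<open>The universal enveloping C*-algebra\<close>

text \<open>The seminorms \<open>\<parallel>\<pi> a\<parallel>\<close> given by the *-homomorphisms \<open>\<pi>\<close> from \<open>A\<close> into C*-algebras are
  exactly the C*-seminorms on \<open>A\<close>, so quantifying over C*-seminorms avoids a quantification
  over types. The universal enveloping C*-algebra is the separated completion of \<open>A\<close> in the
  supremum of these seminorms, realised by classes of Cauchy sequences; its elements are the
  classes, and \<open>env_map\<close> is the canonical map from \<open>A\<close>. The universal property is
  verified in \<open>env_cstar_algebra\<close>, \<open>env_universal\<close> and \<open>env_universal_unique\<close> below.\<close>

definition env_norm :: "('a, 'm) star_alg_scheme \<Rightarrow> 'a \<Rightarrow> real"
  where "env_norm A a = (SUP p\<in>{p. cstar_seminorm A p}. p a)"

definition env_rel :: "('a, 'm) star_alg_scheme \<Rightarrow> ((nat \<Rightarrow> 'a) \<times> (nat \<Rightarrow> 'a)) set"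
  where "env_rel A = {(\<sigma>, \<rho>). Cauchy_in A (env_norm A) \<sigma> \<and> Cauchy_in A (env_norm A) \<rho> \<and>
    (\<lambda>n. env_norm A (adiff A (\<sigma> n) (\<rho> n))) \<longlonglongrightarrow> 0}"

definition enveloping :: "('a, 'm) star_alg_scheme \<Rightarrow> (nat \<Rightarrow> 'a) set cstar_alg"
  where "enveloping A = \<lparr>
    acarrier = Collect (Cauchy_in A (env_norm A)) // env_rel A,
    azero = env_rel A `` {\<lambda>_. azero A},
    aadd = (\<lambda>u v. \<Union>\<sigma>\<in>u. \<Union>\<rho>\<in>v. env_rel A `` {\<lambda>n. aadd A (\<sigma> n) (\<rho> n)}),
    ascale = (\<lambda>k u. \<Union>\<sigma>\<in>u. env_rel A `` {\<lambda>n. ascale A k (\<sigma> n)}),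
    amult = (\<lambda>u v. \<Union>\<sigma>\<in>u. \<Union>\<rho>\<in>v. env_rel A `` {\<lambda>n. amult A (\<sigma> n) (\<rho> n)}),
    astar = (\<lambda>u. \<Union>\<sigma>\<in>u. env_rel A `` {\<lambda>n. astar A (\<sigma> n)}),
    anorm = (\<lambda>u. THE r. \<exists>\<sigma>\<in>u. (\<lambda>n. env_norm A (\<sigma> n)) \<longlonglongrightarrow> r)\<rparr>"

definition env_map :: "('a, 'm) star_alg_scheme \<Rightarrow> 'a \<Rightarrow> (nat \<Rightarrow> 'a) set"
  where "env_map A a = env_rel A `` {\<lambda>_. a}"

context star_algebra
begin

lemmas closed = zero_closed add_closed scale_closed mult_closed star_closed

lemma diff_closed: "\<lbrakk>a \<in> acarrier A; b \<in> acarrier A\<rbrakk> \<Longrightarrow> adiff A a b \<in> acarrier A"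
  by (simp add: adiff_def closed)

lemma add_left_commute: "\<lbrakk>a \<in> acarrier A; b \<in> acarrier A; c \<in> acarrier A\<rbrakk>
    \<Longrightarrow> aadd A a (aadd A b c) = aadd A b (aadd A a c)"
  by (metis add_assoc add_commute)

lemma neg_add: "a \<in> acarrier A \<Longrightarrow> aadd A (ascale A (-1) a) a = azero A"
  using diff_self[of a] add_commute[of a "ascale A (-1) a"] by (simp add: adiff_def closed)

lemma zero_add: "a \<in> acarrier A \<Longrightarrow> aadd A (azero A) a = a"
  by (metis add_zero add_commute zero_closed)

lemma diff_add_cancel: "\<lbrakk>a \<in> acarrier A; b \<in> acarrier A\<rbrakk> \<Longrightarrow> aadd A (adiff A a b) b = a"
  by (simp add: adiff_def closed add_assoc neg_add add_zero)

lemma diff_trans: "\<lbrakk>a \<in> acarrier A; b \<in> acarrier A; c \<in> acarrier A\<rbrakk>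
    \<Longrightarrow> adiff A a c = aadd A (adiff A a b) (adiff A b c)"
  by (metis add_assoc adiff_def diff_add_cancel diff_closed scale_closed)

lemma diff_swap: "\<lbrakk>a \<in> acarrier A; b \<in> acarrier A\<rbrakk> \<Longrightarrow> adiff A b a = ascale A (-1) (adiff A a b)"
  by (simp add: adiff_def closed scale_add_right scale_scale scale_one add_commute)

lemma diff_add_add: "\<lbrakk>a \<in> acarrier A; b \<in> acarrier A; c \<in> acarrier A; d \<in> acarrier A\<rbrakk>
    \<Longrightarrow> adiff A (aadd A a b) (aadd A c d) = aadd A (adiff A a c) (adiff A b d)"
  by (simp add: adiff_def closed scale_add_right add_assoc add_left_commute)

lemma diff_scale: "\<lbrakk>a \<in> acarrier A; b \<in> acarrier A\<rbrakk>
    \<Longrightarrow> adiff A (ascale A k a) (ascale A k b) = ascale A k (adiff A a b)"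
  by (simp add: adiff_def closed scale_add_right scale_scale)

lemma diff_star: "\<lbrakk>a \<in> acarrier A; b \<in> acarrier A\<rbrakk>
    \<Longrightarrow> adiff A (astar A a) (astar A b) = astar A (adiff A a b)"
  by (simp add: adiff_def closed star_add star_scale)

lemma diff_mult: "\<lbrakk>a \<in> acarrier A; b \<in> acarrier A; c \<in> acarrier A; d \<in> acarrier A\<rbrakk>
    \<Longrightarrow> adiff A (amult A a b) (amult A c d) = aadd A (amult A (adiff A a c) b) (amult A c (adiff A b d))"
proof -
  assume *: "a \<in> acarrier A" "b \<in> acarrier A" "c \<in> acarrier A" "d \<in> acarrier A"
  have "amult A (adiff A a c) b = adiff A (amult A a b) (amult A c b)"
    using * by (simp add: adiff_def closed mult_add_left mult_scale_left)
  moreover have "amult A c (adiff A b d) = adiff A (amult A c b) (amult A c d)"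
    using * by (simp add: adiff_def closed mult_add_right mult_scale_right)
  ultimately show ?thesis
    using * diff_trans[of "amult A a b" "amult A c b" "amult A c d"] by (simp add: closed)
qed

lemma diff_zero_iff: "\<lbrakk>a \<in> acarrier A; b \<in> acarrier A\<rbrakk> \<Longrightarrow> adiff A a b = azero A \<longleftrightarrow> a = b"
  by (metis diff_add_cancel diff_self zero_add)

lemma scale_0: "a \<in> acarrier A \<Longrightarrow> ascale A 0 a = azero A"
  using scale_add_left[of a 1 "-1"] diff_self[of a] by (simp add: adiff_def scale_one)

lemma diff_zero: "a \<in> acarrier A \<Longrightarrow> adiff A a (azero A) = a"
  by (metis add_zero diff_add_cancel diff_closed zero_closed)

end

locale seminormed_star_algebra = star_algebra A for A :: "('a, 'm) star_alg_scheme" +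
  fixes q :: "'a \<Rightarrow> real"
  assumes q: "cstar_seminorm A q"
begin

lemma q_nonneg: "a \<in> acarrier A \<Longrightarrow> 0 \<le> q a"
  and q_add: "\<lbrakk>a \<in> acarrier A; b \<in> acarrier A\<rbrakk> \<Longrightarrow> q (aadd A a b) \<le> q a + q b"
  and q_scale: "a \<in> acarrier A \<Longrightarrow> q (ascale A k a) = cmod k * q a"
  and q_mult: "\<lbrakk>a \<in> acarrier A; b \<in> acarrier A\<rbrakk> \<Longrightarrow> q (amult A a b) \<le> q a * q b"
  and q_cstar: "a \<in> acarrier A \<Longrightarrow> q (amult A (astar A a) a) = (q a)\<^sup>2"
  using q by (auto simp: cstar_seminorm_def)

lemma q_zero: "q (azero A) = 0"
  using q_scale[of "azero A" 0] by (simp add: scale_0 zero_closed)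

lemma q_star_le: "a \<in> acarrier A \<Longrightarrow> q a \<le> q (astar A a)"
proof -
  assume a: "a \<in> acarrier A"
  have "q a * q a \<le> q (astar A a) * q a"
    using q_cstar[OF a] q_mult[of "astar A a" a] a by (simp add: closed power2_eq_square)
  then show ?thesis
    using q_nonneg[OF a] q_nonneg[OF star_closed[OF a]] by (cases "q a = 0") auto
qed

lemma q_star: "a \<in> acarrier A \<Longrightarrow> q (astar A a) = q a"
  using q_star_le[of a] q_star_le[of "astar A a"] by (simp add: closed star_star)

lemma q_swap: "\<lbrakk>a \<in> acarrier A; b \<in> acarrier A\<rbrakk> \<Longrightarrow> q (adiff A b a) = q (adiff A a b)"
  by (simp add: diff_swap[of a b] q_scale diff_closed)

lemma q_trans: "\<lbrakk>a \<in> acarrier A; b \<in> acarrier A; c \<in> acarrier A\<rbrakk>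
    \<Longrightarrow> q (adiff A a c) \<le> q (adiff A a b) + q (adiff A b c)"
  by (metis diff_closed diff_trans q_add)

lemma q_le: "\<lbrakk>a \<in> acarrier A; b \<in> acarrier A\<rbrakk> \<Longrightarrow> q a \<le> q (adiff A a b) + q b"
  by (metis diff_add_cancel diff_closed q_add)

lemma q_diff_abs: "\<lbrakk>a \<in> acarrier A; b \<in> acarrier A\<rbrakk> \<Longrightarrow> \<bar>q a - q b\<bar> \<le> q (adiff A a b)"
  using q_le[of a b] q_le[of b a] q_swap[of a b] by auto

lemma q_add_diff: "\<lbrakk>a \<in> acarrier A; b \<in> acarrier A; c \<in> acarrier A; d \<in> acarrier A\<rbrakk>
    \<Longrightarrow> q (adiff A (aadd A a b) (aadd A c d)) \<le> q (adiff A a c) + q (adiff A b d)"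
  by (simp add: diff_add_add diff_closed q_add)

lemma q_mult_diff: "\<lbrakk>a \<in> acarrier A; b \<in> acarrier A; c \<in> acarrier A; d \<in> acarrier A\<rbrakk>
    \<Longrightarrow> q (adiff A (amult A a b) (amult A c d)) \<le> q (adiff A a c) * q b + q c * q (adiff A b d)"
  using q_add[of "amult A (adiff A a c) b" "amult A c (adiff A b d)"]
    q_mult[of "adiff A a c" b] q_mult[of c "adiff A b d"]
  by (simp add: diff_mult diff_closed closed)

lemma q_scale_diff: "\<lbrakk>a \<in> acarrier A; b \<in> acarrier A\<rbrakk>
    \<Longrightarrow> q (adiff A (ascale A k a) (ascale A k b)) = cmod k * q (adiff A a b)"
  by (simp add: diff_scale diff_closed q_scale)

lemma q_star_diff: "\<lbrakk>a \<in> acarrier A; b \<in> acarrier A\<rbrakk>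
    \<Longrightarrow> q (adiff A (astar A a) (astar A b)) = q (adiff A a b)"
  by (simp add: diff_star diff_closed q_star)

lemma Cauchy_inD: "Cauchy_in A q \<sigma> \<Longrightarrow> \<sigma> n \<in> acarrier A"
  by (simp add: Cauchy_in_def)

lemma Cauchy_const: "a \<in> acarrier A \<Longrightarrow> Cauchy_in A q (\<lambda>_. a)"
  by (simp add: Cauchy_in_def diff_self q_zero)

lemma Cauchy_norm: assumes "Cauchy_in A q \<sigma>" shows "convergent (\<lambda>n. q (\<sigma> n))"
proof -
  have "Cauchy (\<lambda>n. q (\<sigma> n))"
    unfolding Cauchy_def dist_real_def
    using assms q_diff_abs Cauchy_inD[OF assms]
    unfolding Cauchy_in_def by (meson le_less_trans)
  then show ?thesis by (simp add: Cauchy_convergent_iff)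
qed

lemma Cauchy_bounded: assumes "Cauchy_in A q \<sigma>" shows "\<exists>K>0. \<forall>n. q (\<sigma> n) \<le> K"
proof -
  have "Bseq (\<lambda>n. q (\<sigma> n))" using Cauchy_norm[OF assms] by (rule convergent_imp_Bseq)
  then obtain K where "K > 0" "\<And>n. norm (q (\<sigma> n)) \<le> K" by (auto simp: Bseq_def)
  then show ?thesis by (metis abs_ge_self order_trans real_norm_def)
qed

lemma Cauchy_add: assumes s: "Cauchy_in A q \<sigma>" and r: "Cauchy_in A q \<rho>"
  shows "Cauchy_in A q (\<lambda>n. aadd A (\<sigma> n) (\<rho> n))"
  unfolding Cauchy_in_def
proof (intro conjI allI impI)
  show "aadd A (\<sigma> n) (\<rho> n) \<in> acarrier A" for n
    by (simp add: closed Cauchy_inD[OF s] Cauchy_inD[OF r])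
  fix \<epsilon> :: real assume "\<epsilon> > 0"
  then have "\<epsilon>/2 > 0" by simp
  with s r obtain M N where M: "\<forall>m\<ge>M. \<forall>n\<ge>M. q (adiff A (\<sigma> m) (\<sigma> n)) < \<epsilon>/2"
    and N: "\<forall>m\<ge>N. \<forall>n\<ge>N. q (adiff A (\<rho> m) (\<rho> n)) < \<epsilon>/2"
    unfolding Cauchy_in_def by meson
  have "q (adiff A (aadd A (\<sigma> m) (\<rho> m)) (aadd A (\<sigma> n) (\<rho> n))) < \<epsilon>"
    if "m \<ge> max M N" "n \<ge> max M N" for m n
  proof -
    have "q (adiff A (\<sigma> m) (\<sigma> n)) < \<epsilon>/2" "q (adiff A (\<rho> m) (\<rho> n)) < \<epsilon>/2"
      using M N that by auto
    then show ?thesis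
      using q_add_diff[of "\<sigma> m" "\<rho> m" "\<sigma> n" "\<rho> n"] Cauchy_inD[OF s] Cauchy_inD[OF r]
      by fastforce
  qed
  then show "\<exists>N. \<forall>m\<ge>N. \<forall>n\<ge>N. q (adiff A (aadd A (\<sigma> m) (\<rho> m)) (aadd A (\<sigma> n) (\<rho> n))) < \<epsilon>" by blast
qed

lemma Cauchy_scale: assumes s: "Cauchy_in A q \<sigma>"
  shows "Cauchy_in A q (\<lambda>n. ascale A k (\<sigma> n))"
  unfolding Cauchy_in_def
proof (intro conjI allI impI)
  show "ascale A k (\<sigma> n) \<in> acarrier A" for n
    by (simp add: closed Cauchy_inD[OF s])
  fix \<epsilon> :: real assume "\<epsilon> > 0"
  then have "\<epsilon> / (cmod k + 1) > 0"
    by (simp add: add_nonneg_pos)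
  with s obtain M where M: "\<forall>m\<ge>M. \<forall>n\<ge>M. q (adiff A (\<sigma> m) (\<sigma> n)) < \<epsilon> / (cmod k + 1)"
    unfolding Cauchy_in_def by meson
  have "q (adiff A (ascale A k (\<sigma> m)) (ascale A k (\<sigma> n))) < \<epsilon>" if "m \<ge> M" "n \<ge> M" for m n
  proof -
    have *: "q (adiff A (\<sigma> m) (\<sigma> n)) < \<epsilon> / (cmod k + 1)" "0 \<le> q (adiff A (\<sigma> m) (\<sigma> n))"
      using M that by (auto simp: q_nonneg diff_closed Cauchy_inD[OF s])
    have "cmod k * q (adiff A (\<sigma> m) (\<sigma> n)) \<le> (cmod k + 1) * q (adiff A (\<sigma> m) (\<sigma> n))"
      using * by (simp add: mult_right_mono)
    also have "\<dots> < \<epsilon>"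
      using * by (simp add: pos_less_divide_eq add_nonneg_pos mult.commute)
    finally show ?thesis by (simp add: q_scale_diff Cauchy_inD[OF s])
  qed
  then show "\<exists>N. \<forall>m\<ge>N. \<forall>n\<ge>N. q (adiff A (ascale A k (\<sigma> m)) (ascale A k (\<sigma> n))) < \<epsilon>" by blast
qed

lemma Cauchy_star: assumes s: "Cauchy_in A q \<sigma>"
  shows "Cauchy_in A q (\<lambda>n. astar A (\<sigma> n))"
  using s unfolding Cauchy_in_def by (simp add: closed q_star_diff)

lemma Cauchy_mult: assumes s: "Cauchy_in A q \<sigma>" and r: "Cauchy_in A q \<rho>"
  shows "Cauchy_in A q (\<lambda>n. amult A (\<sigma> n) (\<rho> n))"
  unfolding Cauchy_in_def
proof (intro conjI allI impI)
  show "amult A (\<sigma> n) (\<rho> n) \<in> acarrier A" for n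
    by (simp add: closed Cauchy_inD[OF s] Cauchy_inD[OF r])
  fix \<epsilon> :: real assume e: "\<epsilon> > 0"
  obtain K L where K: "K > 0" "\<And>n. q (\<sigma> n) \<le> K" and L: "L > 0" "\<And>n. q (\<rho> n) \<le> L"
    using Cauchy_bounded[OF s] Cauchy_bounded[OF r] by blast
  have "\<epsilon>/(2*L) > 0" "\<epsilon>/(2*K) > 0" using e K L by auto
  with s r obtain M N where M: "\<forall>m\<ge>M. \<forall>n\<ge>M. q (adiff A (\<sigma> m) (\<sigma> n)) < \<epsilon>/(2*L)"
    and N: "\<forall>m\<ge>N. \<forall>n\<ge>N. q (adiff A (\<rho> m) (\<rho> n)) < \<epsilon>/(2*K)"
    unfolding Cauchy_in_def by meson
  have "q (adiff A (amult A (\<sigma> m) (\<rho> m)) (amult A (\<sigma> n) (\<rho> n))) < \<epsilon>"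
    if "m \<ge> max M N" "n \<ge> max M N" for m n
  proof -
    have a: "q (adiff A (\<sigma> m) (\<sigma> n)) < \<epsilon>/(2*L)" "q (adiff A (\<rho> m) (\<rho> n)) < \<epsilon>/(2*K)"
      using M N that by auto
    have nn: "0 \<le> q (adiff A (\<sigma> m) (\<sigma> n))" "0 \<le> q (adiff A (\<rho> m) (\<rho> n))"
      by (auto simp: q_nonneg diff_closed Cauchy_inD[OF s] Cauchy_inD[OF r])
    have "q (adiff A (\<sigma> m) (\<sigma> n)) * q (\<rho> m) \<le> q (adiff A (\<sigma> m) (\<sigma> n)) * L"
      using nn L by (simp add: mult_left_mono)
    also have "\<dots> < \<epsilon>/2" using a L by (simp add: field_simps)
    finally have 1: "q (adiff A (\<sigma> m) (\<sigma> n)) * q (\<rho> m) < \<epsilon>/2" .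
    have "q (\<sigma> n) * q (adiff A (\<rho> m) (\<rho> n)) \<le> K * q (adiff A (\<rho> m) (\<rho> n))"
      using nn K by (simp add: mult_right_mono)
    also have "\<dots> < \<epsilon>/2" using a K by (simp add: field_simps)
    finally have 2: "q (\<sigma> n) * q (adiff A (\<rho> m) (\<rho> n)) < \<epsilon>/2" .
    show ?thesis
      using 1 2 q_mult_diff[of "\<sigma> m" "\<rho> m" "\<sigma> n" "\<rho> n"] Cauchy_inD[OF s] Cauchy_inD[OF r]
      by fastforce
  qed
  then show "\<exists>N. \<forall>m\<ge>N. \<forall>n\<ge>N. q (adiff A (amult A (\<sigma> m) (\<rho> m)) (amult A (\<sigma> n) (\<rho> n))) < \<epsilon>" by blast
qed

text \<open>\<open>\<sigma>\<close> and \<open>\<rho>\<close> have the same limit.\<close>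

definition same where "same \<sigma> \<rho> \<longleftrightarrow> Cauchy_in A q \<sigma> \<and> Cauchy_in A q \<rho> \<and>
  (\<lambda>n. q (adiff A (\<sigma> n) (\<rho> n))) \<longlonglongrightarrow> 0"

lemma null_bound:
  assumes "\<And>n. 0 \<le> f n" "\<And>n. f n \<le> (g n :: real)" "g \<longlonglongrightarrow> c" "c = 0" shows "f \<longlonglongrightarrow> 0"
  using assms by (auto intro: tendsto_sandwich[of "\<lambda>_. 0" f sequentially g])

lemma same_refl: "Cauchy_in A q \<sigma> \<Longrightarrow> same \<sigma> \<sigma>"
  by (simp add: same_def diff_self q_zero Cauchy_inD)

lemma same_sym: "same \<sigma> \<rho> \<Longrightarrow> same \<rho> \<sigma>"
  by (auto simp: same_def q_swap[OF Cauchy_inD Cauchy_inD])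

lemma same_trans: assumes "same \<sigma> \<rho>" "same \<rho> \<tau>" shows "same \<sigma> \<tau>"
proof -
  have c: "\<sigma> n \<in> acarrier A" "\<rho> n \<in> acarrier A" "\<tau> n \<in> acarrier A" for n
    using assms by (auto simp: same_def Cauchy_inD)
  have "(\<lambda>n. q (adiff A (\<sigma> n) (\<rho> n)) + q (adiff A (\<rho> n) (\<tau> n))) \<longlonglongrightarrow> 0 + 0"
    using assms by (intro tendsto_add) (auto simp: same_def)
  then have "(\<lambda>n. q (adiff A (\<sigma> n) (\<tau> n))) \<longlonglongrightarrow> 0"
    by (rule null_bound[rotated 2]) (simp_all add: c q_trans q_nonneg diff_closed)
  then show ?thesis using assms by (simp add: same_def)
qed

lemma same_add: assumes "same \<sigma> \<sigma>'" "same \<rho> \<rho>'"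
  shows "same (\<lambda>n. aadd A (\<sigma> n) (\<rho> n)) (\<lambda>n. aadd A (\<sigma>' n) (\<rho>' n))"
proof -
  have c: "\<sigma> n \<in> acarrier A" "\<rho> n \<in> acarrier A" "\<sigma>' n \<in> acarrier A" "\<rho>' n \<in> acarrier A" for n
    using assms by (auto simp: same_def Cauchy_inD)
  have "(\<lambda>n. q (adiff A (\<sigma> n) (\<sigma>' n)) + q (adiff A (\<rho> n) (\<rho>' n))) \<longlonglongrightarrow> 0 + 0"
    using assms by (intro tendsto_add) (auto simp: same_def)
  then have "(\<lambda>n. q (adiff A (aadd A (\<sigma> n) (\<rho> n)) (aadd A (\<sigma>' n) (\<rho>' n)))) \<longlonglongrightarrow> 0"
    by (rule null_bound[rotated 2]) (simp_all add: c q_add_diff q_nonneg diff_closed closed)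
  then show ?thesis using assms by (simp add: same_def Cauchy_add)
qed

lemma same_scale: assumes "same \<sigma> \<sigma>'"
  shows "same (\<lambda>n. ascale A k (\<sigma> n)) (\<lambda>n. ascale A k (\<sigma>' n))"
proof -
  have c: "\<sigma> n \<in> acarrier A" "\<sigma>' n \<in> acarrier A" for n
    using assms by (auto simp: same_def Cauchy_inD)
  have "(\<lambda>n. cmod k * q (adiff A (\<sigma> n) (\<sigma>' n))) \<longlonglongrightarrow> cmod k * 0"
    using assms by (intro tendsto_mult_left) (auto simp: same_def)
  then show ?thesis using assms c by (simp add: same_def Cauchy_scale q_scale_diff)
qed

lemma same_star: "same \<sigma> \<sigma>' \<Longrightarrow> same (\<lambda>n. astar A (\<sigma> n)) (\<lambda>n. astar A (\<sigma>' n))"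
  by (auto simp: same_def Cauchy_star q_star_diff Cauchy_inD)

lemma same_mult: assumes "same \<sigma> \<sigma>'" "same \<rho> \<rho>'"
  shows "same (\<lambda>n. amult A (\<sigma> n) (\<rho> n)) (\<lambda>n. amult A (\<sigma>' n) (\<rho>' n))"
proof -
  have c: "\<sigma> n \<in> acarrier A" "\<rho> n \<in> acarrier A" "\<sigma>' n \<in> acarrier A" "\<rho>' n \<in> acarrier A" for n
    using assms by (auto simp: same_def Cauchy_inD)
  obtain a b where "(\<lambda>n. q (\<rho> n)) \<longlonglongrightarrow> a" "(\<lambda>n. q (\<sigma>' n)) \<longlonglongrightarrow> b"
    using assms Cauchy_norm by (meson convergent_def same_def)
  then have "(\<lambda>n. q (adiff A (\<sigma> n) (\<sigma>' n)) * q (\<rho> n) + q (\<sigma>' n) * q (adiff A (\<rho> n) (\<rho>' n)))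
      \<longlonglongrightarrow> 0 * a + b * 0"
    using assms by (intro tendsto_add tendsto_mult) (auto simp: same_def)
  then have "(\<lambda>n. q (adiff A (amult A (\<sigma> n) (\<rho> n)) (amult A (\<sigma>' n) (\<rho>' n)))) \<longlonglongrightarrow> 0"
    by (rule null_bound[rotated 2]) (simp_all add: c q_mult_diff q_nonneg diff_closed closed)
  then show ?thesis using assms by (simp add: same_def Cauchy_mult)
qed

lemma same_lim: assumes "same \<sigma> \<rho>" "(\<lambda>n. q (\<sigma> n)) \<longlonglongrightarrow> r" shows "(\<lambda>n. q (\<rho> n)) \<longlonglongrightarrow> r"
proof -
  have c: "\<sigma> n \<in> acarrier A" "\<rho> n \<in> acarrier A" for n
    using assms by (auto simp: same_def Cauchy_inD)
  have "(\<lambda>n. \<bar>q (\<sigma> n) - q (\<rho> n)\<bar>) \<longlonglongrightarrow> 0"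
    by (rule null_bound[of _ "\<lambda>n. q (adiff A (\<sigma> n) (\<rho> n))" 0])
      (use assms(1) in \<open>simp_all add: same_def c q_diff_abs\<close>)
  then have "(\<lambda>n. q (\<sigma> n) - q (\<rho> n)) \<longlonglongrightarrow> 0" by (simp add: tendsto_rabs_zero_iff)
  from tendsto_diff[OF assms(2) this] show ?thesis by simp
qed

end

text \<open>The algebras for which the supremum defining \<open>env_norm\<close> is finite; both algebras considered
  below are of this kind, since \<open>p (\<delta>\<^sub>s f) \<le> \<parallel>f\<parallel>\<^sub>\<infinity>\<close> and \<open>p h \<le> \<parallel>h\<parallel>\<^sub>\<infinity>\<close> for every C*-seminorm \<open>p\<close>
  and every \<open>h\<close> supported in an open bisection.\<close>

locale bounded_star_algebra = star_algebra A for A :: "('a, 'm) star_alg_scheme" +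
  assumes bounded: "a \<in> acarrier A \<Longrightarrow> bdd_above ((\<lambda>p. p a) ` {p. cstar_seminorm A p})"
begin

lemma zero_seminorm: "cstar_seminorm A (\<lambda>_. 0)"
  by (simp add: cstar_seminorm_def)

lemma env_norm_upper: "\<lbrakk>cstar_seminorm A p; a \<in> acarrier A\<rbrakk> \<Longrightarrow> p a \<le> env_norm A a"
  unfolding env_norm_def by (rule cSUP_upper) (auto simp: bounded)

lemma env_norm_least: "(\<And>p. cstar_seminorm A p \<Longrightarrow> p a \<le> M) \<Longrightarrow> env_norm A a \<le> M"
  unfolding env_norm_def by (rule cSUP_least) (use zero_seminorm in auto)

lemma env_norm_nonneg: "a \<in> acarrier A \<Longrightarrow> 0 \<le> env_norm A a"
  using env_norm_upper[OF zero_seminorm] by simp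

lemma env_norm_seminorm: "cstar_seminorm A (env_norm A)"
  unfolding cstar_seminorm_def
proof (intro conjI ballI allI)
  fix a assume a: "a \<in> acarrier A"
  show "0 \<le> env_norm A a" by (rule env_norm_nonneg[OF a])
  have le: "env_norm A (ascale A k b) \<le> cmod k * env_norm A b" if "b \<in> acarrier A" for k b
    by (rule env_norm_least) (use that in \<open>auto simp: cstar_seminorm_def env_norm_upper mult_left_mono\<close>)
  show "env_norm A (ascale A k a) = cmod k * env_norm A a" for k
  proof (cases "k = 0")
    case True
    then show ?thesis using le[OF a, of 0] env_norm_nonneg[of "ascale A 0 a"] a by (simp add: closed)
  next
    case False
    have "env_norm A a = env_norm A (ascale A (inverse k) (ascale A k a))"
      using False a by (simp add: scale_scale scale_one)
    also have "\<dots> \<le> inverse (cmod k) * env_norm A (ascale A k a)"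
      using le[of "ascale A k a" "inverse k"] a by (simp add: closed norm_inverse)
    finally have "cmod k * env_norm A a \<le> env_norm A (ascale A k a)"
      using False by (simp add: field_simps)
    then show ?thesis using le[OF a, of k] by simp
  qed
  show "env_norm A (amult A (astar A a) a) = (env_norm A a)\<^sup>2"
  proof (rule antisym)
    show "env_norm A (amult A (astar A a) a) \<le> (env_norm A a)\<^sup>2"
    proof (rule env_norm_least)
      fix p assume p: "cstar_seminorm A p"
      then have "p (amult A (astar A a) a) = (p a)\<^sup>2" "0 \<le> p a" "p a \<le> env_norm A a"
        using a by (auto simp: cstar_seminorm_def env_norm_upper)
      then show "p (amult A (astar A a) a) \<le> (env_norm A a)\<^sup>2" by (simp add: power_mono)
    qed
    have nn: "0 \<le> env_norm A (amult A (astar A a) a)" using a by (simp add: env_norm_nonneg closed)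
    have "env_norm A a \<le> sqrt (env_norm A (amult A (astar A a) a))"
    proof (rule env_norm_least)
      fix p assume p: "cstar_seminorm A p"
      then have "(p a)\<^sup>2 \<le> env_norm A (amult A (astar A a) a)"
        using a env_norm_upper[OF p, of "amult A (astar A a) a"] by (auto simp: cstar_seminorm_def closed)
      then show "p a \<le> sqrt (env_norm A (amult A (astar A a) a))" by (rule real_le_rsqrt)
    qed
    then have "(env_norm A a)\<^sup>2 \<le> (sqrt (env_norm A (amult A (astar A a) a)))\<^sup>2"
      using env_norm_nonneg[OF a] by (intro power_mono) auto
    then show "(env_norm A a)\<^sup>2 \<le> env_norm A (amult A (astar A a) a)"
      using nn by simp
  qed
  fix b assume b: "b \<in> acarrier A"
  show "env_norm A (aadd A a b) \<le> env_norm A a + env_norm A b"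
  proof (rule env_norm_least)
    fix p assume p: "cstar_seminorm A p"
    then have "p (aadd A a b) \<le> p a + p b" using a b by (simp add: cstar_seminorm_def)
    then show "p (aadd A a b) \<le> env_norm A a + env_norm A b"
      using env_norm_upper[OF p a] env_norm_upper[OF p b] by simp
  qed
  show "env_norm A (amult A a b) \<le> env_norm A a * env_norm A b"
  proof (rule env_norm_least)
    fix p assume p: "cstar_seminorm A p"
    then have "p (amult A a b) \<le> p a * p b" "0 \<le> p b" using a b by (auto simp: cstar_seminorm_def)
    moreover have "p a * p b \<le> env_norm A a * env_norm A b"
      using env_norm_upper[OF p a] env_norm_upper[OF p b] env_norm_nonneg[OF a] \<open>0 \<le> p b\<close>
      by (intro mult_mono) auto
    ultimately show "p (amult A a b) \<le> env_norm A a * env_norm A b" by simp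
  qed
qed

sublocale env: seminormed_star_algebra A "env_norm A"
  by unfold_locales (rule env_norm_seminorm)

abbreviation "env_cl \<sigma> \<equiv> env_rel A `` {\<sigma>}"
abbreviation "env_Cauchy \<equiv> Cauchy_in A (env_norm A)"

lemma env_rel_same: "(\<sigma>, \<rho>) \<in> env_rel A \<longleftrightarrow> env.same \<sigma> \<rho>"
  by (simp add: env_rel_def env.same_def)

lemma env_equiv: "equiv (Collect env_Cauchy) (env_rel A)"
proof -
  have "env_rel A \<subseteq> Collect env_Cauchy \<times> Collect env_Cauchy"
    unfolding env_rel_def by blast
  moreover have "(\<sigma>, \<sigma>) \<in> env_rel A" if "\<sigma> \<in> Collect env_Cauchy" for \<sigma>
    using that env.same_refl by (simp add: env_rel_same)
  moreover have "sym (env_rel A)"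
    by (rule symI) (simp add: env_rel_same env.same_sym)
  moreover have "trans (env_rel A)"
    by (rule transI) (unfold env_rel_same, rule env.same_trans)
  ultimately show ?thesis
    unfolding equiv_def refl_on_def by blast
qed

lemma env_cl_eqI: "env.same \<sigma> \<rho> \<Longrightarrow> env_cl \<sigma> = env_cl \<rho>"
  by (rule equiv_class_eq[OF env_equiv]) (simp add: env_rel_same)

lemma env_cl_self: "env_Cauchy \<sigma> \<Longrightarrow> \<sigma> \<in> env_cl \<sigma>"
  by (simp add: env_rel_same env.same_refl)

lemma env_carrier: "u \<in> acarrier (enveloping A) \<longleftrightarrow> (\<exists>\<sigma>. env_Cauchy \<sigma> \<and> u = env_cl \<sigma>)"
  by (auto simp: enveloping_def quotient_def)

lemma env_carrierI: "env_Cauchy \<sigma> \<Longrightarrow> env_cl \<sigma> \<in> acarrier (enveloping A)"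
  by (auto simp: env_carrier)

lemma env_zero: "azero (enveloping A) = env_cl (\<lambda>_. azero A)"
  by (simp add: enveloping_def)

lemma UN_const_eq: "\<lbrakk>x \<in> S; \<And>y. y \<in> S \<Longrightarrow> F y = c\<rbrakk> \<Longrightarrow> (\<Union>y\<in>S. F y) = c"
  by blast

lemma env_add: assumes "env_Cauchy \<sigma>" "env_Cauchy \<rho>"
  shows "aadd (enveloping A) (env_cl \<sigma>) (env_cl \<rho>) = env_cl (\<lambda>n. aadd A (\<sigma> n) (\<rho> n))"
  unfolding enveloping_def star_alg.simps
  by (intro UN_const_eq[OF env_cl_self] env_cl_eqI env.same_sym[OF env.same_add])
     (use assms in \<open>auto simp: env_rel_same\<close>)

lemma env_mult: assumes "env_Cauchy \<sigma>" "env_Cauchy \<rho>"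
  shows "amult (enveloping A) (env_cl \<sigma>) (env_cl \<rho>) = env_cl (\<lambda>n. amult A (\<sigma> n) (\<rho> n))"
  unfolding enveloping_def star_alg.simps
  by (intro UN_const_eq[OF env_cl_self] env_cl_eqI env.same_sym[OF env.same_mult])
     (use assms in \<open>auto simp: env_rel_same\<close>)

lemma env_scale: assumes "env_Cauchy \<sigma>"
  shows "ascale (enveloping A) k (env_cl \<sigma>) = env_cl (\<lambda>n. ascale A k (\<sigma> n))"
  unfolding enveloping_def star_alg.simps
  by (intro UN_const_eq[OF env_cl_self] env_cl_eqI env.same_sym[OF env.same_scale])
     (use assms in \<open>auto simp: env_rel_same\<close>)

lemma env_star: assumes "env_Cauchy \<sigma>"
  shows "astar (enveloping A) (env_cl \<sigma>) = env_cl (\<lambda>n. astar A (\<sigma> n))"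
  unfolding enveloping_def star_alg.simps
  by (intro UN_const_eq[OF env_cl_self] env_cl_eqI env.same_sym[OF env.same_star])
     (use assms in \<open>auto simp: env_rel_same\<close>)

lemma env_diff: assumes "env_Cauchy \<sigma>" "env_Cauchy \<rho>"
  shows "adiff (enveloping A) (env_cl \<sigma>) (env_cl \<rho>) = env_cl (\<lambda>n. adiff A (\<sigma> n) (\<rho> n))"
  using assms by (simp add: adiff_def env_scale env_add env.Cauchy_scale)

lemma env_Cauchy_diff: "\<lbrakk>env_Cauchy \<sigma>; env_Cauchy \<rho>\<rbrakk> \<Longrightarrow> env_Cauchy (\<lambda>n. adiff A (\<sigma> n) (\<rho> n))"
  by (simp add: adiff_def env.Cauchy_scale env.Cauchy_add)

lemma env_anorm_eq: assumes "env_Cauchy \<sigma>" "(\<lambda>n. env_norm A (\<sigma> n)) \<longlonglongrightarrow> r"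
  shows "anorm (enveloping A) (env_cl \<sigma>) = r"
  unfolding enveloping_def cstar_alg.simps
proof (rule the_equality)
  show "\<exists>\<rho>\<in>env_cl \<sigma>. (\<lambda>n. env_norm A (\<rho> n)) \<longlonglongrightarrow> r" using assms env_cl_self by blast
  fix r' assume "\<exists>\<rho>\<in>env_cl \<sigma>. (\<lambda>n. env_norm A (\<rho> n)) \<longlonglongrightarrow> r'"
  then obtain \<rho> where "env.same \<sigma> \<rho>" and \<rho>: "(\<lambda>n. env_norm A (\<rho> n)) \<longlonglongrightarrow> r'"
    by (auto simp: env_rel_same)
  then show "r' = r"
    using LIMSEQ_unique[OF \<rho> env.same_lim[OF _ assms(2)]] by blast
qed

lemma env_anorm_lim: assumes "env_Cauchy \<sigma>"
  shows "(\<lambda>n. env_norm A (\<sigma> n)) \<longlonglongrightarrow> anorm (enveloping A) (env_cl \<sigma>)"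
  using env.Cauchy_norm[OF assms] env_anorm_eq[OF assms] by (auto simp: convergent_def)

lemma env_star_algebra: "star_algebra (enveloping A)"
proof
  fix k l :: complex
  show "azero (enveloping A) \<in> acarrier (enveloping A)"
    by (simp add: env_zero env_carrierI env.Cauchy_const closed)
  fix u assume "u \<in> acarrier (enveloping A)"
  then obtain \<sigma> where s: "env_Cauchy \<sigma>" and u: "u = env_cl \<sigma>" by (auto simp: env_carrier)
  note C = s env.Cauchy_add env.Cauchy_mult env.Cauchy_scale env.Cauchy_star env.Cauchy_const[OF zero_closed]
  note E = u env_add env_mult env_scale env_star env_zero env_carrierI
  note D = closed env.Cauchy_inD[OF s]
  show "ascale (enveloping A) k u \<in> acarrier (enveloping A)"
    "astar (enveloping A) u \<in> acarrier (enveloping A)"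
    by (simp_all add: E C)
  show "aadd (enveloping A) u (azero (enveloping A)) = u"
    "ascale (enveloping A) (k + l) u = aadd (enveloping A) (ascale (enveloping A) k u) (ascale (enveloping A) l u)"
    "ascale (enveloping A) k (ascale (enveloping A) l u) = ascale (enveloping A) (k * l) u"
    "ascale (enveloping A) 1 u = u"
    "astar (enveloping A) (astar (enveloping A) u) = u"
    "astar (enveloping A) (ascale (enveloping A) k u) = ascale (enveloping A) (cnj k) (astar (enveloping A) u)"
    by (simp_all add: E C D add_zero scale_add_left scale_scale scale_one star_star star_scale)
  show "adiff (enveloping A) u u = azero (enveloping A)"
    by (simp add: E C D env_diff diff_self)
  fix v assume "v \<in> acarrier (enveloping A)"
  then obtain \<rho> where r: "env_Cauchy \<rho>" and v: "v = env_cl \<rho>" by (auto simp: env_carrier)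
  note C = C r and E = E v and D = D env.Cauchy_inD[OF r]
  show "aadd (enveloping A) u v \<in> acarrier (enveloping A)"
    "amult (enveloping A) u v \<in> acarrier (enveloping A)"
    by (simp_all add: E C)
  show "aadd (enveloping A) u v = aadd (enveloping A) v u"
    using add_commute[OF env.Cauchy_inD[OF s] env.Cauchy_inD[OF r]] by (simp add: E C)
  show "ascale (enveloping A) k (aadd (enveloping A) u v) =
      aadd (enveloping A) (ascale (enveloping A) k u) (ascale (enveloping A) k v)"
    "amult (enveloping A) (ascale (enveloping A) k u) v = ascale (enveloping A) k (amult (enveloping A) u v)"
    "amult (enveloping A) u (ascale (enveloping A) k v) = ascale (enveloping A) k (amult (enveloping A) u v)"
    "astar (enveloping A) (aadd (enveloping A) u v) = aadd (enveloping A) (astar (enveloping A) u) (astar (enveloping A) v)"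
    "astar (enveloping A) (amult (enveloping A) u v) = amult (enveloping A) (astar (enveloping A) v) (astar (enveloping A) u)"
    by (simp_all add: E C D scale_add_right mult_scale_left mult_scale_right star_add star_mult)
  fix w assume "w \<in> acarrier (enveloping A)"
  then obtain \<tau> where t: "env_Cauchy \<tau>" and w: "w = env_cl \<tau>" by (auto simp: env_carrier)
  note C = C t and E = E w and D = D env.Cauchy_inD[OF t]
  show "aadd (enveloping A) (aadd (enveloping A) u v) w = aadd (enveloping A) u (aadd (enveloping A) v w)"
    "amult (enveloping A) (amult (enveloping A) u v) w = amult (enveloping A) u (amult (enveloping A) v w)"
    "amult (enveloping A) (aadd (enveloping A) u v) w = aadd (enveloping A) (amult (enveloping A) u w) (amult (enveloping A) v w)"
    "amult (enveloping A) u (aadd (enveloping A) v w) = aadd (enveloping A) (amult (enveloping A) u v) (amult (enveloping A) u w)"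
    by (simp_all add: E C D add_assoc mult_assoc mult_add_left mult_add_right)
qed

lemma env_anorm_seminorm: "cstar_seminorm (enveloping A) (anorm (enveloping A))"
  unfolding cstar_seminorm_def
proof (intro conjI ballI allI)
  fix u assume "u \<in> acarrier (enveloping A)"
  then obtain \<sigma> where s: "env_Cauchy \<sigma>" and u: "u = env_cl \<sigma>" by (auto simp: env_carrier)
  note ls = env_anorm_lim[OF s]
  note cs = env.Cauchy_inD[OF s]
  show "0 \<le> anorm (enveloping A) u"
    unfolding u by (rule LIMSEQ_le_const[OF ls]) (auto simp: env_norm_nonneg cs)
  show "anorm (enveloping A) (ascale (enveloping A) k u) = cmod k * anorm (enveloping A) u" for k
    unfolding u env_scale[OF s]
    by (rule env_anorm_eq[OF env.Cauchy_scale[OF s]]) (simp add: env.q_scale cs tendsto_mult_left ls)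
  show "anorm (enveloping A) (amult (enveloping A) (astar (enveloping A) u) u) = (anorm (enveloping A) u)\<^sup>2"
    unfolding u env_star[OF s] env_mult[OF env.Cauchy_star[OF s] s]
    by (rule env_anorm_eq[OF env.Cauchy_mult[OF env.Cauchy_star[OF s] s]])
      (simp add: env.q_cstar cs tendsto_power ls)
  fix v assume "v \<in> acarrier (enveloping A)"
  then obtain \<rho> where r: "env_Cauchy \<rho>" and v: "v = env_cl \<rho>" by (auto simp: env_carrier)
  note lr = env_anorm_lim[OF r]
  note cr = env.Cauchy_inD[OF r]
  show "anorm (enveloping A) (aadd (enveloping A) u v) \<le> anorm (enveloping A) u + anorm (enveloping A) v"
    unfolding u v env_add[OF s r]
    by (rule LIMSEQ_le[OF env_anorm_lim[OF env.Cauchy_add[OF s r]] tendsto_add[OF ls lr]])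
      (auto simp: env.q_add cs cr)
  show "anorm (enveloping A) (amult (enveloping A) u v) \<le> anorm (enveloping A) u * anorm (enveloping A) v"
    unfolding u v env_mult[OF s r]
    by (rule LIMSEQ_le[OF env_anorm_lim[OF env.Cauchy_mult[OF s r]] tendsto_mult[OF ls lr]])
      (auto simp: env.q_mult cs cr)
qed

lemma env_map_carrier: "a \<in> acarrier A \<Longrightarrow> env_map A a \<in> acarrier (enveloping A)"
  by (simp add: env_map_def env_carrierI env.Cauchy_const)

lemma env_map_hom: "star_hom A (enveloping A) (env_map A)"
  unfolding star_hom_def
  by (auto simp: env_map_carrier)
     (auto simp: env_map_def env_add env_mult env_scale env_star env.Cauchy_const)

lemma env_map_norm: "a \<in> acarrier A \<Longrightarrow> anorm (enveloping A) (env_map A a) = env_norm A a"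
  unfolding env_map_def by (rule env_anorm_eq) (auto simp: env.Cauchy_const)

lemma env_map_dense:
  assumes "env_Cauchy \<sigma>"
  shows "(\<lambda>k. anorm (enveloping A) (adiff (enveloping A) (env_map A (\<sigma> k)) (env_cl \<sigma>))) \<longlonglongrightarrow> 0"
proof (rule LIMSEQ_I)
  fix \<epsilon> :: real assume "\<epsilon> > 0"
  then have "\<epsilon> / 2 > 0" by simp
  with assms obtain N where N: "\<And>m n. \<lbrakk>m \<ge> N; n \<ge> N\<rbrakk> \<Longrightarrow> env_norm A (adiff A (\<sigma> m) (\<sigma> n)) < \<epsilon> / 2"
    unfolding Cauchy_in_def by meson
  note c = env.Cauchy_inD[OF assms]
  have "norm (anorm (enveloping A) (adiff (enveloping A) (env_map A (\<sigma> k)) (env_cl \<sigma>)) - 0) < \<epsilon>" if "k \<ge> N" for k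
  proof -
    have C: "env_Cauchy (\<lambda>n. adiff A (\<sigma> k) (\<sigma> n))"
      by (rule env_Cauchy_diff[OF env.Cauchy_const[OF c] assms])
    have eq: "adiff (enveloping A) (env_map A (\<sigma> k)) (env_cl \<sigma>) = env_cl (\<lambda>n. adiff A (\<sigma> k) (\<sigma> n))"
      unfolding env_map_def by (rule env_diff[OF env.Cauchy_const[OF c] assms])
    have "anorm (enveloping A) (env_cl (\<lambda>n. adiff A (\<sigma> k) (\<sigma> n))) \<le> \<epsilon> / 2"
      by (rule LIMSEQ_le_const2[OF env_anorm_lim[OF C]]) (use N that in \<open>auto intro: less_imp_le\<close>)
    moreover have "0 \<le> anorm (enveloping A) (env_cl (\<lambda>n. adiff A (\<sigma> k) (\<sigma> n)))"
      using env_anorm_seminorm env_carrierI[OF C] by (auto simp: cstar_seminorm_def)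
    ultimately show ?thesis using \<open>\<epsilon> > 0\<close> by (simp add: eq)
  qed
  then show "\<exists>N. \<forall>k\<ge>N. norm (anorm (enveloping A) (adiff (enveloping A) (env_map A (\<sigma> k)) (env_cl \<sigma>)) - 0) < \<epsilon>" by blast
qed

lemma env_cstar_algebra: "cstar_algebra (enveloping A)"
proof -
  let ?B = "enveloping A"
  interpret B: seminormed_star_algebra ?B "anorm ?B"
    using env_star_algebra env_anorm_seminorm
    by (simp add: seminormed_star_algebra_def seminormed_star_algebra_axioms_def)
  show ?thesis
  proof
    show "cstar_seminorm ?B (anorm ?B)" by (rule env_anorm_seminorm)
    fix u assume "u \<in> acarrier ?B" and 0: "anorm ?B u = 0"
    then obtain \<sigma> where s: "env_Cauchy \<sigma>" and u: "u = env_cl \<sigma>" by (auto simp: env_carrier)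
    have "(\<lambda>n. env_norm A (adiff A (\<sigma> n) (azero A))) \<longlonglongrightarrow> 0"
      using env_anorm_lim[OF s] 0 u by (simp add: diff_zero env.Cauchy_inD[OF s])
    then show "u = azero ?B"
      unfolding u env_zero
      by (intro env_cl_eqI) (simp add: env.same_def s env.Cauchy_const closed)
  next
    fix U assume U: "Cauchy_in ?B (anorm ?B) U"
    note cU = B.Cauchy_inD[OF U]
    have "\<exists>a\<in>acarrier A. anorm ?B (adiff ?B (env_map A a) (U k)) < inverse (real (Suc k))" for k
    proof -
      obtain \<sigma> where s: "env_Cauchy \<sigma>" and u: "U k = env_cl \<sigma>" using cU[of k] by (auto simp: env_carrier)
      obtain N where "norm (anorm ?B (adiff ?B (env_map A (\<sigma> N)) (env_cl \<sigma>)) - 0) < inverse (real (Suc k))"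
        using LIMSEQ_D[OF env_map_dense[OF s], of "inverse (real (Suc k))"] by auto
      then show ?thesis using u env.Cauchy_inD[OF s] by (intro bexI[of _ "\<sigma> N"]) auto
    qed
    then obtain \<rho> where \<rho>: "\<And>k. \<rho> k \<in> acarrier A"
      and near: "\<And>k. anorm ?B (adiff ?B (env_map A (\<rho> k)) (U k)) < inverse (real (Suc k))"
      by metis
    note c\<rho> = env_map_carrier[OF \<rho>]
    have md: "env_norm A (adiff A (\<rho> m) (\<rho> n)) = anorm ?B (adiff ?B (env_map A (\<rho> m)) (env_map A (\<rho> n)))" for m n
      using env_map_norm[of "adiff A (\<rho> m) (\<rho> n)"] \<rho> env_map_hom
      by (simp add: star_hom_def adiff_def closed)
    have C: "env_Cauchy \<rho>"
      unfolding Cauchy_in_def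
    proof (intro conjI allI impI \<rho>)
      fix \<epsilon> :: real assume "\<epsilon> > 0"
      then have e: "\<epsilon> / 3 > 0" by simp
      with U obtain N where N: "\<And>m n. \<lbrakk>m \<ge> N; n \<ge> N\<rbrakk> \<Longrightarrow> anorm ?B (adiff ?B (U m) (U n)) < \<epsilon> / 3"
        unfolding Cauchy_in_def by meson
      obtain M where M: "inverse (real (Suc M)) < \<epsilon> / 3" using e reals_Archimedean by blast
      have near': "anorm ?B (adiff ?B (env_map A (\<rho> k)) (U k)) < \<epsilon> / 3" if "k \<ge> M" for k
      proof -
        have "inverse (real (Suc k)) \<le> inverse (real (Suc M))" using that by (simp add: le_imp_inverse_le)
        then show ?thesis using near[of k] M by linarith
      qed
      have "env_norm A (adiff A (\<rho> m) (\<rho> n)) < \<epsilon>" if "m \<ge> max M N" "n \<ge> max M N" for m n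
      proof -
        have "anorm ?B (adiff ?B (env_map A (\<rho> m)) (U m)) < \<epsilon> / 3"
          "anorm ?B (adiff ?B (env_map A (\<rho> n)) (U n)) < \<epsilon> / 3"
          "anorm ?B (adiff ?B (U m) (U n)) < \<epsilon> / 3"
          using near' N that by auto
        then show ?thesis
          using B.q_trans[OF c\<rho>[of m] cU[of m] c\<rho>[of n]] B.q_trans[OF cU[of m] cU[of n] c\<rho>[of n]]
            B.q_swap[OF c\<rho>[of n] cU[of n]] unfolding md by linarith
      qed
      then show "\<exists>N. \<forall>m\<ge>N. \<forall>n\<ge>N. env_norm A (adiff A (\<rho> m) (\<rho> n)) < \<epsilon>" by blast
    qed
    have "(\<lambda>k. inverse (real (Suc k)) + anorm ?B (adiff ?B (env_map A (\<rho> k)) (env_cl \<rho>))) \<longlonglongrightarrow> 0 + 0"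
      by (intro tendsto_add LIMSEQ_inverse_real_of_nat env_map_dense[OF C])
    moreover have "anorm ?B (adiff ?B (U k) (env_cl \<rho>))
        \<le> inverse (real (Suc k)) + anorm ?B (adiff ?B (env_map A (\<rho> k)) (env_cl \<rho>))" for k
      using B.q_trans[OF cU[of k] c\<rho>[of k] env_carrierI[OF C]] near[of k]
        B.q_swap[OF c\<rho>[of k] cU[of k]] by linarith
    ultimately have "(\<lambda>k. anorm ?B (adiff ?B (U k) (env_cl \<rho>))) \<longlonglongrightarrow> 0"
      by (intro B.null_bound[rotated 2, of _ "0 + 0"]) (simp_all add: B.q_nonneg B.diff_closed cU env_carrierI[OF C])
    then show "\<exists>a\<in>acarrier ?B. (\<lambda>n. anorm ?B (adiff ?B (U n) a)) \<longlonglongrightarrow> 0"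
      using env_carrierI[OF C] by blast
  qed
qed

text \<open>The bound on the norm is automatic for *-homomorphisms between C*-algebras.\<close>

lemma env_universal:
  fixes B :: "('b, 'n) cstar_alg_scheme"
  assumes "cstar_algebra B" and \<pi>: "star_hom A B \<pi>"
  shows "\<exists>\<rho>. star_hom (enveloping A) B \<rho> \<and>
    (\<forall>u\<in>acarrier (enveloping A). anorm B (\<rho> u) \<le> anorm (enveloping A) u) \<and>
    (\<forall>a\<in>acarrier A. \<rho> (env_map A a) = \<pi> a)"
proof -
  interpret BC: cstar_algebra B by fact
  interpret B: seminormed_star_algebra B "anorm B" by unfold_locales (rule BC.norm_seminorm)
  have \<pi>c: "\<pi> a \<in> acarrier B" if "a \<in> acarrier A" for a using \<pi> that by (simp add: star_hom_def)
  have \<pi>d: "adiff B (\<pi> a) (\<pi> b) = \<pi> (adiff A a b)" if "a \<in> acarrier A" "b \<in> acarrier A" for a b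
    using \<pi> that by (simp add: star_hom_def adiff_def closed)
  have "cstar_seminorm A (\<lambda>a. anorm B (\<pi> a))"
    unfolding cstar_seminorm_def
    using \<pi> by (auto simp: star_hom_def closed B.q_nonneg B.q_add B.q_scale B.q_mult B.q_cstar)
  from env_norm_upper[OF this] have le: "anorm B (\<pi> a) \<le> env_norm A a" if "a \<in> acarrier A" for a
    using that by simp
  have led: "anorm B (adiff B (\<pi> a) (\<pi> b)) \<le> env_norm A (adiff A a b)"
    if "a \<in> acarrier A" "b \<in> acarrier A" for a b
    using le[of "adiff A a b"] that by (simp add: \<pi>d diff_closed)
  have PC: "Cauchy_in B (anorm B) (\<lambda>n. \<pi> (\<sigma> n))" if s: "env_Cauchy \<sigma>" for \<sigma>
    unfolding Cauchy_in_def
  proof (intro conjI allI impI \<pi>c env.Cauchy_inD[OF s])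
    fix \<epsilon> :: real assume "\<epsilon> > 0"
    with s obtain N where "\<forall>m\<ge>N. \<forall>n\<ge>N. env_norm A (adiff A (\<sigma> m) (\<sigma> n)) < \<epsilon>"
      unfolding Cauchy_in_def by meson
    then show "\<exists>N. \<forall>m\<ge>N. \<forall>n\<ge>N. anorm B (adiff B (\<pi> (\<sigma> m)) (\<pi> (\<sigma> n))) < \<epsilon>"
      using led[OF env.Cauchy_inD[OF s] env.Cauchy_inD[OF s]] le_less_trans by blast
  qed
  have PS: "B.same (\<lambda>n. \<pi> (\<sigma> n)) (\<lambda>n. \<pi> (\<sigma>' n))" if s: "env.same \<sigma> \<sigma>'" for \<sigma> \<sigma>'
  proof -
    have C: "env_Cauchy \<sigma>" "env_Cauchy \<sigma>'" and l: "(\<lambda>n. env_norm A (adiff A (\<sigma> n) (\<sigma>' n))) \<longlonglongrightarrow> 0"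
      using s by (auto simp: env.same_def)
    have "(\<lambda>n. anorm B (adiff B (\<pi> (\<sigma> n)) (\<pi> (\<sigma>' n)))) \<longlonglongrightarrow> 0"
      using env.Cauchy_inD[OF C(1)] env.Cauchy_inD[OF C(2)]
      by (intro B.null_bound[OF _ _ l]) (simp_all add: led \<pi>c B.q_nonneg BC.diff_closed)
    then show ?thesis by (simp add: B.same_def PC C)
  qed
  have uniq: "b = c" if "b \<in> acarrier B" "c \<in> acarrier B" "B.same (\<lambda>_. b) (\<lambda>_. c)" for b c
    using that BC.norm_eq_zero[of "adiff B b c"] by (simp add: B.same_def LIMSEQ_const_iff BC.diff_closed BC.diff_zero_iff)
  define \<rho> where "\<rho> u = (THE b. b \<in> acarrier B \<and> (\<exists>\<sigma>\<in>u. env_Cauchy \<sigma> \<and> B.same (\<lambda>n. \<pi> (\<sigma> n)) (\<lambda>_. b)))" for u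
  have \<rho>: "\<rho> (env_cl \<sigma>) = b" if s: "env_Cauchy \<sigma>" and b: "b \<in> acarrier B" "B.same (\<lambda>n. \<pi> (\<sigma> n)) (\<lambda>_. b)" for \<sigma> b
    unfolding \<rho>_def
  proof (rule the_equality)
    show "b \<in> acarrier B \<and> (\<exists>\<sigma>'\<in>env_cl \<sigma>. env_Cauchy \<sigma>' \<and> B.same (\<lambda>n. \<pi> (\<sigma>' n)) (\<lambda>_. b))"
      using s b env_cl_self by blast
    fix c assume "c \<in> acarrier B \<and> (\<exists>\<sigma>'\<in>env_cl \<sigma>. env_Cauchy \<sigma>' \<and> B.same (\<lambda>n. \<pi> (\<sigma>' n)) (\<lambda>_. c))"
    then obtain \<sigma>' where c: "c \<in> acarrier B" "env.same \<sigma> \<sigma>'" "B.same (\<lambda>n. \<pi> (\<sigma>' n)) (\<lambda>_. c)"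
      by (auto simp: env_rel_same)
    then show "c = b" using uniq b PS by (meson B.same_sym B.same_trans)
  qed
  have lim: "\<exists>b\<in>acarrier B. B.same (\<lambda>n. \<pi> (\<sigma> n)) (\<lambda>_. b)" if "env_Cauchy \<sigma>" for \<sigma>
    using BC.complete[OF PC[OF that]] PC[OF that] by (auto simp: B.same_def B.Cauchy_const)
  have \<rho>s: "\<rho> (env_cl \<sigma>) \<in> acarrier B \<and> B.same (\<lambda>n. \<pi> (\<sigma> n)) (\<lambda>_. \<rho> (env_cl \<sigma>))" if "env_Cauchy \<sigma>" for \<sigma>
    using lim[OF that] \<rho>[OF that] by auto
  have hom: "star_hom (enveloping A) B \<rho>"
    unfolding star_hom_def
  proof (intro conjI ballI allI)
    fix u assume "u \<in> acarrier (enveloping A)"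
    then obtain \<sigma> where s: "env_Cauchy \<sigma>" and u: "u = env_cl \<sigma>" by (auto simp: env_carrier)
    note rs = \<rho>s[OF s] and cs = env.Cauchy_inD[OF s]
    show "\<rho> u \<in> acarrier B" using rs u by simp
    show "\<rho> (ascale (enveloping A) k u) = ascale B k (\<rho> u)" for k
      unfolding u env_scale[OF s]
      by (rule \<rho>) (use rs \<pi> cs B.same_scale[of _ "\<lambda>_. \<rho> (env_cl \<sigma>)" k] s in
        \<open>auto simp: env.Cauchy_scale BC.closed star_hom_def\<close>)
    show "\<rho> (astar (enveloping A) u) = astar B (\<rho> u)"
      unfolding u env_star[OF s]
      by (rule \<rho>) (use rs \<pi> cs B.same_star[of _ "\<lambda>_. \<rho> (env_cl \<sigma>)"] s in
        \<open>auto simp: env.Cauchy_star BC.closed star_hom_def\<close>)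
    fix v assume "v \<in> acarrier (enveloping A)"
    then obtain \<tau> where t: "env_Cauchy \<tau>" and v: "v = env_cl \<tau>" by (auto simp: env_carrier)
    note rt = \<rho>s[OF t] and ct = env.Cauchy_inD[OF t]
    show "\<rho> (aadd (enveloping A) u v) = aadd B (\<rho> u) (\<rho> v)"
      unfolding u v env_add[OF s t]
      by (rule \<rho>) (use rs rt \<pi> cs ct B.same_add[of _ "\<lambda>_. \<rho> (env_cl \<sigma>)" _ "\<lambda>_. \<rho> (env_cl \<tau>)"] s t in
        \<open>auto simp: env.Cauchy_add BC.closed star_hom_def\<close>)
    show "\<rho> (amult (enveloping A) u v) = amult B (\<rho> u) (\<rho> v)"
      unfolding u v env_mult[OF s t]
      by (rule \<rho>) (use rs rt \<pi> cs ct B.same_mult[of _ "\<lambda>_. \<rho> (env_cl \<sigma>)" _ "\<lambda>_. \<rho> (env_cl \<tau>)"] s t in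
        \<open>auto simp: env.Cauchy_mult BC.closed star_hom_def\<close>)
  qed
  moreover have "anorm B (\<rho> u) \<le> anorm (enveloping A) u" if u: "u \<in> acarrier (enveloping A)" for u
  proof -
    obtain \<sigma> where s: "env_Cauchy \<sigma>" and u: "u = env_cl \<sigma>" using u by (auto simp: env_carrier)
    have "(\<lambda>n. anorm B (\<pi> (\<sigma> n))) \<longlonglongrightarrow> anorm B (\<rho> u)"
      using B.same_lim[OF B.same_sym tendsto_const] \<rho>s[OF s] u by blast
    then show ?thesis
      unfolding u by (rule LIMSEQ_le[OF _ env_anorm_lim[OF s]]) (auto simp: le env.Cauchy_inD[OF s])
  qed
  moreover have "\<rho> (env_map A a) = \<pi> a" if "a \<in> acarrier A" for a
    unfolding env_map_def
    by (rule \<rho>) (use that in \<open>auto simp: env.Cauchy_const \<pi>c B.same_refl B.Cauchy_const\<close>)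
  ultimately show ?thesis by blast
qed

lemma env_universal_unique:
  fixes B :: "('b, 'n) cstar_alg_scheme"
  assumes "cstar_algebra B"
    and \<rho>: "star_hom (enveloping A) B \<rho>" "\<forall>u\<in>acarrier (enveloping A). anorm B (\<rho> u) \<le> anorm (enveloping A) u"
    and \<rho>': "star_hom (enveloping A) B \<rho>'" "\<forall>u\<in>acarrier (enveloping A). anorm B (\<rho>' u) \<le> anorm (enveloping A) u"
    and eq: "\<And>a. a \<in> acarrier A \<Longrightarrow> \<rho> (env_map A a) = \<rho>' (env_map A a)"
    and u: "u \<in> acarrier (enveloping A)"
  shows "\<rho> u = \<rho>' u"
proof -
  interpret BC: cstar_algebra B by fact
  interpret B: seminormed_star_algebra B "anorm B" by unfold_locales (rule BC.norm_seminorm)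
  interpret E: star_algebra "enveloping A" by (rule env_star_algebra)
  obtain \<sigma> where s: "env_Cauchy \<sigma>" and us: "u = env_cl \<sigma>" using u by (auto simp: env_carrier)
  note c = env.Cauchy_inD[OF s] and mc = env_map_carrier[OF env.Cauchy_inD[OF s]]
  have b: "anorm B (adiff B (r (env_map A (\<sigma> n))) (r u)) \<le> anorm (enveloping A) (adiff (enveloping A) (env_map A (\<sigma> n)) u)"
    if "star_hom (enveloping A) B r" "\<forall>u\<in>acarrier (enveloping A). anorm B (r u) \<le> anorm (enveloping A) u" for r n
  proof -
    have "adiff B (r (env_map A (\<sigma> n))) (r u) = r (adiff (enveloping A) (env_map A (\<sigma> n)) u)"
      using that(1) mc u by (simp add: adiff_def star_hom_def E.closed)
    then show ?thesis using that(2) mc u by (simp add: E.diff_closed)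
  qed
  have rc: "\<rho> u \<in> acarrier B" "\<rho>' u \<in> acarrier B" "\<rho>' (env_map A (\<sigma> n)) \<in> acarrier B" for n
    using \<rho>(1) \<rho>'(1) u mc by (auto simp: star_hom_def)
  let ?d = "\<lambda>n. anorm (enveloping A) (adiff (enveloping A) (env_map A (\<sigma> n)) u)"
  have "(\<lambda>n. ?d n + ?d n) \<longlonglongrightarrow> 0 + 0"
    unfolding us by (intro tendsto_add env_map_dense s)
  moreover have "anorm B (adiff B (\<rho> u) (\<rho>' u)) \<le> ?d n + ?d n" for n
    using b[OF \<rho>, of n] b[OF \<rho>', of n] B.q_trans[OF rc(1) rc(3)[of n] rc(2)] eq[OF c[of n]]
      B.q_swap[OF rc(1) rc(3)[of n]] by simp
  ultimately have "anorm B (adiff B (\<rho> u) (\<rho>' u)) \<le> 0"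
    using LIMSEQ_le_const[of "\<lambda>n. ?d n + ?d n" 0] by auto
  then have "adiff B (\<rho> u) (\<rho>' u) = azero B"
    using rc by (intro BC.norm_eq_zero antisym) (auto simp: BC.diff_closed B.q_nonneg)
  then show ?thesis using rc BC.diff_zero_iff by blast
qed

end


section \<open>Function spaces, groupoid algebras and KS-crossed products\<close>

text \<open>Functions on a space, or on a subset of it, are extended by zero to the whole type.\<close>

definition C0 :: "'x topology \<Rightarrow> ('x \<Rightarrow> complex) set"
  where "C0 Y = {f. continuous_map Y euclidean f \<and> (\<forall>x. x \<notin> topspace Y \<longrightarrow> f x = 0) \<and>
    (\<forall>\<epsilon>>0. compactin Y {x \<in> topspace Y. \<epsilon> \<le> cmod (f x)})}"

definition Cc :: "'x topology \<Rightarrow> ('x \<Rightarrow> complex) set"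
  where "Cc Y = {f. continuous_map Y euclidean f \<and> (\<forall>x. x \<notin> topspace Y \<longrightarrow> f x = 0) \<and>
    compactin Y (Y closure_of {x \<in> topspace Y. f x \<noteq> 0})}"

definition open_bisection :: "('g, 'z) top_groupoid \<Rightarrow> 'g set \<Rightarrow> bool"
  where "open_bisection G U \<longleftrightarrow> openin (gtop G) U \<and> inj_on (gdom G) U \<and> inj_on (grng G) U"

text \<open>In the convolution product, only finitely many \<open>\<beta>\<close> over a given unit satisfy
  \<open>g \<beta> \<noteq> 0\<close>.\<close>

definition groupoid_algebra :: "('g, 'z) top_groupoid \<Rightarrow> ('g \<Rightarrow> complex) star_alg"
  where "groupoid_algebra G = \<lparr>
    acarrier = {(\<lambda>\<gamma>. \<Sum>i<n. c i * h i \<gamma>) | (n::nat) c h.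
      \<forall>i<n. \<exists>U. open_bisection G U \<and> h i \<in> Cc (subtopology (gtop G) U)},
    azero = (\<lambda>\<gamma>. 0),
    aadd = (\<lambda>f g \<gamma>. f \<gamma> + g \<gamma>),
    ascale = (\<lambda>k f \<gamma>. k * f \<gamma>),
    amult = (\<lambda>f g \<gamma>. if \<gamma> \<in> topspace (gtop G)
      then \<Sum>\<beta> | \<beta> \<in> topspace (gtop G) \<and> gdom G \<beta> = gdom G \<gamma> \<and> g \<beta> \<noteq> 0.
             f (gmult G \<gamma> (ginv G \<beta>)) * g \<beta>
      else 0),
    astar = (\<lambda>f \<gamma>. if \<gamma> \<in> topspace (gtop G) then cnj (f (ginv G \<gamma>)) else 0)\<rparr>"

definition alpha :: "('s::inverse_semigroup \<Rightarrow> 'x \<rightharpoonup> 'x) \<Rightarrow> 's \<Rightarrow> ('x \<Rightarrow> complex) \<Rightarrow> 'x \<Rightarrow> complex"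
  where "alpha \<theta> s f x = (case \<theta> (s\<^sup>\<star>) x of None \<Rightarrow> 0 | Some y \<Rightarrow> f y)"

definition delta :: "'s \<Rightarrow> ('x \<Rightarrow> complex) \<Rightarrow> 's \<Rightarrow> 'x \<Rightarrow> complex"
  where "delta s f = (\<lambda>t. if t = s then f else (\<lambda>x. 0))"

text \<open>An element of the direct sum is a finitely supported family \<open>a\<close>, i.e. the sum of the
  \<open>delta s (a s)\<close>; product and involution are the (bi)additive extensions of
  \<open>(\<delta>\<^sub>s f)(\<delta>\<^sub>t g) = \<delta>\<^sub>s\<^sub>t \<alpha>\<^sub>t\<^sub>*(f \<alpha>\<^sub>t(g))\<close> and \<open>(\<delta>\<^sub>s f)\<^sup>* = \<delta>\<^sub>s\<^sub>* \<alpha>\<^sub>s(f\<^sup>*)\<close>, the latter read at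
  the index \<open>u = s\<^sup>*\<close>.\<close>

definition KS_algebraic :: "'x topology \<Rightarrow> ('s::inverse_semigroup \<Rightarrow> 'x \<rightharpoonup> 'x)
    \<Rightarrow> ('s \<Rightarrow> 'x \<Rightarrow> complex) star_alg"
  where "KS_algebraic X \<theta> = \<lparr>
    acarrier = {a. (\<forall>s. a s \<in> C0 (subtopology X (act_dom \<theta> (s\<^sup>\<star> * s)))) \<and>
                   finite {s. a s \<noteq> (\<lambda>x. 0)}},
    azero = (\<lambda>s x. 0),
    aadd = (\<lambda>a b s x. a s x + b s x),
    ascale = (\<lambda>k a s x. k * a s x),
    amult = (\<lambda>a b u x. \<Sum>(s, t) | a s \<noteq> (\<lambda>x. 0) \<and> b t \<noteq> (\<lambda>x. 0) \<and> s * t = u.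
      alpha \<theta> (t\<^sup>\<star>) (\<lambda>y. a s y * alpha \<theta> t (b t) y) x),
    astar = (\<lambda>a u. alpha \<theta> (u\<^sup>\<star>) (\<lambda>y. cnj (a (u\<^sup>\<star>) y)))\<rparr>"

lemma inv_star_props: "s * s\<^sup>\<star> * s = s" "s\<^sup>\<star> * s * s\<^sup>\<star> = s\<^sup>\<star>"
  unfolding inv_star_def using theI'[OF ex1_inverse[of s]] by auto

lemma inv_star_inv_star: "(s\<^sup>\<star>)\<^sup>\<star> = s"
  by (metis ex1_inverse inv_star_props)

lemma alpha_zero: "alpha \<theta> s (\<lambda>x. 0) = (\<lambda>x. 0)"
  by (auto simp: alpha_def split: option.split)

lemma delta_mult: "amult (KS_algebraic X \<theta>) (delta s f) (delta t g) =
  delta (s * t) (alpha \<theta> (t\<^sup>\<star>) (\<lambda>y. f y * alpha \<theta> t g y))"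
proof (intro ext)
  fix u x
  have *: "{(s', t'). delta s f s' \<noteq> (\<lambda>x. 0) \<and> delta t g t' \<noteq> (\<lambda>x. 0) \<and> s' * t' = u} =
      (if f \<noteq> (\<lambda>x. 0) \<and> g \<noteq> (\<lambda>x. 0) \<and> u = s * t then {(s, t)} else {})"
    by (auto simp: delta_def split: if_splits)
  show "amult (KS_algebraic X \<theta>) (delta s f) (delta t g) u x =
      delta (s * t) (alpha \<theta> (t\<^sup>\<star>) (\<lambda>y. f y * alpha \<theta> t g y)) u x"
    by (simp add: KS_algebraic_def *) (auto simp: delta_def alpha_zero)
qed

lemma delta_star: "astar (KS_algebraic X \<theta>) (delta s f) = delta (s\<^sup>\<star>) (alpha \<theta> s (\<lambda>y. cnj (f y)))"
proof (intro ext)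
  fix u x
  have "u\<^sup>\<star> = s \<longleftrightarrow> u = s\<^sup>\<star>" by (metis inv_star_inv_star)
  then show "astar (KS_algebraic X \<theta>) (delta s f) u x = delta (s\<^sup>\<star>) (alpha \<theta> s (\<lambda>y. cnj (f y))) u x"
    by (auto simp: KS_algebraic_def delta_def alpha_zero inv_star_inv_star)
qed

definition KS_crossed_product :: "'x topology \<Rightarrow> ('s::inverse_semigroup \<Rightarrow> 'x \<rightharpoonup> 'x)
    \<Rightarrow> (nat \<Rightarrow> 's \<Rightarrow> 'x \<Rightarrow> complex) set cstar_alg"
  where "KS_crossed_product X \<theta> = enveloping (KS_algebraic X \<theta>)"

definition groupoid_cstar_algebra :: "('g, 'z) top_groupoid \<Rightarrow> (nat \<Rightarrow> 'g \<Rightarrow> complex) set cstar_alg"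
  where "groupoid_cstar_algebra G = enveloping (groupoid_algebra G)"

end

(*
  Let phi send delta_s f, with f in C_c(X_{s*s}), to the function [s,tau] |-> f(tau(s*s)).  Every
  C*-seminorm of either algebra is bounded by the sum of the sup norms of the components, so it is
  enough to work with the dense subalgebra of compactly supported functions, and the point is to bound
  a C*-seminorm p on it in terms of phi.  For an element b supported on a finite set of idempotents
  the points of X^KS detect enough of b to give p(b) <= C sup |phi(b)| with C depending only on that
  set, and the C*-identity applied to high powers of b*b removes C.  An element a supported below
  one s reduces to this case, because a*a is supported on idempotents.  If the sum of n such elements,
  below s_1, ..., s_n, is small on the groupoid, then where one of them is large another one has the
  same germ, so the large part can be moved there, and induction on n gives a bound with a constant
  depending on n only.  Finally, by the Stone-Weierstrass theorem, p(a) is at most the sum of the sup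
  norms of any family of functions on X^KS that represents phi(a), and the image of phi is dense for
  this quotient seminorm, so that phi and its inverse both extend to the enveloping C*-algebras.
*)

theory Submission
  imports Defs
begin

section \<open>Inverse semigroups\<close>

text \<open>The map \<open>phi\<close> lives on compactly supported coefficients, and its image is
  dense but in general not everything. The groupoid need not be Hausdorff: a function in its algebra
  is a sum over bisections in many ways, need not be continuous, and its sup norm controls a
  C*-seminorm only up to a constant that depends on the index set. On the groupoid side the proof
  therefore measures functions by the infimum of the sums of sup norms over all representing
  families. The decisive point is that this also bounds every C*-seminorm \<open>p\<close> of the
  source, although the components of a representing family need not come from the source. The
  constant of the inductive estimate is harmless there: it is fixed by \<open>p\<close> and the
  finite index set, while the approximation error that it multiplies can be made arbitrarily small.
  The detour through C_c is forced: for \<open>f\<close> in C_0 the function induced on a bisection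
  need not have compact support, so it is not an element of \<open>Cc\<close> of that
  bisection.\<close>

lemma inv_star_unique: "s * t * s = s \<Longrightarrow> t * s * t = t \<Longrightarrow> s\<^sup>\<star> = t"
  by (metis ex1_inverse inv_star_props)

lemma inv_star_simps [simp]:
  "s * (s\<^sup>\<star> * s) = s" "s\<^sup>\<star> * (s * s\<^sup>\<star>) = s\<^sup>\<star>" "s * (s\<^sup>\<star> * (s * u)) = s * u" "s\<^sup>\<star> * (s * (s\<^sup>\<star> * u)) = s\<^sup>\<star> * u"
  by (metis inv_star_props mult.assoc)+

declare inv_star_inv_star [simp]

lemma idem_inv_star: "e \<in> idempotents \<Longrightarrow> e\<^sup>\<star> = e"
  by (rule inv_star_unique) (simp_all add: idempotents_def)

text \<open>With \<open>x\<close> the inverse of \<open>e * f\<close>, the element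
  \<open>f * x * e\<close> is an inverse too, so \<open>x = f * x * e\<close> by uniqueness. This
  form makes \<open>x\<close> idempotent, and an idempotent is its own inverse, so
  \<open>x = e * f\<close>.\<close>

lemma idem_mult_closed:
  assumes "e \<in> idempotents" "f \<in> idempotents" shows "e * f \<in> idempotents"
proof -
  have ee: "e * e = e" "f * f = f" using assms by (auto simp: idempotents_def)
  then have ee': "e * (e * u) = e * u" "f * (f * u) = f * u" for u by (metis mult.assoc)+
  define x where "x = (e * f)\<^sup>\<star>"
  have x: "e * (f * (x * (e * f))) = e * f" "x * (e * (f * x)) = x"
    using inv_star_props[of "e * f"] unfolding x_def by (simp_all add: mult.assoc)
  have x2: "x * (e * (f * (x * u))) = x * u" for u using x(2) by (metis mult.assoc)
  have "x = f * (x * e)"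
    unfolding x_def by (rule inv_star_unique) (simp_all add: mult.assoc ee' x[unfolded x_def] x2[unfolded x_def])
  then have "x * x = x" by (metis mult.assoc x2)
  then have "x \<in> idempotents" by (simp add: idempotents_def)
  then show ?thesis using idem_inv_star[of x] by (simp add: x_def)
qed

text \<open>Both products are idempotent, which makes \<open>f * e\<close> an inverse of
  \<open>e * f\<close>; but \<open>e * f\<close> is its own inverse.\<close>

lemma idem_commute:
  assumes "e \<in> idempotents" "f \<in> idempotents" shows "e * f = f * e"
proof -
  have ee: "e * e = e" "f * f = f" using assms by (auto simp: idempotents_def)
  then have ee': "e * (e * u) = e * u" "f * (f * u) = f * u" for u by (metis mult.assoc)+
  have ef: "e * f * (e * f) = e * f" "f * e * (f * e) = f * e"
    using idem_mult_closed assms by (auto simp: idempotents_def)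
  have "(e * f)\<^sup>\<star> = f * e"
    by (rule inv_star_unique) (use ef in \<open>simp_all add: mult.assoc ee'\<close>)
  then show ?thesis using idem_inv_star[OF idem_mult_closed[OF assms]] by simp
qed

lemma star_mult_idem [simp]: "s\<^sup>\<star> * s \<in> idempotents" "s * s\<^sup>\<star> \<in> idempotents"
  by (simp_all add: idempotents_def mult.assoc)

lemma inv_star_mult: "(s * t)\<^sup>\<star> = t\<^sup>\<star> * s\<^sup>\<star>"
proof (rule inv_star_unique)
  have *: "t * t\<^sup>\<star> * (s\<^sup>\<star> * s) = s\<^sup>\<star> * s * (t * t\<^sup>\<star>)" by (rule idem_commute) simp_all
  have "s * t * (t\<^sup>\<star> * s\<^sup>\<star>) * (s * t) = s * (t * t\<^sup>\<star> * (s\<^sup>\<star> * s)) * t" by (simp add: mult.assoc)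
  also have "\<dots> = s * t" unfolding * by (simp add: mult.assoc)
  finally show "s * t * (t\<^sup>\<star> * s\<^sup>\<star>) * (s * t) = s * t" .
  have "t\<^sup>\<star> * s\<^sup>\<star> * (s * t) * (t\<^sup>\<star> * s\<^sup>\<star>) = t\<^sup>\<star> * (s\<^sup>\<star> * s * (t * t\<^sup>\<star>)) * s\<^sup>\<star>" by (simp add: mult.assoc)
  also have "\<dots> = t\<^sup>\<star> * s\<^sup>\<star>" unfolding *[symmetric] by (simp add: mult.assoc)
  finally show "t\<^sup>\<star> * s\<^sup>\<star> * (s * t) * (t\<^sup>\<star> * s\<^sup>\<star>) = t\<^sup>\<star> * s\<^sup>\<star>" .
qed

lemma idem_self: "e \<in> idempotents \<Longrightarrow> e * e = e"
  by (simp add: idempotents_def)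

lemma idem_self_left: "e \<in> idempotents \<Longrightarrow> e * (e * u) = e * u"
  by (metis idem_self mult.assoc)

lemma idem_left_commute: "e \<in> idempotents \<Longrightarrow> f \<in> idempotents \<Longrightarrow> e * (f * u) = f * (e * u)"
  by (metis idem_commute mult.assoc)

lemma conj_idem:
  assumes "e \<in> idempotents" shows "s\<^sup>\<star> * e * s \<in> idempotents"
proof -
  have "s\<^sup>\<star> * e * s * (s\<^sup>\<star> * e * s) = s\<^sup>\<star> * (e * (s * s\<^sup>\<star>)) * e * s" by (simp add: mult.assoc)
  also have "\<dots> = s\<^sup>\<star> * e * s"
    unfolding idem_commute[OF assms star_mult_idem(2)] by (simp add: mult.assoc idem_self_left assms)
  finally show ?thesis by (simp add: idempotents_def)
qed

section \<open>The natural partial order\<close>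

lemma natural_le_iff: "natural_le u s \<longleftrightarrow> s * (u\<^sup>\<star> * u) = u"
  by (simp add: natural_le_def mult.assoc)

lemma natural_le_idem_iff: "e \<in> idempotents \<Longrightarrow> natural_le e s \<longleftrightarrow> s * e = e"
  by (simp add: natural_le_iff idem_inv_star idem_self)

lemma star_mult_mult_idem:
  assumes "e \<in> idempotents" shows "(s * e)\<^sup>\<star> * (s * e) = s\<^sup>\<star> * s * e"
proof -
  have "(s * e)\<^sup>\<star> * (s * e) = (e * (s\<^sup>\<star> * s)) * e"
    using assms by (simp add: inv_star_mult idem_inv_star mult.assoc)
  also have "\<dots> = s\<^sup>\<star> * s * e"
    unfolding idem_commute[OF assms star_mult_idem(1)] using assms by (simp add: mult.assoc idem_self)
  finally show ?thesis .
qed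

lemma natural_le_mult_idem: "e \<in> idempotents \<Longrightarrow> natural_le (s * e) s"
  unfolding natural_le_iff by (simp add: star_mult_mult_idem mult.assoc)

lemma natural_le_refl: "natural_le s s"
  by (simp add: natural_le_iff)

text \<open>Restrictions of one \<open>s\<close> differ only in their domains, so
  \<open>u\<^sup>\<star> * v\<close> is the idempotent of the common domain.\<close>

lemma natural_le_star_mult:
  assumes "natural_le u s" "natural_le v s"
  shows "u\<^sup>\<star> * v = (u\<^sup>\<star> * u) * (v\<^sup>\<star> * v)"
proof -
  have "u\<^sup>\<star> * v = (s * (u\<^sup>\<star> * u))\<^sup>\<star> * (s * (v\<^sup>\<star> * v))" using assms by (simp add: natural_le_iff)
  also have "\<dots> = u\<^sup>\<star> * u * (s\<^sup>\<star> * s) * (v\<^sup>\<star> * v)" by (simp add: inv_star_mult mult.assoc)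
  also have "\<dots> = s\<^sup>\<star> * s * (u\<^sup>\<star> * u) * (v\<^sup>\<star> * v)"
    unfolding idem_commute[OF star_mult_idem(1)[of u] star_mult_idem(1)[of s]] ..
  also have "\<dots> = s\<^sup>\<star> * (s * (u\<^sup>\<star> * u)) * (v\<^sup>\<star> * v)" by (simp only: mult.assoc)
  also have "\<dots> = s\<^sup>\<star> * u * (v\<^sup>\<star> * v)" using assms by (simp add: natural_le_iff)
  finally have 1: "u\<^sup>\<star> * v = s\<^sup>\<star> * u * (v\<^sup>\<star> * v)" .
  have "(s * (u\<^sup>\<star> * u))\<^sup>\<star> = u\<^sup>\<star>" using assms by (simp add: natural_le_iff)
  then have "u\<^sup>\<star> = u\<^sup>\<star> * u * s\<^sup>\<star>" by (simp add: inv_star_mult)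
  then have "u\<^sup>\<star> * u = (u\<^sup>\<star> * u) * (s\<^sup>\<star> * s) * (u\<^sup>\<star> * u)" using assms(1)[unfolded natural_le_iff]
    by (metis mult.assoc)
  also have "\<dots> = s\<^sup>\<star> * s * (u\<^sup>\<star> * u)"
    unfolding idem_commute[OF star_mult_idem(1)[of u] star_mult_idem(1)[of s]] by (simp add: mult.assoc)
  also have "\<dots> = s\<^sup>\<star> * u" using assms(1) by (simp add: natural_le_iff mult.assoc)
  finally show ?thesis using 1 by simp
qed

text \<open>Idempotents commute, so adding \<open>e\<close> to a closed set \<open>G\<close>
  requires only the further products \<open>e * g\<close>. The result keeps all powers of an element
  supported on idempotents inside one finite support.\<close>

lemma finite_idem_closure:
  assumes "finite F" "F \<subseteq> idempotents"
  shows "\<exists>G. finite G \<and> F \<subseteq> G \<and> G \<subseteq> idempotents \<and> (\<forall>e\<in>G. \<forall>f\<in>G. e * f \<in> G)"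
  using assms
proof (induction F rule: finite_induct)
  case empty
  then show ?case by (intro exI[of _ "{}"]) auto
next
  case (insert e F)
  then have "F \<subseteq> idempotents" and e: "e \<in> idempotents" by auto
  from insert.IH[OF this(1)] obtain G where G: "finite G" "F \<subseteq> G" "G \<subseteq> idempotents"
    and G4: "\<forall>e\<in>G. \<forall>f\<in>G. e * f \<in> G" by (elim exE conjE)
  let ?G = "insert e (G \<union> (*) e ` G)"
  have *: "x * e = e * x" "x * (e * u) = e * (x * u)" if "x \<in> G" for x u
    using that G(3) e idem_commute idem_left_commute by blast+
  have A: "x * y \<in> ?G" if "x \<in> G" "y \<in> ?G" for x y
    using that(2) *[OF that(1)] bspec[OF G4 that(1)] that(1) by auto
  have B: "e * y \<in> ?G" if "y \<in> ?G" for y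
    using that idem_self[OF e] idem_self_left[OF e] by auto
  have "x * y \<in> ?G" if x: "x \<in> ?G" and y: "y \<in> ?G" for x y
  proof -
    from x consider "x = e" | "x \<in> G" | g where "g \<in> G" "x = e * g" by blast
    then show ?thesis
    proof cases
      case 3
      then show ?thesis using B[OF A[OF 3(1) y]] by (simp add: mult.assoc)
    qed (use A B y in blast)+
  qed
  moreover have "?G \<subseteq> idempotents" using G(3) e idem_mult_closed by blast
  ultimately show ?case using G(1,2) by (intro exI[of _ ?G] conjI ballI) auto
qed


section \<open>Spaces of continuous functions\<close>

text \<open>Makes the limit rules for sums, products and conjugates available for maps on abstract
  topologies.\<close>

lemma continuous_map_iff_tendsto:
  "continuous_map X euclidean f \<longleftrightarrow> (\<forall>x\<in>topspace X. (f \<longlongrightarrow> f x) (atin X x))"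
  by (simp add: continuous_map_atin)

lemma continuous_map_cmult:
  fixes f g :: "'x \<Rightarrow> 'b::real_normed_algebra"
  shows "continuous_map X euclidean f \<Longrightarrow> continuous_map X euclidean g \<Longrightarrow> continuous_map X euclidean (\<lambda>x. f x * g x)"
  by (auto simp: continuous_map_iff_tendsto intro: tendsto_mult)

lemma continuous_map_cadd:
  fixes f g :: "'x \<Rightarrow> 'b::real_normed_vector"
  shows "continuous_map X euclidean f \<Longrightarrow> continuous_map X euclidean g \<Longrightarrow> continuous_map X euclidean (\<lambda>x. f x + g x)"
  by (auto simp: continuous_map_iff_tendsto intro: tendsto_add)

lemma continuous_map_cdiff:
  fixes f g :: "'x \<Rightarrow> 'b::real_normed_vector"
  shows "continuous_map X euclidean f \<Longrightarrow> continuous_map X euclidean g \<Longrightarrow> continuous_map X euclidean (\<lambda>x. f x - g x)"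
  by (auto simp: continuous_map_iff_tendsto intro: tendsto_diff)

lemma continuous_map_ccnj: "continuous_map X euclidean f \<Longrightarrow> continuous_map X euclidean (\<lambda>x. cnj (f x))"
  by (auto simp: continuous_map_iff_tendsto intro: tendsto_cnj)

lemma continuous_map_comp_cont:
  fixes f :: "'x \<Rightarrow> 'b::topological_space" and g :: "'b \<Rightarrow> 'c::topological_space"
  shows "continuous_map X euclidean f \<Longrightarrow> continuous_on UNIV g \<Longrightarrow> continuous_map X euclidean (\<lambda>x. g (f x))"
  using continuous_map_compose[of X euclidean f euclidean g] by (simp add: o_def)

text \<open>For \<open>c = True\<close> the functions with compact support inside \<open>U\<close>, for \<open>c = False\<close> those vanishing at
  infinity on \<open>U\<close>, so that the two algebras built from them can be treated together.\<close>

definition vanish :: "bool \<Rightarrow> 'x topology \<Rightarrow> 'x set \<Rightarrow> ('x \<Rightarrow> complex) \<Rightarrow> bool"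
  where "vanish c X U f \<longleftrightarrow>
    (\<forall>\<epsilon>>0. \<exists>K. compactin X K \<and> K \<subseteq> U \<and> (\<forall>x. x \<notin> K \<longrightarrow> (if c then f x = 0 else cmod (f x) < \<epsilon>)))"

definition Fn :: "bool \<Rightarrow> 'x topology \<Rightarrow> 'x set \<Rightarrow> ('x \<Rightarrow> complex) set"
  where "Fn c X U = {f. continuous_map X euclidean f \<and> vanish c X U f}"

lemma vanishD:
  assumes "vanish c X U f" "\<epsilon> > 0"
  shows "\<exists>K. compactin X K \<and> K \<subseteq> U \<and> (\<forall>x. x \<notin> K \<longrightarrow> cmod (f x) < \<epsilon> \<and> (c \<longrightarrow> f x = 0))"
proof -
  obtain K where "compactin X K" "K \<subseteq> U" "\<forall>x. x \<notin> K \<longrightarrow> (if c then f x = 0 else cmod (f x) < \<epsilon>)"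
    using assms unfolding vanish_def by meson
  with assms(2) show ?thesis by (intro exI[of _ K]) (auto split: if_splits)
qed

lemma vanish_zero: assumes "vanish c X U f" "x \<notin> U" shows "f x = 0"
proof -
  have "cmod (f x) < \<epsilon>" if "\<epsilon> > 0" for \<epsilon>
    using vanishD[OF assms(1) that] assms(2) by auto
  then have "cmod (f x) \<le> 0" by (meson less_irrefl not_le)
  then show ?thesis by simp
qed

lemma Fn_zero: "f \<in> Fn c X U \<Longrightarrow> x \<notin> U \<Longrightarrow> f x = 0"
  by (auto simp: Fn_def vanish_zero)

lemma Fn_cont: "f \<in> Fn c X U \<Longrightarrow> continuous_map X euclidean f"
  by (simp add: Fn_def)

lemma Fn_True_support:
  assumes "f \<in> Fn True X U"
  obtains K where "compactin X K" "K \<subseteq> U" "\<And>x. x \<notin> K \<Longrightarrow> f x = 0"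
  using vanishD[of True X U f 1] assms that unfolding Fn_def by auto

lemma FnD:
  "f \<in> Fn c X U \<Longrightarrow> \<epsilon> > 0 \<Longrightarrow>
    \<exists>K. compactin X K \<and> K \<subseteq> U \<and> (\<forall>x. x \<notin> K \<longrightarrow> cmod (f x) < \<epsilon> \<and> (c \<longrightarrow> f x = 0))"
  by (simp add: Fn_def vanishD)

lemma Fn_TrueI:
  "continuous_map X euclidean f \<Longrightarrow> compactin X K \<Longrightarrow> K \<subseteq> U \<Longrightarrow> (\<And>x. x \<notin> K \<Longrightarrow> f x = 0) \<Longrightarrow> f \<in> Fn True X U"
  by (auto simp: Fn_def vanish_def)

lemma Fn_mono: "f \<in> Fn c X U \<Longrightarrow> U \<subseteq> V \<Longrightarrow> f \<in> Fn c X V"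
  unfolding Fn_def vanish_def by (blast intro: order_trans)

lemma Fn_True_subset: assumes "f \<in> Fn True X U" shows "f \<in> Fn c X U"
  by (rule Fn_True_support[OF assms]) (use assms in \<open>auto simp: Fn_def vanish_def\<close>)

text \<open>Extension by zero stays continuous: a neighbourhood of 0 pulls back to a set that
  contains the complement of a compact, hence closed, subset \<open>K\<close> of
  \<open>D\<close>.\<close>

lemma vanish_continuous:
  assumes H: "Hausdorff_space X" and D: "openin X D" and f: "continuous_map (subtopology X D) euclidean f"
    and v: "vanish c X D f"
  shows "continuous_map X euclidean f"
  unfolding continuous_map_def
proof (intro conjI allI impI)
  fix V :: "complex set" assume V: "openin euclidean V"
  have D1: "openin X {x \<in> D. f x \<in> V}"
  proof -
    have "openin (subtopology X D) {x \<in> topspace (subtopology X D). f x \<in> V}"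
      using f V by (rule openin_continuous_map_preimage)
    then show ?thesis
      using D openin_subset[OF D] by (simp add: openin_open_subtopology Collect_conj_eq Int_absorb1)
  qed
  show "openin X {x \<in> topspace X. f x \<in> V}"
  proof (cases "0 \<in> V")
    case False
    then have "{x \<in> topspace X. f x \<in> V} = {x \<in> D. f x \<in> V}"
      using vanish_zero[OF v] openin_subset[OF D] by auto metis
    then show ?thesis using D1 by simp
  next
    case True
    then obtain \<epsilon> where e: "\<epsilon> > 0" "ball 0 \<epsilon> \<subseteq> V" using V by (meson open_contains_ball open_openin)
    obtain K where K: "compactin X K" "K \<subseteq> D" "\<And>x. x \<notin> K \<Longrightarrow> cmod (f x) < \<epsilon>"
      using vanishD[OF v e(1)] by auto
    have "{x \<in> topspace X. f x \<in> V} = {x \<in> D. f x \<in> V} \<union> (topspace X - K)"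
      using K e openin_subset[OF D] by (auto simp: subset_iff)
    moreover have "openin X (topspace X - K)" using compactin_imp_closedin[OF H K(1)] by blast
    ultimately show ?thesis using D1 by (simp add: openin_Un)
  qed
qed auto

lemma FnI:
  assumes "Hausdorff_space X" "openin X D" "continuous_map (subtopology X D) euclidean f" "U \<subseteq> D" "vanish c X U f"
  shows "f \<in> Fn c X U"
proof -
  have "vanish c X D f" using assms(4,5) unfolding vanish_def by (meson order_trans)
  then show ?thesis using assms vanish_continuous by (auto simp: Fn_def)
qed

section \<open>Agreement with C_c and C_0 of open subspaces\<close>

lemma Fn_True_eq_Cc:
  assumes H: "Hausdorff_space X" and U: "openin X U"
  shows "Fn True X U = Cc (subtopology X U)"
proof (intro set_eqI iffI)
  have sub: "U \<subseteq> topspace X" using U openin_subset by blast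
  fix f
  { assume f: "f \<in> Fn True X U"
    obtain K where K: "compactin X K" "K \<subseteq> U" "\<And>x. x \<notin> K \<Longrightarrow> f x = 0" using f Fn_True_support by metis
    have Kc: "compactin (subtopology X U) K" using K by (simp add: compactin_subtopology)
    have cl: "closedin (subtopology X U) K"
      using compactin_imp_closedin[OF Hausdorff_space_subtopology[OF H] Kc] .
    have "subtopology X U closure_of {x \<in> topspace (subtopology X U). f x \<noteq> 0} \<subseteq> K"
      by (rule closure_of_minimal[OF _ cl]) (use K(3) in blast)
    then have "compactin (subtopology X U) (subtopology X U closure_of {x \<in> topspace (subtopology X U). f x \<noteq> 0})"
      by (rule closed_compactin[OF Kc]) simp
    then show "f \<in> Cc (subtopology X U)"
      using f K sub by (auto simp: Cc_def continuous_map_from_subtopology Fn_cont)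
  }
  { assume f: "f \<in> Cc (subtopology X U)"
    let ?K = "subtopology X U closure_of {x \<in> topspace (subtopology X U). f x \<noteq> 0}"
    have K: "compactin X ?K" "?K \<subseteq> U"
      using f by (auto simp: Cc_def compactin_subtopology)
    have "f x = 0" if "x \<notin> ?K" for x
    proof (rule ccontr)
      assume "f x \<noteq> 0"
      then have "x \<in> {x \<in> topspace (subtopology X U). f x \<noteq> 0}" using f by (auto simp: Cc_def)
      then show False using that closure_of_subset[of "{x \<in> topspace (subtopology X U). f x \<noteq> 0}" "subtopology X U"] by auto
    qed
    then have "vanish True X U f" using K by (auto simp: vanish_def)
    then show "f \<in> Fn True X U"
      using f by (intro FnI[OF H U]) (auto simp: Cc_def) }
qed

lemma Fn_False_eq_C0:
  assumes H: "Hausdorff_space X" and U: "openin X U"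
  shows "Fn False X U = C0 (subtopology X U)"
proof (intro set_eqI iffI)
  have sub: "U \<subseteq> topspace X" using U openin_subset by blast
  then have top: "topspace (subtopology X U) = U" by auto
  fix f
  { assume f: "f \<in> Fn False X U"
    have "compactin X {x \<in> U. \<epsilon> \<le> cmod (f x)}" if e: "\<epsilon> > 0" for \<epsilon>
    proof -
      obtain K where K: "compactin X K" "K \<subseteq> U" "\<And>x. x \<notin> K \<Longrightarrow> cmod (f x) < \<epsilon>"
        using FnD[OF f e] by auto
      have "continuous_map X euclidean (\<lambda>x. cmod (f x))"
        using Fn_cont[OF f] continuous_map_norm by blast
      then have "closedin X {x \<in> topspace X. cmod (f x) \<in> {\<epsilon>..}}"
        by (rule closedin_continuous_map_preimage) auto
      moreover have "{x \<in> topspace X. cmod (f x) \<in> {\<epsilon>..}} = {x \<in> U. \<epsilon> \<le> cmod (f x)}"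
        using sub K Fn_zero[OF f] e by force
      moreover have "{x \<in> U. \<epsilon> \<le> cmod (f x)} \<subseteq> K" using K(3) by (auto simp: not_less[symmetric])
      ultimately show ?thesis using closed_compactin[OF K(1)] by simp
    qed
    then show "f \<in> C0 (subtopology X U)"
      using f Fn_zero[OF f] unfolding C0_def top compactin_subtopology
      by (auto simp: continuous_map_from_subtopology Fn_cont)
  }
  { assume f: "f \<in> C0 (subtopology X U)"
    have "vanish False X U f"
      unfolding vanish_def
    proof (intro allI impI)
      fix \<epsilon> :: real assume e: "\<epsilon> > 0"
      have "compactin X {x \<in> U. \<epsilon> \<le> cmod (f x)}" "\<forall>x. x \<notin> U \<longrightarrow> f x = 0"
        using f e unfolding C0_def top compactin_subtopology by auto
      then show "\<exists>K. compactin X K \<and> K \<subseteq> U \<and> (\<forall>x. x \<notin> K \<longrightarrow> (if False then f x = 0 else cmod (f x) < \<epsilon>))"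
        using e by (intro exI[of _ "{x \<in> U. \<epsilon> \<le> cmod (f x)}"]) (auto simp: not_le)
    qed
    then show "f \<in> Fn False X U"
      using f by (intro FnI[OF H U]) (auto simp: C0_def) }
qed

section \<open>Algebraic operations on these functions\<close>

lemma Fn_bounded: assumes "f \<in> Fn c X U" shows "\<exists>M>0. \<forall>x. cmod (f x) \<le> M"
proof -
  obtain K where K: "compactin X K" "K \<subseteq> U" "\<And>x. x \<notin> K \<Longrightarrow> cmod (f x) < 1"
    using FnD[OF assms, of 1] by auto
  have "compactin euclidean (f ` K)" using image_compactin[OF K(1)] Fn_cont[OF assms] by blast
  then have "bounded (f ` K)" by (simp add: compact_imp_bounded)
  then obtain B where B: "B > 0" "\<And>x. x \<in> K \<Longrightarrow> cmod (f x) \<le> B" by (auto simp: bounded_pos)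
  have "cmod (f x) \<le> B + 1" for x
    using B(1) B(2)[of x] K(3)[of x] by (cases "x \<in> K") auto
  then show ?thesis using B(1) by (intro exI[of _ "B + 1"]) auto
qed

lemma Fn_0 [simp]: "(\<lambda>x. 0) \<in> Fn c X U"
  by (auto simp: Fn_def vanish_def intro: exI[of _ "{}"])

lemma Fn_add: assumes "f \<in> Fn c X U" "g \<in> Fn c X U" shows "(\<lambda>x. f x + g x) \<in> Fn c X U"
proof -
  have "vanish c X U (\<lambda>x. f x + g x)"
    unfolding vanish_def
  proof (intro allI impI)
    fix \<epsilon> :: real assume "\<epsilon> > 0"
    then have e: "\<epsilon>/2 > 0" by simp
    obtain K where K: "compactin X K" "K \<subseteq> U" "\<And>x. x \<notin> K \<Longrightarrow> cmod (f x) < \<epsilon>/2" "\<And>x. x \<notin> K \<Longrightarrow> c \<Longrightarrow> f x = 0"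
      using FnD[OF assms(1) e] by auto
    obtain L where L: "compactin X L" "L \<subseteq> U" "\<And>x. x \<notin> L \<Longrightarrow> cmod (g x) < \<epsilon>/2" "\<And>x. x \<notin> L \<Longrightarrow> c \<Longrightarrow> g x = 0"
      using FnD[OF assms(2) e] by auto
    have "cmod (f x + g x) < \<epsilon>" if "x \<notin> K \<union> L" for x
      using K(3)[of x] L(3)[of x] norm_triangle_ineq[of "f x" "g x"] that by auto
    then show "\<exists>K. compactin X K \<and> K \<subseteq> U \<and> (\<forall>x. x \<notin> K \<longrightarrow> (if c then f x + g x = 0 else cmod (f x + g x) < \<epsilon>))"
      using K L by (intro exI[of _ "K \<union> L"]) (auto simp: compactin_Un)
  qed
  then show ?thesis using assms by (auto simp: Fn_def intro: continuous_map_cadd)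
qed

lemma Fn_mult_bounded:
  assumes f: "f \<in> Fn c X U" and g: "continuous_map X euclidean g" and M: "\<And>x. cmod (g x) \<le> M"
  shows "(\<lambda>x. g x * f x) \<in> Fn c X U"
proof -
  have "vanish c X U (\<lambda>x. g x * f x)"
    unfolding vanish_def
  proof (intro allI impI)
    fix \<epsilon> :: real assume e: "\<epsilon> > 0"
    have M0: "0 \<le> M" using M order_trans norm_ge_zero by blast
    then have e: "\<epsilon>/(M+1) > 0" using e by simp
    obtain K where K: "compactin X K" "K \<subseteq> U" "\<And>x. x \<notin> K \<Longrightarrow> cmod (f x) < \<epsilon>/(M+1)" "\<And>x. x \<notin> K \<Longrightarrow> c \<Longrightarrow> f x = 0"
      using FnD[OF f e] by auto
    have "cmod (g x * f x) < \<epsilon>" if "x \<notin> K" for x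
    proof -
      have "cmod (g x) * cmod (f x) \<le> (M+1) * cmod (f x)" using M[of x] by (intro mult_right_mono) auto
      also have "\<dots> < \<epsilon>" using K(3)[OF that] M0 by (simp add: pos_less_divide_eq mult.commute)
      finally show ?thesis by (simp add: norm_mult)
    qed
    then show "\<exists>K. compactin X K \<and> K \<subseteq> U \<and> (\<forall>x. x \<notin> K \<longrightarrow> (if c then g x * f x = 0 else cmod (g x * f x) < \<epsilon>))"
      using K by (intro exI[of _ K]) auto
  qed
  then show ?thesis using assms by (auto simp: Fn_def intro: continuous_map_cmult)
qed

lemma Fn_scale: "f \<in> Fn c X U \<Longrightarrow> (\<lambda>x. k * f x) \<in> Fn c X U"
  by (rule Fn_mult_bounded[where M = "cmod k"]) auto

lemma Fn_cnj: "f \<in> Fn c X U \<Longrightarrow> (\<lambda>x. cnj (f x)) \<in> Fn c X U"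
  by (simp add: Fn_def vanish_def continuous_map_ccnj cong: if_cong)

lemma Fn_diff: "f \<in> Fn c X U \<Longrightarrow> g \<in> Fn c X U \<Longrightarrow> (\<lambda>x. f x - g x) \<in> Fn c X U"
  using Fn_add[of f c X U "\<lambda>x. (-1) * g x"] Fn_scale[of g c X U "-1"] by simp

text \<open>Covers the product of \<open>f o tr t\<close> and \<open>g\<close> in the crossed
  product: \<open>f o m\<close> alone is given on \<open>D\<close> only and need not vanish towards
  the boundary of \<open>D\<close>. The points of the compact \<open>L\<close> for \<open>g\<close>
  that \<open>m\<close> sends into \<open>K\<close> form a closed subset of \<open>L\<close>, hence
  a compact set.\<close>

lemma Fn_shift_mult:
  assumes H: "Hausdorff_space X" and D: "openin X D"
    and m: "continuous_map (subtopology X D) X m" and f: "f \<in> Fn c X U" and g: "g \<in> Fn c X D"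
  shows "(\<lambda>x. f (m x) * g x) \<in> Fn c X {x \<in> D. m x \<in> U}"
proof (rule FnI[OF H D])
  show "continuous_map (subtopology X D) euclidean (\<lambda>x. f (m x) * g x)"
    using continuous_map_compose[OF m Fn_cont[OF f]] continuous_map_from_subtopology[OF Fn_cont[OF g]]
    unfolding o_def by (rule continuous_map_cmult)
  show "vanish c X {x \<in> D. m x \<in> U} (\<lambda>x. f (m x) * g x)"
    unfolding vanish_def
  proof (intro allI impI)
    fix \<epsilon> :: real assume e: "\<epsilon> > 0"
    obtain M N where M: "M > 0" "\<And>x. cmod (f x) \<le> M" and N: "N > 0" "\<And>x. cmod (g x) \<le> N"
      using Fn_bounded[OF f] Fn_bounded[OF g] by blast
    have e1: "\<epsilon> / M > 0" and e2: "\<epsilon> / N > 0" using e M N by auto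
    obtain K where K: "compactin X K" "K \<subseteq> U" "\<And>x. x \<notin> K \<Longrightarrow> cmod (f x) < \<epsilon>/N" "\<And>x. x \<notin> K \<Longrightarrow> c \<Longrightarrow> f x = 0"
      using FnD[OF f e2] by auto
    obtain L where L: "compactin X L" "L \<subseteq> D" "\<And>x. x \<notin> L \<Longrightarrow> cmod (g x) < \<epsilon>/M" "\<And>x. x \<notin> L \<Longrightarrow> c \<Longrightarrow> g x = 0"
      using FnD[OF g e1] by auto
    let ?K = "{x \<in> L. m x \<in> K}"
    have mL: "continuous_map (subtopology X L) X m" using m L(2) continuous_map_from_subtopology_mono by blast
    have "closedin (subtopology X L) {x \<in> topspace (subtopology X L). m x \<in> K}"
      by (rule closedin_continuous_map_preimage[OF mL compactin_imp_closedin[OF H K(1)]])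
    moreover have "{x \<in> topspace (subtopology X L). m x \<in> K} = ?K"
      using compactin_subset_topspace[OF L(1)] by auto
    moreover have "compact_space (subtopology X L)" using L(1) compact_space_subtopology by blast
    ultimately have "compactin (subtopology X L) ?K" using closedin_compact_space by metis
    then have 1: "compactin X ?K" by (simp add: compactin_subtopology)
    have 2: "cmod (f (m x) * g x) < \<epsilon>" if "x \<notin> ?K" for x
    proof (cases "x \<in> L")
      case True
      then have "cmod (f (m x)) < \<epsilon>/N" using K that by blast
      then have "cmod (f (m x)) * N < \<epsilon>" using N by (simp add: pos_less_divide_eq)
      moreover have "cmod (f (m x)) * cmod (g x) \<le> cmod (f (m x)) * N" using N by (simp add: mult_left_mono)
      ultimately show ?thesis by (simp add: norm_mult)
    next
      case False
      then have "cmod (g x) < \<epsilon>/M" using L by blast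
      then have "M * cmod (g x) < \<epsilon>" using M by (simp add: pos_less_divide_eq mult.commute)
      moreover have "cmod (f (m x)) * cmod (g x) \<le> M * cmod (g x)" using M by (simp add: mult_right_mono)
      ultimately show ?thesis by (simp add: norm_mult)
    qed
    have 3: "f (m x) * g x = 0" if "x \<notin> ?K" c for x using that K(4) L(4) by auto
    show "\<exists>K. compactin X K \<and> K \<subseteq> {x \<in> D. m x \<in> U} \<and> (\<forall>x. x \<notin> K \<longrightarrow> (if c then f (m x) * g x = 0 else cmod (f (m x) * g x) < \<epsilon>))"
      by (rule exI[of _ ?K]) (use 1 2 3 K(2) L(2) in auto)
  qed
qed auto

lemma Fn_mult:
  assumes "Hausdorff_space X" "openin X D" "f \<in> Fn c X U" "g \<in> Fn c X D"
  shows "(\<lambda>x. f x * g x) \<in> Fn c X (U \<inter> D)"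
proof -
  have "continuous_map (subtopology X D) X id" by (simp add: continuous_map_from_subtopology)
  from Fn_shift_mult[OF assms(1,2) this assms(3,4)] show ?thesis by (simp add: Int_def conj_commute)
qed

lemma Fn_True_mult_local:
  assumes H: "Hausdorff_space X" and V: "openin X V" and f: "continuous_map (subtopology X V) euclidean f"
    and g: "g \<in> Fn True X V"
  shows "(\<lambda>x. f x * g x) \<in> Fn True X V"
proof (rule FnI[OF H V])
  obtain K where "compactin X K" "K \<subseteq> V" "\<And>x. x \<notin> K \<Longrightarrow> g x = 0" using g Fn_True_support by metis
  then show "vanish True X V (\<lambda>x. f x * g x)" by (auto simp: vanish_def)
  show "continuous_map (subtopology X V) euclidean (\<lambda>x. f x * g x)"
    by (intro continuous_map_cmult f continuous_map_from_subtopology Fn_cont[OF g])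
qed auto

text \<open>Local compactness of \<open>U\<close> inserts an open \<open>V\<close> and a compact
  \<open>L\<close> between \<open>K\<close> and \<open>U\<close>; a function separating
  \<open>K\<close> from the complement of \<open>V\<close> then has its support in
  \<open>L\<close>.\<close>

lemma Urysohn_bump:
  assumes X: "locally_compact_space X" "Hausdorff_space X" and U: "openin X U" and K: "compactin X K" "K \<subseteq> U"
  shows "\<exists>g :: 'x \<Rightarrow> real. (\<lambda>x. of_real (g x)) \<in> Fn True X U \<and> (\<forall>x. 0 \<le> g x \<and> g x \<le> 1) \<and> (\<forall>x\<in>K. g x = 1)"
proof -
  have Y: "locally_compact_space (subtopology X U)" "Hausdorff_space (subtopology X U)"
    using locally_compact_space_open_subset[OF _ X(1) U] X Hausdorff_space_subtopology by blast+
  have "compactin (subtopology X U) K" using K by (simp add: compactin_subtopology)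
  then obtain V L where V: "openin (subtopology X U) V" and L: "compactin (subtopology X U) L" and KV: "K \<subseteq> V" "V \<subseteq> L"
    using Y locally_compact_space_compact_closed_compact[of "subtopology X U"] by metis
  have VX: "openin X V" using V U by (simp add: openin_open_subtopology)
  have LX: "compactin X L" "L \<subseteq> U" using L by (auto simp: compactin_subtopology)
  have cr: "completely_regular_space X" using X locally_compact_regular_imp_completely_regular_space by blast
  obtain f where f: "continuous_map X euclideanreal f" "f ` (topspace X - V) \<subseteq> {0}" "f ` K \<subseteq> {1}"
    by (rule Urysohn_completely_regular_compact_closed_alt[OF cr K(1), of "topspace X - V" 0 1])
      (use VX KV in \<open>auto simp: disjnt_def\<close>)
  define g where "g x = (if x \<in> topspace X then max 0 (min 1 (f x)) else 0)" for x
  have "continuous_map X euclideanreal (\<lambda>x. max 0 (min 1 (f x)))"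
    by (intro continuous_map_real_max continuous_map_real_min f) auto
  then have "continuous_map X euclideanreal g" by (rule continuous_map_eq) (simp add: g_def)
  then have "continuous_map X euclidean (\<lambda>x. complex_of_real (g x))"
    by (rule continuous_map_comp_cont) (intro continuous_intros)
  moreover have "g x = 0" if "x \<notin> L" for x
  proof (cases "x \<in> topspace X")
    case True
    then have "f x = 0" using that f(2) KV by blast
    then show ?thesis by (simp add: g_def)
  qed (simp add: g_def)
  ultimately have "(\<lambda>x. of_real (g x)) \<in> Fn True X U" using LX by (intro Fn_TrueI[of _ _ L]) auto
  moreover have "g x = 1" if "x \<in> K" for x
    using that f(3) compactin_subset_topspace[OF K(1)] by (auto simp: g_def)
  moreover have "0 \<le> g x \<and> g x \<le> 1" for x by (simp add: g_def)
  ultimately show ?thesis by blast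
qed

definition snorm :: "('x \<Rightarrow> complex) \<Rightarrow> real"
  where "snorm f = (SUP x. cmod (f x))"

lemma snorm_upper: assumes "f \<in> Fn c X U" shows "cmod (f x) \<le> snorm f"
  unfolding snorm_def
  by (rule cSUP_upper) (use Fn_bounded[OF assms] in \<open>auto simp: bdd_above_def\<close>)

lemma snorm_least: "(\<And>x. cmod (f x) \<le> M) \<Longrightarrow> snorm f \<le> M"
  unfolding snorm_def by (rule cSUP_least) auto

lemma snorm_nonneg: assumes "f \<in> Fn c X U" shows "0 \<le> snorm f"
  using snorm_upper[OF assms] norm_ge_zero order_trans by blast

lemma snorm_0 [simp]: "snorm (\<lambda>x. 0) = 0"
  by (simp add: snorm_def)

section \<open>Actions on locally compact Hausdorff spaces\<close>

text \<open>Only the carrier depends on \<open>c\<close>, so all identities are proved once.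
  \<open>c = False\<close> is the given algebra (\<open>alg_False\<close>), \<open>c = True\<close>
  the dense subalgebra on which \<open>phi\<close> is defined.\<close>

definition alg :: "bool \<Rightarrow> 'x topology \<Rightarrow> ('s::inverse_semigroup \<Rightarrow> 'x \<rightharpoonup> 'x) \<Rightarrow> ('s \<Rightarrow> 'x \<Rightarrow> complex) star_alg"
  where "alg c X \<theta> = (KS_algebraic X \<theta>)
    \<lparr>acarrier := {a. (\<forall>s. a s \<in> Fn c X (act_dom \<theta> (s\<^sup>\<star> * s))) \<and> finite {s. a s \<noteq> (\<lambda>x. 0)}}\<rparr>"

text \<open>The l^1-sum of the sup norms of the components: submultiplicative, not increased by the
  involution, an upper bound for every C*-seminorm, but in general not a C*-norm itself.\<close>

definition nsum :: "('s \<Rightarrow> 'x \<Rightarrow> complex) \<Rightarrow> real"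
  where "nsum a = (\<Sum>s | a s \<noteq> (\<lambda>x. 0). snorm (a s))"

lemma nsum_eq:
  assumes "finite F" "{s. a s \<noteq> (\<lambda>x. 0)} \<subseteq> F" shows "nsum a = (\<Sum>s\<in>F. snorm (a s))"
  unfolding nsum_def by (rule sum.mono_neutral_left) (use assms in auto)

lemma nsum_delta: "nsum (delta s f) = snorm f"
  by (subst nsum_eq[of "{s}"]) (auto simp: delta_def)

locale lch_action =
  fixes X :: "'x topology" and \<theta> :: "'s::inverse_semigroup \<Rightarrow> 'x \<rightharpoonup> 'x"
  assumes LC: "locally_compact_space X" and Haus: "Hausdorff_space X" and act: "is_action X \<theta>"
begin

definition dm :: "'s \<Rightarrow> 'x set" where "dm s = act_dom \<theta> (s\<^sup>\<star> * s)"
definition tr :: "'s \<Rightarrow> 'x \<Rightarrow> 'x" where "tr s x = the (\<theta> s x)"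

lemma act_comp: "\<theta> (s * t) x = Option.bind (\<theta> t x) (\<theta> s)"
  using act by (auto simp: is_action_def map_comp_def split: option.splits)

lemma act_pb: "partial_bijection (topspace X) (\<theta> s)"
  using act by (simp add: is_action_def)

lemma act_inj: "\<theta> s x = Some z \<Longrightarrow> \<theta> s y = Some z \<Longrightarrow> x = y"
  using act_pb[of s] unfolding partial_bijection_def inj_on_def by (metis domI)

lemma act_idem: assumes "e \<in> idempotents" "\<theta> e x = Some y" shows "y = x"
proof -
  have "\<theta> (e * e) x = Some y" using assms by (simp add: idem_self)
  then have "\<theta> e y = Some y" using assms by (simp add: act_comp)
  then show ?thesis using act_inj assms by metis
qed

text \<open>Idempotents act as identities on their domains, and
  \<open>s = s * (s\<^sup>\<star> * s)\<close> forces \<open>s\<close> to be undefined wherever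
  \<open>s\<^sup>\<star> * s\<close> is.\<close>

lemma act_None_iff: "\<theta> s x = None \<longleftrightarrow> x \<notin> dm s"
proof
  assume "\<theta> s x = None" then show "x \<notin> dm s" by (simp add: dm_def act_dom_def act_comp)
next
  assume a: "x \<notin> dm s"
  have "\<theta> (s\<^sup>\<star> * s) x = None"
  proof (cases "\<theta> (s\<^sup>\<star> * s) x")
    case (Some y)
    then have "y = x" by (rule act_idem[rotated]) simp
    then show ?thesis using a Some by (simp add: dm_def act_dom_def)
  qed
  then have "\<theta> (s * (s\<^sup>\<star> * s)) x = None" by (subst act_comp) simp
  then show "\<theta> s x = None" by simp
qed

lemma act_Some: "x \<in> dm s \<Longrightarrow> \<theta> s x = Some (tr s x)"
  using act_None_iff[of s x] by (auto simp: tr_def)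

lemma act_Some_iff: "\<theta> s x = Some y \<longleftrightarrow> x \<in> dm s \<and> y = tr s x"
  using act_None_iff[of s x] act_Some[of x s] by fastforce

lemma act_dom_idem: "e \<in> idempotents \<Longrightarrow> act_dom \<theta> e = dm e"
  by (simp add: dm_def idem_inv_star idem_self)

lemma tr_idem: "e \<in> idempotents \<Longrightarrow> x \<in> dm e \<Longrightarrow> tr e x = x"
  using act_idem act_Some by blast

lemma dm_mult: "dm (s * t) = {x \<in> dm t. tr t x \<in> dm s}"
proof -
  have "x \<in> dm (s * t) \<longleftrightarrow> x \<in> dm t \<and> tr t x \<in> dm s" for x
    using act_None_iff[of "s * t" x] act_None_iff[of t x] act_None_iff[of s "tr t x"] act_Some[of x t]
    unfolding act_comp by (cases "\<theta> t x") auto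
  then show ?thesis by blast
qed

lemma tr_mult: "x \<in> dm (s * t) \<Longrightarrow> tr (s * t) x = tr s (tr t x)"
  using act_Some[of x "s * t"] act_Some[of x t] act_Some[of "tr t x" s] by (auto simp: act_comp dm_mult)

lemma dm_star_self: "dm (s\<^sup>\<star> * s) = dm s"
  by (simp add: dm_def inv_star_mult mult.assoc)

lemma tr_in: "x \<in> dm s \<Longrightarrow> tr s x \<in> dm (s\<^sup>\<star>)"
  using dm_star_self[of s] by (auto simp: dm_mult)

lemma tr_star_tr [simp]: "x \<in> dm s \<Longrightarrow> tr (s\<^sup>\<star>) (tr s x) = x"
  using tr_mult[of x "s\<^sup>\<star>" s] tr_idem[of "s\<^sup>\<star> * s" x] by (simp add: dm_star_self)

lemma tr_tr_star [simp]: "x \<in> dm (s\<^sup>\<star>) \<Longrightarrow> tr s (tr (s\<^sup>\<star>) x) = x"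
  using tr_star_tr[of x "s\<^sup>\<star>"] by simp

lemma dm_idem_mult: "e \<in> idempotents \<Longrightarrow> f \<in> idempotents \<Longrightarrow> dm (e * f) = dm e \<inter> dm f"
  by (auto simp: dm_mult tr_idem)

lemma dm_mult_idem: "e \<in> idempotents \<Longrightarrow> dm (s * e) = dm s \<inter> dm e"
  by (auto simp: dm_mult tr_idem)

lemma tr_mult_idem: "e \<in> idempotents \<Longrightarrow> x \<in> dm s \<Longrightarrow> x \<in> dm e \<Longrightarrow> tr (s * e) x = tr s x"
  by (simp add: tr_mult dm_mult_idem tr_idem)

lemma openin_dm: "openin X (dm s)"
  using act unfolding is_action_def dm_def using star_mult_idem(1) by blast

lemma dm_sub: "dm s \<subseteq> topspace X"
  using openin_dm openin_subset by blast

lemma cont_tr: "continuous_map (subtopology X (dm s)) X (tr s)"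
proof -
  have "continuous_map (subtopology X (dm s)) (subtopology X (act_dom \<theta> (s * s\<^sup>\<star>))) (\<lambda>x. the (\<theta> s x))"
    using act unfolding is_action_def dm_def by blast
  then show ?thesis by (simp add: tr_def[abs_def] continuous_map_in_subtopology)
qed

lemma natural_le_dm: assumes "natural_le u s" shows "dm u \<subseteq> dm s"
proof -
  have "dm u = dm (s * (u\<^sup>\<star> * u))" using assms by (simp add: natural_le_iff)
  then show ?thesis by (simp add: dm_mult_idem)
qed

section \<open>The *-algebra of finitely supported families\<close>

abbreviation Al where "Al c \<equiv> alg c X \<theta>"
abbreviation carr where "carr c \<equiv> acarrier (alg c X \<theta>)"

lemma carr_iff: "a \<in> carr c \<longleftrightarrow> (\<forall>s. a s \<in> Fn c X (dm s)) \<and> finite {s. a s \<noteq> (\<lambda>x. 0)}"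
  by (simp add: alg_def dm_def)

lemma alg_False: "alg False X \<theta> = KS_algebraic X \<theta>"
  using Fn_False_eq_C0[OF Haus openin_dm] by (simp add: alg_def KS_algebraic_def dm_def)

lemma alg_ops [simp]:
  "azero (Al c) = (\<lambda>s x. 0)" "aadd (Al c) = (\<lambda>a b s x. a s x + b s x)" "ascale (Al c) = (\<lambda>k a s x. k * a s x)"
  "amult (Al c) = amult (KS_algebraic X \<theta>)" "astar (Al c) = astar (KS_algebraic X \<theta>)"
  by (simp_all add: alg_def KS_algebraic_def)

lemma adiff_alg [simp]: "adiff (Al c) = (\<lambda>a b s x. a s x - b s x)"
  by (intro ext) (simp add: adiff_def)

lemma carr_zero_off: "a \<in> carr c \<Longrightarrow> x \<notin> dm s \<Longrightarrow> a s x = 0"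
  using Fn_zero carr_iff by metis

lemma carr_Fn: "a \<in> carr c \<Longrightarrow> a s \<in> Fn c X (dm s)"
  by (simp add: carr_iff)

lemma carr_fin: "a \<in> carr c \<Longrightarrow> finite {s. a s \<noteq> (\<lambda>x. 0)}"
  by (simp add: carr_iff)

lemma carr_zero [simp]: "(\<lambda>s x. 0) \<in> carr c"
  by (simp add: carr_iff)

lemma carr_add: assumes "a \<in> carr c" "b \<in> carr c" shows "(\<lambda>s x. a s x + b s x) \<in> carr c"
proof -
  have "finite {s. (\<lambda>x. a s x + b s x) \<noteq> (\<lambda>x. 0)}"
    by (rule finite_subset[OF _ finite_UnI[OF carr_fin[OF assms(1)] carr_fin[OF assms(2)]]]) (auto simp: fun_eq_iff)
  then show ?thesis using assms by (simp add: carr_iff Fn_add)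
qed

lemma carr_scale: assumes "a \<in> carr c" shows "(\<lambda>s x. k * a s x) \<in> carr c"
proof -
  have "finite {s. (\<lambda>x. k * a s x) \<noteq> (\<lambda>x. 0)}"
    by (rule finite_subset[OF _ carr_fin[OF assms(1)]]) (auto simp: fun_eq_iff)
  then show ?thesis using assms by (simp add: carr_iff Fn_scale)
qed

lemma carr_diff: "a \<in> carr c \<Longrightarrow> b \<in> carr c \<Longrightarrow> (\<lambda>s x. a s x - b s x) \<in> carr c"
  using carr_add[of a c "\<lambda>s x. (-1) * b s x"] carr_scale[of b c "-1"] by simp

lemma carr_sum: "finite I \<Longrightarrow> (\<And>i. i \<in> I \<Longrightarrow> a i \<in> carr c) \<Longrightarrow> (\<lambda>s x. \<Sum>i\<in>I. a i s x) \<in> carr c"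
  by (induction I rule: finite_induct) (simp_all add: carr_add)

lemma carr_True: "a \<in> carr True \<Longrightarrow> a \<in> carr c"
  by (simp add: carr_iff Fn_True_subset)

lemma delta_carr: assumes "f \<in> Fn c X (dm s)" shows "delta s f \<in> carr c"
proof -
  have "finite {t. delta s f t \<noteq> (\<lambda>x. 0)}" by (rule finite_subset[of _ "{s}"]) (auto simp: delta_def)
  then show ?thesis using assms by (auto simp: carr_iff delta_def)
qed

lemma alg_induct_disjoint [consumes 1, case_names zero step]:
  assumes "a \<in> carr c" and 0: "P (\<lambda>s x. 0)"
    and step: "\<And>a s f. a \<in> carr c \<Longrightarrow> f \<in> Fn c X (dm s) \<Longrightarrow> a s = (\<lambda>x. 0) \<Longrightarrow> P a \<Longrightarrow> P (\<lambda>t x. a t x + delta s f t x)"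
  shows "P a"
proof -
  have "\<forall>a. a \<in> carr c \<and> {s. a s \<noteq> (\<lambda>x. 0)} = F \<longrightarrow> P a" if "finite F" for F
    using that
  proof (induction F rule: finite_induct)
    case empty
    have "a = (\<lambda>s x. 0)" if "{s. a s \<noteq> (\<lambda>x. 0)} = {}" for a :: "'s \<Rightarrow> 'x \<Rightarrow> complex"
      using that by (auto simp: fun_eq_iff)
    then show ?case using 0 by metis
  next
    case (insert s F)
    show ?case
    proof (intro allI impI, elim conjE)
      fix a assume a: "a \<in> carr c" "{s. a s \<noteq> (\<lambda>x. 0)} = insert s F"
      define b where "b = a(s := (\<lambda>x. 0))"
      have sb: "{s. b s \<noteq> (\<lambda>x. 0)} = F" using a(2) insert.hyps unfolding b_def by auto
      have b: "b \<in> carr c" using a insert.hyps sb by (auto simp: carr_iff b_def)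
      have "P (\<lambda>t x. b t x + delta s (a s) t x)"
        by (rule step[OF b]) (use carr_Fn[OF a(1)] insert.IH b sb in \<open>auto simp: b_def\<close>)
      moreover have "(\<lambda>t x. b t x + delta s (a s) t x) = a" by (auto simp: b_def delta_def fun_eq_iff)
      ultimately show "P a" by simp
    qed
  qed
  then show ?thesis using assms(1) carr_fin by blast
qed

lemma alg_induct [consumes 1, case_names zero add delta]:
  assumes "a \<in> carr c" and "P (\<lambda>s x. 0)"
    and "\<And>a b. a \<in> carr c \<Longrightarrow> b \<in> carr c \<Longrightarrow> P a \<Longrightarrow> P b \<Longrightarrow> P (\<lambda>t x. a t x + b t x)"
    and "\<And>s f. f \<in> Fn c X (dm s) \<Longrightarrow> P (delta s f)"
  shows "P a"
  using assms(1) by (induction rule: alg_induct_disjoint) (use assms delta_carr in auto)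

text \<open>The two transports along \<open>t\<close> cancel on \<open>g\<close>; this brings the
  product of the crossed product into the form \<open>f o tr t\<close> times \<open>g\<close>, which
  is used from here on.\<close>

lemma alpha_mult:
  assumes "\<And>x. x \<notin> dm t \<Longrightarrow> g x = 0"
  shows "alpha \<theta> (t\<^sup>\<star>) (\<lambda>y. f y * alpha \<theta> t g y) = (\<lambda>x. f (tr t x) * g x)"
proof
  fix x show "alpha \<theta> (t\<^sup>\<star>) (\<lambda>y. f y * alpha \<theta> t g y) x = f (tr t x) * g x"
  proof (cases "x \<in> dm t")
    case True
    then show ?thesis using act_Some[OF True] act_Some[OF tr_in[OF True]] by (simp add: alpha_def)
  next
    case False
    then have "\<theta> t x = None" by (simp add: act_None_iff)
    then show ?thesis using assms[OF False] by (simp add: alpha_def)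
  qed
qed

lemma amult_alg:
  assumes "b \<in> carr c" "finite F" "{s. a s \<noteq> (\<lambda>x. 0)} \<subseteq> F" "finite G" "{s. b s \<noteq> (\<lambda>x. 0)} \<subseteq> G"
  shows "amult (KS_algebraic X \<theta>) a b u x = (\<Sum>s\<in>F. \<Sum>t\<in>G. if s * t = u then a s (tr t x) * b t x else 0)"
proof -
  have "amult (KS_algebraic X \<theta>) a b u x
      = (\<Sum>(s, t) | a s \<noteq> (\<lambda>x. 0) \<and> b t \<noteq> (\<lambda>x. 0) \<and> s * t = u. a s (tr t x) * b t x)"
    using alpha_mult[OF carr_zero_off[OF assms(1)]] by (simp add: KS_algebraic_def cong: sum.cong)
  also have "\<dots> = (\<Sum>(s, t)\<in>F \<times> G. if s * t = u then a s (tr t x) * b t x else 0)"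
    by (rule sum.mono_neutral_cong_left) (use assms in \<open>auto split: if_splits\<close>)
  finally show ?thesis by (simp add: sum.cartesian_product)
qed

lemma astar_alg: "astar (KS_algebraic X \<theta>) a u x = (if x \<in> dm u then cnj (a (u\<^sup>\<star>) (tr u x)) else 0)"
  using act_None_iff[of u x] act_Some[of x u] by (auto simp: KS_algebraic_def alpha_def)

lemma delta_mult_tr:
  assumes "g \<in> Fn c X (dm t)"
  shows "amult (KS_algebraic X \<theta>) (delta s f) (delta t g) = delta (s * t) (\<lambda>x. f (tr t x) * g x)"
  unfolding delta_mult by (subst alpha_mult) (use Fn_zero[OF assms] in auto)

definition starf :: "'s \<Rightarrow> ('x \<Rightarrow> complex) \<Rightarrow> 'x \<Rightarrow> complex"
  where "starf s f x = (if x \<in> dm (s\<^sup>\<star>) then cnj (f (tr (s\<^sup>\<star>) x)) else 0)"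

lemma delta_star_tr: "astar (KS_algebraic X \<theta>) (delta s f) = delta (s\<^sup>\<star>) (starf s f)"
proof -
  have "alpha \<theta> s (\<lambda>y. cnj (f y)) x = starf s f x" for x
  proof (cases "x \<in> dm (s\<^sup>\<star>)")
    case False
    then have "\<theta> (s\<^sup>\<star>) x = None" by (simp add: act_None_iff)
    then show ?thesis using False by (simp add: alpha_def starf_def)
  qed (simp add: alpha_def starf_def act_Some)
  then have "alpha \<theta> s (\<lambda>y. cnj (f y)) = starf s f" by blast
  then show ?thesis by (simp add: delta_star)
qed

lemma mult_Fn:
  "f \<in> Fn c X (dm s) \<Longrightarrow> g \<in> Fn c X (dm t) \<Longrightarrow> (\<lambda>x. f (tr t x) * g x) \<in> Fn c X (dm (s * t))"
  unfolding dm_mult by (rule Fn_shift_mult[OF Haus openin_dm cont_tr])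

lemma starf_Fn: assumes f: "f \<in> Fn c X (dm s)" shows "starf s f \<in> Fn c X (dm (s\<^sup>\<star>))"
proof (rule FnI[OF Haus openin_dm])
  have "continuous_map (subtopology X (dm (s\<^sup>\<star>))) euclidean (\<lambda>x. cnj (f (tr (s\<^sup>\<star>) x)))"
    using continuous_map_compose[OF cont_tr continuous_map_ccnj[OF Fn_cont[OF f]]] by (simp add: o_def)
  then show "continuous_map (subtopology X (dm (s\<^sup>\<star>))) euclidean (starf s f)"
    by (rule continuous_map_eq) (simp add: starf_def)
  show "vanish c X (dm (s\<^sup>\<star>)) (starf s f)"
    unfolding vanish_def
  proof (intro allI impI)
    fix \<epsilon> :: real assume e: "\<epsilon> > 0"
    obtain K where K: "compactin X K" "K \<subseteq> dm s" "\<And>x. x \<notin> K \<Longrightarrow> cmod (f x) < \<epsilon>" "\<And>x. x \<notin> K \<Longrightarrow> c \<Longrightarrow> f x = 0"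
      using FnD[OF f e] by auto
    have "compactin X (tr s ` K)"
      by (rule image_compactin[OF _ cont_tr]) (simp add: compactin_subtopology K)
    moreover have "tr s ` K \<subseteq> dm (s\<^sup>\<star>)" using K tr_in by blast
    moreover have "tr (s\<^sup>\<star>) x \<notin> K" if "x \<notin> tr s ` K" "x \<in> dm (s\<^sup>\<star>)" for x
      using that tr_tr_star by (metis image_eqI)
    ultimately show "\<exists>K. compactin X K \<and> K \<subseteq> dm (s\<^sup>\<star>) \<and> (\<forall>x. x \<notin> K \<longrightarrow> (if c then starf s f x = 0 else cmod (starf s f x) < \<epsilon>))"
      using K e by (intro exI[of _ "tr s ` K"]) (auto simp: starf_def)
  qed
qed auto

lemma mult_zero [simp]:
  "amult (KS_algebraic X \<theta>) a (\<lambda>s x. 0) = (\<lambda>s x. 0)" "amult (KS_algebraic X \<theta>) (\<lambda>s x. 0) a = (\<lambda>s x. 0)"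
  by (simp_all add: KS_algebraic_def)

lemma mult_add_left_alg:
  assumes "a \<in> carr c" "b \<in> carr c" "d \<in> carr c"
  shows "amult (KS_algebraic X \<theta>) (\<lambda>s x. a s x + b s x) d
    = (\<lambda>s x. amult (KS_algebraic X \<theta>) a d s x + amult (KS_algebraic X \<theta>) b d s x)"
proof (intro ext)
  fix u x
  let ?F = "{s. a s \<noteq> (\<lambda>x. 0)} \<union> {s. b s \<noteq> (\<lambda>x. 0)}" and ?G = "{s. d s \<noteq> (\<lambda>x. 0)}"
  have F: "finite ?F" "finite ?G" using assms carr_fin by blast+
  have s: "{s. (\<lambda>x. a s x + b s x) \<noteq> (\<lambda>x. 0)} \<subseteq> ?F" by (auto simp: fun_eq_iff)
  show "amult (KS_algebraic X \<theta>) (\<lambda>s x. a s x + b s x) d u x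
    = amult (KS_algebraic X \<theta>) a d u x + amult (KS_algebraic X \<theta>) b d u x"
    using amult_alg[OF assms(3) F(1) _ F(2), of a u x] amult_alg[OF assms(3) F(1) _ F(2), of b u x]
      amult_alg[OF assms(3) F(1) s F(2), of u x]
    by (simp add: sum.distrib[symmetric] distrib_right if_distrib cong: if_cong sum.cong)
qed

lemma mult_add_right_alg:
  assumes "a \<in> carr c" "b \<in> carr c" "d \<in> carr c"
  shows "amult (KS_algebraic X \<theta>) d (\<lambda>s x. a s x + b s x)
    = (\<lambda>s x. amult (KS_algebraic X \<theta>) d a s x + amult (KS_algebraic X \<theta>) d b s x)"
proof (intro ext)
  fix u x
  let ?F = "{s. a s \<noteq> (\<lambda>x. 0)} \<union> {s. b s \<noteq> (\<lambda>x. 0)}" and ?G = "{s. d s \<noteq> (\<lambda>x. 0)}"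
  have F: "finite ?F" "finite ?G" using assms carr_fin by blast+
  have s: "{s. (\<lambda>x. a s x + b s x) \<noteq> (\<lambda>x. 0)} \<subseteq> ?F" by (auto simp: fun_eq_iff)
  show "amult (KS_algebraic X \<theta>) d (\<lambda>s x. a s x + b s x) u x
    = amult (KS_algebraic X \<theta>) d a u x + amult (KS_algebraic X \<theta>) d b u x"
    using amult_alg[OF assms(1) F(2) _ F(1), of d u x] amult_alg[OF assms(2) F(2) _ F(1), of d u x]
      amult_alg[OF carr_add[OF assms(1,2)] F(2) _ F(1), of d u x] s
    by (simp add: sum.distrib[symmetric] distrib_left if_distrib cong: if_cong sum.cong)
qed

lemma mult_scale_left_alg:
  assumes "a \<in> carr c" "b \<in> carr c"
  shows "amult (KS_algebraic X \<theta>) (\<lambda>s x. k * a s x) b = (\<lambda>s x. k * amult (KS_algebraic X \<theta>) a b s x)"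
proof (intro ext)
  fix u x
  let ?F = "{s. a s \<noteq> (\<lambda>x. 0)}" and ?G = "{s. b s \<noteq> (\<lambda>x. 0)}"
  have F: "finite ?F" "finite ?G" using assms carr_fin by blast+
  have s: "{s. (\<lambda>x. k * a s x) \<noteq> (\<lambda>x. 0)} \<subseteq> ?F" by (auto simp: fun_eq_iff)
  show "amult (KS_algebraic X \<theta>) (\<lambda>s x. k * a s x) b u x = k * amult (KS_algebraic X \<theta>) a b u x"
    using amult_alg[OF assms(2) F(1) _ F(2), of a u x] amult_alg[OF assms(2) F(1) s F(2), of u x]
    by (simp add: sum_distrib_left mult.assoc if_distrib cong: if_cong sum.cong)
qed

lemma mult_scale_right_alg:
  assumes "a \<in> carr c" "b \<in> carr c"
  shows "amult (KS_algebraic X \<theta>) a (\<lambda>s x. k * b s x) = (\<lambda>s x. k * amult (KS_algebraic X \<theta>) a b s x)"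
proof (intro ext)
  fix u x
  let ?F = "{s. a s \<noteq> (\<lambda>x. 0)}" and ?G = "{s. b s \<noteq> (\<lambda>x. 0)}"
  have F: "finite ?F" "finite ?G" using assms carr_fin by blast+
  have s: "{s. (\<lambda>x. k * b s x) \<noteq> (\<lambda>x. 0)} \<subseteq> ?G" by (auto simp: fun_eq_iff)
  show "amult (KS_algebraic X \<theta>) a (\<lambda>s x. k * b s x) u x = k * amult (KS_algebraic X \<theta>) a b u x"
    using amult_alg[OF assms(2) F(1) _ F(2), of a u x]
      amult_alg[OF carr_scale[OF assms(2)] F(1) _ F(2), where a = a and u = u and x = x and k2 = k] s
    by (simp add: sum_distrib_left mult.left_commute if_distrib cong: if_cong sum.cong)
qed

lemma star_add_alg: "astar (KS_algebraic X \<theta>) (\<lambda>s x. a s x + b s x)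
    = (\<lambda>s x. astar (KS_algebraic X \<theta>) a s x + astar (KS_algebraic X \<theta>) b s x)"
  by (auto simp: astar_alg fun_eq_iff)

lemma star_zero_alg: "astar (KS_algebraic X \<theta>) (\<lambda>s x. 0) = (\<lambda>s x. 0)"
  by (auto simp: astar_alg fun_eq_iff)

lemma carr_mult: assumes "a \<in> carr c" "b \<in> carr c" shows "amult (KS_algebraic X \<theta>) a b \<in> carr c"
  using assms
proof (induction rule: alg_induct)
  case (add a a')
  then show ?case by (simp add: mult_add_left_alg[of _ c] carr_add)
next
  case (delta s f)
  note f = delta(1)
  from \<open>b \<in> carr c\<close> show ?case
  proof (induction rule: alg_induct)
    case (add b b')
    then show ?case using mult_add_right_alg[OF add(1,2) delta_carr[OF f]] carr_add by simp
  next
    case (delta t g)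
    show ?case unfolding delta_mult_tr[OF delta] by (rule delta_carr[OF mult_Fn[OF f delta]])
  qed simp
qed simp

lemma carr_star: assumes "a \<in> carr c" shows "astar (KS_algebraic X \<theta>) a \<in> carr c"
  using assms
  by (induction rule: alg_induct)
    (simp_all add: star_add_alg star_zero_alg carr_add delta_star_tr starf_Fn delta_carr)

lemma mult_assoc_alg:
  assumes "a \<in> carr c" "b \<in> carr c" "d \<in> carr c"
  shows "amult (KS_algebraic X \<theta>) (amult (KS_algebraic X \<theta>) a b) d = amult (KS_algebraic X \<theta>) a (amult (KS_algebraic X \<theta>) b d)"
  using assms(1)
proof (induction rule: alg_induct)
  case (add a a')
  then show ?case using assms by (simp add: mult_add_left_alg[of _ c] carr_mult[of _ c])
next
  case (delta s f)
  note f = delta_carr[OF delta]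
  from assms(2) show ?case
  proof (induction rule: alg_induct)
    case (add b b')
    then show ?case using assms f
      by (simp add: mult_add_left_alg[of _ c] mult_add_right_alg[of _ c] carr_mult[of _ c])
  next
    case (delta t g)
    note g = delta_carr[OF delta]
    from assms(3) show ?case
    proof (induction rule: alg_induct)
      case (add d d')
      then show ?case using f g
        by (simp add: mult_add_right_alg[of _ c] carr_mult[of _ c])
    next
      case h: (delta r h)
      \<comment> \<open>\<open>tr (t * r)\<close> is the composite of \<open>tr t\<close> and
        \<open>tr r\<close> only on \<open>dm (t * r)\<close>; elsewhere the factor
        \<open>g (tr r x) * h x\<close> vanishes.\<close>
      have "f (tr t (tr r x)) * (g (tr r x) * h x) = f (tr (t * r) x) * (g (tr r x) * h x)" for x
      proof (cases "x \<in> dm r \<and> tr r x \<in> dm t")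
        case True
        then show ?thesis using tr_mult[of x t r] by (simp add: dm_mult)
      next
        case False
        then have "g (tr r x) * h x = 0" using Fn_zero[OF h] Fn_zero[OF delta] by auto
        then show ?thesis by simp
      qed
      then have "(\<lambda>x. f (tr t (tr r x)) * (g (tr r x) * h x)) = (\<lambda>x. f (tr (t * r) x) * (g (tr r x) * h x))" by blast
      then show ?case
        using delta_mult_tr[OF h, of "s * t"] delta_mult_tr[OF delta, of s f] delta_mult_tr[OF h, of t g]
          delta_mult_tr[OF mult_Fn[OF delta h], of s f]
        by (simp add: mult.assoc)
    qed simp
  qed simp
qed simp

lemma star_mult_alg:
  assumes "a \<in> carr c" "b \<in> carr c"
  shows "astar (KS_algebraic X \<theta>) (amult (KS_algebraic X \<theta>) a b)
    = amult (KS_algebraic X \<theta>) (astar (KS_algebraic X \<theta>) b) (astar (KS_algebraic X \<theta>) a)"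
  using assms(1)
proof (induction rule: alg_induct)
  case (add a a')
  then show ?case using assms
    by (simp add: mult_add_left_alg[of _ c] mult_add_right_alg[of _ c] star_add_alg carr_star[of _ c])
next
  case (delta s f)
  note f = delta_carr[OF delta]
  from assms(2) show ?case
  proof (induction rule: alg_induct)
    case (add b b')
    then show ?case using assms f
      by (simp add: mult_add_left_alg[of _ c] mult_add_right_alg[of _ c] star_add_alg carr_star[of _ c])
  next
    case g: (delta t g)
    have "starf (s * t) (\<lambda>x. f (tr t x) * g x) x = starf t g (tr (s\<^sup>\<star>) x) * starf s f x" for x
      using tr_mult[of x "t\<^sup>\<star>" "s\<^sup>\<star>"] by (auto simp: starf_def inv_star_mult dm_mult)
    then have "starf (s * t) (\<lambda>x. f (tr t x) * g x) = (\<lambda>x. starf t g (tr (s\<^sup>\<star>) x) * starf s f x)" by blast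
    then show ?case
      using delta_mult_tr[OF g, of s f] delta_mult_tr[OF starf_Fn[OF delta], of "t\<^sup>\<star>" "starf t g"]
      by (simp add: delta_star_tr inv_star_mult)
  qed (simp add: star_zero_alg)
qed (simp add: star_zero_alg)

lemma star_star_alg: assumes "a \<in> carr c" shows "astar (KS_algebraic X \<theta>) (astar (KS_algebraic X \<theta>) a) = a"
  using carr_zero_off[OF assms] tr_in by (auto simp: astar_alg fun_eq_iff)

lemma alg_star_algebra: "star_algebra (Al c)"
  by unfold_locales
    (auto simp: carr_add carr_scale carr_mult carr_star mult_assoc_alg mult_add_left_alg mult_add_right_alg
      mult_scale_left_alg mult_scale_right_alg star_star_alg star_add_alg star_mult_alg fun_eq_iff algebra_simps astar_alg)

section \<open>Bounds on C*-seminorms\<close>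

text \<open>A real function \<open>g\<close> with \<open>\<bar>g\<bar> \<le> 1\<close> is the average of the unimodular functions
  \<open>u = g + i sqrt (1 - g\<^sup>2)\<close> and \<open>cnj u\<close>, and by the C*-identity multiplication by \<open>u\<close> does
  not change the seminorm.\<close>

lemma seminorm_delta_real:
  assumes p: "cstar_seminorm (Al c) p" and e: "e \<in> idempotents" and g: "g \<in> Fn c X (dm e)"
    and r: "\<And>x. g x \<in> \<real>" and M: "M > 0" "\<And>x. cmod (g x) \<le> M"
  shows "p (delta e g) \<le> M"
proof -
  interpret seminormed_star_algebra "Al c" p
    using alg_star_algebra p by (simp add: seminormed_star_algebra_def seminormed_star_algebra_axioms_def)
  define G where "G x = Re (g x) / M" for x
  have gG: "g x = of_real (M * G x)" for x using r[of x] M by (simp add: G_def)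
  have G1: "\<bar>G x\<bar> \<le> 1" for x using M(2)[of x] M(1) unfolding gG by (simp add: norm_mult abs_mult)
  have G2: "(G x)\<^sup>2 \<le> 1" for x using G1[of x] by (simp add: abs_square_le_1)
  define u where "u \<sigma> x = Complex (G x) (\<sigma> * sqrt (1 - (G x)\<^sup>2))" for \<sigma> x
  have cu: "continuous_map X euclidean (u \<sigma>)" for \<sigma>
  proof -
    have "continuous_on UNIV (\<lambda>z. Complex (Re z / M) (\<sigma> * sqrt (1 - (Re z / M)\<^sup>2)))"
      using M unfolding Complex_eq by (intro continuous_intros) auto
    from continuous_map_comp_cont[OF Fn_cont[OF g] this] show ?thesis by (simp add: u_def[abs_def] G_def)
  qed
  have nu: "cmod (u \<sigma> x) = 1" if "\<bar>\<sigma>\<bar> = 1" for \<sigma> x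
  proof -
    have "\<sigma>\<^sup>2 = 1" using that by (metis abs_1 power2_abs power_one)
    then show ?thesis using G2[of x] by (simp add: u_def cmod_def power_mult_distrib)
  qed
  have Fu: "(\<lambda>x. u \<sigma> x * g x) \<in> Fn c X (dm e)" if "\<bar>\<sigma>\<bar> = 1" for \<sigma>
    by (rule Fn_mult_bounded[OF g cu, where M = 1]) (simp add: nu that)
  have sq: "amult (Al c) (astar (Al c) (delta e f)) (delta e f) = delta e (\<lambda>x. cnj (f x) * f x)"
    if f: "f \<in> Fn c X (dm e)" for f
  proof -
    have "starf e f (tr e x) * f x = cnj (f x) * f x" for x
      by (cases "x \<in> dm e") (use Fn_zero[OF f] e in \<open>auto simp: starf_def idem_inv_star tr_idem\<close>)
    then have "(\<lambda>x. starf e f (tr e x) * f x) = (\<lambda>x. cnj (f x) * f x)" by blast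
    then show ?thesis using delta_mult_tr[OF f, of "e\<^sup>\<star>" "starf e f"] e
      by (simp add: delta_star_tr idem_inv_star idem_self)
  qed
  have eq: "p (delta e (\<lambda>x. u \<sigma> x * g x)) = p (delta e g)" if s: "\<bar>\<sigma>\<bar> = 1" for \<sigma>
  proof -
    have "cnj (u \<sigma> x * g x) * (u \<sigma> x * g x) = cnj (g x) * g x" for x
      using nu[OF s, of x] complex_norm_square[of "u \<sigma> x"] by (simp add: algebra_simps)
    then have fe: "(\<lambda>x. cnj (u \<sigma> x * g x) * (u \<sigma> x * g x)) = (\<lambda>x. cnj (g x) * g x)" by blast
    have "(p (delta e (\<lambda>x. u \<sigma> x * g x)))\<^sup>2 = (p (delta e g))\<^sup>2"
      unfolding q_cstar[OF delta_carr[OF Fu[OF s]], symmetric] q_cstar[OF delta_carr[OF g], symmetric]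
        sq[OF Fu[OF s]] sq[OF g] fe ..
    then show ?thesis using q_nonneg[OF delta_carr[OF Fu[OF s]]] q_nonneg[OF delta_carr[OF g]] power2_eq_iff_nonneg by blast
  qed
  have "u 1 x * g x + u (-1) x * g x = of_real (2/M) * (cnj (g x) * g x)" for x
  proof -
    have "u 1 x + u (-1) x = of_real (2 * G x)" by (simp add: u_def complex_eq_iff)
    then have "u 1 x * g x + u (-1) x * g x = of_real (2 * G x) * g x" by (metis distrib_right)
    then show ?thesis using M(1) by (simp add: gG)
  qed
  then have *: "aadd (Al c) (delta e (\<lambda>x. u 1 x * g x)) (delta e (\<lambda>x. u (-1) x * g x))
      = ascale (Al c) (of_real (2/M)) (delta e (\<lambda>x. cnj (g x) * g x))"
    by (auto simp: delta_def fun_eq_iff)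
  have gg: "delta e (\<lambda>x. cnj (g x) * g x) \<in> carr c"
    using sq[OF g] closed(4,5) delta_carr[OF g] by metis
  \<comment> \<open>Both unimodular multiples of \<open>g\<close> have the seminorm of
    \<open>g\<close>, so the C*-identity on the left and the triangle inequality on the right give
    \<open>2/M * p(g)^2 \<le> 2 * p(g)\<close>.\<close>
  have "2/M * (p (delta e g))\<^sup>2 = p (ascale (Al c) (of_real (2/M)) (delta e (\<lambda>x. cnj (g x) * g x)))"
    using q_scale[OF gg, of "of_real (2/M)"] q_cstar[OF delta_carr[OF g]] sq[OF g] M(1) by (simp add: norm_divide)
  also have "\<dots> \<le> p (delta e g) + p (delta e g)"
    using q_add[OF delta_carr[OF Fu[of 1]] delta_carr[OF Fu[of "-1"]]] eq[of 1] eq[of "-1"] unfolding * by simp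
  finally have le: "(p (delta e g))\<^sup>2 \<le> M * p (delta e g)" using M(1) by (simp add: field_simps)
  show ?thesis
  proof (cases "p (delta e g) = 0")
    case False
    then have "p (delta e g) > 0" using q_nonneg[OF delta_carr[OF g]] by simp
    then show ?thesis using le by (simp add: power2_eq_square)
  qed (use M in simp)
qed

lemma star_delta_mult_delta:
  assumes f: "f \<in> Fn c X (dm s)"
  shows "amult (KS_algebraic X \<theta>) (astar (KS_algebraic X \<theta>) (delta s f)) (delta s f) = delta (s\<^sup>\<star> * s) (\<lambda>x. cnj (f x) * f x)"
proof -
  have "starf s f (tr s x) * f x = cnj (f x) * f x" for x
    using Fn_zero[OF f, of x] tr_in by (cases "x \<in> dm s") (auto simp: starf_def)
  then have "(\<lambda>x. starf s f (tr s x) * f x) = (\<lambda>x. cnj (f x) * f x)" by blast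
  then show ?thesis using delta_mult_tr[OF f, of "s\<^sup>\<star>" "starf s f"] by (simp only: delta_star_tr)
qed

text \<open>By the C*-identity it suffices to bound the real function \<open>|f|^2\<close>, which
  sits at the idempotent \<open>s\<^sup>\<star> * s\<close>. Bounds \<open>M\<close> strictly above
  \<open>snorm f\<close> are used because \<open>seminorm_delta_real\<close> asks for
  \<open>M > 0\<close>.\<close>

lemma seminorm_delta:
  assumes p: "cstar_seminorm (Al c) p" and f: "f \<in> Fn c X (dm s)"
  shows "p (delta s f) \<le> snorm f"
proof -
  interpret seminormed_star_algebra "Al c" p
    using alg_star_algebra p by (simp add: seminormed_star_algebra_def seminormed_star_algebra_axioms_def)
  have gF: "(\<lambda>x. cnj (f x) * f x) \<in> Fn c X (dm (s\<^sup>\<star> * s))"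
    using Fn_mult[OF Haus openin_dm Fn_cnj[OF f] f] by (simp add: dm_star_self)
  have "p (delta s f) \<le> M" if M: "M > 0" "M > snorm f" for M
  proof -
    have b: "cmod (f x) \<le> M" for x using snorm_upper[OF f, of x] M(2) by simp
    have "cmod (cnj (f x) * f x) \<le> M\<^sup>2" for x
      using mult_mono[OF b[of x] b[of x]] M(1) by (simp add: norm_mult power2_eq_square)
    then have "p (delta (s\<^sup>\<star> * s) (\<lambda>x. cnj (f x) * f x)) \<le> M\<^sup>2"
      using M(1) by (intro seminorm_delta_real[OF p _ gF])
        (auto simp: complex_is_Real_iff)
    then have "(p (delta s f))\<^sup>2 \<le> M\<^sup>2"
      using q_cstar[OF delta_carr[OF f]] star_delta_mult_delta[OF f] by simp
    then show ?thesis using M(1) power2_le_imp_le by (metis less_imp_le)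
  qed
  then show ?thesis
    using snorm_nonneg[OF f] by (metis dense le_less_trans not_le)
qed

section \<open>The sum of the sup norms as an algebra norm\<close>

lemma nsum_nonneg: "a \<in> carr c \<Longrightarrow> 0 \<le> nsum a"
  unfolding nsum_def using carr_Fn snorm_nonneg by (metis (mono_tags, lifting) sum_nonneg)

lemma nsum_add: assumes a: "a \<in> carr c" and b: "b \<in> carr c" shows "nsum (\<lambda>s x. a s x + b s x) \<le> nsum a + nsum b"
proof -
  let ?F = "{s. a s \<noteq> (\<lambda>x. 0)} \<union> {s. b s \<noteq> (\<lambda>x. 0)}"
  have F: "finite ?F" using assms carr_fin by blast
  have "nsum (\<lambda>s x. a s x + b s x) = (\<Sum>s\<in>?F. snorm (\<lambda>x. a s x + b s x))"
    by (rule nsum_eq[OF F]) (auto simp: fun_eq_iff)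
  also have "\<dots> \<le> (\<Sum>s\<in>?F. snorm (a s) + snorm (b s))"
  proof (intro sum_mono snorm_least)
    fix s x show "cmod (a s x + b s x) \<le> snorm (a s) + snorm (b s)"
      using norm_triangle_ineq[of "a s x" "b s x"] snorm_upper[OF carr_Fn[OF a], of s x] snorm_upper[OF carr_Fn[OF b], of s x]
      by linarith
  qed
  also have "\<dots> = nsum a + nsum b" using nsum_eq[OF F, of a] nsum_eq[OF F, of b] by (simp add: sum.distrib)
  finally show ?thesis .
qed

lemma nsum_add_delta:
  assumes "a \<in> carr c" "a s = (\<lambda>x. 0)" shows "nsum (\<lambda>t x. a t x + delta s f t x) = nsum a + snorm f"
proof -
  let ?F = "{s. a s \<noteq> (\<lambda>x. 0)}"
  have F: "finite ?F" "finite (insert s ?F)" using assms carr_fin by blast+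
  have "nsum (\<lambda>t x. a t x + delta s f t x) = (\<Sum>t\<in>insert s ?F. snorm (\<lambda>x. a t x + delta s f t x))"
    by (rule nsum_eq[OF F(2)]) (auto simp: fun_eq_iff delta_def)
  also have "\<dots> = snorm f + (\<Sum>t\<in>?F. snorm (\<lambda>x. a t x + delta s f t x))"
    using F assms by (simp add: delta_def)
  also have "(\<Sum>t\<in>?F. snorm (\<lambda>x. a t x + delta s f t x)) = nsum a"
    unfolding nsum_def by (rule sum.cong) (use assms in \<open>auto simp: delta_def\<close>)
  finally show ?thesis by simp
qed

lemma nsum_0 [simp]: "nsum (\<lambda>s x. 0) = 0"
  by (simp add: nsum_def)

lemma nsum_scale: assumes a: "a \<in> carr c" shows "nsum (\<lambda>s x. k * a s x) \<le> cmod k * nsum a"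
proof -
  let ?F = "{s. a s \<noteq> (\<lambda>x. 0)}"
  have F: "finite ?F" using a carr_fin by blast
  have "nsum (\<lambda>s x. k * a s x) = (\<Sum>s\<in>?F. snorm (\<lambda>x. k * a s x))"
    by (rule nsum_eq[OF F]) (auto simp: fun_eq_iff)
  also have "\<dots> \<le> (\<Sum>s\<in>?F. cmod k * snorm (a s))"
    by (intro sum_mono snorm_least) (simp add: norm_mult mult_left_mono snorm_upper[OF carr_Fn[OF a]])
  finally show ?thesis by (simp add: nsum_def sum_distrib_left)
qed

lemma nsum_mult: assumes a: "a \<in> carr c" and b: "b \<in> carr c" shows "nsum (amult (KS_algebraic X \<theta>) a b) \<le> nsum a * nsum b"
  using a
proof (induction rule: alg_induct_disjoint)
  case (step a s f)
  note df = delta_carr[OF step(2)]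
  have "nsum (amult (KS_algebraic X \<theta>) (delta s f) b) \<le> snorm f * nsum b"
    using b
  proof (induction rule: alg_induct_disjoint)
    case g: (step b t g)
    note dg = delta_carr[OF g(2)]
    have "snorm (\<lambda>x. f (tr t x) * g x) \<le> snorm f * snorm g"
      by (rule snorm_least)
        (simp add: norm_mult mult_mono snorm_upper[OF step(2)] snorm_upper[OF g(2)] snorm_nonneg[OF step(2)])
    then show ?case
      using nsum_add[OF carr_mult[OF df g(1)] carr_mult[OF df dg]] g(4)
      by (simp add: mult_add_right_alg[OF g(1) dg df] delta_mult_tr[OF g(2)] nsum_delta nsum_add_delta[OF g(1,3)] distrib_left)
  qed simp
  then show ?case
    using nsum_add[OF carr_mult[OF step(1) b] carr_mult[OF df b]] step(4)
    by (simp add: mult_add_left_alg[OF step(1) df b] nsum_add_delta[OF step(1,3)] distrib_right)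
qed simp

lemma nsum_star: assumes a: "a \<in> carr c" shows "nsum (astar (KS_algebraic X \<theta>) a) \<le> nsum a"
  using a
proof (induction rule: alg_induct_disjoint)
  case (step a s f)
  have "snorm (starf s f) \<le> snorm f"
    by (rule snorm_least) (simp add: starf_def snorm_upper[OF step(2)] snorm_nonneg[OF step(2)])
  then show ?case
    using nsum_add[OF carr_star[OF step(1)] carr_star[OF delta_carr[OF step(2)]]] step(4)
    by (simp add: star_add_alg delta_star_tr nsum_delta nsum_add_delta[OF step(1,3)])
qed (simp add: star_zero_alg)

lemma seminorm_le_nsum:
  assumes p: "cstar_seminorm (Al c) p" and a: "a \<in> carr c" shows "p a \<le> nsum a"
proof -
  interpret seminormed_star_algebra "Al c" p
    using alg_star_algebra p by (simp add: seminormed_star_algebra_def seminormed_star_algebra_axioms_def)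
  show ?thesis
    using a
  proof (induction rule: alg_induct_disjoint)
    case (step a s f)
    then show ?case
      using q_add[OF step(1) delta_carr[OF step(2)]] seminorm_delta[OF p step(2)]
      by (simp add: nsum_add_delta[OF step(1,3)])
  qed (use q_zero in simp)
qed

lemma alg_bounded: "bounded_star_algebra (Al c)"
proof -
  interpret star_algebra "Al c" by (rule alg_star_algebra)
  show ?thesis
    by unfold_locales (use seminorm_le_nsum in \<open>auto simp: bdd_above_def\<close>)
qed

end

section \<open>Images of *-algebras\<close>

lemma cstar_seminorm_comp:
  assumes "star_algebra A" "star_hom A B \<phi>" "cstar_seminorm B p"
  shows "cstar_seminorm A (\<lambda>a. p (\<phi> a))"
proof -
  interpret star_algebra A by fact
  show ?thesis using assms(2,3) unfolding cstar_seminorm_def star_hom_def by (auto simp: closed)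
qed

text \<open>The laws of convolution are obtained in this way: the algebra of the groupoid is the
  image of a *-algebra of families, which transfers associativity without a computation with
  germs.\<close>

lemma star_algebra_image:
  assumes A: "star_algebra A" and h: "star_hom A B \<phi>" and im: "acarrier B = \<phi> ` acarrier A"
    and 0: "\<phi> (azero A) = azero B"
  shows "star_algebra B"
proof -
  interpret star_algebra A by fact
  have H: "aadd B (\<phi> a) (\<phi> b) = \<phi> (aadd A a b)" "amult B (\<phi> a) (\<phi> b) = \<phi> (amult A a b)"
    "ascale B k (\<phi> a) = \<phi> (ascale A k a)" "astar B (\<phi> a) = \<phi> (astar A a)"
    if "a \<in> acarrier A" "b \<in> acarrier A" for a b k
    using h that unfolding star_hom_def by auto
  have D: "adiff B (\<phi> a) (\<phi> b) = \<phi> (adiff A a b)" if "a \<in> acarrier A" "b \<in> acarrier A" for a b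
    using that by (simp add: adiff_def H closed)
  note Z = 0[symmetric]
  show ?thesis
  proof
    show "azero B \<in> acarrier B" using im Z closed by simp
    fix x k l assume "x \<in> acarrier B"
    then obtain a where a: "a \<in> acarrier A" "x = \<phi> a" using im by auto
    show "ascale B k x \<in> acarrier B" "astar B x \<in> acarrier B" using a im by (auto simp: H closed)
    show "aadd B x (azero B) = x" "adiff B x x = azero B"
      "ascale B (k + l) x = aadd B (ascale B k x) (ascale B l x)"
      "ascale B k (ascale B l x) = ascale B (k * l) x" "ascale B 1 x = x"
      "astar B (astar B x) = x" "astar B (ascale B k x) = ascale B (cnj k) (astar B x)"
      using a by (simp_all add: Z H D closed diff_closed add_zero diff_self scale_add_left scale_scale scale_one star_star star_scale)
    fix y assume "y \<in> acarrier B"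
    then obtain b where b: "b \<in> acarrier A" "y = \<phi> b" using im by auto
    show "aadd B x y \<in> acarrier B" "amult B x y \<in> acarrier B" using a b im by (auto simp: H closed)
    show "aadd B x y = aadd B y x" using a b add_commute[of a b] by (simp add: H)
    show "ascale B k (aadd B x y) = aadd B (ascale B k x) (ascale B k y)"
      "amult B (ascale B k x) y = ascale B k (amult B x y)" "amult B x (ascale B k y) = ascale B k (amult B x y)"
      "astar B (aadd B x y) = aadd B (astar B x) (astar B y)" "astar B (amult B x y) = amult B (astar B y) (astar B x)"
      using a b by (simp_all add: H closed scale_add_right mult_scale_left mult_scale_right star_add star_mult)
    fix z assume "z \<in> acarrier B"
    then obtain d where d: "d \<in> acarrier A" "z = \<phi> d" using im by auto
    show "aadd B (aadd B x y) z = aadd B x (aadd B y z)" "amult B (amult B x y) z = amult B x (amult B y z)"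
      "amult B (aadd B x y) z = aadd B (amult B x z) (amult B y z)"
      "amult B x (aadd B y z) = aadd B (amult B x y) (amult B x z)"
      using a b d by (simp_all add: H closed add_assoc mult_assoc mult_add_left mult_add_right)
  qed
qed

lemma bounded_star_algebra_image:
  assumes A: "bounded_star_algebra A" and h: "star_hom A B \<phi>" and im: "acarrier B = \<phi> ` acarrier A"
    and 0: "\<phi> (azero A) = azero B"
  shows "bounded_star_algebra B"
proof -
  interpret bounded_star_algebra A by fact
  interpret B: star_algebra B by (rule star_algebra_image[OF star_algebra_axioms h im 0])
  show ?thesis
  proof
    fix x assume "x \<in> acarrier B"
    then obtain a where a: "a \<in> acarrier A" "x = \<phi> a" using im by auto
    have "p x \<le> env_norm A a" if "cstar_seminorm B p" for p
      using env_norm_upper[OF cstar_seminorm_comp[OF star_algebra_axioms h that] a(1)] a(2) by simp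
    then show "bdd_above ((\<lambda>p. p x) ` {p. cstar_seminorm B p})" by (auto simp: bdd_above_def)
  qed
qed

text \<open>The finite subcover is returned as a list because it later indexes a product, once also
  with repetitions.\<close>

lemma compactin_finite_list:
  assumes C: "compactin X C" and R: "\<And>x. x \<in> C \<Longrightarrow> \<exists>i V. openin X V \<and> x \<in> V \<and> R i \<and> (\<forall>y\<in>V \<inter> C. S i y)"
  shows "\<exists>L. (\<forall>i\<in>set L. R i) \<and> (\<forall>y\<in>C. \<exists>i\<in>set L. S i y)"
proof -
  let ?U = "{V. openin X V \<and> (\<exists>i. R i \<and> (\<forall>y\<in>V \<inter> C. S i y))}"
  have "C \<subseteq> \<Union>?U" using R by blast
  then obtain F where F: "finite F" "F \<subseteq> ?U" "C \<subseteq> \<Union>F"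
    using C unfolding compactin_def by (metis (no_types, lifting) mem_Collect_eq)
  have "\<forall>V\<in>F. \<exists>i. R i \<and> (\<forall>y\<in>V \<inter> C. S i y)" using F(2) by blast
  then obtain i where i: "\<forall>V\<in>F. R (i V) \<and> (\<forall>y\<in>V \<inter> C. S (i V) y)" by metis
  obtain L where L: "set L = i ` F" using F(1) finite_list finite_imageI by metis
  have "\<exists>i\<in>set L. S i y" if y: "y \<in> C" for y
  proof -
    obtain V where "V \<in> F" "y \<in> V" using y F(3) by blast
    then show ?thesis using L i y by blast
  qed
  then show ?thesis using L i by (intro exI[of _ L]) auto
qed

section \<open>The transformation groupoid\<close>

context lch_action
begin

lemma act_dom_eq: "act_dom \<theta> (s\<^sup>\<star> * s) = dm s"
  by (simp add: dm_def)

lemma germ_mem: "(t, w) \<in> germ \<theta> s z \<longleftrightarrow> z \<in> dm s \<and> w \<in> dm t \<and> w = z \<and> (\<exists>e\<in>idempotents. s * e = t * e \<and> z \<in> dm e)"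
  using act_dom_idem by (auto simp: germ_def germ_rel_def act_dom_eq)

section \<open>The equivalence relation defining germs\<close>

definition same_germ :: "'s \<Rightarrow> 's \<Rightarrow> 'x \<Rightarrow> bool"
  where "same_germ s t z \<longleftrightarrow> (\<exists>e\<in>idempotents. s * e = t * e \<and> z \<in> dm e)"

lemma same_germ_sym: "same_germ s t z \<Longrightarrow> same_germ t s z"
  unfolding same_germ_def by metis

lemma same_germ_trans: assumes "same_germ s t z" "same_germ t r z" shows "same_germ s r z"
proof -
  obtain e f where e: "e \<in> idempotents" "s * e = t * e" "z \<in> dm e" and f: "f \<in> idempotents" "t * f = r * f" "z \<in> dm f"
    using assms by (auto simp: same_germ_def)
  have "s * (e * f) = r * (e * f)" using e(2) f(2) idem_commute[OF e(1) f(1)] by (metis mult.assoc)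
  then show ?thesis unfolding same_germ_def using idem_mult_closed[OF e(1) f(1)] dm_idem_mult[OF e(1) f(1)] e f by blast
qed

lemma same_germ_refl: "z \<in> dm s \<Longrightarrow> same_germ s s z"
  unfolding same_germ_def using dm_star_self star_mult_idem(1) by blast

lemma same_germ_idem: "e \<in> idempotents \<Longrightarrow> z \<in> dm e \<Longrightarrow> same_germ (s * e) s z"
  unfolding same_germ_def using idem_self mult.assoc by metis

lemma germ_eq_iff:
  assumes "z \<in> dm s" "w \<in> dm t" shows "germ \<theta> s z = germ \<theta> t w \<longleftrightarrow> z = w \<and> same_germ s t z"
proof
  assume "germ \<theta> s z = germ \<theta> t w"
  moreover have "(s, z) \<in> germ \<theta> s z" using same_germ_refl[OF assms(1)] assms by (simp add: germ_mem same_germ_def)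
  ultimately show "z = w \<and> same_germ s t z" using same_germ_sym by (auto simp: germ_mem same_germ_def)
next
  assume a: "z = w \<and> same_germ s t z"
  have "(r, v) \<in> germ \<theta> s z \<longleftrightarrow> (r, v) \<in> germ \<theta> t w" for r v
    using a assms same_germ_trans same_germ_sym unfolding germ_mem same_germ_def[symmetric] by blast
  then show "germ \<theta> s z = germ \<theta> t w" by auto
qed

lemma same_germ_tr: assumes "same_germ s t z" "z \<in> dm s" "z \<in> dm t" shows "tr s z = tr t z"
proof -
  obtain e where e: "e \<in> idempotents" "s * e = t * e" "z \<in> dm e" using assms by (auto simp: same_germ_def)
  then show ?thesis using tr_mult_idem[OF e(1) assms(2) e(3)] tr_mult_idem[OF e(1) assms(3) e(3)] by simp
qed

text \<open>The idempotent \<open>f\<close> that identifies \<open>s\<close> with \<open>s'\<close>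
  acts after \<open>t\<close>; it is moved to the domain side of \<open>t\<close> by
  \<open>t * (t\<^sup>\<star> * f * t) = f * t\<close>.\<close>

lemma same_germ_mult:
  assumes s: "same_germ s s' (tr t z)" and t: "same_germ t t' z" and z: "z \<in> dm t"
  shows "same_germ (s * t) (s' * t') z"
proof -
  obtain f where f: "f \<in> idempotents" "s * f = s' * f" "tr t z \<in> dm f" using s by (auto simp: same_germ_def)
  obtain e where e: "e \<in> idempotents" "t * e = t' * e" "z \<in> dm e" using t by (auto simp: same_germ_def)
  let ?g = "t\<^sup>\<star> * f * t"
  have g: "?g \<in> idempotents" by (rule conj_idem[OF f(1)])
  have tg: "t * (?g * u) = f * (t * u)" for u
  proof -
    have "t * (?g * u) = (t * t\<^sup>\<star>) * f * (t * u)" by (simp add: mult.assoc)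
    also have "\<dots> = f * (t * u)" unfolding idem_commute[OF star_mult_idem(2) f(1)] by (simp add: mult.assoc)
    finally show ?thesis .
  qed
  note tg = tg[unfolded mult.assoc] and eg = idem_commute[OF e(1) g, unfolded mult.assoc]
  have "s * t * (?g * e) = s * f * (t * e)" by (simp only: mult.assoc tg)
  also have "\<dots> = s' * f * (t * e)" by (simp add: f(2))
  also have "\<dots> = s' * (t * (?g * e))" by (simp only: mult.assoc tg)
  also have "\<dots> = s' * (t * e * ?g)" by (simp only: eg mult.assoc)
  also have "\<dots> = s' * t' * (?g * e)" unfolding e(2) by (simp only: eg mult.assoc)
  finally have "s * t * (?g * e) = s' * t' * (?g * e)" .
  moreover have "z \<in> dm (?g * e)"
    using z e f tr_in[OF z] tr_idem[OF f(1,3)] tr_idem[OF e(1,3)] by (simp add: dm_mult)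
  ultimately show ?thesis unfolding same_germ_def using idem_mult_closed[OF g e(1)] by blast
qed

text \<open>The witness is the range idempotent of \<open>s * e = t * e\<close>: multiplying
  \<open>s\<^sup>\<star>\<close> or \<open>t\<^sup>\<star>\<close> by it gives the inverse of this
  common element.\<close>

lemma same_germ_star:
  assumes "same_germ s t z" "z \<in> dm s" shows "same_germ (s\<^sup>\<star>) (t\<^sup>\<star>) (tr s z)"
proof -
  obtain e where e: "e \<in> idempotents" "s * e = t * e" "z \<in> dm e" using assms by (auto simp: same_germ_def)
  let ?g = "(s * e) * (s * e)\<^sup>\<star>"
  have "r\<^sup>\<star> * ((r * e) * (r * e)\<^sup>\<star>) = (r * e)\<^sup>\<star>" for r
  proof -
    have "r\<^sup>\<star> * ((r * e) * (r * e)\<^sup>\<star>) = (r\<^sup>\<star> * r) * e * r\<^sup>\<star>"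
      using e(1) by (simp add: inv_star_mult idem_inv_star mult.assoc idem_self_left)
    also have "\<dots> = (r * e)\<^sup>\<star>"
      unfolding idem_commute[OF star_mult_idem(1) e(1)] using e(1) by (simp add: inv_star_mult idem_inv_star mult.assoc)
    finally show ?thesis .
  qed
  from this[of s] this[of t] have "s\<^sup>\<star> * ?g = t\<^sup>\<star> * ?g" using e(2) by simp
  moreover have "tr s z \<in> dm ?g"
  proof -
    have "z \<in> dm (s * e)" using e(1,3) assms(2) by (simp add: dm_mult_idem)
    from tr_in[OF this] have "tr s z \<in> dm ((s * e)\<^sup>\<star>)" using tr_mult_idem[OF e(1) assms(2) e(3)] by simp
    then show ?thesis using dm_star_self[of "(s * e)\<^sup>\<star>"] by simp
  qed
  ultimately show ?thesis unfolding same_germ_def using star_mult_idem(2) by blast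
qed

section \<open>The groupoid operations and the topology of germs\<close>

abbreviation GG where "GG \<equiv> transformation_groupoid X \<theta>"

definition arr :: "('s \<times> 'x) set set" where "arr = {germ \<theta> s z | s z. z \<in> dm s}"

lemma germ_arr: "z \<in> dm s \<Longrightarrow> germ \<theta> s z \<in> arr"
  by (auto simp: arr_def)

lemma arr_cases: assumes "\<gamma> \<in> arr" obtains s z where "z \<in> dm s" "\<gamma> = germ \<theta> s z"
  using assms by (auto simp: arr_def)

lemma gdom_germ [simp]: assumes "z \<in> dm s" shows "gdom GG (germ \<theta> s z) = z"
  unfolding transformation_groupoid_def top_groupoid.simps
  by (rule the_equality) (use assms same_germ_refl[OF assms] in \<open>auto simp: germ_mem same_germ_def\<close>)

lemma grng_germ [simp]: assumes "z \<in> dm s" shows "grng GG (germ \<theta> s z) = tr s z"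
  unfolding transformation_groupoid_def top_groupoid.simps
proof (rule the_equality)
  show "\<exists>s' z'. (s', z') \<in> germ \<theta> s z \<and> \<theta> s' z' = Some (tr s z)"
    using same_germ_refl[OF assms] assms act_Some[OF assms] unfolding germ_mem same_germ_def[symmetric] by blast
  fix y assume "\<exists>s' z'. (s', z') \<in> germ \<theta> s z \<and> \<theta> s' z' = Some y"
  then obtain s' where "z \<in> dm s'" "same_germ s s' z" "\<theta> s' z = Some y"
    unfolding germ_mem same_germ_def[symmetric] by blast
  then show "y = tr s z" using same_germ_tr[of s s' z] assms by (simp add: act_Some_iff)
qed

lemma gmult_germ:
  assumes z: "z \<in> dm t" and s: "tr t z \<in> dm s"
  shows "gmult GG (germ \<theta> s (tr t z)) (germ \<theta> t z) = germ \<theta> (s * t) z"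
  unfolding transformation_groupoid_def top_groupoid.simps
proof (rule the_equality)
  show "\<exists>t' s' z' y. (s', z') \<in> germ \<theta> t z \<and> \<theta> s' z' = Some y \<and> (t', y) \<in> germ \<theta> s (tr t z) \<and> germ \<theta> (s * t) z = germ \<theta> (t' * s') z'"
    using same_germ_refl[OF z] same_germ_refl[OF s] z s act_Some[OF z] unfolding germ_mem same_germ_def[symmetric] by blast
  fix \<eta> assume "\<exists>t' s' z' y. (s', z') \<in> germ \<theta> t z \<and> \<theta> s' z' = Some y \<and> (t', y) \<in> germ \<theta> s (tr t z) \<and> \<eta> = germ \<theta> (t' * s') z'"
  then obtain t' s' where *: "z \<in> dm s'" "same_germ t s' z" "tr t z \<in> dm t'" "same_germ s t' (tr t z)" "\<eta> = germ \<theta> (t' * s') z"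
    unfolding germ_mem same_germ_def[symmetric] by blast
  have "tr t z = tr s' z" using same_germ_tr * z by blast
  then have "z \<in> dm (t' * s')" "z \<in> dm (s * t)" using * z s by (auto simp: dm_mult)
  then show "\<eta> = germ \<theta> (s * t) z"
    using same_germ_mult[OF *(4,2) z] *(5) germ_eq_iff same_germ_sym by blast
qed

lemma ginv_germ: assumes z: "z \<in> dm s" shows "ginv GG (germ \<theta> s z) = germ \<theta> (s\<^sup>\<star>) (tr s z)"
  unfolding transformation_groupoid_def top_groupoid.simps
proof (rule the_equality)
  show "\<exists>s' z' y. (s', z') \<in> germ \<theta> s z \<and> \<theta> s' z' = Some y \<and> germ \<theta> (s\<^sup>\<star>) (tr s z) = germ \<theta> (s'\<^sup>\<star>) y"
    using same_germ_refl[OF z] z act_Some[OF z] unfolding germ_mem same_germ_def[symmetric] by blast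
  fix \<eta> assume "\<exists>s' z' y. (s', z') \<in> germ \<theta> s z \<and> \<theta> s' z' = Some y \<and> \<eta> = germ \<theta> (s'\<^sup>\<star>) y"
  then obtain s' where *: "z \<in> dm s'" "same_germ s s' z" "\<eta> = germ \<theta> (s'\<^sup>\<star>) (tr s' z)"
    unfolding germ_mem same_germ_def[symmetric] by (auto simp: act_Some_iff)
  then show "\<eta> = germ \<theta> (s\<^sup>\<star>) (tr s z)"
    using same_germ_star[OF *(2) z] same_germ_tr[OF *(2) z *(1)] germ_eq_iff[of "tr s z" "s\<^sup>\<star>" "tr s z" "s'\<^sup>\<star>"] tr_in[OF z] tr_in[OF *(1)]
    by auto
qed

lemma gtop_eq: "gtop GG = topology_generated_by {germ \<theta> s ` U | s U. openin X U \<and> U \<subseteq> dm s}"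
  by (simp add: transformation_groupoid_def act_dom_eq)

lemma topspace_gtop [simp]: "topspace (gtop GG) = arr"
proof -
  have "germ \<theta> s z \<in> \<Union>{germ \<theta> s ` U | s U. openin X U \<and> U \<subseteq> dm s}" if "z \<in> dm s" for s z
    using that openin_dm[of s] by blast
  then show ?thesis unfolding gtop_eq topology_generated_by_topspace arr_def by blast
qed

text \<open>Inside \<open>dm s\<close> the preimage of a basic set of \<open>t\<close> is cut out by
  the domains of the idempotents that witness equality of the germs of \<open>s\<close> and
  \<open>t\<close>, and the union of these domains is open.\<close>

lemma cont_germ: "continuous_map (subtopology X (dm s)) (gtop GG) (germ \<theta> s)"
  unfolding gtop_eq
proof (rule continuous_on_generated_topo)
  fix W assume "W \<in> {germ \<theta> s ` U | s U. openin X U \<and> U \<subseteq> dm s}"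
  then obtain t U where W: "W = germ \<theta> t ` U" and U: "openin X U" "U \<subseteq> dm t" by blast
  have "germ \<theta> s -` W \<inter> topspace (subtopology X (dm s)) = dm s \<inter> U \<inter> \<Union>{dm e | e. e \<in> idempotents \<and> s * e = t * e}"
    (is "?L = ?R")
  proof (intro set_eqI iffI)
    fix z assume "z \<in> ?L"
    then obtain w where "w \<in> U" "germ \<theta> s z = germ \<theta> t w" "z \<in> dm s" unfolding W by auto
    then show "z \<in> ?R" using germ_eq_iff[of z s w t] U by (auto simp: same_germ_def)
  next
    fix z assume z: "z \<in> ?R"
    then have "germ \<theta> s z = germ \<theta> t z" using U germ_eq_iff[of z s z t] by (auto simp: same_germ_def)
    then show "z \<in> ?L" using z dm_sub unfolding W by auto
  qed
  moreover have "openin X ?R" using U openin_dm by (intro openin_Int) auto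
  ultimately show "openin (subtopology X (dm s)) (germ \<theta> s -` W \<inter> topspace (subtopology X (dm s)))"
    using openin_dm by (auto simp: openin_open_subtopology)
next
  have "germ \<theta> s ` topspace (subtopology X (dm s)) \<subseteq> topspace (gtop GG)" using germ_arr by auto
  then show "germ \<theta> s ` topspace (subtopology X (dm s)) \<subseteq> \<Union>{germ \<theta> s ` U | s U. openin X U \<and> U \<subseteq> dm s}"
    unfolding gtop_eq topology_generated_by_topspace .
qed

lemma openin_gtop_germ: "openin X U \<Longrightarrow> U \<subseteq> dm s \<Longrightarrow> openin (gtop GG) (germ \<theta> s ` U)"
  unfolding gtop_eq by (rule topology_generated_by_Basis) blast

lemma openin_gtop_preimage: assumes "openin (gtop GG) W" shows "openin X {z \<in> dm s. germ \<theta> s z \<in> W}"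
proof -
  have "openin (subtopology X (dm s)) {z \<in> topspace (subtopology X (dm s)). germ \<theta> s z \<in> W}"
    by (rule openin_continuous_map_preimage[OF cont_germ assms])
  moreover have "{z \<in> topspace (subtopology X (dm s)). germ \<theta> s z \<in> W} = {z \<in> dm s. germ \<theta> s z \<in> W}"
    using dm_sub by auto
  ultimately show ?thesis using openin_dm by (simp add: openin_open_subtopology)
qed

text \<open>Together with \<open>openin_gtop_preimage\<close> this says that the topology is final
  for the maps \<open>germ \<theta> s\<close>, so openness may be tested on each \<open>s\<close>
  separately.\<close>

lemma openin_gtopI:
  assumes "W \<subseteq> arr" "\<And>s. openin X {z \<in> dm s. germ \<theta> s z \<in> W}" shows "openin (gtop GG) W"
proof -
  have "W = \<Union>{germ \<theta> s ` {z \<in> dm s. germ \<theta> s z \<in> W} | s. True}"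
  proof (intro equalityI subsetI)
    fix \<gamma> assume g: "\<gamma> \<in> W"
    then obtain s z where "z \<in> dm s" "\<gamma> = germ \<theta> s z" using assms(1) arr_cases by blast
    then show "\<gamma> \<in> \<Union>{germ \<theta> s ` {z \<in> dm s. germ \<theta> s z \<in> W} | s. True}" using g by blast
  qed blast
  moreover have "openin (gtop GG) (\<Union>{germ \<theta> s ` {z \<in> dm s. germ \<theta> s z \<in> W} | s. True})"
    by (rule openin_Union) (use openin_gtop_germ[OF assms(2)] in blast)
  ultimately show ?thesis by simp
qed

lemma cont_gdom: "continuous_map (gtop GG) X (gdom GG)"
  unfolding continuous_map_def
proof (intro conjI allI impI)
  show "gdom GG \<in> topspace (gtop GG) \<rightarrow> topspace X" by (auto elim!: arr_cases dest: subsetD[OF dm_sub])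
  fix V assume V: "openin X V"
  show "openin (gtop GG) {\<gamma> \<in> topspace (gtop GG). gdom GG \<gamma> \<in> V}"
  proof (rule openin_gtopI)
    fix s
    have "{z \<in> dm s. germ \<theta> s z \<in> {\<gamma> \<in> topspace (gtop GG). gdom GG \<gamma> \<in> V}} = dm s \<inter> V"
      using germ_arr by auto
    then show "openin X {z \<in> dm s. germ \<theta> s z \<in> {\<gamma> \<in> topspace (gtop GG). gdom GG \<gamma> \<in> V}}"
      using V openin_dm by (simp add: openin_Int)
  qed auto
qed

section \<open>From families to functions on the groupoid\<close>

definition br :: "'s \<Rightarrow> ('x \<Rightarrow> complex) \<Rightarrow> ('s \<times> 'x) set \<Rightarrow> complex"
  where "br s h \<gamma> = (if \<gamma> \<in> germ \<theta> s ` dm s then h (gdom GG \<gamma>) else 0)"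

lemma br_germ: "z \<in> dm u \<Longrightarrow> br s h (germ \<theta> u z) = (if z \<in> dm s \<and> same_germ u s z then h z else 0)"
  using germ_eq_iff[of z u _ s] by (auto simp: br_def image_iff)

lemma br_off: "\<gamma> \<notin> arr \<Longrightarrow> br s h \<gamma> = 0"
  using germ_arr by (auto simp: br_def)

lemma br_zero [simp]: "br s (\<lambda>x. 0) \<gamma> = 0"
  by (simp add: br_def)

lemma br_Cc:
  assumes h: "h \<in> Fn True X (dm s)" shows "br s h \<in> Cc (subtopology (gtop GG) (germ \<theta> s ` dm s))"
proof -
  let ?W = "germ \<theta> s ` dm s"
  let ?T = "subtopology (gtop GG) ?W"
  have top: "topspace ?T = ?W" using germ_arr by auto
  have c: "continuous_map ?T X (gdom GG)" using cont_gdom continuous_map_from_subtopology by blast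
  have "continuous_map ?T euclidean (\<lambda>\<gamma>. h (gdom GG \<gamma>))"
    using continuous_map_compose[OF c Fn_cont[OF h]] by (simp add: o_def)
  then have cont: "continuous_map ?T euclidean (br s h)"
    by (rule continuous_map_eq) (auto simp: top br_def)
  obtain K where K: "compactin X K" "K \<subseteq> dm s" "\<And>x. x \<notin> K \<Longrightarrow> h x = 0" using h Fn_True_support by metis
  have "compactin (gtop GG) (germ \<theta> s ` K)"
    by (rule image_compactin[OF _ cont_germ]) (simp add: compactin_subtopology K)
  then have cK: "compactin ?T (germ \<theta> s ` K)" using K(2) by (auto simp: compactin_subtopology)
  have "closedin ?T {\<gamma> \<in> topspace ?T. gdom GG \<gamma> \<in> K}"
    by (rule closedin_continuous_map_preimage[OF c compactin_imp_closedin[OF Haus K(1)]])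
  moreover have "{\<gamma> \<in> topspace ?T. gdom GG \<gamma> \<in> K} = germ \<theta> s ` K" unfolding top using K(2) by auto
  ultimately have cl: "closedin ?T (germ \<theta> s ` K)" by simp
  have "?T closure_of {\<gamma> \<in> topspace ?T. br s h \<gamma> \<noteq> 0} \<subseteq> germ \<theta> s ` K"
  proof (rule closure_of_minimal[OF _ cl])
    have "x \<in> K" if "h x \<noteq> 0" for x using that K(3) by blast
    then show "{\<gamma> \<in> topspace ?T. br s h \<gamma> \<noteq> 0} \<subseteq> germ \<theta> s ` K"
      unfolding top by (auto simp: br_def)
  qed
  then have "compactin ?T (?T closure_of {\<gamma> \<in> topspace ?T. br s h \<gamma> \<noteq> 0})"
    by (rule closed_compactin[OF cK]) simp
  moreover have "\<forall>\<gamma>. \<gamma> \<notin> topspace ?T \<longrightarrow> br s h \<gamma> = 0" unfolding top by (simp add: br_def)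
  ultimately show ?thesis using cont by (simp only: Cc_def mem_Collect_eq)
qed

lemma open_bisection_germ: "open_bisection GG (germ \<theta> s ` dm s)"
  unfolding open_bisection_def
proof (intro conjI)
  show "openin (gtop GG) (germ \<theta> s ` dm s)" using openin_gtop_germ[OF openin_dm] by blast
  show "inj_on (gdom GG) (germ \<theta> s ` dm s)" by (auto simp: inj_on_def)
  have "z = w" if "z \<in> dm s" "w \<in> dm s" "tr s z = tr s w" for z w using that tr_star_tr by metis
  then show "inj_on (grng GG) (germ \<theta> s ` dm s)" by (auto simp: inj_on_def)
qed

text \<open>The canonical map from families to functions on the groupoid. It is not injective in
  general, since germs of different semigroup elements can coincide; the algebra of the groupoid is
  its image (\<open>groupoid_carrier\<close>).\<close>

definition Qm :: "('s \<Rightarrow> 'x \<Rightarrow> complex) \<Rightarrow> ('s \<times> 'x) set \<Rightarrow> complex"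
  where "Qm a \<gamma> = (\<Sum>s | a s \<noteq> (\<lambda>x. 0). br s (a s) \<gamma>)"

lemma Qm_eq:
  assumes "finite F" "{s. a s \<noteq> (\<lambda>x. 0)} \<subseteq> F" shows "Qm a \<gamma> = (\<Sum>s\<in>F. br s (a s) \<gamma>)"
  unfolding Qm_def by (rule sum.mono_neutral_left) (use assms in auto)

lemma Qm_delta: "Qm (delta s f) = br s f"
  by (rule ext, subst Qm_eq[of "{s}"]) (auto simp: delta_def)

lemma Qm_zero [simp]: "Qm (\<lambda>s x. 0) = (\<lambda>\<gamma>. 0)"
  by (simp add: Qm_def[abs_def])

lemma Qm_off: "\<gamma> \<notin> arr \<Longrightarrow> Qm a \<gamma> = 0"
  by (simp add: Qm_def br_off)

lemma Qm_add: assumes "a \<in> carr c" "b \<in> carr c" shows "Qm (\<lambda>s x. a s x + b s x) = (\<lambda>\<gamma>. Qm a \<gamma> + Qm b \<gamma>)"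
proof
  fix \<gamma>
  let ?F = "{s. a s \<noteq> (\<lambda>x. 0)} \<union> {s. b s \<noteq> (\<lambda>x. 0)}"
  have F: "finite ?F" using assms carr_fin by blast
  have "{s. (\<lambda>x. a s x + b s x) \<noteq> (\<lambda>x. 0)} \<subseteq> ?F" by (auto simp: fun_eq_iff)
  then show "Qm (\<lambda>s x. a s x + b s x) \<gamma> = Qm a \<gamma> + Qm b \<gamma>"
    using Qm_eq[OF F, of a \<gamma>] Qm_eq[OF F, of b \<gamma>] Qm_eq[OF F, of "\<lambda>s x. a s x + b s x" \<gamma>]
    by (auto simp: sum.distrib[symmetric] br_def intro!: sum.cong)
qed

lemma Qm_scale: assumes "a \<in> carr c" shows "Qm (\<lambda>s x. k * a s x) = (\<lambda>\<gamma>. k * Qm a \<gamma>)"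
proof
  fix \<gamma>
  let ?F = "{s. a s \<noteq> (\<lambda>x. 0)}"
  have F: "finite ?F" using assms carr_fin by blast
  have "{s. (\<lambda>x. k * a s x) \<noteq> (\<lambda>x. 0)} \<subseteq> ?F" by (auto simp: fun_eq_iff)
  then show "Qm (\<lambda>s x. k * a s x) \<gamma> = k * Qm a \<gamma>"
    using Qm_eq[OF F, of a \<gamma>] Qm_eq[OF F, of "\<lambda>s x. k * a s x" \<gamma>]
    by (auto simp: sum_distrib_left br_def intro!: sum.cong)
qed

lemma Qm_fibre_finite: assumes "a \<in> carr c" shows "finite {\<beta>. \<beta> \<in> arr \<and> gdom GG \<beta> = z \<and> Qm a \<beta> \<noteq> 0}"
proof (rule finite_subset)
  show "finite ((\<lambda>s. germ \<theta> s z) ` {s. a s \<noteq> (\<lambda>x. 0)})" using carr_fin[OF assms] by blast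
  show "{\<beta>. \<beta> \<in> arr \<and> gdom GG \<beta> = z \<and> Qm a \<beta> \<noteq> 0} \<subseteq> (\<lambda>s. germ \<theta> s z) ` {s. a s \<noteq> (\<lambda>x. 0)}"
  proof
    fix \<beta> assume b: "\<beta> \<in> {\<beta>. \<beta> \<in> arr \<and> gdom GG \<beta> = z \<and> Qm a \<beta> \<noteq> 0}"
    then obtain s where "a s \<noteq> (\<lambda>x. 0)" "br s (a s) \<beta> \<noteq> 0"
      unfolding Qm_def by (auto elim!: sum.not_neutral_contains_not_neutral)
    then show "\<beta> \<in> (\<lambda>s. germ \<theta> s z) ` {s. a s \<noteq> (\<lambda>x. 0)}" using b by (auto simp: br_def split: if_splits)
  qed
qed

abbreviation conv where "conv \<equiv> amult (groupoid_algebra GG)"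

text \<open>Convolution sums over the support of the right factor; allowing any larger finite part
  \<open>T\<close> of the fibre puts the sums for different factors over one index set.\<close>

lemma conv_eq:
  assumes "finite T" "{\<beta>. \<beta> \<in> arr \<and> gdom GG \<beta> = gdom GG \<gamma> \<and> g \<beta> \<noteq> 0} \<subseteq> T" "T \<subseteq> {\<beta>. \<beta> \<in> arr \<and> gdom GG \<beta> = gdom GG \<gamma>}"
  shows "conv f g \<gamma> = (if \<gamma> \<in> arr then \<Sum>\<beta>\<in>T. f (gmult GG \<gamma> (ginv GG \<beta>)) * g \<beta> else 0)"
proof -
  have "(\<Sum>\<beta> | \<beta> \<in> arr \<and> gdom GG \<beta> = gdom GG \<gamma> \<and> g \<beta> \<noteq> 0. f (gmult GG \<gamma> (ginv GG \<beta>)) * g \<beta>)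
      = (\<Sum>\<beta>\<in>T. f (gmult GG \<gamma> (ginv GG \<beta>)) * g \<beta>)"
    by (rule sum.mono_neutral_left) (use assms in auto)
  then show ?thesis by (simp add: groupoid_algebra_def)
qed

lemma conv_add_left: "conv (\<lambda>\<gamma>. f \<gamma> + g \<gamma>) h = (\<lambda>\<gamma>. conv f h \<gamma> + conv g h \<gamma>)"
  by (auto simp: groupoid_algebra_def distrib_right sum.distrib fun_eq_iff)

lemma conv_zero [simp]: "conv (\<lambda>\<gamma>. 0) h = (\<lambda>\<gamma>. 0)" "conv h (\<lambda>\<gamma>. 0) = (\<lambda>\<gamma>. 0)"
  by (auto simp: groupoid_algebra_def fun_eq_iff)

lemma conv_add_right:
  assumes "a \<in> carr c" "b \<in> carr c"
  shows "conv f (\<lambda>\<gamma>. Qm a \<gamma> + Qm b \<gamma>) = (\<lambda>\<gamma>. conv f (Qm a) \<gamma> + conv f (Qm b) \<gamma>)"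
proof
  fix \<gamma>
  let ?T = "{\<beta>. \<beta> \<in> arr \<and> gdom GG \<beta> = gdom GG \<gamma> \<and> Qm a \<beta> \<noteq> 0} \<union> {\<beta>. \<beta> \<in> arr \<and> gdom GG \<beta> = gdom GG \<gamma> \<and> Qm b \<beta> \<noteq> 0}"
  have T: "finite ?T" using Qm_fibre_finite assms by blast
  have T': "?T \<subseteq> {\<beta>. \<beta> \<in> arr \<and> gdom GG \<beta> = gdom GG \<gamma>}" by blast
  have s: "{\<beta>. \<beta> \<in> arr \<and> gdom GG \<beta> = gdom GG \<gamma> \<and> Qm a \<beta> + Qm b \<beta> \<noteq> 0} \<subseteq> ?T" by auto
  show "conv f (\<lambda>\<gamma>. Qm a \<gamma> + Qm b \<gamma>) \<gamma> = conv f (Qm a) \<gamma> + conv f (Qm b) \<gamma>"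
    using conv_eq[OF T _ T', of "Qm a" f] conv_eq[OF T _ T', of "Qm b" f] conv_eq[OF T s T', of f]
    by (simp add: distrib_left sum.distrib)
qed

text \<open>Over \<open>z\<close> only the arrow \<open>[t, z]\<close> contributes. For
  \<open>\<gamma> = [u, z]\<close> the quotient by it is
  \<open>[u * t\<^sup>\<star>, tr t z]\<close>, and where \<open>tr t z\<close> lies in
  \<open>dm s\<close> this is a germ of \<open>s\<close> exactly if \<open>[u, z]\<close> is a germ
  of \<open>s * t\<close>.\<close>

lemma conv_br:
  assumes f: "f \<in> Fn c X (dm s)" and g: "g \<in> Fn c X (dm t)"
  shows "conv (br s f) (br t g) = br (s * t) (\<lambda>x. f (tr t x) * g x)"
proof
  fix \<gamma> show "conv (br s f) (br t g) \<gamma> = br (s * t) (\<lambda>x. f (tr t x) * g x) \<gamma>"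
  proof (cases "\<gamma> \<in> arr")
    case False
    then show ?thesis by (simp add: br_off groupoid_algebra_def)
  next
    case True
    then obtain u z where z: "z \<in> dm u" and \<gamma>: "\<gamma> = germ \<theta> u z" by (rule arr_cases)
    show ?thesis
    proof (cases "z \<in> dm t")
      case False
      have "{\<beta>. \<beta> \<in> arr \<and> gdom GG \<beta> = gdom GG \<gamma> \<and> br t g \<beta> \<noteq> 0} \<subseteq> {}"
        using False z unfolding \<gamma> by (auto simp: br_def split: if_splits)
      from conv_eq[OF _ this] have "conv (br s f) (br t g) \<gamma> = 0" by simp
      then show ?thesis using False Fn_zero[OF g] z by (simp add: \<gamma> br_germ)
    next
      case zt: True
      have tt: "tr t z \<in> dm (u * t\<^sup>\<star>)" using zt z tr_in by (simp add: dm_mult)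
      have "conv (br s f) (br t g) \<gamma> = br s f (gmult GG \<gamma> (ginv GG (germ \<theta> t z))) * br t g (germ \<theta> t z)"
      proof -
        have "{\<beta>. \<beta> \<in> arr \<and> gdom GG \<beta> = gdom GG \<gamma> \<and> br t g \<beta> \<noteq> 0} \<subseteq> {germ \<theta> t z}"
          using z zt unfolding \<gamma> by (auto simp: br_def split: if_splits)
        from conv_eq[OF _ this, of "br s f"] show ?thesis using True zt z germ_arr \<gamma> by simp
      qed
      also have "gmult GG \<gamma> (ginv GG (germ \<theta> t z)) = germ \<theta> (u * t\<^sup>\<star>) (tr t z)"
        using gmult_germ[of "tr t z" "t\<^sup>\<star>" u] tr_in[OF zt] zt z by (simp add: \<gamma> ginv_germ)
      also have "br t g (germ \<theta> t z) = g z" using zt same_germ_refl by (simp add: br_germ)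
      also have "br s f (germ \<theta> (u * t\<^sup>\<star>) (tr t z)) * g z = br (s * t) (\<lambda>x. f (tr t x) * g x) \<gamma>"
      proof -
        have "same_germ (u * t\<^sup>\<star>) s (tr t z) \<longleftrightarrow> same_germ u (s * t) z" if "tr t z \<in> dm s"
        proof
          assume "same_germ (u * t\<^sup>\<star>) s (tr t z)"
          from same_germ_mult[OF this same_germ_refl[OF zt] zt]
          have "same_germ (u * (t\<^sup>\<star> * t)) (s * t) z" by (simp add: mult.assoc)
          then show "same_germ u (s * t) z"
            using same_germ_idem[of "t\<^sup>\<star> * t" z u] zt dm_star_self same_germ_trans same_germ_sym by (metis star_mult_idem(1))
        next
          assume a: "same_germ u (s * t) z"
          have "same_germ (u * t\<^sup>\<star>) (s * t * t\<^sup>\<star>) (tr t z)"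
            by (rule same_germ_mult[OF _ same_germ_refl]) (use a zt tr_in in auto)
          moreover have "same_germ (s * (t * t\<^sup>\<star>)) s (tr t z)"
            by (rule same_germ_idem) (use tr_in[OF zt] dm_star_self[of "t\<^sup>\<star>"] in auto)
          ultimately show "same_germ (u * t\<^sup>\<star>) s (tr t z)" using same_germ_trans by (simp add: mult.assoc)
        qed
        then show ?thesis using br_germ[OF tt] br_germ[OF z] zt by (auto simp: \<gamma> dm_mult)
      qed
      finally show ?thesis .
    qed
  qed
qed

lemma Qm_mult: assumes "a \<in> carr c" "b \<in> carr c" shows "Qm (amult (KS_algebraic X \<theta>) a b) = conv (Qm a) (Qm b)"
  using assms(1)
proof (induction rule: alg_induct)
  case (add a a')
  then show ?case using assms(2)
    by (simp add: mult_add_left_alg[of _ c] Qm_add[of _ c] carr_mult[of _ c] conv_add_left)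
next
  case f: (delta s f)
  from assms(2) show ?case
  proof (induction rule: alg_induct)
    case (add b b')
    then show ?case using delta_carr[OF f]
      by (simp add: mult_add_right_alg[of _ c] Qm_add[of _ c] carr_mult[of _ c] conv_add_right[of _ c])
  next
    case g: (delta t g)
    show ?case using conv_br[OF f g] delta_mult_tr[OF g] by (simp add: Qm_delta)
  qed simp
qed simp

lemma star_br: assumes f: "f \<in> Fn c X (dm s)" shows "astar (groupoid_algebra GG) (br s f) = br (s\<^sup>\<star>) (starf s f)"
proof
  fix \<gamma> show "astar (groupoid_algebra GG) (br s f) \<gamma> = br (s\<^sup>\<star>) (starf s f) \<gamma>"
  proof (cases "\<gamma> \<in> arr")
    case True
    then obtain u z where z: "z \<in> dm u" and \<gamma>: "\<gamma> = germ \<theta> u z" by (rule arr_cases)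
    have eq: "tr u z \<in> dm s \<and> same_germ (u\<^sup>\<star>) s (tr u z) \<longleftrightarrow> z \<in> dm (s\<^sup>\<star>) \<and> same_germ u (s\<^sup>\<star>) z"
    proof
      assume a: "tr u z \<in> dm s \<and> same_germ (u\<^sup>\<star>) s (tr u z)"
      then have "tr s (tr u z) = z" using same_germ_tr[of "u\<^sup>\<star>" s "tr u z"] tr_in[OF z] z by simp
      then show "z \<in> dm (s\<^sup>\<star>) \<and> same_germ u (s\<^sup>\<star>) z"
        using same_germ_star[of "u\<^sup>\<star>" s "tr u z"] a tr_in[OF z] z tr_in[of "tr u z" s] by simp
    next
      assume a: "z \<in> dm (s\<^sup>\<star>) \<and> same_germ u (s\<^sup>\<star>) z"
      then have "tr u z = tr (s\<^sup>\<star>) z" using same_germ_tr[of u "s\<^sup>\<star>" z] z by simp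
      then show "tr u z \<in> dm s \<and> same_germ (u\<^sup>\<star>) s (tr u z)"
        using same_germ_star[of u "s\<^sup>\<star>" z] a z tr_in[of z "s\<^sup>\<star>"] by simp
    qed
    have "tr u z = tr (s\<^sup>\<star>) z" if "z \<in> dm (s\<^sup>\<star>) \<and> same_germ u (s\<^sup>\<star>) z"
      using same_germ_tr[of u "s\<^sup>\<star>" z] that z by simp
    then show ?thesis
      using True eq br_germ[OF z] br_germ[OF tr_in[OF z]]
      by (auto simp: groupoid_algebra_def \<gamma> ginv_germ[OF z] starf_def)
  qed (simp add: br_off groupoid_algebra_def)
qed

lemma Qm_star: assumes "a \<in> carr c" shows "Qm (astar (KS_algebraic X \<theta>) a) = astar (groupoid_algebra GG) (Qm a)"
  using assms
proof (induction rule: alg_induct)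
  case (add a b)
  have "astar (groupoid_algebra GG) (\<lambda>\<gamma>. f \<gamma> + g \<gamma>) = (\<lambda>\<gamma>. astar (groupoid_algebra GG) f \<gamma> + astar (groupoid_algebra GG) g \<gamma>)" for f g
    by (auto simp: groupoid_algebra_def fun_eq_iff)
  then show ?case using add by (simp add: star_add_alg Qm_add[of _ c] carr_star)
next
  case (delta s f)
  then show ?case using star_br by (simp add: Qm_delta delta_star_tr)
qed (auto simp: star_zero_alg groupoid_algebra_def)

text \<open>The bump is 1 on a whole neighbourhood, not only at \<open>z\<close>, so that finitely
  many of them can cover a compact set.\<close>

lemma bump_nbhd:
  assumes V: "openin X V" and z: "z \<in> V"
  shows "\<exists>k W. k \<in> Fn True X V \<and> openin X W \<and> z \<in> W \<and> (\<forall>x\<in>W. k x = 1)"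
proof -
  have Y: "locally_compact_space (subtopology X V)" "Hausdorff_space (subtopology X V)"
    using locally_compact_space_open_subset[OF _ LC V] Haus Hausdorff_space_subtopology by blast+
  have "z \<in> topspace (subtopology X V)" using z openin_subset[OF V] by auto
  then obtain W L where W: "openin (subtopology X V) W" "compactin (subtopology X V) L" "z \<in> W" "W \<subseteq> L"
    using Y(1) unfolding locally_compact_space_def by blast
  have "openin X W" "compactin X L" "L \<subseteq> V" using W V by (auto simp: openin_open_subtopology compactin_subtopology)
  moreover obtain g :: "'x \<Rightarrow> real" where "(\<lambda>x. complex_of_real (g x)) \<in> Fn True X V" "\<forall>x\<in>L. g x = 1"
    using Urysohn_bump[OF LC Haus V \<open>compactin X L\<close> \<open>L \<subseteq> V\<close>] by blast
  ultimately show ?thesis using W by (intro exI[of _ "\<lambda>x. complex_of_real (g x)"] exI[of _ W]) auto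
qed

text \<open>Instead of a partition of unity: with bumps \<open>k\<^sub>i\<close> equal to 1 on pieces covering the support of
  \<open>h\<close>, the product of the \<open>1 - k\<^sub>i\<close> vanishes there, and \<open>h\<close> times one minus that product telescopes
  into functions supported in the pieces.\<close>

lemma Qm_surj_bisection:
  assumes U: "open_bisection GG U" and h: "h \<in> Cc (subtopology (gtop GG) U)"
  shows "\<exists>a\<in>carr True. h = Qm a"
proof -
  have Uo: "openin (gtop GG) U" and inj: "inj_on (gdom GG) U" using U by (auto simp: open_bisection_def)
  have UA: "U \<subseteq> arr" using openin_subset[OF Uo] by simp
  have topU: "topspace (subtopology (gtop GG) U) = U" using UA by auto
  define V where "V s = {z \<in> dm s. germ \<theta> s z \<in> U}" for s
  have V: "openin X (V s)" "V s \<subseteq> dm s" for s using openin_gtop_preimage[OF Uo] by (auto simp: V_def)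
  define C where "C = subtopology (gtop GG) U closure_of {x \<in> topspace (subtopology (gtop GG) U). h x \<noteq> 0}"
  have C: "compactin (gtop GG) C" "C \<subseteq> U" using h by (auto simp: Cc_def C_def compactin_subtopology)
  have h0: "h \<gamma> = 0" if "\<gamma> \<notin> C" for \<gamma>
  proof (rule ccontr)
    assume "h \<gamma> \<noteq> 0"
    then have "\<gamma> \<in> {x \<in> topspace (subtopology (gtop GG) U). h x \<noteq> 0}" using h by (auto simp: Cc_def)
    then show False using that closure_of_subset[of "{x \<in> topspace (subtopology (gtop GG) U). h x \<noteq> 0}" "subtopology (gtop GG) U"]
      by (auto simp: C_def)
  qed
  have hV: "continuous_map (subtopology X (V s)) euclidean (\<lambda>z. h (germ \<theta> s z))" for s
  proof -
    have "continuous_map (subtopology X (V s)) (gtop GG) (germ \<theta> s)"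
      using cont_germ V(2) continuous_map_from_subtopology_mono by blast
    then have "continuous_map (subtopology X (V s)) (subtopology (gtop GG) U) (germ \<theta> s)"
      by (auto simp: continuous_map_in_subtopology V_def)
    from continuous_map_compose[OF this, of euclidean h] show ?thesis using h by (simp add: Cc_def o_def)
  qed
  define P where "P L z = prod_list (map (\<lambda>(s, k). 1 - k z) L)" for L :: "('s \<times> ('x \<Rightarrow> complex)) list" and z
  have Pc: "continuous_map X euclidean (P L)" if "\<forall>(s, k)\<in>set L. k \<in> Fn True X (V s)" for L
    using that
  proof (induction L)
    case (Cons sk L)
    obtain s k where sk: "sk = (s, k)" by fastforce
    have "continuous_map X euclidean (\<lambda>z. (1 - k z) * P L z)"
      using Cons sk by (intro continuous_map_cmult continuous_map_cdiff) (auto simp: Fn_cont)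
    then show ?case by (simp add: P_def[abs_def] sk)
  qed (simp add: P_def[abs_def])
  have step: "\<exists>a\<in>carr True. Qm a = (\<lambda>\<gamma>. h \<gamma> * (1 - P L (gdom GG \<gamma>)))" if "\<forall>(s, k)\<in>set L. k \<in> Fn True X (V s)" for L
    using that
  proof (induction L)
    case Nil
    show ?case by (rule bexI[of _ "\<lambda>s x. 0"]) (simp_all add: P_def)
  next
    case (Cons sk L)
    obtain s k where sk: "sk = (s, k)" by fastforce
    have k: "k \<in> Fn True X (V s)" and L: "\<forall>(s, k)\<in>set L. k \<in> Fn True X (V s)" using Cons.prems sk by auto
    obtain a where a: "a \<in> carr True" "Qm a = (\<lambda>\<gamma>. h \<gamma> * (1 - P L (gdom GG \<gamma>)))" using Cons.IH L by blast
    define f where "f z = h (germ \<theta> s z) * P L z * k z" for z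
    have "f \<in> Fn True X (V s)"
      unfolding f_def[abs_def]
      by (rule Fn_True_mult_local[OF Haus V(1) _ k])
        (intro continuous_map_cmult hV continuous_map_from_subtopology Pc[OF L])
    then have f: "f \<in> Fn True X (dm s)" using V(2) Fn_mono by blast
    have br: "br s f \<gamma> = h \<gamma> * P L (gdom GG \<gamma>) * k (gdom GG \<gamma>)" for \<gamma>
    proof (cases "\<gamma> \<in> germ \<theta> s ` dm s")
      case True
      then show ?thesis by (auto simp: br_def f_def)
    next
      case False
      \<comment> \<open>If both were nonzero, \<open>\<gamma>\<close> and the germ of
        \<open>s\<close> over the same unit would lie in \<open>U\<close>, hence coincide because
        \<open>gdom\<close> is injective there.\<close>
      have "h \<gamma> = 0 \<or> k (gdom GG \<gamma>) = 0"
      proof (rule ccontr)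
        assume a: "\<not> (h \<gamma> = 0 \<or> k (gdom GG \<gamma>) = 0)"
        then have "\<gamma> \<in> U" using h0 C(2) by blast
        moreover have z: "gdom GG \<gamma> \<in> V s" using a Fn_zero[OF k] by blast
        then have "germ \<theta> s (gdom GG \<gamma>) \<in> U" "gdom GG (germ \<theta> s (gdom GG \<gamma>)) = gdom GG \<gamma>" by (auto simp: V_def)
        ultimately have "germ \<theta> s (gdom GG \<gamma>) = \<gamma>" using inj by (meson inj_onD)
        then show False using False z V(2) by (metis image_eqI subsetD)
      qed
      then show ?thesis using False by (auto simp: br_def)
    qed
    have PC: "P (sk # L) z = (1 - k z) * P L z" for z by (simp add: P_def sk)
    have "h \<gamma> * (1 - P L (gdom GG \<gamma>)) + br s f \<gamma> = h \<gamma> * (1 - P (sk # L) (gdom GG \<gamma>))" for \<gamma>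
      unfolding br PC by (simp add: algebra_simps)
    then have "Qm (\<lambda>t x. a t x + delta s f t x) = (\<lambda>\<gamma>. h \<gamma> * (1 - P (sk # L) (gdom GG \<gamma>)))"
      by (simp add: Qm_add[OF a(1) delta_carr[OF f]] a(2) Qm_delta)
    then show ?case using carr_add[OF a(1) delta_carr[OF f]] by blast
  qed
  have "\<exists>L. (\<forall>sk\<in>set L. (case sk of (s, k) \<Rightarrow> k \<in> Fn True X (V s))) \<and> (\<forall>\<gamma>\<in>C. \<exists>sk\<in>set L. snd sk (gdom GG \<gamma>) = 1)"
  proof (rule compactin_finite_list[OF C(1)])
    fix \<gamma> assume g: "\<gamma> \<in> C"
    then have gU: "\<gamma> \<in> U" "\<gamma> \<in> arr" using C(2) UA by auto
    then obtain s z where sz: "z \<in> dm s" "\<gamma> = germ \<theta> s z" using arr_cases by metis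
    then have "z \<in> V s" using gU by (simp add: V_def)
    then obtain k W where k: "k \<in> Fn True X (V s)" and W: "openin X W" "z \<in> W" "\<forall>x\<in>W. k x = 1"
      using bump_nbhd[OF V(1)] by blast
    have "openin (gtop GG) {\<beta> \<in> topspace (gtop GG). gdom GG \<beta> \<in> W}"
      by (rule openin_continuous_map_preimage[OF cont_gdom W(1)])
    then show "\<exists>sk B. openin (gtop GG) B \<and> \<gamma> \<in> B \<and> (case sk of (s, k) \<Rightarrow> k \<in> Fn True X (V s)) \<and> (\<forall>y\<in>B \<inter> C. snd sk (gdom GG y) = 1)"
      by (intro exI[of _ "(s, k)"] exI[of _ "{\<beta> \<in> topspace (gtop GG). gdom GG \<beta> \<in> W}"])
        (use k W sz gU in auto)
  qed
  then obtain L where L: "\<forall>(s, k)\<in>set L. k \<in> Fn True X (V s)" and L1: "\<And>\<gamma>. \<gamma> \<in> C \<Longrightarrow> \<exists>sk\<in>set L. snd sk (gdom GG \<gamma>) = 1"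
    by blast
  obtain a where a: "a \<in> carr True" "Qm a = (\<lambda>\<gamma>. h \<gamma> * (1 - P L (gdom GG \<gamma>)))" using step[OF L] by blast
  have "P L (gdom GG \<gamma>) = 0" if g: "\<gamma> \<in> C" for \<gamma>
  proof -
    obtain sk where "sk \<in> set L" "snd sk (gdom GG \<gamma>) = 1" using L1[OF g] by blast
    then have "0 \<in> set (map (\<lambda>(s, k). 1 - k (gdom GG \<gamma>)) L)" by (force simp: case_prod_beta)
    then show ?thesis by (simp add: P_def prod_list_zero_iff)
  qed
  then have "h = Qm a" using a(2) h0 by fastforce
  then show ?thesis using a(1) by blast
qed

lemma groupoid_carrier: "acarrier (groupoid_algebra GG) = Qm ` carr True"
proof (intro set_eqI iffI)
  fix f assume "f \<in> acarrier (groupoid_algebra GG)"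
  then obtain n :: nat and k h where f: "f = (\<lambda>\<gamma>. \<Sum>i<n. k i * h i \<gamma>)"
    and "\<forall>i<n. \<exists>U. open_bisection GG U \<and> h i \<in> Cc (subtopology (gtop GG) U)"
    by (auto simp: groupoid_algebra_def)
  then have "\<forall>i<n. \<exists>a\<in>carr True. h i = Qm a" using Qm_surj_bisection by blast
  then obtain a where a: "\<And>i. i < n \<Longrightarrow> a i \<in> carr True \<and> h i = Qm (a i)" by metis
  have "\<exists>b\<in>carr True. (\<lambda>\<gamma>. \<Sum>i<m. k i * h i \<gamma>) = Qm b" if "m \<le> n" for m
    using that
  proof (induction m)
    case 0
    show ?case by (rule bexI[of _ "\<lambda>s x. 0"]) auto
  next
    case (Suc m)
    then obtain b where b: "b \<in> carr True" "(\<lambda>\<gamma>. \<Sum>i<m. k i * h i \<gamma>) = Qm b" by auto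
    have am: "a m \<in> carr True" "h m = Qm (a m)" using a Suc.prems by auto
    have "(\<lambda>\<gamma>. \<Sum>i<Suc m. k i * h i \<gamma>) = Qm (\<lambda>s x. b s x + k m * a m s x)"
      using b(2) by (simp add: Qm_add[OF b(1) carr_scale[OF am(1)]] Qm_scale[OF am(1)] am(2) fun_eq_iff)
    then show ?case using carr_add[OF b(1) carr_scale[OF am(1)]] by blast
  qed
  then show "f \<in> Qm ` carr True" using f by blast
next
  fix f assume "f \<in> Qm ` carr True"
  then obtain a where a: "a \<in> carr True" and f: "f = Qm a" by blast
  let ?F = "{s. a s \<noteq> (\<lambda>x. 0)}"
  obtain e where e: "bij_betw e {..<card ?F} ?F" using carr_fin[OF a] bij_betw_from_nat_into_finite by blast
  have "f = (\<lambda>\<gamma>. \<Sum>i<card ?F. 1 * br (e i) (a (e i)) \<gamma>)"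
    unfolding f Qm_def[abs_def] using sum.reindex_bij_betw[OF e, of "\<lambda>s. br s (a s) _"] by (intro ext) (simp add: sum.reindex_bij_betw[OF e, of "\<lambda>s. br s (a s) _"])
  moreover have "\<exists>U. open_bisection GG U \<and> br (e i) (a (e i)) \<in> Cc (subtopology (gtop GG) U)" for i
    using open_bisection_germ br_Cc[OF carr_Fn[OF a]] by blast
  ultimately show "f \<in> acarrier (groupoid_algebra GG)"
    unfolding groupoid_algebra_def star_alg.simps mem_Collect_eq
    by (intro exI[of _ "card ?F"] exI[of _ "\<lambda>_. 1"] exI[of _ "\<lambda>i. br (e i) (a (e i))"]) simp
qed

lemma Qm_hom: "star_hom (alg True X \<theta>) (groupoid_algebra GG) Qm"
  unfolding star_hom_def
  using groupoid_carrier Qm_add Qm_scale Qm_mult Qm_star by (auto simp: groupoid_algebra_def[of GG])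

lemma groupoid_bounded: "bounded_star_algebra (groupoid_algebra GG)"
  by (rule bounded_star_algebra_image[OF alg_bounded Qm_hom groupoid_carrier]) (simp add: groupoid_algebra_def)

end

section \<open>The action on \<open>X\<^sup>K\<^sup>S\<close>\<close>

definition hv :: "('x \<Rightarrow> complex) \<Rightarrow> 'x option \<Rightarrow> complex"
  where "hv f p = (case p of None \<Rightarrow> 0 | Some x \<Rightarrow> f x)"

lemma hv_simps [simp]: "hv f None = 0" "hv f (Some x) = f x"
  by (simp_all add: hv_def)

lemma hv_zero [simp]: "hv (\<lambda>x. 0) p = 0"
  by (cases p) auto

lemma hv_add: "hv (\<lambda>x. f x + g x) p = hv f p + hv g p"
  by (cases p) auto

lemma hv_scale: "hv (\<lambda>x. k * f x) p = k * hv f p"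
  by (cases p) auto

context lch_action
begin

abbreviation Z where "Z \<equiv> KS_space X \<theta>"
abbreviation \<kappa> where "\<kappa> \<equiv> KS_action X \<theta>"

lemma act_dom_sub: "e \<in> idempotents \<Longrightarrow> subtopology X (act_dom \<theta> e) = subtopology X (dm e)"
  by (simp add: act_dom_idem)

lemma topspace_KS_product:
  "topspace (KS_product X \<theta>) = (\<Pi>\<^sub>E e\<in>idempotents. insert None (Some ` dm e))"
proof -
  have "topspace X \<inter> dm e = dm e" for e using dm_sub by blast
  then show ?thesis by (auto simp: KS_product_def act_dom_idem PiE_iff)
qed

lemma KS_tilde_iff:
  "\<tau> \<in> KS_tilde X \<theta> \<longleftrightarrow> \<tau> \<in> extensional idempotents \<and> (\<forall>e\<in>idempotents. \<forall>x. \<tau> e = Some x \<longrightarrow> x \<in> dm e) \<and>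
    (\<forall>e\<in>idempotents. \<forall>f\<in>idempotents. f * e = e \<and> \<tau> e \<noteq> None \<longrightarrow> \<tau> f = \<tau> e) \<and>
    (\<forall>e\<in>idempotents. \<forall>f\<in>idempotents. \<tau> e \<noteq> None \<and> \<tau> f \<noteq> None \<longrightarrow> \<tau> (e * f) \<noteq> None)"
proof -
  have "\<tau> \<in> topspace (KS_product X \<theta>) \<longleftrightarrow> \<tau> \<in> extensional idempotents \<and> (\<forall>e\<in>idempotents. \<forall>x. \<tau> e = Some x \<longrightarrow> x \<in> dm e)"
    unfolding topspace_KS_product PiE_iff by (auto; metis image_iff not_None_eq insert_iff)
  then show ?thesis by (simp add: KS_tilde_def natural_le_idem_iff cong: ball_cong)
qed

lemma KS_tilde_sub: "KS_tilde X \<theta> \<subseteq> topspace (KS_product X \<theta>)"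
  by (auto simp: KS_tilde_def)

lemma topspace_Z: "topspace Z = KS_tilde X \<theta> - {KS_infinity}"
  using KS_tilde_sub by (auto simp: KS_space_def)

lemma KS_infinity_iff: "\<tau> \<in> KS_tilde X \<theta> \<Longrightarrow> \<tau> = KS_infinity \<longleftrightarrow> (\<forall>e\<in>idempotents. \<tau> e = None)"
  by (auto simp: KS_infinity_def KS_tilde_iff extensional_def fun_eq_iff)

lemma Z_iff: "\<tau> \<in> topspace Z \<longleftrightarrow> \<tau> \<in> KS_tilde X \<theta> \<and> (\<exists>e\<in>idempotents. \<tau> e \<noteq> None)"
  unfolding topspace_Z by (cases "\<tau> \<in> KS_tilde X \<theta>") (simp_all add: KS_infinity_iff)

lemma Z_tilde: "\<tau> \<in> topspace Z \<Longrightarrow> \<tau> \<in> KS_tilde X \<theta>"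
  by (simp add: Z_iff)

lemma tilde_dm: "\<tau> \<in> KS_tilde X \<theta> \<Longrightarrow> e \<in> idempotents \<Longrightarrow> \<tau> e = Some x \<Longrightarrow> x \<in> dm e"
  unfolding KS_tilde_iff by blast

lemma tilde_up: "\<tau> \<in> KS_tilde X \<theta> \<Longrightarrow> e \<in> idempotents \<Longrightarrow> f \<in> idempotents \<Longrightarrow> f * e = e \<Longrightarrow> \<tau> e = Some x \<Longrightarrow> \<tau> f = Some x"
  unfolding KS_tilde_iff by (metis option.distinct(1))

lemma tilde_mult:
  assumes "\<tau> \<in> KS_tilde X \<theta>" "e \<in> idempotents" "f \<in> idempotents" "\<tau> e = Some x" "\<tau> f = Some y"
  shows "\<tau> (e * f) = Some x" "y = x"
proof -
  have ef: "e * f \<in> idempotents" using assms idem_mult_closed by blast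
  have "\<tau> (e * f) \<noteq> None" using assms unfolding KS_tilde_iff by blast
  then obtain z where z: "\<tau> (e * f) = Some z" by blast
  have "e * (e * f) = e * f" "f * (e * f) = e * f"
    using assms(2,3) idem_self_left idem_left_commute idem_self by metis+
  then have "\<tau> e = Some z" "\<tau> f = Some z" using tilde_up[OF assms(1) ef _ _ z] assms by blast+
  then show "\<tau> (e * f) = Some x" "y = x" using z assms by auto
qed

lemma tilde_mult_iff:
  assumes "\<tau> \<in> KS_tilde X \<theta>" "e \<in> idempotents" "f \<in> idempotents"
  shows "\<tau> (e * f) = Some x \<longleftrightarrow> \<tau> e = Some x \<and> \<tau> f = Some x"
proof
  assume a: "\<tau> (e * f) = Some x"
  have "e * (e * f) = e * f" "f * (e * f) = e * f"
    using assms(2,3) idem_self_left idem_left_commute idem_self by metis+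
  then show "\<tau> e = Some x \<and> \<tau> f = Some x" using tilde_up[OF assms(1) idem_mult_closed[OF assms(2,3)] _ _ a] assms by blast
qed (use tilde_mult assms in blast)

lemma hv_mult:
  assumes "\<tau> \<in> KS_tilde X \<theta>" "e \<in> idempotents" "f \<in> idempotents"
  shows "hv (\<lambda>x. u x * v x) (\<tau> (e * f)) = hv u (\<tau> e) * hv v (\<tau> f)"
proof (cases "\<tau> (e * f)")
  case (Some x)
  then show ?thesis using tilde_mult_iff[OF assms, of x] by simp
next
  case None
  then have "\<tau> e = None \<or> \<tau> f = None" using tilde_mult[OF assms] by (metis not_None_eq)
  then show ?thesis using None by auto
qed

lemma Fn_idem_mult:
  assumes "e \<in> idempotents" "f \<in> idempotents" "u \<in> Fn c X (dm e)" "v \<in> Fn c X (dm f)"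
  shows "(\<lambda>x. u x * v x) \<in> Fn c X (dm (e * f))"
  using Fn_mult[OF Haus openin_dm assms(3,4)] by (simp add: dm_idem_mult assms)

lemma point_bump:
  assumes "openin X U" "x \<in> U" shows "\<exists>k\<in>Fn True X U. k x = 1"
  using bump_nbhd[OF assms] by blast

text \<open>The two order conditions together say that the numbers \<open>hv u (\<tau> e)\<close>
  are multiplicative in the pair \<open>(e, u)\<close>. In this form they are equations between
  continuous functions, which makes the set closed.\<close>

lemma KS_tilde_eq:
  "KS_tilde X \<theta> = {\<tau> \<in> topspace (KS_product X \<theta>). \<forall>e\<in>idempotents. \<forall>f\<in>idempotents. \<forall>u\<in>Fn True X (dm e). \<forall>v\<in>Fn True X (dm f).
    hv u (\<tau> e) * hv v (\<tau> f) = hv (\<lambda>x. u x * v x) (\<tau> (e * f))}" (is "_ = ?R")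
proof (intro equalityI subsetI)
  fix \<tau> assume "\<tau> \<in> KS_tilde X \<theta>"
  then show "\<tau> \<in> ?R" using KS_tilde_sub hv_mult by auto
next
  fix \<tau> assume t: "\<tau> \<in> ?R"
  then have P: "\<tau> \<in> (\<Pi>\<^sub>E e\<in>idempotents. insert None (Some ` dm e))" by (simp only: topspace_KS_product mem_Collect_eq)
  have top: "\<tau> \<in> extensional idempotents" "\<And>e x. e \<in> idempotents \<Longrightarrow> \<tau> e = Some x \<Longrightarrow> x \<in> dm e"
    using P PiE_mem[OF P] by (auto simp: PiE_iff)
  have R: "hv u (\<tau> e) * hv v (\<tau> f) = hv (\<lambda>x. u x * v x) (\<tau> (e * f))"
    if "e \<in> idempotents" "f \<in> idempotents" "u \<in> Fn True X (dm e)" "v \<in> Fn True X (dm f)" for e f u v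
    using t that by blast
  have 1: "\<tau> f = \<tau> e" if ef: "e \<in> idempotents" "f \<in> idempotents" "f * e = e" "\<tau> e = Some x" for e f x
  proof -
    have fe: "e * f = e" using ef idem_commute by metis
    have xe: "x \<in> dm e" using top ef by blast
    then have xf: "x \<in> dm f" using fe dm_idem_mult[OF ef(1,2)] by auto
    obtain u where u: "u \<in> Fn True X (dm e)" "u x = 1" using point_bump[OF openin_dm xe] by blast
    \<comment> \<open>Since \<open>e * f = e\<close> and \<open>u x = 1\<close>, multiplicativity
      makes every test function \<open>v\<close> take at \<open>\<tau> f\<close> the value that it
      has at \<open>x\<close>; this determines \<open>\<tau> f\<close>.\<close>
    have v: "hv v (\<tau> f) = v x" if "v \<in> Fn True X (dm f)" for v
      using R[OF ef(1,2) u(1) that] u(2) ef fe by simp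
    obtain v where v1: "v \<in> Fn True X (dm f)" "v x = 1" using point_bump[OF openin_dm xf] by blast
    obtain y where y: "\<tau> f = Some y" using v[OF v1(1)] v1(2) by (cases "\<tau> f") auto
    have "y = x"
    proof (rule ccontr)
      assume n: "y \<noteq> x"
      have "openin X (dm f - {y})" using openin_dm[of f] Haus top(2)[OF ef(2) y] dm_sub[of f]
        by (meson Hausdorff_imp_t1_space closedin_t1_singleton openin_diff subsetD)
      then obtain w where w: "w \<in> Fn True X (dm f - {y})" "w x = 1" using point_bump[of "dm f - {y}" x] xf n by blast
      have "w \<in> Fn True X (dm f)" using Fn_mono[OF w(1)] by blast
      from v[OF this] y w Fn_zero[OF w(1), of y] show False by simp
    qed
    then show ?thesis using y ef by simp
  qed
  have 2: "\<tau> (e * f) \<noteq> None" if ef: "e \<in> idempotents" "f \<in> idempotents" "\<tau> e = Some x" "\<tau> f = Some y" for e f x y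
  proof -
    obtain u v where "u \<in> Fn True X (dm e)" "u x = 1" "v \<in> Fn True X (dm f)" "v y = 1"
      using point_bump[OF openin_dm] top(2) ef by meson
    then show ?thesis using R[OF ef(1,2), of u v] ef by (cases "\<tau> (e * f)") auto
  qed
  show "\<tau> \<in> KS_tilde X \<theta>" unfolding KS_tilde_iff using top 1 2 by (auto simp: not_None_eq; metis)
qed

text \<open>If \<open>V\<close> contains 0, the points sent outside \<open>V\<close> form a closed
  part of the support of \<open>f\<close>, so the preimage is the complement of a compact set
  together with \<open>None\<close>.\<close>

lemma cont_hv_Alexandroff:
  assumes f: "f \<in> Fn True X (dm e)"
  shows "continuous_map (Alexandroff_compactification (subtopology X (dm e))) euclidean (hv f)"
  unfolding continuous_map_def
proof (intro conjI allI impI)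
  have top: "topspace (subtopology X (dm e)) = dm e" using dm_sub by auto
  fix V :: "complex set" assume V: "openin euclidean V"
  have c: "openin X {x \<in> topspace X. f x \<in> V}" by (rule openin_continuous_map_preimage[OF Fn_cont[OF f] V])
  let ?P = "{p \<in> topspace (Alexandroff_compactification (subtopology X (dm e))). hv f p \<in> V}"
  show "openin (Alexandroff_compactification (subtopology X (dm e))) ?P"
  proof (cases "0 \<in> V")
    case False
    then have P: "?P = Some ` (dm e \<inter> {x \<in> topspace X. f x \<in> V})" using dm_sub by (auto simp: top)
    have "openin (subtopology X (dm e)) (dm e \<inter> {x \<in> topspace X. f x \<in> V})"
      using c by (metis inf_commute openin_subtopology)
    then show ?thesis unfolding P by simp
  next
    case True
    let ?C = "{x \<in> dm e. f x \<notin> V}"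
    obtain K where K: "compactin X K" "K \<subseteq> dm e" "\<And>x. x \<notin> K \<Longrightarrow> f x = 0" using f Fn_True_support by metis
    have "?C = topspace X - {x \<in> topspace X. f x \<in> V}" using dm_sub Fn_zero[OF f] True by force
    then have "closedin X ?C" using c by (simp add: openin_closedin_eq)
    moreover have "?C \<subseteq> K" using K(3) True by force
    ultimately have "compactin X ?C" using closed_compactin[OF K(1)] by blast
    then have C: "compactin (subtopology X (dm e)) ?C" by (auto simp: compactin_subtopology)
    then have "closedin (subtopology X (dm e)) ?C" using compactin_imp_closedin Hausdorff_space_subtopology[OF Haus] by blast
    moreover have "?P = insert None (Some ` (topspace (subtopology X (dm e)) - ?C))" 
      unfolding topspace_Alexandroff_compactification top using True by auto
    ultimately show ?thesis using C unfolding openin_Alexandroff_compactification by blast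
  qed
qed auto

section \<open>The topology of the KS space\<close>

lemma cont_hv_product:
  assumes e: "e \<in> idempotents" and f: "f \<in> Fn True X (dm e)"
  shows "continuous_map (KS_product X \<theta>) euclidean (\<lambda>\<tau>. hv f (\<tau> e))"
proof -
  have "continuous_map (KS_product X \<theta>) (Alexandroff_compactification (subtopology X (dm e))) (\<lambda>\<tau>. \<tau> e)"
    unfolding KS_product_def act_dom_sub[OF e, symmetric] by (rule continuous_map_product_projection[OF e])
  from continuous_map_compose[OF this cont_hv_Alexandroff[OF f]] show ?thesis by (simp add: o_def)
qed

lemma compact_KS_product: "compact_space (KS_product X \<theta>)"
  by (auto simp: KS_product_def compact_space_product_topology)

lemma Hausdorff_KS_product: "Hausdorff_space (KS_product X \<theta>)"
proof -
  have "Hausdorff_space (Alexandroff_compactification (subtopology X (act_dom \<theta> e)))" if "e \<in> idempotents" for e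
    using locally_compact_space_open_subset[OF _ LC openin_dm] Haus Hausdorff_space_subtopology that
    by (auto simp: Hausdorff_space_Alexandroff_compactification act_dom_idem)
  then show ?thesis by (simp add: KS_product_def Hausdorff_space_product_topology)
qed

lemma closedin_KS_tilde: "closedin (KS_product X \<theta>) (KS_tilde X \<theta>)"
proof -
  let ?I = "{(e, f, u, v). e \<in> idempotents \<and> f \<in> idempotents \<and> u \<in> Fn True X (dm e) \<and> v \<in> Fn True X (dm f)}"
  let ?S = "\<lambda>(e, f, u, v). {\<tau> \<in> topspace (KS_product X \<theta>). hv u (\<tau> e) * hv v (\<tau> f) = hv (\<lambda>x. u x * v x) (\<tau> (e * f))}"
  have "closedin (KS_product X \<theta>) (?S i)" if i: "i \<in> ?I" for i
  proof -
    obtain e f u v where i': "i = (e, f, u, v)" by (metis prod_cases4)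
    show ?thesis using i unfolding i'
      by (auto intro!: closedin_continuous_maps_eq[OF Hausdorff_space_euclidean] continuous_map_cmult cont_hv_product
          idem_mult_closed Fn_idem_mult)
  qed
  \<comment> \<open>The whole space is inserted so that the family of closed sets is nonempty and
    its intersection stays inside the space.\<close>
  then have "closedin (KS_product X \<theta>) (\<Inter>(insert (topspace (KS_product X \<theta>)) (?S ` ?I)))"
    by (intro closedin_Inter) auto
  moreover have "\<Inter>(insert (topspace (KS_product X \<theta>)) (?S ` ?I)) = KS_tilde X \<theta>"
    unfolding KS_tilde_eq by auto
  ultimately show ?thesis by simp
qed

lemma compactin_KS_tilde: "compactin (KS_product X \<theta>) (KS_tilde X \<theta>)"
  using closedin_compact_space[OF compact_KS_product closedin_KS_tilde] .

lemma Z_Hausdorff: "Hausdorff_space Z"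
  by (simp add: KS_space_def Hausdorff_space_subtopology Hausdorff_KS_product)

lemma Z_locally_compact: "locally_compact_space Z"
proof -
  let ?T = "subtopology (KS_product X \<theta>) (KS_tilde X \<theta>)"
  have T: "Hausdorff_space ?T" "compact_space ?T"
    using Hausdorff_KS_product compactin_KS_tilde by (auto simp: Hausdorff_space_subtopology compact_space_subtopology)
  have top: "topspace ?T = KS_tilde X \<theta>" using KS_tilde_sub by auto
  have "openin ?T (KS_tilde X \<theta> - {KS_infinity})"
    using Hausdorff_imp_t1_space[OF T(1)] top by (metis openin_topspace t1_space_openin_delete_alt)
  then have "locally_compact_space (subtopology ?T (KS_tilde X \<theta> - {KS_infinity}))"
    using T compact_imp_locally_compact_space locally_compact_space_open_subset by blast
  moreover have "subtopology ?T (KS_tilde X \<theta> - {KS_infinity}) = Z"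
    by (simp add: KS_space_def subtopology_subtopology Int_absorb1)
  ultimately show ?thesis by simp
qed

definition Jf :: "'s \<Rightarrow> ('x \<Rightarrow> complex) \<Rightarrow> ('s \<Rightarrow> 'x option) \<Rightarrow> complex"
  where "Jf s f \<tau> = (if \<tau> \<in> topspace Z then hv f (\<tau> (s\<^sup>\<star> * s)) else 0)"

lemma KS_dom_iff: "\<tau> \<in> KS_dom X \<theta> e \<longleftrightarrow> \<tau> \<in> topspace Z \<and> \<tau> e \<noteq> None"
  by (simp add: KS_dom_def)

lemma cont_hv_Z:
  assumes "e \<in> idempotents" "f \<in> Fn True X (dm e)" shows "continuous_map Z euclidean (\<lambda>\<tau>. hv f (\<tau> e))"
  using cont_hv_product[OF assms] continuous_map_from_subtopology by (auto simp: KS_space_def)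

text \<open>The points whose value at \<open>s\<^sup>\<star> * s\<close> lies in the compact
  \<open>K\<close> form a closed subset of the compact set \<open>KS_tilde X \<theta>\<close>. It
  misses \<open>KS_infinity\<close>, hence is a compact subset of \<open>Z\<close>, and it supports
  \<open>Jf s f\<close>.\<close>

lemma Jf_Fn:
  assumes f: "f \<in> Fn True X (dm s)" shows "Jf s f \<in> Fn True Z (KS_dom X \<theta> (s\<^sup>\<star> * s))"
proof -
  let ?e = "s\<^sup>\<star> * s"
  have fe: "f \<in> Fn True X (dm ?e)" using f by (simp add: dm_star_self)
  obtain K where K: "compactin X K" "K \<subseteq> dm ?e" "\<And>x. x \<notin> K \<Longrightarrow> f x = 0" using fe Fn_True_support by metis
  let ?L = "KS_tilde X \<theta> \<inter> {\<tau> \<in> topspace (KS_product X \<theta>). \<tau> ?e \<in> Some ` K}"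
  have "continuous_map (KS_product X \<theta>) (Alexandroff_compactification (subtopology X (dm ?e))) (\<lambda>\<tau>. \<tau> ?e)"
    unfolding KS_product_def act_dom_sub[OF star_mult_idem(1), symmetric]
    by (rule continuous_map_product_projection) simp
  moreover have "closedin (Alexandroff_compactification (subtopology X (dm ?e))) (Some ` K)"
    using K compactin_imp_closedin[OF Hausdorff_space_subtopology[OF Haus]] by (auto simp: compactin_subtopology)
  ultimately have "closedin (KS_product X \<theta>) {\<tau> \<in> topspace (KS_product X \<theta>). \<tau> ?e \<in> Some ` K}"
    by (rule closedin_continuous_map_preimage)
  then have "compactin (KS_product X \<theta>) ?L"
    using closedin_KS_tilde closedin_compact_space[OF compact_KS_product] closedin_Int by blast
  moreover have L: "?L \<subseteq> KS_tilde X \<theta> - {KS_infinity}" by (auto simp: KS_infinity_def)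
  ultimately have "compactin Z ?L" by (simp add: KS_space_def compactin_subtopology)
  moreover have "?L \<subseteq> KS_dom X \<theta> ?e" using L by (auto simp: KS_dom_iff topspace_Z)
  moreover have "Jf s f \<tau> = 0" if "\<tau> \<notin> ?L" for \<tau>
  proof (cases "\<tau> \<in> topspace Z")
    case True
    then have "\<tau> ?e \<notin> Some ` K" using that KS_tilde_sub Z_tilde by blast
    then show ?thesis using K(3) by (cases "\<tau> ?e") (auto simp: Jf_def)
  qed (simp add: Jf_def)
  moreover have "continuous_map Z euclidean (Jf s f)"
    by (rule continuous_map_eq[OF cont_hv_Z[OF _ fe]]) (auto simp: Jf_def)
  ultimately show ?thesis by (intro Fn_TrueI[of _ _ ?L])
qed

lemma openin_KS_dom: assumes e: "e \<in> idempotents" shows "openin Z (KS_dom X \<theta> e)"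
proof (subst openin_subopen, intro ballI)
  fix \<tau> assume t: "\<tau> \<in> KS_dom X \<theta> e"
  then obtain x where x: "\<tau> e = Some x" "\<tau> \<in> topspace Z" by (auto simp: KS_dom_iff)
  then obtain k where k: "k \<in> Fn True X (dm e)" "k x = 1" using point_bump[OF openin_dm] tilde_dm[OF Z_tilde e] by blast
  have "openin Z {\<tau> \<in> topspace Z. hv k (\<tau> e) \<in> - {0}}"
    by (rule openin_continuous_map_preimage[OF cont_hv_Z[OF e k(1)]]) auto
  moreover have "{\<tau> \<in> topspace Z. hv k (\<tau> e) \<in> - {0}} \<subseteq> KS_dom X \<theta> e"
    by (auto simp: KS_dom_iff hv_def split: option.splits)
  ultimately show "\<exists>T. openin Z T \<and> \<tau> \<in> T \<and> T \<subseteq> KS_dom X \<theta> e" using x k by (intro exI conjI) auto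
qed

text \<open>The topology of \<open>X\<^sup>K\<^sup>S\<close> is initial for the functions \<open>\<tau> \<mapsto> f(\<tau>(e))\<close>.\<close>

lemma continuous_map_into_Z:
  assumes g: "\<And>y. y \<in> topspace Y \<Longrightarrow> g y \<in> topspace Z"
    and c: "\<And>e f. e \<in> idempotents \<Longrightarrow> f \<in> Fn True X (dm e) \<Longrightarrow> continuous_map Y euclidean (\<lambda>y. hv f (g y e))"
  shows "continuous_map Y Z g"
proof -
  have "continuous_map Y (Alexandroff_compactification (subtopology X (dm e))) (\<lambda>y. g y e)" if e: "e \<in> idempotents" for e
    unfolding continuous_map_def
  proof (intro conjI allI impI)
    have top: "topspace (subtopology X (dm e)) = dm e" using dm_sub by auto
    have dme: "x \<in> dm e" if "y \<in> topspace Y" "g y e = Some x" for x y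
      using tilde_dm[OF Z_tilde[OF g] e] that by blast
    then show "(\<lambda>y. g y e) \<in> topspace Y \<rightarrow> topspace (Alexandroff_compactification (subtopology X (dm e)))"
      unfolding topspace_Alexandroff_compactification top
    proof (intro Pi_I)
      fix y assume "y \<in> topspace Y"
      then show "g y e \<in> insert None (Some ` dm e)" using dme by (cases "g y e") auto
    qed
    fix V assume V: "openin (Alexandroff_compactification (subtopology X (dm e))) V"
    have pre: "openin Y {y \<in> topspace Y. hv k (g y e) \<in> W}" if "k \<in> Fn True X (dm e)" "open W" for k W
      by (rule openin_continuous_map_preimage[OF c[OF e that(1)]]) (use that in auto)
    have A: "openin Y {y \<in> topspace Y. g y e \<in> Some ` U}" if U: "openin X U" "U \<subseteq> dm e" for U
    proof (subst openin_subopen, intro ballI)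
      fix y assume y: "y \<in> {y \<in> topspace Y. g y e \<in> Some ` U}"
      then obtain x where x: "g y e = Some x" "x \<in> U" by auto
      obtain k where k: "k \<in> Fn True X U" "k x = 1" using point_bump[OF U(1) x(2)] by blast
      have "openin Y {y \<in> topspace Y. hv k (g y e) \<in> - {0}}" using pre Fn_mono[OF k(1) U(2)] by blast
      moreover have "{y \<in> topspace Y. hv k (g y e) \<in> - {0}} \<subseteq> {y \<in> topspace Y. g y e \<in> Some ` U}"
      proof
        fix z assume z: "z \<in> {y \<in> topspace Y. hv k (g y e) \<in> - {0}}"
        then obtain w where w: "g z e = Some w" "k w \<noteq> 0" by (cases "g z e") auto
        then have "w \<in> U" using Fn_zero[OF k(1)] by blast
        then show "z \<in> {y \<in> topspace Y. g y e \<in> Some ` U}" using z w by auto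
      qed
      ultimately show "\<exists>T. openin Y T \<and> y \<in> T \<and> T \<subseteq> {y \<in> topspace Y. g y e \<in> Some ` U}"
        using y x k by (intro exI conjI) auto
    qed
    show "openin Y {y \<in> topspace Y. g y e \<in> V}"
      using V unfolding openin_Alexandroff_compactification
    proof (elim disjE exE conjE)
      fix U assume "openin (subtopology X (dm e)) U" "V = Some ` U"
      then show ?thesis using A openin_dm by (simp add: openin_open_subtopology)
    next
      fix C assume C: "compactin (subtopology X (dm e)) C" "closedin (subtopology X (dm e)) C"
        and V': "V = insert None (Some ` (topspace (subtopology X (dm e)) - C))"
      have "openin (subtopology X (dm e)) (dm e - C)" using C(2) top by (metis openin_diff openin_topspace)
      then have 1: "openin Y {y \<in> topspace Y. g y e \<in> Some ` (dm e - C)}" using A openin_dm by (simp add: openin_open_subtopology)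
      \<comment> \<open>The open set where \<open>hv k\<close> differs from 1 contains every
        \<open>y\<close> with value \<open>None\<close> and, as \<open>k = 1\<close> on
        \<open>C\<close>, no \<open>y\<close> with a value in \<open>C\<close>.\<close>
      obtain k :: "'x \<Rightarrow> real" where k: "(\<lambda>x. complex_of_real (k x)) \<in> Fn True X (dm e)" "\<forall>x\<in>C. k x = 1"
        using Urysohn_bump[OF LC Haus openin_dm, of C e] C(1) by (auto simp: compactin_subtopology)
      have 2: "openin Y {y \<in> topspace Y. hv (\<lambda>x. complex_of_real (k x)) (g y e) \<in> - {1}}" by (rule pre[OF k(1)]) auto
      have "{y \<in> topspace Y. g y e \<in> V} = {y \<in> topspace Y. g y e \<in> Some ` (dm e - C)} \<union>
          {y \<in> topspace Y. hv (\<lambda>x. complex_of_real (k x)) (g y e) \<in> - {1}}"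
      proof (intro equalityI subsetI)
        fix y assume y: "y \<in> {y \<in> topspace Y. g y e \<in> V}"
        show "y \<in> {y \<in> topspace Y. g y e \<in> Some ` (dm e - C)} \<union>
          {y \<in> topspace Y. hv (\<lambda>x. complex_of_real (k x)) (g y e) \<in> - {1}}"
          using y by (cases "g y e") (auto simp: V' top)
      next
        fix y assume y: "y \<in> {y \<in> topspace Y. g y e \<in> Some ` (dm e - C)} \<union>
          {y \<in> topspace Y. hv (\<lambda>x. complex_of_real (k x)) (g y e) \<in> - {1}}"
        then have yY: "y \<in> topspace Y" by blast
        show "y \<in> {y \<in> topspace Y. g y e \<in> V}"
        proof (cases "g y e")
          case (Some x)
          then have "x \<in> dm e" "x \<notin> C" using dme[OF yY Some] y k(2) by auto
          then show ?thesis using yY Some unfolding V' top by auto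
        qed (use yY V' in simp)
      qed
      then show ?thesis using 1 2 by (simp add: openin_Un)
    qed
  qed
  then have "continuous_map Y (KS_product X \<theta>) g"
    using g Z_tilde unfolding KS_product_def continuous_map_componentwise by (auto simp: act_dom_sub KS_tilde_iff)
  then show ?thesis using g by (auto simp: KS_space_def continuous_map_in_subtopology topspace_Z[unfolded KS_space_def])
qed

text \<open>The action as a total function, with \<open>\<theta> s\<close> in place of
  \<open>\<theta> (e * s)\<close>. Both give the same value on points of \<open>Z\<close>: a finite
  value of \<open>\<tau>\<close> at \<open>s\<^sup>\<star> * e * s\<close> already lies in the
  domain of \<open>e * s\<close>, and \<open>e\<close> acts as the identity.\<close>

definition sh :: "'s \<Rightarrow> ('s \<Rightarrow> 'x option) \<Rightarrow> 's \<Rightarrow> 'x option"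
  where "sh s \<tau> = (\<lambda>e\<in>idempotents. Option.bind (\<tau> (s\<^sup>\<star> * e * s)) (\<theta> s))"

lemma conj_dm: assumes "e \<in> idempotents" shows "dm (s\<^sup>\<star> * e * s) = {x \<in> dm s. tr s x \<in> dm e}"
  using assms tr_in by (auto simp: dm_mult tr_idem)

lemma conj_le: assumes "e \<in> idempotents" shows "s\<^sup>\<star> * s * (s\<^sup>\<star> * e * s) = s\<^sup>\<star> * e * s"
  by (simp add: mult.assoc)

lemma sh_eq:
  assumes t: "\<tau> \<in> KS_tilde X \<theta>" and e: "e \<in> idempotents"
  shows "sh s \<tau> e = (case \<tau> (s\<^sup>\<star> * e * s) of None \<Rightarrow> None | Some x \<Rightarrow> Some (tr s x))"
proof (cases "\<tau> (s\<^sup>\<star> * e * s)")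
  case (Some x)
  then have "x \<in> dm s" using tilde_dm[OF t conj_idem[OF e] Some] conj_dm[OF e] by blast
  then show ?thesis using Some e by (simp add: sh_def act_Some)
qed (simp add: sh_def e)

lemma \<kappa>_eq: assumes "\<tau> \<in> KS_dom X \<theta> (s\<^sup>\<star> * s)" shows "\<kappa> s \<tau> = Some (sh s \<tau>)"
proof -
  have t: "\<tau> \<in> KS_tilde X \<theta>" using assms by (simp add: KS_dom_iff Z_tilde)
  have "(case \<tau> (s\<^sup>\<star> * e * s) of None \<Rightarrow> None | Some x \<Rightarrow> \<theta> (e * s) x) = sh s \<tau> e" if e: "e \<in> idempotents" for e
  proof (cases "\<tau> (s\<^sup>\<star> * e * s)")
    case (Some x)
    then have x: "x \<in> dm s" "tr s x \<in> dm e" using tilde_dm[OF t conj_idem[OF e] Some] conj_dm[OF e] by auto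
    then have "\<theta> (e * s) x = Some (tr s x)" using act_Some[OF x(1)] act_Some[OF x(2)] tr_idem[OF e x(2)] by (simp add: act_comp)
    then show ?thesis using Some by (simp add: sh_eq[OF t e])
  qed (simp add: sh_eq[OF t e])
  then have "(\<lambda>e\<in>idempotents. case \<tau> (s\<^sup>\<star> * e * s) of None \<Rightarrow> None | Some x \<Rightarrow> \<theta> (e * s) x) = sh s \<tau>"
    by (auto simp: sh_def restrict_def fun_eq_iff)
  then show ?thesis using assms by (simp add: KS_action_def)
qed

lemma \<kappa>_None: "\<tau> \<notin> KS_dom X \<theta> (s\<^sup>\<star> * s) \<Longrightarrow> \<kappa> s \<tau> = None"
  by (simp add: KS_action_def)

lemma sh_ss: "\<tau> \<in> KS_tilde X \<theta> \<Longrightarrow> \<tau> (s\<^sup>\<star> * s) = Some x \<Longrightarrow> sh s \<tau> (s * s\<^sup>\<star>) = Some (tr s x)"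
  using sh_eq[of \<tau> "s * s\<^sup>\<star>" s] by (simp add: mult.assoc)

lemma conj_mult: assumes "e \<in> idempotents" "f \<in> idempotents"
  shows "(s\<^sup>\<star> * e * s) * (s\<^sup>\<star> * f * s) = s\<^sup>\<star> * (e * f) * s"
proof -
  have "(s\<^sup>\<star> * e * s) * (s\<^sup>\<star> * f * s) = s\<^sup>\<star> * (e * (s * s\<^sup>\<star>)) * (f * s)" by (simp add: mult.assoc)
  also have "\<dots> = s\<^sup>\<star> * (e * f) * s" unfolding idem_commute[OF assms(1) star_mult_idem(2)] by (simp add: mult.assoc)
  finally show ?thesis .
qed

lemma sh_Z: assumes "\<tau> \<in> KS_dom X \<theta> (s\<^sup>\<star> * s)" shows "sh s \<tau> \<in> topspace Z"
proof -
  have t: "\<tau> \<in> KS_tilde X \<theta>" using assms by (simp add: KS_dom_iff Z_tilde)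
  obtain x where x: "\<tau> (s\<^sup>\<star> * s) = Some x" using assms by (auto simp: KS_dom_iff)
  have S: "sh s \<tau> e = Some y \<longleftrightarrow> (\<exists>x. \<tau> (s\<^sup>\<star> * e * s) = Some x \<and> y = tr s x)" if "e \<in> idempotents" for e y
    using sh_eq[OF t that, of s] by (auto split: option.splits)
  have "sh s \<tau> \<in> KS_tilde X \<theta>"
    unfolding KS_tilde_iff
  proof (intro conjI ballI allI impI)
    show "sh s \<tau> \<in> extensional idempotents" by (simp add: sh_def)
    fix e :: 's assume e: "e \<in> idempotents"
    show "y \<in> dm e" if y: "sh s \<tau> e = Some y" for y
    proof -
      obtain x where x: "\<tau> (s\<^sup>\<star> * e * s) = Some x" "y = tr s x" using y S[OF e] by auto
      then show ?thesis using tilde_dm[OF t conj_idem[OF e] x(1)] conj_dm[OF e, of s] by simp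
    qed
    fix f :: 's assume f: "f \<in> idempotents"
    show "sh s \<tau> f = sh s \<tau> e" if fe: "f * e = e \<and> sh s \<tau> e \<noteq> None"
    proof -
      obtain x where x: "\<tau> (s\<^sup>\<star> * e * s) = Some x" using fe S[OF e] by auto
      have "(s\<^sup>\<star> * f * s) * (s\<^sup>\<star> * e * s) = s\<^sup>\<star> * e * s" using fe conj_mult[OF f e, of s] by simp
      then have "\<tau> (s\<^sup>\<star> * f * s) = Some x" using tilde_up[OF t conj_idem[OF e] conj_idem[OF f] _ x] by blast
      then show ?thesis using x sh_eq[OF t e] sh_eq[OF t f] by simp
    qed
    show "sh s \<tau> (e * f) \<noteq> None" if ef: "sh s \<tau> e \<noteq> None \<and> sh s \<tau> f \<noteq> None"
    proof -
      obtain x y where xy: "\<tau> (s\<^sup>\<star> * e * s) = Some x" "\<tau> (s\<^sup>\<star> * f * s) = Some y" using ef S[OF e] S[OF f] by auto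
      then have "\<tau> (s\<^sup>\<star> * (e * f) * s) = Some x"
        using tilde_mult(1)[OF t conj_idem[OF e] conj_idem[OF f] xy] conj_mult[OF e f, of s] by simp
      then show ?thesis using S[OF idem_mult_closed[OF e f]] by simp
    qed
  qed
  then show ?thesis using sh_ss[OF t x] star_mult_idem(2) by (auto simp: Z_iff)
qed

lemma \<kappa>_mult: "\<kappa> (s * t) = \<kappa> s \<circ>\<^sub>m \<kappa> t"
proof
  fix \<tau>
  have st: "(s * t)\<^sup>\<star> * e * (s * t) = t\<^sup>\<star> * (s\<^sup>\<star> * e * s) * t" for e by (simp add: inv_star_mult mult.assoc)
  have st': "(s * t)\<^sup>\<star> * (s * t) = t\<^sup>\<star> * (s\<^sup>\<star> * s) * t" by (simp add: inv_star_mult mult.assoc)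
  have le: "(t\<^sup>\<star> * t) * (t\<^sup>\<star> * (s\<^sup>\<star> * s) * t) = t\<^sup>\<star> * (s\<^sup>\<star> * s) * t" by (simp add: mult.assoc)
  have dom: "\<tau> \<in> KS_dom X \<theta> ((s * t)\<^sup>\<star> * (s * t)) \<longleftrightarrow> \<tau> \<in> KS_dom X \<theta> (t\<^sup>\<star> * t) \<and> sh t \<tau> \<in> KS_dom X \<theta> (s\<^sup>\<star> * s)"
  proof (cases "\<tau> \<in> topspace Z")
    case True
    have t: "\<tau> \<in> KS_tilde X \<theta>" using True Z_tilde by blast
    have "\<tau> (t\<^sup>\<star> * t) \<noteq> None" if "\<tau> (t\<^sup>\<star> * (s\<^sup>\<star> * s) * t) \<noteq> None"
      using tilde_up[OF t conj_idem[OF star_mult_idem(1)] star_mult_idem(1) le] that by auto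
    moreover have "sh t \<tau> (s\<^sup>\<star> * s) \<noteq> None \<longleftrightarrow> \<tau> (t\<^sup>\<star> * (s\<^sup>\<star> * s) * t) \<noteq> None"
      by (simp add: sh_eq[OF t star_mult_idem(1)] split: option.split)
    ultimately show ?thesis using sh_Z True by (auto simp: KS_dom_iff st')
  qed (simp add: KS_dom_iff)
  show "\<kappa> (s * t) \<tau> = (\<kappa> s \<circ>\<^sub>m \<kappa> t) \<tau>"
  proof (cases "\<tau> \<in> KS_dom X \<theta> ((s * t)\<^sup>\<star> * (s * t))")
    case True
    then have d: "\<tau> \<in> KS_dom X \<theta> (t\<^sup>\<star> * t)" "sh t \<tau> \<in> KS_dom X \<theta> (s\<^sup>\<star> * s)" using dom by auto
    have t: "\<tau> \<in> KS_tilde X \<theta>" "sh t \<tau> \<in> KS_tilde X \<theta>" using d by (simp_all add: KS_dom_iff Z_tilde)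
    have "sh (s * t) \<tau> e = sh s (sh t \<tau>) e" for e
    proof (cases "e \<in> idempotents")
      case e: True
      show ?thesis
      proof (cases "\<tau> (t\<^sup>\<star> * (s\<^sup>\<star> * e * s) * t)")
        case (Some x)
        have "(s * t)\<^sup>\<star> * e * (s * t) \<in> idempotents" by (rule conj_idem[OF e])
        then have "x \<in> dm (s * t)" using tilde_dm[OF t(1) _ Some] conj_dm[OF e, of "s * t"] unfolding st by blast
        then show ?thesis using Some tr_mult[of x s t]
          by (simp add: sh_eq[OF t(1) e] sh_eq[OF t(2) e] sh_eq[OF t(1) conj_idem[OF e]] st)
      qed (simp add: sh_eq[OF t(1) e] sh_eq[OF t(2) e] sh_eq[OF t(1) conj_idem[OF e]] st)
    qed (simp add: sh_def)
    then show ?thesis using \<kappa>_eq[OF True] \<kappa>_eq[OF d(1)] \<kappa>_eq[OF d(2)] by (auto simp: map_comp_def)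
  next
    case False
    then have "\<kappa> t \<tau> = None \<or> (\<kappa> t \<tau> = Some (sh t \<tau>) \<and> \<kappa> s (sh t \<tau>) = None)"
      using dom \<kappa>_None \<kappa>_eq by metis
    then show ?thesis using \<kappa>_None[OF False] by (auto simp: map_comp_def)
  qed
qed

text \<open>Where \<open>\<tau> e\<close> is finite, \<open>\<tau>\<close> takes equal values at
  \<open>f\<close> and at \<open>e * f\<close>, so conjugating the index by \<open>e\<close> changes
  nothing.\<close>

lemma sh_idem: assumes e: "e \<in> idempotents" and t: "\<tau> \<in> KS_dom X \<theta> e" shows "sh e \<tau> = \<tau>"
proof
  fix f
  have T: "\<tau> \<in> KS_tilde X \<theta>" using t by (simp add: KS_dom_iff Z_tilde)
  obtain x where x: "\<tau> e = Some x" using t by (auto simp: KS_dom_iff)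
  show "sh e \<tau> f = \<tau> f"
  proof (cases "f \<in> idempotents")
    case f: True
    have ef: "e\<^sup>\<star> * f * e = e * f" using e f by (simp add: idem_inv_star mult.assoc idem_commute[OF f e] idem_self_left)
    show ?thesis
    proof (cases "\<tau> f")
      case (Some y)
      then have "\<tau> (e * f) = Some x" "y = x" using tilde_mult[OF T e f x Some] by auto
      then show ?thesis using Some tr_idem[OF e tilde_dm[OF T e x]] by (simp add: sh_eq[OF T f] ef)
    next
      case None
      then have "\<tau> (e * f) = None" using tilde_mult_iff[OF T e f] by (metis not_None_eq)
      then show ?thesis using None by (simp add: sh_eq[OF T f] ef)
    qed
  next
    case False
    then show ?thesis using T by (auto simp: sh_def KS_tilde_iff extensional_def)
  qed
qed

lemma act_dom_\<kappa>: assumes e: "e \<in> idempotents" shows "act_dom \<kappa> e = KS_dom X \<theta> e"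
proof -
  have "e\<^sup>\<star> * e = e" using e by (simp add: idem_inv_star idem_self)
  then have "\<kappa> e \<tau> = Some \<tau> \<longleftrightarrow> \<tau> \<in> KS_dom X \<theta> e" for \<tau>
    using \<kappa>_eq[of \<tau> e] sh_idem[OF e, of \<tau>] \<kappa>_None[of \<tau> e] by (cases "\<tau> \<in> KS_dom X \<theta> e") auto
  then show ?thesis by (auto simp: act_dom_def)
qed

lemma sh_star: assumes "\<tau> \<in> KS_dom X \<theta> (s\<^sup>\<star> * s)"
  shows "sh s \<tau> \<in> KS_dom X \<theta> (s * s\<^sup>\<star>)" "sh (s\<^sup>\<star>) (sh s \<tau>) = \<tau>"
proof -
  obtain x where x: "\<tau> (s\<^sup>\<star> * s) = Some x" "\<tau> \<in> KS_tilde X \<theta>" using assms by (auto simp: KS_dom_iff Z_tilde)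
  then show d: "sh s \<tau> \<in> KS_dom X \<theta> (s * s\<^sup>\<star>)" using sh_ss sh_Z[OF assms] by (simp add: KS_dom_iff)
  have "\<kappa> (s\<^sup>\<star> * s) \<tau> = Some \<tau>" using act_dom_\<kappa>[of "s\<^sup>\<star> * s"] assms by (auto simp: act_dom_def)
  then show "sh (s\<^sup>\<star>) (sh s \<tau>) = \<tau>"
    using \<kappa>_eq[OF assms] \<kappa>_eq[of "sh s \<tau>" "s\<^sup>\<star>"] d by (simp add: \<kappa>_mult map_comp_def)
qed

text \<open>\<open>f o tr s\<close> need not extend to a compactly supported function, so the
  continuity of \<open>F\<close> cannot be read off from \<open>cont_hv_Z\<close>. With a bump
  \<open>k\<close> that is 1 at the finite value \<open>x0\<close> of the given point,
  \<open>F * H = G\<close> for continuous \<open>G\<close> and \<open>H\<close>, and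
  \<open>F = G / H\<close> near the point.\<close>

lemma cont_sh: "continuous_map (subtopology Z (KS_dom X \<theta> (s\<^sup>\<star> * s))) Z (sh s)"
proof (rule continuous_map_into_Z)
  let ?Y = "subtopology Z (KS_dom X \<theta> (s\<^sup>\<star> * s))"
  show "sh s y \<in> topspace Z" if "y \<in> topspace ?Y" for y using that sh_Z by auto
  fix e f assume e: "e \<in> idempotents" and f: "f \<in> Fn True X (dm e)"
  show "continuous_map ?Y euclidean (\<lambda>\<tau>. hv f (sh s \<tau> e))"
    unfolding continuous_map_iff_tendsto
  proof
    fix \<tau>0 assume t0: "\<tau>0 \<in> topspace ?Y"
    then obtain x0 where x0: "\<tau>0 (s\<^sup>\<star> * s) = Some x0" "\<tau>0 \<in> KS_tilde X \<theta>" by (auto simp: KS_dom_iff Z_tilde)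
    have "x0 \<in> dm s" using tilde_dm[OF x0(2) star_mult_idem(1) x0(1)] by (simp add: dm_star_self)
    then obtain k where k: "k \<in> Fn True X (dm s)" "k x0 = 1" using point_bump[OF openin_dm] by blast
    define F where "F \<tau> = hv f (sh s \<tau> e)" for \<tau>
    define H where "H \<tau> = hv k (\<tau> (s\<^sup>\<star> * s))" for \<tau> :: "'s \<Rightarrow> 'x option"
    define G where "G \<tau> = hv (\<lambda>x. f (tr s x) * k x) (\<tau> (s\<^sup>\<star> * e * s))" for \<tau> :: "'s \<Rightarrow> 'x option"
    have "dm (e * s) = dm (s\<^sup>\<star> * e * s)" unfolding conj_dm[OF e] dm_mult[of e s] ..
    then have "(\<lambda>x. f (tr s x) * k x) \<in> Fn True X (dm (s\<^sup>\<star> * e * s))" using mult_Fn[OF f k(1)] by simp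
    then have Gc: "continuous_map ?Y euclidean G"
      unfolding G_def[abs_def] by (intro continuous_map_from_subtopology cont_hv_Z conj_idem e)
    have Hc: "continuous_map ?Y euclidean H"
      unfolding H_def[abs_def] by (intro continuous_map_from_subtopology cont_hv_Z) (use k in \<open>auto simp: dm_star_self\<close>)
    have FG: "F \<tau> * H \<tau> = G \<tau>" if "\<tau> \<in> topspace ?Y" for \<tau>
    proof -
      have T: "\<tau> \<in> KS_tilde X \<theta>" using that by (auto simp: Z_tilde)
      show ?thesis
      proof (cases "\<tau> (s\<^sup>\<star> * e * s)")
        case (Some x)
        then have "\<tau> (s\<^sup>\<star> * s) = Some x" using tilde_up[OF T conj_idem[OF e] star_mult_idem(1) conj_le[OF e]] by blast
        then show ?thesis using Some by (simp add: F_def G_def H_def sh_eq[OF T e])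
      qed (simp add: F_def G_def sh_eq[OF T e])
    qed
    have H0: "H \<tau>0 \<noteq> 0" using k x0 by (simp add: H_def)
    have lH: "(H \<longlongrightarrow> H \<tau>0) (atin ?Y \<tau>0)" and lG: "(G \<longlongrightarrow> G \<tau>0) (atin ?Y \<tau>0)"
      using Hc Gc t0 unfolding continuous_map_iff_tendsto by auto
    have "((\<lambda>\<tau>. G \<tau> / H \<tau>) \<longlongrightarrow> G \<tau>0 / H \<tau>0) (atin ?Y \<tau>0)" by (rule tendsto_divide[OF lG lH H0])
    moreover have "G \<tau>0 / H \<tau>0 = F \<tau>0" using FG[OF t0] H0 by (simp add: field_simps)
    moreover have "eventually (\<lambda>\<tau>. G \<tau> / H \<tau> = F \<tau>) (atin ?Y \<tau>0)"
    proof -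
      have "eventually (\<lambda>\<tau>. H \<tau> \<noteq> 0) (atin ?Y \<tau>0)" by (rule tendsto_imp_eventually_ne[OF lH H0])
      moreover have "eventually (\<lambda>\<tau>. \<tau> \<in> topspace ?Y) (atin ?Y \<tau>0)"
        unfolding eventually_atin using t0 openin_topspace by blast
      ultimately show ?thesis by eventually_elim (use FG in \<open>auto simp: field_simps\<close>)
    qed
    ultimately have "(F \<longlongrightarrow> F \<tau>0) (atin ?Y \<tau>0)" using Lim_transform_eventually by fastforce
    then show "((\<lambda>\<tau>. hv f (sh s \<tau> e)) \<longlongrightarrow> hv f (sh s \<tau>0 e)) (atin ?Y \<tau>0)"
      by (simp add: F_def[abs_def])
  qed
qed

lemma KS_is_action: "is_action Z \<kappa>"
  unfolding is_action_def
proof (intro conjI allI ballI)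
  fix s
  have "\<tau> \<in> dom (\<kappa> s) \<longleftrightarrow> \<tau> \<in> KS_dom X \<theta> (s\<^sup>\<star> * s)" for \<tau>
    using \<kappa>_eq[of \<tau> s] \<kappa>_None[of \<tau> s] by (cases "\<tau> \<in> KS_dom X \<theta> (s\<^sup>\<star> * s)") (auto simp: dom_def)
  then have dom: "dom (\<kappa> s) = KS_dom X \<theta> (s\<^sup>\<star> * s)" by blast
  show "partial_bijection (topspace Z) (\<kappa> s)"
    unfolding partial_bijection_def dom
  proof (intro conjI)
    show "KS_dom X \<theta> (s\<^sup>\<star> * s) \<subseteq> topspace Z" by (auto simp: KS_dom_iff)
    show "ran (\<kappa> s) \<subseteq> topspace Z"
    proof
      fix \<rho> assume "\<rho> \<in> ran (\<kappa> s)"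
      then obtain \<tau> where \<tau>: "\<kappa> s \<tau> = Some \<rho>" by (auto simp: ran_def)
      then have "\<tau> \<in> KS_dom X \<theta> (s\<^sup>\<star> * s)" using \<kappa>_None by force
      then show "\<rho> \<in> topspace Z" using \<kappa>_eq sh_Z \<tau> by auto
    qed
    show "inj_on (\<kappa> s) (KS_dom X \<theta> (s\<^sup>\<star> * s))"
      by (rule inj_onI) (use \<kappa>_eq sh_star(2) in \<open>metis option.inject\<close>)
  qed
  show "\<kappa> (s * t) = \<kappa> s \<circ>\<^sub>m \<kappa> t" for t by (rule \<kappa>_mult)
  have "continuous_map (subtopology Z (KS_dom X \<theta> (s\<^sup>\<star> * s))) (subtopology Z (KS_dom X \<theta> (s * s\<^sup>\<star>))) (sh s)"
    using cont_sh sh_star(1) by (auto simp: continuous_map_in_subtopology)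
  then have "continuous_map (subtopology Z (KS_dom X \<theta> (s\<^sup>\<star> * s))) (subtopology Z (KS_dom X \<theta> (s * s\<^sup>\<star>))) (\<lambda>x. the (\<kappa> s x))"
    by (rule continuous_map_eq) (auto simp: \<kappa>_eq)
  then show "continuous_map (subtopology Z (act_dom \<kappa> (s\<^sup>\<star> * s))) (subtopology Z (act_dom \<kappa> (s * s\<^sup>\<star>))) (\<lambda>x. the (\<kappa> s x))"
    by (simp add: act_dom_\<kappa>)
next
  fix e :: 's assume "e \<in> idempotents"
  then show "openin Z (act_dom \<kappa> e)" by (simp add: act_dom_\<kappa> openin_KS_dom)
next
  show "(\<Union>e\<in>idempotents. act_dom \<kappa> e) = topspace Z"
    by (auto simp: act_dom_\<kappa> KS_dom_iff Z_iff)
qed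

lemma KS_lch_action: "lch_action Z \<kappa>"
  by (simp add: lch_action_def Z_locally_compact Z_Hausdorff KS_is_action)

end

section \<open>The homomorphism into the groupoid algebra\<close>

context lch_action
begin

interpretation ZK: lch_action Z \<kappa> by (rule KS_lch_action)

lemma ZK_dm: "ZK.dm s = KS_dom X \<theta> (s\<^sup>\<star> * s)"
  by (simp add: ZK.dm_def act_dom_\<kappa>)

lemma ZK_tr: "\<tau> \<in> ZK.dm s \<Longrightarrow> ZK.tr s \<tau> = sh s \<tau>"
  by (simp add: ZK.tr_def \<kappa>_eq ZK_dm)

lemma ZK_dm_iff: "\<tau> \<in> ZK.dm s \<longleftrightarrow> \<tau> \<in> topspace Z \<and> \<tau> (s\<^sup>\<star> * s) \<noteq> None"
  by (simp add: ZK_dm KS_dom_iff)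

lemma Jf_ZK: "f \<in> Fn True X (dm s) \<Longrightarrow> Jf s f \<in> Fn True Z (ZK.dm s)"
  by (simp add: ZK_dm Jf_Fn)

lemma Jf_off: "\<tau> \<notin> ZK.dm s \<Longrightarrow> Jf s f \<tau> = 0"
  by (auto simp: Jf_def ZK_dm_iff)

lemma Jf_zero [simp]: "Jf s (\<lambda>x. 0) = (\<lambda>\<tau>. 0)"
  by (auto simp: Jf_def)

lemma Jf_add: "Jf s (\<lambda>x. f x + g x) \<tau> = Jf s f \<tau> + Jf s g \<tau>"
  by (simp add: Jf_def hv_add)

lemma Jf_scale: "Jf s (\<lambda>x. k * f x) \<tau> = k * Jf s f \<tau>"
  by (simp add: Jf_def hv_scale)

lemma Jf_le: assumes "f \<in> Fn c X U" "\<And>x. cmod (f x) \<le> M" shows "cmod (Jf s f \<tau>) \<le> M"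
proof -
  have "0 \<le> M" using assms(2) norm_ge_zero order_trans by blast
  then show ?thesis using assms(2) by (cases "\<tau> (s\<^sup>\<star> * s)") (auto simp: Jf_def)
qed

lemma Jf_mult:
  assumes f: "f \<in> Fn True X (dm s)" and g: "g \<in> Fn True X (dm t)"
  shows "Jf (s * t) (\<lambda>x. f (tr t x) * g x) = (\<lambda>\<tau>. Jf s f (ZK.tr t \<tau>) * Jf t g \<tau>)"
proof
  fix \<tau>
  have st: "(s * t)\<^sup>\<star> * (s * t) = t\<^sup>\<star> * (s\<^sup>\<star> * s) * t" by (simp add: inv_star_mult mult.assoc)
  show "Jf (s * t) (\<lambda>x. f (tr t x) * g x) \<tau> = Jf s f (ZK.tr t \<tau>) * Jf t g \<tau>"
  proof (cases "\<tau> \<in> ZK.dm t")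
    case True
    then have Z: "\<tau> \<in> topspace Z" and T: "\<tau> \<in> KS_tilde X \<theta>" by (auto simp: ZK_dm_iff Z_tilde)
    have sZ: "sh t \<tau> \<in> topspace Z" using True sh_Z by (simp add: ZK_dm)
    show ?thesis
    proof (cases "\<tau> (t\<^sup>\<star> * (s\<^sup>\<star> * s) * t)")
      case (Some x)
      have "(t\<^sup>\<star> * t) * (t\<^sup>\<star> * (s\<^sup>\<star> * s) * t) = t\<^sup>\<star> * (s\<^sup>\<star> * s) * t" by (simp add: mult.assoc)
      then have "\<tau> (t\<^sup>\<star> * t) = Some x" using tilde_up[OF T conj_idem star_mult_idem(1) _ Some] by simp
      then show ?thesis
        using Some Z sZ ZK_tr[OF True] sh_eq[OF T, of "s\<^sup>\<star> * s" t] unfolding Jf_def st by simp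
    next
      case None
      then show ?thesis using Z sZ ZK_tr[OF True] sh_eq[OF T, of "s\<^sup>\<star> * s" t] unfolding Jf_def st by simp
    qed
  next
    case False
    have "\<tau> \<notin> ZK.dm (s * t)" using False by (simp add: ZK.dm_mult)
    then show ?thesis using False by (simp add: Jf_off)
  qed
qed

lemma Jf_starf: "Jf (s\<^sup>\<star>) (starf s f) = ZK.starf s (Jf s f)"
proof
  fix \<tau> show "Jf (s\<^sup>\<star>) (starf s f) \<tau> = ZK.starf s (Jf s f) \<tau>"
  proof (cases "\<tau> \<in> ZK.dm (s\<^sup>\<star>)")
    case True
    then obtain x where x: "\<tau> (s * s\<^sup>\<star>) = Some x" and Z: "\<tau> \<in> topspace Z" by (auto simp: ZK_dm_iff)
    have sZ: "sh (s\<^sup>\<star>) \<tau> \<in> topspace Z" using True sh_Z[of \<tau> "s\<^sup>\<star>"] by (simp add: ZK_dm)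
    have "x \<in> dm (s\<^sup>\<star>)" using tilde_dm[OF Z_tilde[OF Z] _ x] dm_star_self[of "s\<^sup>\<star>"] by simp
    then show ?thesis
      using Z sZ x True ZK_tr[OF True] sh_ss[OF Z_tilde[OF Z], of "s\<^sup>\<star>" x] by (simp add: Jf_def starf_def ZK.starf_def)
  qed (simp add: Jf_off ZK.starf_def)
qed

definition Jm :: "('s \<Rightarrow> 'x \<Rightarrow> complex) \<Rightarrow> 's \<Rightarrow> ('s \<Rightarrow> 'x option) \<Rightarrow> complex"
  where "Jm a s = Jf s (a s)"

lemma Jm_carr: assumes "a \<in> carr True" shows "Jm a \<in> ZK.carr True"
proof -
  have "finite {s. Jm a s \<noteq> (\<lambda>x. 0)}"
    by (rule finite_subset[OF _ carr_fin[OF assms]]) (auto simp: Jm_def)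
  then show ?thesis using carr_Fn[OF assms] Jf_ZK by (simp add: ZK.carr_iff Jm_def)
qed

lemma Jm_zero: "Jm (\<lambda>s x. 0) = (\<lambda>s \<tau>. 0)"
  by (simp add: Jm_def[abs_def])

lemma Jm_add: "Jm (\<lambda>s x. a s x + b s x) = (\<lambda>s \<tau>. Jm a s \<tau> + Jm b s \<tau>)"
  by (intro ext) (simp add: Jm_def Jf_add)

lemma Jm_scale: "Jm (\<lambda>s x. k * a s x) = (\<lambda>s \<tau>. k * Jm a s \<tau>)"
  by (intro ext) (simp add: Jm_def Jf_scale)

lemma Jm_delta: "Jm (delta s f) = delta s (Jf s f)"
  by (intro ext) (simp add: Jm_def delta_def)

lemma Jm_mult:
  assumes "a \<in> carr True" "b \<in> carr True"
  shows "Jm (amult (KS_algebraic X \<theta>) a b) = amult (KS_algebraic Z \<kappa>) (Jm a) (Jm b)"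
  using assms(1)
proof (induction rule: alg_induct)
  case (add a a')
  then show ?case using assms(2)
    by (simp add: mult_add_left_alg[of _ True] ZK.mult_add_left_alg[of _ True] Jm_add Jm_carr)
next
  case f: (delta s f)
  from assms(2) show ?case
  proof (induction rule: alg_induct)
    case (add b b')
    then show ?case using delta_carr[OF f] Jm_carr[OF delta_carr[OF f]]
      by (simp add: mult_add_right_alg[of _ True] ZK.mult_add_right_alg[of _ True] Jm_add Jm_carr)
  next
    case g: (delta t g)
    show ?case
      by (simp add: Jm_delta delta_mult_tr[OF g] ZK.delta_mult_tr[OF Jf_ZK[OF g]] Jf_mult[OF f g])
  qed (simp add: Jm_zero)
qed (simp add: Jm_zero)

lemma Jm_star: assumes "a \<in> carr True" shows "Jm (astar (KS_algebraic X \<theta>) a) = astar (KS_algebraic Z \<kappa>) (Jm a)"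
  using assms
  by (induction rule: alg_induct)
    (simp_all add: star_add_alg star_zero_alg ZK.star_add_alg ZK.star_zero_alg Jm_add Jm_zero Jm_delta delta_star_tr
      ZK.delta_star_tr Jf_starf)

text \<open>Factoring through the families on \<open>Z\<close> separates the pullback of functions
  (\<open>Jm\<close>) from the identification of germs (\<open>Qm\<close>); each of the two is
  checked to be a homomorphism by itself.\<close>

definition phi :: "('s \<Rightarrow> 'x \<Rightarrow> complex) \<Rightarrow> ('s \<times> ('s \<Rightarrow> 'x option)) set \<Rightarrow> complex"
  where "phi a = ZK.Qm (Jm a)"

lemma phi_hom: "star_hom (alg True X \<theta>) (groupoid_algebra ZK.GG) phi"
proof -
  have Q: "ZK.Qm u \<in> acarrier (groupoid_algebra ZK.GG)"
    "ZK.Qm (\<lambda>s x. k * u s x) = ascale (groupoid_algebra ZK.GG) k (ZK.Qm u)"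
    "ZK.Qm (astar (KS_algebraic Z \<kappa>) u) = astar (groupoid_algebra ZK.GG) (ZK.Qm u)"
    if "u \<in> ZK.carr True" for u k
    using ZK.Qm_hom that unfolding star_hom_def by auto
  have Q2: "ZK.Qm (\<lambda>s x. u s x + v s x) = aadd (groupoid_algebra ZK.GG) (ZK.Qm u) (ZK.Qm v)"
    "ZK.Qm (amult (KS_algebraic Z \<kappa>) u v) = amult (groupoid_algebra ZK.GG) (ZK.Qm u) (ZK.Qm v)"
    if "u \<in> ZK.carr True" "v \<in> ZK.carr True" for u v
    using ZK.Qm_hom that unfolding star_hom_def by auto
  show ?thesis
    unfolding star_hom_def phi_def
    by (simp add: Q Q2 Jm_carr Jm_add Jm_scale Jm_mult Jm_star)
qed

lemma phi_add: "a \<in> carr True \<Longrightarrow> b \<in> carr True \<Longrightarrow> phi (\<lambda>s x. a s x + b s x) = (\<lambda>\<gamma>. phi a \<gamma> + phi b \<gamma>)"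
  by (simp add: phi_def Jm_add ZK.Qm_add[of _ True] Jm_carr)

lemma phi_zero: "phi (\<lambda>s x. 0) = (\<lambda>\<gamma>. 0)"
  by (simp add: phi_def Jm_zero)

lemma phi_sum:
  assumes "finite I" "\<And>i. i \<in> I \<Longrightarrow> a i \<in> carr True"
  shows "phi (\<lambda>s x. \<Sum>i\<in>I. a i s x) = (\<lambda>\<gamma>. \<Sum>i\<in>I. phi (a i) \<gamma>)"
  using assms by (induction I rule: finite_induct) (simp_all add: phi_zero phi_add carr_sum)

lemma phi_delta: "phi (delta s f) = ZK.br s (Jf s f)"
  by (simp add: phi_def Jm_delta ZK.Qm_delta)

section \<open>Elements supported on a set of semigroup elements\<close>

definition sub :: "'s set \<Rightarrow> ('s \<Rightarrow> 'x \<Rightarrow> complex) set"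
  where "sub S = {a \<in> carr True. \<forall>u. a u \<noteq> (\<lambda>x. 0) \<longrightarrow> u \<in> S}"

lemma sub_carr: "a \<in> sub S \<Longrightarrow> a \<in> carr True"
  by (simp add: sub_def)

lemma sub_mono: "a \<in> sub S \<Longrightarrow> S \<subseteq> T \<Longrightarrow> a \<in> sub T"
  by (auto simp: sub_def)

lemma sub_zero [simp]: "(\<lambda>s x. 0) \<in> sub S"
  by (simp add: sub_def)

lemma sub_add: "a \<in> sub S \<Longrightarrow> b \<in> sub S \<Longrightarrow> (\<lambda>s x. a s x + b s x) \<in> sub S"
  unfolding sub_def using carr_add by (auto simp: fun_eq_iff) (metis add_0)

lemma sub_scale: "a \<in> sub S \<Longrightarrow> (\<lambda>s x. k * a s x) \<in> sub S"
  unfolding sub_def using carr_scale by (auto simp: fun_eq_iff)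

lemma sub_diff: "a \<in> sub S \<Longrightarrow> b \<in> sub S \<Longrightarrow> (\<lambda>s x. a s x - b s x) \<in> sub S"
  using sub_add[of a S "\<lambda>s x. (-1) * b s x"] sub_scale[of b S "-1"] by simp

lemma sub_delta: "f \<in> Fn True X (dm s) \<Longrightarrow> s \<in> S \<Longrightarrow> delta s f \<in> sub S"
  using delta_carr by (auto simp: sub_def delta_def[THEN fun_cong] split: if_splits)

lemma sub_induct [consumes 1, case_names zero add delta]:
  assumes a: "a \<in> sub S" and 0: "P (\<lambda>s x. 0)"
    and add: "\<And>a b. a \<in> sub S \<Longrightarrow> b \<in> sub S \<Longrightarrow> P a \<Longrightarrow> P b \<Longrightarrow> P (\<lambda>t x. a t x + b t x)"
    and delta: "\<And>s f. f \<in> Fn True X (dm s) \<Longrightarrow> s \<in> S \<Longrightarrow> P (delta s f)"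
  shows "P a"
proof -
  have "a \<in> carr True" using a by (rule sub_carr)
  then have "(\<forall>u. a u \<noteq> (\<lambda>x. 0) \<longrightarrow> u \<in> S) \<longrightarrow> P a"
  proof (induction rule: alg_induct_disjoint)
    case (step a s f)
    show ?case
    proof
      assume u: "\<forall>u. (\<lambda>x. a u x + delta s f u x) \<noteq> (\<lambda>x. 0) \<longrightarrow> u \<in> S"
      have eq: "(\<lambda>x. a u x + delta s f u x) = (if u = s then f else a u)" for u
        using step(3) by (auto simp: delta_def)
      have "\<forall>u. a u \<noteq> (\<lambda>x. 0) \<longrightarrow> u \<in> S" using u[unfolded eq] step(3) by metis
      then have a: "a \<in> sub S" "P a" using step by (auto simp: sub_def)
      show "P (\<lambda>t x. a t x + delta s f t x)"
      proof (cases "f = (\<lambda>x. 0)")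
        case True
        then have "(\<lambda>t x. a t x + delta s f t x) = a" by (simp add: delta_def fun_eq_iff)
        then show ?thesis using a by simp
      next
        case False
        then have "s \<in> S" using u[unfolded eq] by metis
        then show ?thesis using add[OF a(1) sub_delta[OF step(2)] a(2) delta[OF step(2)]] by blast
      qed
    qed
  qed (use 0 in simp)
  then show ?thesis using a by (simp add: sub_def)
qed

lemma sub_mult:
  assumes "a \<in> sub S" "b \<in> sub T" and ST: "\<And>s t. s \<in> S \<Longrightarrow> t \<in> T \<Longrightarrow> s * t \<in> U"
  shows "amult (KS_algebraic X \<theta>) a b \<in> sub U"
  using assms(1)
proof (induction rule: sub_induct)
  case (add a a')
  then show ?case using assms(2) by (simp add: mult_add_left_alg[of _ True] sub_add sub_carr)
next
  case f: (delta s f)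
  from assms(2) show ?case
  proof (induction rule: sub_induct)
    case (add b b')
    then show ?case using delta_carr[OF f(1)] by (simp add: mult_add_right_alg[of _ True] sub_add sub_carr)
  next
    case g: (delta t g)
    show ?case unfolding delta_mult_tr[OF g(1)] by (rule sub_delta[OF mult_Fn[OF f(1) g(1)] ST[OF f(2) g(2)]])
  qed simp
qed simp

text \<open>All components are added as functions on \<open>Z\<close>, forgetting their indices. On
  elements supported on idempotents each \<open>\<tau>\<close> gives a multiplicative *-functional
  in this way; below one \<open>s\<close> the result is the restriction of \<open>phi a\<close> to
  the bisection of \<open>s\<close> (\<open>phi_down\<close>).\<close>

definition evl :: "('s \<Rightarrow> 'x \<Rightarrow> complex) \<Rightarrow> ('s \<Rightarrow> 'x option) \<Rightarrow> complex"
  where "evl a \<tau> = (\<Sum>u | a u \<noteq> (\<lambda>x. 0). Jf u (a u) \<tau>)"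

lemma evl_eq:
  assumes "finite F" "{s. a s \<noteq> (\<lambda>x. 0)} \<subseteq> F" shows "evl a \<tau> = (\<Sum>s\<in>F. Jf s (a s) \<tau>)"
  unfolding evl_def by (rule sum.mono_neutral_left) (use assms in auto)

lemma evl_delta [simp]: "evl (delta s f) = Jf s f"
  by (rule ext, subst evl_eq[of "{s}"]) (auto simp: delta_def)

lemma evl_zero [simp]: "evl (\<lambda>s x. 0) = (\<lambda>\<tau>. 0)"
  by (simp add: evl_def[abs_def])

lemma evl_add: assumes "a \<in> carr c" "b \<in> carr c" shows "evl (\<lambda>s x. a s x + b s x) \<tau> = evl a \<tau> + evl b \<tau>"
proof -
  let ?F = "{s. a s \<noteq> (\<lambda>x. 0)} \<union> {s. b s \<noteq> (\<lambda>x. 0)}"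
  have F: "finite ?F" using assms carr_fin by blast
  have "{s. (\<lambda>x. a s x + b s x) \<noteq> (\<lambda>x. 0)} \<subseteq> ?F" by (auto simp: fun_eq_iff)
  then show ?thesis
    using evl_eq[OF F, of a \<tau>] evl_eq[OF F, of b \<tau>] evl_eq[OF F, of "\<lambda>s x. a s x + b s x" \<tau>]
    by (simp add: sum.distrib[symmetric] Jf_add)
qed

lemma evl_scale: assumes "a \<in> carr c" shows "evl (\<lambda>s x. k * a s x) \<tau> = k * evl a \<tau>"
proof -
  let ?F = "{s. a s \<noteq> (\<lambda>x. 0)}"
  have F: "finite ?F" using assms carr_fin by blast
  have "{s. (\<lambda>x. k * a s x) \<noteq> (\<lambda>x. 0)} \<subseteq> ?F" by (auto simp: fun_eq_iff)
  then show ?thesis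
    using evl_eq[OF F, of a \<tau>] evl_eq[OF F, of "\<lambda>s x. k * a s x" \<tau>]
    by (simp add: sum_distrib_left Jf_scale)
qed

lemma evl_diff: "a \<in> carr c \<Longrightarrow> b \<in> carr c \<Longrightarrow> evl (\<lambda>s x. a s x - b s x) \<tau> = evl a \<tau> - evl b \<tau>"
  using evl_add[of a c "\<lambda>s x. (-1) * b s x"] carr_scale[of b c "-1"] evl_scale[of b c "-1"] by simp

lemma evl_Fn: assumes "a \<in> sub S" "\<And>u. u \<in> S \<Longrightarrow> ZK.dm u \<subseteq> U" shows "evl a \<in> Fn True Z U"
  using assms(1)
proof (induction rule: sub_induct)
  case (add a b)
  have "evl (\<lambda>s x. a s x + b s x) = (\<lambda>\<tau>. evl a \<tau> + evl b \<tau>)" using evl_add add sub_carr by blast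
  then show ?case using add by (simp add: Fn_add)
next
  case (delta s f)
  then show ?case using Fn_mono[OF Jf_ZK] assms(2) by simp
qed simp

lemma evl_Fn_Z: "a \<in> carr True \<Longrightarrow> evl a \<in> Fn True Z (topspace Z)"
  by (rule evl_Fn[of a UNIV]) (use ZK.dm_sub in \<open>auto simp: sub_def\<close>)

lemma Jf_mult_idem:
  assumes g: "e \<in> idempotents"
  shows "Jf (u * e) (\<lambda>x. f x * g x) \<tau> = Jf u f \<tau> * Jf e g \<tau>"
  using hv_mult[OF Z_tilde star_mult_idem(1) g, of \<tau> f g u]
  by (simp add: Jf_def star_mult_mult_idem[OF g] idem_inv_star[OF g] idem_self[OF g])

lemma delta_mult_idem:
  assumes e: "e \<in> idempotents" and g: "g \<in> Fn c X (dm e)"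
  shows "amult (KS_algebraic X \<theta>) (delta u f) (delta e g) = delta (u * e) (\<lambda>x. f x * g x)"
proof -
  have "f (tr e x) * g x = f x * g x" for x
    by (cases "x \<in> dm e") (use tr_idem[OF e] Fn_zero[OF g] in auto)
  then have "(\<lambda>x. f (tr e x) * g x) = (\<lambda>x. f x * g x)" by blast
  then show ?thesis by (simp only: delta_mult_tr[OF g])
qed

text \<open>Multiplying from the right by something supported on idempotents does not displace the
  left coefficient, because \<open>tr e\<close> is the identity on \<open>dm e\<close>.\<close>

lemma evl_mult:
  assumes "a \<in> carr True" "b \<in> sub idempotents"
  shows "evl (amult (KS_algebraic X \<theta>) a b) \<tau> = evl a \<tau> * evl b \<tau>"
  using assms(1)
proof (induction rule: alg_induct)
  case (add a a')
  then show ?case using sub_carr[OF assms(2)]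
    by (simp add: mult_add_left_alg[of _ True] evl_add[of _ True] carr_mult[of _ True] distrib_right)
next
  case f: (delta s f)
  from assms(2) show ?case
  proof (induction rule: sub_induct)
    case (add b b')
    then show ?case using delta_carr[OF f]
      by (simp add: mult_add_right_alg[of _ True] evl_add[of _ True] carr_mult[of _ True] distrib_left sub_carr)
  next
    case g: (delta e g)
    show ?case by (simp add: delta_mult_idem[OF g(2,1)] Jf_mult_idem[OF g(2)])
  qed simp
qed simp

lemma starf_idem: assumes e: "e \<in> idempotents" and f: "f \<in> Fn c X (dm e)" shows "starf e f = (\<lambda>x. cnj (f x))"
proof
  fix x show "starf e f x = cnj (f x)"
    by (cases "x \<in> dm e") (use e Fn_zero[OF f] in \<open>auto simp: starf_def idem_inv_star tr_idem\<close>)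
qed

lemma hv_cnj: "hv (\<lambda>x. cnj (f x)) p = cnj (hv f p)"
  by (cases p) auto

lemma Jf_cnj: "Jf s (\<lambda>x. cnj (f x)) \<tau> = cnj (Jf s f \<tau>)"
  by (simp add: Jf_def hv_cnj)

lemma star_sub_idem:
  assumes "b \<in> sub idempotents"
  shows "astar (KS_algebraic X \<theta>) b \<in> sub idempotents \<and> evl (astar (KS_algebraic X \<theta>) b) \<tau> = cnj (evl b \<tau>)"
  using assms
proof (induction rule: sub_induct)
  case (add a b)
  then show ?case using sub_carr
    by (simp add: star_add_alg sub_add evl_add[of _ True] carr_star)
next
  case (delta e f)
  then show ?case using starf_Fn[OF delta(1)]
    by (simp add: delta_star_tr starf_idem idem_inv_star Jf_cnj sub_delta Fn_cnj)
qed (simp add: star_zero_alg)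

definition down :: "'s \<Rightarrow> 's set" where "down s = {u. natural_le u s}"

text \<open>\<open>natural_le_star_mult\<close> puts the products of indices into the idempotents;
  with the C*-identity this reduces seminorms below one \<open>s\<close> to the case of idempotents
  (\<open>seminorm_down\<close>).\<close>

lemma star_mult_down:
  assumes "a \<in> sub (down s)" "b \<in> sub (down s)"
  shows "amult (KS_algebraic X \<theta>) (astar (KS_algebraic X \<theta>) a) b \<in> sub idempotents \<and>
    evl (amult (KS_algebraic X \<theta>) (astar (KS_algebraic X \<theta>) a) b) \<tau> = cnj (evl a \<tau>) * evl b \<tau>"
  using assms(1)
proof (induction rule: sub_induct)
  case (add a a')
  then show ?case using assms(2)
    by (simp add: star_add_alg mult_add_left_alg[of _ True] evl_add[of _ True] carr_mult[of _ True] carr_star sub_carr sub_add distrib_right)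
next
  case f: (delta u f)
  note u = f(2)[unfolded down_def, simplified]
  from assms(2) show ?case
  proof (induction rule: sub_induct)
    case (add b b')
    then show ?case using carr_star[OF delta_carr[OF f(1)]]
      by (simp add: mult_add_right_alg[of _ True] evl_add[of _ True] carr_mult[of _ True] sub_carr sub_add distrib_left)
  next
    case g: (delta v g)
    note v = g(2)[unfolded down_def, simplified]
    have uv: "u\<^sup>\<star> * v = (u\<^sup>\<star> * u) * (v\<^sup>\<star> * v)" by (rule natural_le_star_mult[OF u v])
    then have E: "u\<^sup>\<star> * v \<in> idempotents" using idem_mult_closed[OF star_mult_idem(1) star_mult_idem(1)] by metis
    have dmuv: "dm (u\<^sup>\<star> * v) = dm u \<inter> dm v" unfolding uv by (simp add: dm_idem_mult dm_star_self)
    have fg: "starf u f (tr v x) * g x = cnj (f x) * g x" for x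
    proof (cases "x \<in> dm v")
      case x: True
      show ?thesis
      proof (cases "x \<in> dm u")
        case True
        then have "x \<in> dm (u\<^sup>\<star> * v)" using x dmuv by simp
        then have "tr v x \<in> dm (u\<^sup>\<star>)" "tr (u\<^sup>\<star>) (tr v x) = x" using tr_idem[OF E] tr_mult[of x "u\<^sup>\<star>" v] by (auto simp: dm_mult)
        then show ?thesis by (simp add: starf_def)
      next
        case False
        then have "x \<notin> dm (u\<^sup>\<star> * v)" using dmuv by simp
        then have "tr v x \<notin> dm (u\<^sup>\<star>)" using x by (simp add: dm_mult)
        then show ?thesis using False Fn_zero[OF f(1)] by (simp add: starf_def)
      qed
    qed (use Fn_zero[OF g(1)] in simp)
    have eq: "amult (KS_algebraic X \<theta>) (astar (KS_algebraic X \<theta>) (delta u f)) (delta v g) = delta (u\<^sup>\<star> * v) (\<lambda>x. cnj (f x) * g x)"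
      using delta_mult_tr[OF g(1), of "u\<^sup>\<star>" "starf u f"] by (simp add: delta_star_tr fg)
    have F: "(\<lambda>x. cnj (f x) * g x) \<in> Fn True X (dm (u\<^sup>\<star> * v))"
      unfolding dmuv by (rule Fn_mult[OF Haus openin_dm Fn_cnj[OF f(1)] g(1)])
    have "(u\<^sup>\<star> * v)\<^sup>\<star> * (u\<^sup>\<star> * v) = (u\<^sup>\<star> * u) * (v\<^sup>\<star> * v)" using E uv by (metis idem_inv_star idem_self)
    then have "Jf (u\<^sup>\<star> * v) (\<lambda>x. cnj (f x) * g x) \<tau> = cnj (Jf u f \<tau>) * Jf v g \<tau>"
      using hv_mult[OF Z_tilde star_mult_idem(1) star_mult_idem(1), of \<tau> "\<lambda>x. cnj (f x)" g u v]
      by (simp add: Jf_def hv_cnj)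
    then show ?case using eq sub_delta[OF F E] by simp
  qed simp
qed (simp add: star_zero_alg)

lemma same_germ_down: "natural_le v s \<Longrightarrow> \<tau> \<in> ZK.dm v \<Longrightarrow> ZK.same_germ v s \<tau>"
  using ZK.same_germ_idem[of "v\<^sup>\<star> * v" \<tau> s] by (simp add: natural_le_iff ZK.dm_star_self)

text \<open>Elements below \<open>s\<close> have the germ of \<open>s\<close> wherever they are
  defined, so all components contribute to the same bisection and add up to
  \<open>evl a\<close>.\<close>

lemma phi_down:
  assumes a: "a \<in> sub (down s)" and u: "\<tau> \<in> ZK.dm u"
  shows "phi a (germ \<kappa> u \<tau>) = (if \<tau> \<in> ZK.dm s \<and> ZK.same_germ u s \<tau> then evl a \<tau> else 0)"
  using a
proof (induction rule: sub_induct)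
  case (add a b)
  then show ?case by (simp add: phi_add evl_add[of _ True] sub_carr)
next
  case (delta v f)
  then have v: "natural_le v s" by (simp add: down_def)
  show ?case
  proof (cases "\<tau> \<in> ZK.dm v")
    case True
    then have "\<tau> \<in> ZK.dm s" using ZK.natural_le_dm[OF v] by blast
    moreover have "ZK.same_germ u v \<tau> \<longleftrightarrow> ZK.same_germ u s \<tau>"
      using same_germ_down[OF v True] ZK.same_germ_trans ZK.same_germ_sym by blast
    ultimately show ?thesis using True by (simp add: phi_delta ZK.br_germ[OF u])
  next
    case False
    then show ?thesis by (simp add: phi_delta ZK.br_germ[OF u] Jf_off)
  qed
qed (simp add: phi_zero)

lemma phi_off: "\<gamma> \<notin> ZK.arr \<Longrightarrow> phi a \<gamma> = 0"
  by (simp add: phi_def ZK.Qm_off)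

lemma evl_down_off: "a \<in> sub (down s) \<Longrightarrow> \<tau> \<notin> ZK.dm s \<Longrightarrow> evl a \<tau> = 0"
  using Fn_zero[OF evl_Fn[of a "down s" "ZK.dm s"]] ZK.natural_le_dm by (auto simp: down_def)

lemma phi_down_le:
  assumes "a \<in> sub (down s)" "\<And>\<tau>. cmod (evl a \<tau>) \<le> M" shows "cmod (phi a \<gamma>) \<le> M"
proof (cases "\<gamma> \<in> ZK.arr")
  case True
  then obtain u \<tau> where "\<tau> \<in> ZK.dm u" "\<gamma> = germ \<kappa> u \<tau>" by (rule ZK.arr_cases)
  then show ?thesis using phi_down[OF assms(1)] assms(2)[of \<tau>] order_trans[OF norm_ge_zero assms(2)] by auto
qed (use order_trans[OF norm_ge_zero assms(2)] in \<open>simp add: phi_off\<close>)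

section \<open>Estimates for C*-seminorms\<close>

text \<open>The point of \<open>Z\<close> given by \<open>x\<close> and the principal filter of
  \<open>e\<close>. Being infinite at every idempotent not above \<open>e\<close>, it isolates the
  contributions of the idempotents above \<open>e\<close>.\<close>

definition chr :: "'s \<Rightarrow> 'x \<Rightarrow> 's \<Rightarrow> 'x option"
  where "chr e x = (\<lambda>f\<in>idempotents. if f * e = e then Some x else None)"

lemma chr_Z: assumes e: "e \<in> idempotents" and x: "x \<in> dm e" shows "chr e x \<in> topspace Z"
proof -
  have le: "x \<in> dm f" if "f \<in> idempotents" "f * e = e" for f
    using dm_idem_mult[OF that(1) e] that x by auto
  have "f' * e = e" if "f' * f = f" "f * e = e" for f f' using that by (metis mult.assoc)
  moreover have "(f * f') * e = e" if "f * e = e" "f' * e = e" for f f' using that by (simp add: mult.assoc)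
  ultimately have "chr e x \<in> KS_tilde X \<theta>"
    unfolding KS_tilde_iff using le by (auto simp: chr_def idem_mult_closed)
  moreover have "chr e x e \<noteq> None" using e by (simp add: chr_def idem_self)
  ultimately show ?thesis using e by (auto simp: Z_iff)
qed

text \<open>A member with the fewest members of \<open>F\<close> above it is maximal: passing to a
  different \<open>f\<close> above \<open>e\<close> would lose \<open>e\<close> itself from that
  set.\<close>

lemma exists_maximal_idem:
  assumes "finite F" "F \<noteq> {}" "F \<subseteq> idempotents"
  shows "\<exists>e\<in>F. \<forall>f\<in>F. f * e = e \<longrightarrow> f = e"
proof -
  let ?up = "\<lambda>e. {f \<in> F. f * e = e}"
  obtain e where e: "e \<in> F" "\<And>f. f \<in> F \<Longrightarrow> card (?up e) \<le> card (?up f)"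
    using ex_has_least_nat[of "\<lambda>e. e \<in> F" _ "\<lambda>e. card (?up e)"] assms(2) by blast
  have "f = e" if f: "f \<in> F" "f * e = e" for f
  proof (rule ccontr)
    assume n: "f \<noteq> e"
    have "?up f \<subseteq> ?up e" using f(2) by (auto simp: mult.assoc[symmetric]) (metis mult.assoc)
    moreover have "e \<notin> ?up f"
    proof
      assume "e \<in> ?up f"
      then have "e * f = f" by simp
      then show False using n f idem_commute[of e f] e(1) assms(3) by auto
    qed
    moreover have "e \<in> ?up e" using e(1) assms(3) idem_self by blast
    ultimately have "?up f \<subset> ?up e" by blast
    then have "card (?up f) < card (?up e)" using assms(1) by (intro psubset_card_mono) auto
    then show False using e(2)[OF f(1)] by simp
  qed
  then show ?thesis using e(1) by blast
qed

text \<open>At \<open>chr e x\<close> with \<open>e\<close> maximal in \<open>F\<close> only the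
  component \<open>c e\<close> is seen, so it is bounded by \<open>M\<close>, and removing it leaves
  an element whose \<open>evl\<close> is bounded by \<open>2 * M\<close>. The factor 3 per
  idempotent comes from \<open>2 * 3^n + 1 \<le> 3^(n+1)\<close>.\<close>

lemma seminorm_finite_idem:
  assumes p: "cstar_seminorm (Al True) p" and F: "finite F" "F \<subseteq> idempotents"
    and c: "c \<in> sub F" and M: "\<And>\<tau>. cmod (evl c \<tau>) \<le> M"
  shows "p c \<le> 3 ^ card F * M"
proof -
  interpret seminormed_star_algebra "Al True" p
    using alg_star_algebra p by (simp add: seminormed_star_algebra_def seminormed_star_algebra_axioms_def)
  show ?thesis
    using F c M
  proof (induction "card F" arbitrary: F c M)
    case 0
    then have "F = {}" by simp
    then have "c = (\<lambda>s x. 0)" using 0 by (auto simp: sub_def fun_eq_iff)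
    then show ?case using q_zero order_trans[OF norm_ge_zero 0(5)] 0(1) by simp
  next
    case (Suc n)
    have M0: "0 \<le> M" using order_trans[OF norm_ge_zero Suc(6)] .
    have "F \<noteq> {}" using Suc(2) by auto
    then obtain e where e: "e \<in> F" and mx: "\<And>f. f \<in> F \<Longrightarrow> f * e = e \<Longrightarrow> f = e"
      using exists_maximal_idem[OF Suc(3) _ Suc(4)] by blast
    have eE: "e \<in> idempotents" using e Suc(4) by blast
    have cF: "c \<in> carr True" using Suc(5) sub_carr by blast
    note ce = carr_Fn[OF cF, of e]
    have b: "cmod (c e x) \<le> M" for x
    proof (cases "x \<in> dm e")
      case True
      have "evl c (chr e x) = (\<Sum>u\<in>F. Jf u (c u) (chr e x))"
        by (rule evl_eq[OF Suc(3)]) (use Suc(5) in \<open>auto simp: sub_def\<close>)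
      also have "\<dots> = (\<Sum>u\<in>F. if u = e then c e x else 0)"
      proof (rule sum.cong)
        fix u assume u: "u \<in> F"
        then have uE: "u \<in> idempotents" using Suc(4) by blast
        show "Jf u (c u) (chr e x) = (if u = e then c e x else 0)"
          using chr_Z[OF eE True] mx[OF u] uE idem_self[OF eE]
          by (auto simp: Jf_def idem_inv_star idem_self chr_def)
      qed simp
      also have "\<dots> = c e x" using e Suc(3) by simp
      finally show ?thesis using Suc(6)[of "chr e x"] by simp
    qed (use M0 Fn_zero[OF ce] in simp)
    let ?c = "\<lambda>s x. c s x - delta e (c e) s x"
    have cs: "?c = c(e := (\<lambda>x. 0))" by (auto simp: delta_def fun_eq_iff)
    have d: "delta e (c e) \<in> carr True" by (rule delta_carr[OF ce])
    have c': "?c \<in> sub (F - {e})"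
      using carr_diff[OF cF d] Suc(5) unfolding cs sub_def by auto
    have M': "cmod (evl ?c \<tau>) \<le> 2 * M" for \<tau>
      using norm_triangle_ineq4[of "evl c \<tau>" "Jf e (c e) \<tau>"] Suc(6)[of \<tau>] Jf_le[OF ce b, of e \<tau>]
      by (simp add: evl_diff[OF cF d])
    have n: "n = card (F - {e})" using Suc(2,3) e by simp
    have "p ?c \<le> 3 ^ card (F - {e}) * (2 * M)"
      by (rule Suc(1)[OF n _ _ c' M']) (use Suc(3,4) in auto)
    moreover have "p (delta e (c e)) \<le> M"
      using seminorm_delta[OF p ce] snorm_least[of "c e" M] b by (meson order_trans)
    moreover have "p c \<le> p ?c + p (delta e (c e))" using q_add[OF sub_carr[OF c'] d] by simp
    moreover have "M \<le> 3 ^ n * M" using M0 by (simp add: mult_le_cancel_right1)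
    ultimately have "p c \<le> 3 ^ n * (2 * M) + 3 ^ n * M" using n by (simp add: algebra_simps)
    then show ?case using Suc(2) by (simp add: Suc(2)[symmetric] algebra_simps)
  qed
qed

text \<open>If \<open>r > q > 0\<close>, the powers of \<open>r / q\<close> are unbounded, so no
  constant factor can compensate for them.\<close>

lemma power_le_limit:
  assumes "\<And>k::nat. r ^ (2 ^ k) \<le> C * q ^ (2 ^ k)" "0 \<le> r" "0 \<le> (q::real)" shows "r \<le> q"
proof (rule ccontr)
  assume a: "\<not> r \<le> q"
  show False
  proof (cases "q = 0")
    case True
    then show False using assms(1)[of 0] a by simp
  next
    case False
    then have q: "q > 0" using assms by simp
    have "1 < r / q" using a q by simp
    then obtain n where n: "C < (r / q) ^ n" using real_arch_pow by blast
    have "(r / q) ^ n \<le> (r / q) ^ (2 ^ n)"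
      by (rule power_increasing) (use \<open>1 < r / q\<close> less_exp[of n] in auto)
    also have "\<dots> = r ^ (2 ^ n) / q ^ (2 ^ n)" by (simp add: power_divide)
    also have "\<dots> \<le> C" using assms(1)[of n] q by (simp add: pos_divide_le_eq)
    finally show False using n by simp
  qed
qed

text \<open>The spectral radius formula in the form needed here: all powers of \<open>b\<^sup>* b\<close> are supported
  on one finite set of idempotents, so the crude bound above applies to them with a fixed constant.\<close>

lemma seminorm_idem:
  assumes p: "cstar_seminorm (Al True) p" and b: "b \<in> sub idempotents" and M: "\<And>\<tau>. cmod (evl b \<tau>) \<le> M"
  shows "p b \<le> M"
proof -
  interpret seminormed_star_algebra "Al True" p
    using alg_star_algebra p by (simp add: seminormed_star_algebra_def seminormed_star_algebra_axioms_def)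
  let ?m = "amult (KS_algebraic X \<theta>)" and ?s = "astar (KS_algebraic X \<theta>)"
  have M0: "0 \<le> M" using order_trans[OF norm_ge_zero M] .
  have bc: "b \<in> carr True" using b sub_carr by blast
  define c where "c = ?m (?s b) b"
  have sb: "?s b \<in> sub idempotents" using star_sub_idem[OF b] by blast
  have cE: "c \<in> sub idempotents" unfolding c_def by (rule sub_mult[OF sb b idem_mult_closed])
  have cc: "c \<in> carr True" using cE sub_carr by blast
  have ec: "evl c \<tau> = cnj (evl b \<tau>) * evl b \<tau>" for \<tau>
    using evl_mult[OF sub_carr[OF sb] b] star_sub_idem[OF b] by (simp add: c_def)
  have sc: "?s c = c" using star_mult_alg[OF sub_carr[OF sb] bc] star_star_alg[OF bc] by (simp add: c_def)
  obtain F where F: "finite F" "{s. c s \<noteq> (\<lambda>x. 0)} \<subseteq> F" "F \<subseteq> idempotents" and FF: "\<forall>e\<in>F. \<forall>f\<in>F. e * f \<in> F"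
  proof -
    have "{s. c s \<noteq> (\<lambda>x. 0)} \<subseteq> idempotents" using cE by (auto simp: sub_def)
    from finite_idem_closure[OF carr_fin[OF cc] this] show ?thesis using that by (elim exE conjE)
  qed
  \<comment> \<open>\<open>d k\<close> is \<open>c\<close> to the power \<open>2 ^ k\<close>.
    Repeated squaring is used because for self-adjoint elements the C*-identity computes the
    seminorm of a square exactly.\<close>
  define d where "d = rec_nat c (\<lambda>_ a. ?m a a)"
  have d0: "d 0 = c" and dS: "d (Suc k) = ?m (d k) (d k)" for k by (simp_all add: d_def)
  have D: "d k \<in> sub F \<and> ?s (d k) = d k \<and> p (d k) = p c ^ (2 ^ k) \<and> (\<forall>\<tau>. evl (d k) \<tau> = evl c \<tau> ^ (2 ^ k))" for k
  proof (induction k)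
    case 0
    show ?case using cc F(2) sc by (auto simp: d0 sub_def)
  next
    case (Suc k)
    then have k: "d k \<in> sub F" "?s (d k) = d k" "p (d k) = p c ^ (2 ^ k)" "\<And>\<tau>. evl (d k) \<tau> = evl c \<tau> ^ (2 ^ k)" by auto
    have kc: "d k \<in> carr True" using k sub_carr by blast
    have "?m (d k) (d k) \<in> sub F" by (rule sub_mult[OF k(1) k(1)]) (use FF in blast)
    moreover have "?s (?m (d k) (d k)) = ?m (d k) (d k)" using star_mult_alg[OF kc kc] k(2) by simp
    moreover have "p (?m (d k) (d k)) = p c ^ (2 ^ Suc k)"
      using q_cstar[of "d k"] kc k(2,3) by (simp add: power_mult[symmetric] mult.commute)
    moreover have "evl (?m (d k) (d k)) \<tau> = evl c \<tau> ^ (2 ^ Suc k)" for \<tau>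
      using evl_mult[OF kc sub_mono[OF k(1) F(3)]] k(4) by (simp add: power_add[symmetric] mult_2)
    ultimately show ?case unfolding dS by blast
  qed
  have "p c ^ (2 ^ k) \<le> 3 ^ card F * (M\<^sup>2) ^ (2 ^ k)" for k
  proof -
    have "cmod (evl (d k) \<tau>) \<le> (M\<^sup>2) ^ (2 ^ k)" for \<tau>
      using D[of k] power_mono[OF M[of \<tau>], of "2"] power_mono[of "(cmod (evl b \<tau>))\<^sup>2" "M\<^sup>2" "2 ^ k"]
      by (simp add: ec norm_power norm_mult power2_eq_square)
    then have "p (d k) \<le> 3 ^ card F * (M\<^sup>2) ^ (2 ^ k)"
      using D[of k] by (intro seminorm_finite_idem[OF p F(1,3)]) auto
    then show ?thesis using D[of k] by simp
  qed
  then have "p c \<le> M\<^sup>2" by (rule power_le_limit) (use q_nonneg cc in auto)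
  moreover have "p c = (p b)\<^sup>2" using q_cstar[of b] bc by (simp add: c_def)
  ultimately show ?thesis using M0 power2_le_imp_le by metis
qed

lemma seminorm_down:
  assumes p: "cstar_seminorm (Al True) p" and a: "a \<in> sub (down s)" and M: "\<And>\<tau>. cmod (evl a \<tau>) \<le> M"
  shows "p a \<le> M"
proof -
  interpret seminormed_star_algebra "Al True" p
    using alg_star_algebra p by (simp add: seminormed_star_algebra_def seminormed_star_algebra_axioms_def)
  have M0: "0 \<le> M" using order_trans[OF norm_ge_zero M] .
  let ?c = "amult (KS_algebraic X \<theta>) (astar (KS_algebraic X \<theta>) a) a"
  have "cmod (evl ?c \<tau>) \<le> M\<^sup>2" for \<tau>
    using star_mult_down[OF a a, of \<tau>] power_mono[OF M[of \<tau>], of 2] by (simp add: norm_mult power2_eq_square)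
  then have "p ?c \<le> M\<^sup>2" using star_mult_down[OF a a] by (intro seminorm_idem[OF p]) auto
  moreover have "p ?c = (p a)\<^sup>2" using q_cstar[of a] sub_carr[OF a] by simp
  ultimately show ?thesis using M0 power2_le_imp_le by metis
qed

text \<open>If \<open>t * e = r * e\<close>, right multiplication by \<open>delta e g\<close> sends
  elements below \<open>t\<close> to elements below both \<open>t\<close> and \<open>r\<close>. Such
  a product can be taken from \<open>a t\<close> and credited to \<open>a r\<close> without changing
  the total. Every list entry thus multiplies \<open>evl (a t)\<close> by
  \<open>1 - Jf e g\<close>.\<close>

lemma move_terms:
  assumes L: "\<forall>(e, g, r)\<in>set L. e \<in> idempotents \<and> g \<in> Fn True X (dm e) \<and> r \<in> T \<and> t * e = r * e"
    and T: "finite T" "t \<in> T" and a: "\<And>r. r \<in> T \<Longrightarrow> a r \<in> sub (down r)"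
    and nt: "\<forall>(e, g, r)\<in>set L. r \<noteq> t"
  shows "\<exists>b. (\<forall>r\<in>T. b r \<in> sub (down r)) \<and> (\<forall>s x. (\<Sum>r\<in>T. b r s x) = (\<Sum>r\<in>T. a r s x)) \<and>
    (\<forall>\<tau>. evl (b t) \<tau> = evl (a t) \<tau> * prod_list (map (\<lambda>(e, g, r). 1 - Jf e g \<tau>) L))"
  using L nt
proof (induction L)
  case Nil
  then show ?case using a by (intro exI[of _ a]) simp
next
  case (Cons i L)
  obtain e g r where i: "i = (e, g, r)" by (metis prod_cases3)
  have egr: "e \<in> idempotents" "g \<in> Fn True X (dm e)" "r \<in> T" "t * e = r * e" "r \<noteq> t" using Cons.prems i by auto
  obtain b where b: "\<And>r. r \<in> T \<Longrightarrow> b r \<in> sub (down r)" "\<And>s x. (\<Sum>r\<in>T. b r s x) = (\<Sum>r\<in>T. a r s x)"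
    and eb: "\<And>\<tau>. evl (b t) \<tau> = evl (a t) \<tau> * prod_list (map (\<lambda>(e, g, r). 1 - Jf e g \<tau>) L)"
    using Cons by auto
  define d where "d = amult (KS_algebraic X \<theta>) (b t) (delta e g)"
  have bt: "b t \<in> sub (down t)" using b T by blast
  have k: "delta e g \<in> sub {e}" by (rule sub_delta[OF egr(2)]) simp
  have le: "natural_le (u * e) t \<and> natural_le (u * e) r" if "natural_le u t" for u
  proof -
    have u: "t * (u\<^sup>\<star> * u) = u" using that by (simp add: natural_le_iff)
    have f: "e * (u\<^sup>\<star> * u) \<in> idempotents" by (rule idem_mult_closed[OF egr(1) star_mult_idem(1)])
    have "u * e = t * ((u\<^sup>\<star> * u) * e)" using u by (metis mult.assoc)
    also have "\<dots> = t * (e * (u\<^sup>\<star> * u))" by (simp add: idem_commute[OF egr(1) star_mult_idem(1)])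
    finally have 1: "u * e = t * (e * (u\<^sup>\<star> * u))" .
    then have 2: "u * e = r * (e * (u\<^sup>\<star> * u))" using egr(4) by (metis mult.assoc)
    show ?thesis using natural_le_mult_idem[OF f, of t] natural_le_mult_idem[OF f, of r] 1 2 by simp
  qed
  have dt: "d \<in> sub (down t)" "d \<in> sub (down r)"
    unfolding d_def using le by (auto simp: down_def intro!: sub_mult[OF bt k])
  define b' where "b' q = (\<lambda>s x. b q s x + (if q = r then d s x else 0) - (if q = t then d s x else 0))" for q
  have b't: "b' t = (\<lambda>s x. b t s x - d s x)" and b'r: "b' r = (\<lambda>s x. b r s x + d s x)"
    and b'q: "q \<noteq> r \<Longrightarrow> q \<noteq> t \<Longrightarrow> b' q = b q" for q
    using egr(5) by (auto simp: b'_def)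
  have "b' q \<in> sub (down q)" if "q \<in> T" for q
    by (cases "q = t"; cases "q = r") (use that b dt b't b'r b'q in \<open>auto simp: sub_diff sub_add\<close>)
  moreover have "(\<Sum>q\<in>T. b' q s x) = (\<Sum>r\<in>T. a r s x)" for s x
    using T egr(3) b(2) by (simp add: b'_def sum.distrib sum_subtractf)
  moreover have "evl (b' t) \<tau> = evl (a t) \<tau> * prod_list (map (\<lambda>(e, g, r). 1 - Jf e g \<tau>) (i # L))" for \<tau>
  proof -
    have "evl d \<tau> = evl (b t) \<tau> * Jf e g \<tau>"
      unfolding d_def using evl_mult[OF sub_carr[OF bt] sub_mono[OF k]] egr(1) by simp
    then show ?thesis unfolding b't evl_diff[OF sub_carr[OF bt] sub_carr[OF dt(1)]] eb by (simp add: i algebra_simps)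
  qed
  ultimately show ?case by blast
qed

text \<open>If the sum over \<open>t \<in> T\<close> is small on the groupoid, then where \<open>evl (a t)\<close> is large another
  term must be nonzero at the same germ; multiplying by bumps moves the large part of \<open>a t\<close> to those
  other terms, without changing the sum, and one argues by induction on the number of terms.\<close>

lemma seminorm_sum_down:
  assumes p: "cstar_seminorm (Al True) p" and T: "finite T"
  shows "\<exists>C\<ge>0. \<forall>a M. M > 0 \<longrightarrow> (\<forall>t\<in>T. a t \<in> sub (down t)) \<longrightarrow> (\<forall>\<gamma>. cmod (\<Sum>t\<in>T. phi (a t) \<gamma>) \<le> M)
    \<longrightarrow> p (\<lambda>s x. \<Sum>t\<in>T. a t s x) \<le> C * M"
proof -
  interpret seminormed_star_algebra "Al True" p
    using alg_star_algebra p by (simp add: seminormed_star_algebra_def seminormed_star_algebra_axioms_def)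
  show ?thesis
    using T
  proof (induction T rule: finite_induct)
    case empty
    then show ?case using q_zero by (intro exI[of _ 0]) simp
  next
    case (insert t T)
    then obtain C where C: "C \<ge> 0" and IH: "\<And>a M. M > 0 \<Longrightarrow> (\<And>t. t \<in> T \<Longrightarrow> a t \<in> sub (down t)) \<Longrightarrow>
      (\<And>\<gamma>. cmod (\<Sum>t\<in>T. phi (a t) \<gamma>) \<le> M) \<Longrightarrow> p (\<lambda>s x. \<Sum>t\<in>T. a t s x) \<le> C * M"
      by blast
    \<comment> \<open>After the move the term at \<open>t\<close> is bounded by
      \<open>2 * M\<close>, so the remaining terms add up to at most \<open>M + 2 * M\<close> on the
      groupoid, and the induction hypothesis bounds them by \<open>3 * C * M\<close>.\<close>
    have "p (\<lambda>s x. \<Sum>r\<in>insert t T. a r s x) \<le> (2 + 3 * C) * M"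
      if M: "M > 0" and a: "\<And>r. r \<in> insert t T \<Longrightarrow> a r \<in> sub (down r)"
        and s: "\<And>\<gamma>. cmod (\<Sum>r\<in>insert t T. phi (a r) \<gamma>) \<le> M" for a M
    proof -
      have at: "a t \<in> sub (down t)" using a by simp
      note eF = evl_Fn_Z[OF sub_carr[OF at]]
      let ?K = "{\<tau> \<in> topspace Z. cmod (evl (a t) \<tau>) \<in> {2 * M..}}"
      obtain K0 where K0: "compactin Z K0" "\<And>\<tau>. \<tau> \<notin> K0 \<Longrightarrow> evl (a t) \<tau> = 0" using eF Fn_True_support by metis
      have "closedin Z ?K"
        by (rule closedin_continuous_map_preimage[of _ euclidean]) (use Fn_cont[OF eF] continuous_map_norm in auto)
      moreover have "?K \<subseteq> K0"
      proof
        fix \<tau> assume "\<tau> \<in> ?K"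
        then have "evl (a t) \<tau> \<noteq> 0" using M by auto
        then show "\<tau> \<in> K0" using K0(2) by blast
      qed
      ultimately have K: "compactin Z ?K" using closed_compactin[OF K0(1)] by blast
      \<comment> \<open>The entries allowed in the list: bumps with values between 0 and 1, on an
        idempotent \<open>e\<close> where \<open>t\<close> agrees with another index
        \<open>r\<close>.\<close>
      define R where "R = (\<lambda>(e, g, r). e \<in> idempotents \<and> g \<in> Fn True X (dm e) \<and> (\<forall>x. \<exists>y. g x = of_real y \<and> 0 \<le> y \<and> y \<le> 1)
        \<and> r \<in> T \<and> t * e = r * e)"
      have "\<exists>L. (\<forall>i\<in>set L. R i) \<and> (\<forall>\<tau>\<in>?K. \<exists>i\<in>set L. cmod (1 - Jf (fst i) (fst (snd i)) \<tau>) \<le> 1/2)"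
      proof (rule compactin_finite_list[OF K])
        fix \<tau> assume \<tau>: "\<tau> \<in> ?K"
        have td: "\<tau> \<in> ZK.dm t"
        proof (rule ccontr)
          assume "\<tau> \<notin> ZK.dm t"
          then show False using evl_down_off[OF at] \<tau> M by auto
        qed
        have ph: "phi (a t) (germ \<kappa> t \<tau>) = evl (a t) \<tau>" using phi_down[OF at td] td ZK.same_germ_refl by simp
        \<comment> \<open>Otherwise the whole sum at the germ of \<open>t\<close> over
          \<open>\<tau>\<close> would be \<open>evl (a t) \<tau>\<close>, of modulus at least
          \<open>2 * M\<close>, against the bound \<open>M\<close>.\<close>
        have "\<exists>r\<in>T. phi (a r) (germ \<kappa> t \<tau>) \<noteq> 0"
        proof (rule ccontr)
          assume "\<not> ?thesis"
          then have "(\<Sum>r\<in>insert t T. phi (a r) (germ \<kappa> t \<tau>)) = evl (a t) \<tau>" using insert.hyps ph by simp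
          then show False using s[of "germ \<kappa> t \<tau>"] \<tau> M by simp
        qed
        then obtain r where r: "r \<in> T" "phi (a r) (germ \<kappa> t \<tau>) \<noteq> 0" by blast
        then have "ZK.same_germ t r \<tau>" using phi_down[OF a td, of r] by (auto split: if_splits)
        then obtain e where e: "e \<in> idempotents" "t * e = r * e" "\<tau> \<in> ZK.dm e" by (auto simp: ZK.same_germ_def)
        then obtain x where x: "\<tau> e = Some x" and tZ: "\<tau> \<in> topspace Z"
          by (auto simp: ZK_dm_iff idem_inv_star idem_self)
        have xe: "x \<in> dm e" using tilde_dm[OF Z_tilde[OF tZ] e(1) x] .
        obtain g :: "'x \<Rightarrow> real" where g: "(\<lambda>x. complex_of_real (g x)) \<in> Fn True X (dm e)" "\<And>x. 0 \<le> g x \<and> g x \<le> 1" "g x = 1"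
          using Urysohn_bump[OF LC Haus openin_dm, of "{x}" e] xe dm_sub by auto
        let ?g = "\<lambda>x. complex_of_real (g x)"
        have "continuous_map Z euclidean (Jf e ?g)" using Fn_cont[OF Jf_ZK[OF g(1)]] .
        then have "openin Z {\<sigma> \<in> topspace Z. Jf e ?g \<sigma> \<in> ball 1 (1/2)}"
          by (rule openin_continuous_map_preimage) auto
        moreover have "Jf e ?g \<tau> = 1" using x tZ g(3) e(1) by (simp add: Jf_def idem_inv_star idem_self)
        moreover have "R (e, ?g, r)" unfolding R_def using e g r by auto
        ultimately show "\<exists>i V. openin Z V \<and> \<tau> \<in> V \<and> R i \<and> (\<forall>\<sigma>\<in>V \<inter> ?K. cmod (1 - Jf (fst i) (fst (snd i)) \<sigma>) \<le> 1/2)"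
          using tZ by (intro exI[of _ "(e, ?g, r)"] exI[of _ "{\<sigma> \<in> topspace Z. Jf e ?g \<sigma> \<in> ball 1 (1/2)}"])
            (auto simp: dist_norm)
      qed
      then obtain L where L: "\<forall>i\<in>set L. R i" and L2: "\<And>\<tau>. \<tau> \<in> ?K \<Longrightarrow> \<exists>i\<in>set L. cmod (1 - Jf (fst i) (fst (snd i)) \<tau>) \<le> 1/2"
        by blast
      define P where "P L' \<tau> = prod_list (map (\<lambda>(e, g, r). 1 - Jf e g \<tau>) L')" for L' :: "('s \<times> ('x \<Rightarrow> complex) \<times> 's) list" and \<tau>
      have le1: "cmod (1 - Jf e g \<tau>) \<le> 1" if "R (e, g, r)" for e g r \<tau>
      proof -
        obtain y where "Jf e g \<tau> = complex_of_real y" "0 \<le> y" "y \<le> 1"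
        proof (cases "\<tau> \<in> topspace Z \<and> \<tau> (e\<^sup>\<star> * e) \<noteq> None")
          case True
          then obtain x where "Jf e g \<tau> = g x" by (auto simp: Jf_def)
          moreover obtain y where "g x = of_real y" "0 \<le> y" "y \<le> 1" using \<open>R (e, g, r)\<close> unfolding R_def by blast
          ultimately show ?thesis using that by simp
        qed (use that[of 0] in \<open>auto simp: Jf_def\<close>)
        moreover from this have "1 - Jf e g \<tau> = complex_of_real (1 - y)" by simp
        ultimately show ?thesis by (simp only: norm_of_real)
      qed
      \<comment> \<open>All factors have modulus at most 1, so passing through the list never
        enlarges \<open>evl (a t)\<close>; off \<open>?K\<close> the bound \<open>2 * M\<close>
        persists.\<close>
      have P1: "cmod (P L' \<tau>) \<le> 1" if "set L' \<subseteq> set L" for L' \<tau>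
        using that
      proof (induction L')
        case (Cons i L')
        obtain e g r where i: "i = (e, g, r)" by (metis prod_cases3)
        have "R (e, g, r)" using L Cons.prems i by auto
        then have "cmod (1 - Jf e g \<tau>) * cmod (P L' \<tau>) \<le> 1 * 1"
          using Cons by (intro mult_mono le1) auto
        then show ?case by (simp add: P_def i norm_mult)
      qed (simp add: P_def)
      have P2: "cmod (P L \<tau>) \<le> 1/2" if k: "\<tau> \<in> ?K" for \<tau>
      proof -
        obtain i where i: "i \<in> set L" "cmod (1 - Jf (fst i) (fst (snd i)) \<tau>) \<le> 1/2" using L2[OF k] by blast
        obtain L1 L3 where L13: "L = L1 @ i # L3" using i(1) by (meson split_list)
        have "P L \<tau> = P L1 \<tau> * ((1 - Jf (fst i) (fst (snd i)) \<tau>) * P L3 \<tau>)"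
          by (simp add: L13 P_def case_prod_beta)
        moreover have "cmod (P L1 \<tau>) * (cmod (1 - Jf (fst i) (fst (snd i)) \<tau>) * cmod (P L3 \<tau>)) \<le> 1 * (1/2 * 1)"
          using i(2) P1[of L1 \<tau>] P1[of L3 \<tau>] L13 by (intro mult_mono) auto
        ultimately show ?thesis by (simp add: norm_mult)
      qed
      have Prep: "P (concat (replicate m L)) \<tau> = P L \<tau> ^ m" for m \<tau>
        by (induction m) (auto simp: P_def)
      obtain B where B: "B > 0" "\<And>\<tau>. cmod (evl (a t) \<tau>) \<le> B" using Fn_bounded[OF eF] by blast
      \<comment> \<open>Each pass through \<open>L\<close> at least halves the function on
        \<open>?K\<close>, so \<open>m\<close> passes bring the global bound \<open>B\<close> below
        \<open>2 * M\<close> there.\<close>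
      obtain m where m: "B * (1/2) ^ m < 2 * M"
      proof -
        obtain m where "(1/2::real) ^ m < 2 * M / B" using real_arch_pow_inv[of "2 * M / B" "1/2"] M B by auto
        then show ?thesis using that B by (simp add: field_simps)
      qed
      let ?L = "concat (replicate m L)"
      have sL: "set ?L \<subseteq> set L" by auto
      have "\<exists>b. (\<forall>r\<in>insert t T. b r \<in> sub (down r)) \<and> (\<forall>s x. (\<Sum>r\<in>insert t T. b r s x) = (\<Sum>r\<in>insert t T. a r s x)) \<and>
        (\<forall>\<tau>. evl (b t) \<tau> = evl (a t) \<tau> * prod_list (map (\<lambda>(e, g, r). 1 - Jf e g \<tau>) ?L))"
      proof (rule move_terms)
        have "R i" if "i \<in> set ?L" for i using that L sL by blast
        then show "\<forall>(e, g, r)\<in>set ?L. e \<in> idempotents \<and> g \<in> Fn True X (dm e) \<and> r \<in> insert t T \<and> t * e = r * e"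
          "\<forall>(e, g, r)\<in>set ?L. r \<noteq> t"
          using insert.hyps(2) unfolding R_def by fast+
      qed (use a insert.hyps in auto)
      then obtain b where b: "\<And>r. r \<in> insert t T \<Longrightarrow> b r \<in> sub (down r)"
        and bs: "\<And>s x. (\<Sum>r\<in>insert t T. b r s x) = (\<Sum>r\<in>insert t T. a r s x)"
        and eb: "\<And>\<tau>. evl (b t) \<tau> = evl (a t) \<tau> * P L \<tau> ^ m"
        unfolding P_def[symmetric] Prep by blast
      have bt: "b t \<in> sub (down t)" using b by simp
      have ebM: "cmod (evl (b t) \<tau>) \<le> 2 * M" for \<tau>
      proof (cases "\<tau> \<in> ?K")
        case True
        have "cmod (evl (b t) \<tau>) \<le> B * (1/2) ^ m"
          unfolding eb norm_mult norm_power using B P2[OF True] by (intro mult_mono power_mono) auto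
        then show ?thesis using m by simp
      next
        case False
        then have "cmod (evl (a t) \<tau>) \<le> 2 * M"
          using M Fn_zero[OF eF, of \<tau>] by (cases "\<tau> \<in> topspace Z") auto
        moreover have "cmod (P L \<tau>) ^ m \<le> 1" using P1[of L \<tau>] by (simp add: power_le_one)
        ultimately have "cmod (evl (a t) \<tau>) * cmod (P L \<tau>) ^ m \<le> (2 * M) * 1" using M by (intro mult_mono) auto
        then show ?thesis by (simp add: eb norm_mult norm_power)
      qed
      have "(\<Sum>r\<in>insert t T. phi (b r) \<gamma>) = (\<Sum>r\<in>insert t T. phi (a r) \<gamma>)" for \<gamma>
      proof -
        have "phi (\<lambda>s x. \<Sum>r\<in>insert t T. b r s x) = phi (\<lambda>s x. \<Sum>r\<in>insert t T. a r s x)" by (simp only: bs)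
        then show ?thesis
          using phi_sum[of "insert t T" a] phi_sum[of "insert t T" b] a b insert.hyps(1) sub_carr
          by (metis (no_types, lifting) finite_insert)
      qed
      then have sum: "(\<Sum>r\<in>T. phi (b r) \<gamma>) = (\<Sum>r\<in>insert t T. phi (a r) \<gamma>) - phi (b t) \<gamma>" for \<gamma>
        using insert.hyps by (simp add: algebra_simps)
      have "cmod (\<Sum>r\<in>T. phi (b r) \<gamma>) \<le> 3 * M" for \<gamma>
        using norm_triangle_ineq4[of "\<Sum>r\<in>insert t T. phi (a r) \<gamma>" "phi (b t) \<gamma>"] s[of \<gamma>] phi_down_le[OF bt ebM, of \<gamma>]
        unfolding sum by linarith
      then have "p (\<lambda>s x. \<Sum>r\<in>T. b r s x) \<le> C * (3 * M)" using b M by (intro IH) auto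
      moreover have "p (b t) \<le> 2 * M" by (rule seminorm_down[OF p bt ebM])
      moreover have "p (\<lambda>s x. \<Sum>r\<in>insert t T. a r s x) \<le> p (b t) + p (\<lambda>s x. \<Sum>r\<in>T. b r s x)"
      proof -
        have "(\<lambda>s x. \<Sum>r\<in>T. b r s x) \<in> carr True" using b sub_carr insert.hyps by (intro carr_sum) auto
        from q_add[OF sub_carr[OF bt] this] show ?thesis unfolding bs[symmetric] using insert.hyps by simp
      qed
      ultimately show ?thesis by (simp add: algebra_simps)
    qed
    then show ?case using C by (intro exI[of _ "2 + 3 * C"]) auto
  qed
qed

end

section \<open>The Stone--Weierstrass theorem for abstract compact spaces\<close>

text \<open>A copy of \<open>'i \<Rightarrow> real\<close> that carries the product topology as a Hausdorff type class instance; for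
  the function type itself this instance would clash with an existing arity.\<close>

typedef 'i wfun = "UNIV :: ('i \<Rightarrow> real) set" morphisms wapp Abs_wfun ..

lemma wapp_Abs [simp]: "wapp (Abs_wfun f) = f"
  by (simp add: Abs_wfun_inverse)

lemma wapp_image: "wapp ` UNIV = UNIV"
  by (metis UNIV_eq_I rangeI wapp_Abs)

lemma inj_wapp: "inj wapp"
  by (meson injI wapp_inject)

instantiation wfun :: (type) topological_space
begin
definition open_wfun :: "'a wfun set \<Rightarrow> bool" where "open_wfun U \<longleftrightarrow> open (wapp ` U)"
instance
proof
  show "open (UNIV :: 'a wfun set)" by (simp add: open_wfun_def wapp_image)
next
  fix S T :: "'a wfun set" assume "open S" "open T"
  then show "open (S \<inter> T)" by (simp add: open_wfun_def image_Int[OF inj_wapp] open_Int)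
next
  fix K :: "'a wfun set set" assume "\<forall>S\<in>K. open S"
  then show "open (\<Union>K)" by (auto simp: open_wfun_def image_Union)
qed
end

lemma open_wfun_vimage: assumes "open (V :: real set)" shows "open {h. wapp h i \<in> V}"
proof -
  have "open ((\<lambda>x::'a\<Rightarrow>real. x i) -` V)"
    by (rule open_vimage[OF assms continuous_on_product_coordinates])
  moreover have "wapp ` {h. wapp h i \<in> V} = (\<lambda>x. x i) -` V"
    by (auto simp: image_iff) (metis wapp_Abs)
  ultimately show ?thesis by (simp add: open_wfun_def)
qed

instance wfun :: (type) t2_space
proof
  fix f g :: "'a wfun" assume "f \<noteq> g"
  then obtain i where "wapp f i \<noteq> wapp g i" by (metis ext wapp_inject)
  then obtain U V where "open U" "open V" "wapp f i \<in> U" "wapp g i \<in> V" "U \<inter> V = {}" by (meson hausdorff)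
  then show "\<exists>U V. open U \<and> open V \<and> f \<in> U \<and> g \<in> V \<and> U \<inter> V = {}"
    by (intro exI[of _ "{h. wapp h i \<in> U}"] exI[of _ "{h. wapp h i \<in> V}"]) (auto simp: open_wfun_vimage)
qed

lemma continuous_map_wfun:
  fixes F :: "'i \<Rightarrow> 'a \<Rightarrow> real"
  assumes "\<And>i. continuous_map T euclideanreal (F i)"
  shows "continuous_map T euclidean (\<lambda>x. Abs_wfun (\<lambda>i. F i x))"
  unfolding continuous_map_def
proof (intro conjI allI impI)
  fix U :: "'i wfun set" assume "openin euclidean U"
  then have U: "open (wapp ` U)" by (simp add: open_wfun_def open_openin[symmetric])
  have "continuous_map T (product_topology (\<lambda>_::'i. euclideanreal) UNIV) (\<lambda>x i. F i x)"
    using assms by (simp add: continuous_map_componentwise_UNIV)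
  then have "continuous_map T euclidean (\<lambda>x i. F i x)" by (simp add: euclidean_product_topology)
  then have "openin T {x \<in> topspace T. (\<lambda>i. F i x) \<in> wapp ` U}"
    by (rule openin_continuous_map_preimage) (use U in simp)
  moreover have "(\<lambda>i. F i x) \<in> wapp ` U \<longleftrightarrow> Abs_wfun (\<lambda>i. F i x) \<in> U" for x
    by (metis image_iff inj_image_mem_iff inj_wapp wapp_Abs)
  ultimately show "openin T {x \<in> topspace T. Abs_wfun (\<lambda>i. F i x) \<in> U}" by simp
qed auto

text \<open>Evaluation at the members of \<open>R\<close> embeds the compact space into a product of
  lines. Going from compact to Hausdorff, this is a homeomorphism onto its image \<open>S\<close>,
  and the approximation theorem for compact sets in a topological type is transported along the
  inverse \<open>G\<close>.\<close>

lemma Stone_Weierstrass_compact_space: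
  fixes R :: "('a \<Rightarrow> real) set"
  assumes T: "compact_space T" and c: "\<And>r. r \<in> R \<Longrightarrow> continuous_map T euclideanreal r"
    and add: "\<And>f g. f \<in> R \<Longrightarrow> g \<in> R \<Longrightarrow> (\<lambda>x. f x + g x) \<in> R"
    and mult: "\<And>f g. f \<in> R \<Longrightarrow> g \<in> R \<Longrightarrow> (\<lambda>x. f x * g x) \<in> R"
    and const: "\<And>c. (\<lambda>x. c) \<in> R"
    and sep: "\<And>x y. x \<in> topspace T \<Longrightarrow> y \<in> topspace T \<Longrightarrow> x \<noteq> y \<Longrightarrow> \<exists>r\<in>R. r x \<noteq> r y"
    and f: "continuous_map T euclideanreal f" and e: "0 < (e::real)"
  shows "\<exists>r\<in>R. \<forall>x\<in>topspace T. \<bar>f x - r x\<bar> < e"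
proof -
  \<comment> \<open>The coordinates run over all functions of the type; those outside
    \<open>R\<close>, which may be discontinuous, are replaced by 0.\<close>
  define E where "E x = Abs_wfun (\<lambda>r. if r \<in> R then r x else 0)" for x
  define S where "S = E ` topspace T"
  have "continuous_map T euclideanreal (\<lambda>x. if r \<in> R then r x else 0)" for r
    using c by (cases "r \<in> R") auto
  then have E: "continuous_map T euclidean E" unfolding E_def[abs_def] by (rule continuous_map_wfun)
  have "compactin euclidean S" unfolding S_def using image_compactin[OF _ E] T by (simp add: compact_space_def)
  then have S: "compact S" by simp
  have inj: "inj_on E (topspace T)"
  proof (rule inj_onI, rule ccontr)
    fix x y assume xy: "x \<in> topspace T" "y \<in> topspace T" "E x = E y" "x \<noteq> y"
    then obtain r where "r \<in> R" "r x \<noteq> r y" using sep by blast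
    then show False using arg_cong[OF xy(3), of "\<lambda>h. wapp h r"] by (simp add: E_def)
  qed
  have "homeomorphic_map T (top_of_set S) E"
  proof (rule continuous_imp_homeomorphic_map[OF _ T])
    have "Hausdorff_space (euclidean :: ('a \<Rightarrow> real) wfun topology)"
      unfolding Hausdorff_space_def disjnt_def open_openin[symmetric] by (blast dest: hausdorff)
    then show "Hausdorff_space (top_of_set S)" by (rule Hausdorff_space_subtopology)
    show "continuous_map T (top_of_set S) E" using E by (auto simp: continuous_map_in_subtopology S_def)
  qed (use inj in \<open>auto simp: S_def\<close>)
  then obtain G where "homeomorphic_maps T (top_of_set S) E G" by (meson homeomorphic_map_maps)
  then have G: "continuous_map (top_of_set S) T G" "\<And>x. x \<in> topspace T \<Longrightarrow> G (E x) = x" "\<And>y. y \<in> S \<Longrightarrow> E (G y) = y"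
    by (auto simp: homeomorphic_maps_def)
  have GT: "G y \<in> topspace T" if "y \<in> S" for y using G(2) that by (auto simp: S_def)
  have cG: "continuous_on S (\<lambda>y. h (G y))" if "continuous_map T euclideanreal h" for h
    using continuous_map_compose[OF G(1) that] by (simp add: o_def)
  interpret function_ring_on "(\<lambda>r y. r (G y)) ` R" S
  proof
    show "(\<lambda>x. f x + g x) \<in> (\<lambda>r y. r (G y)) ` R" if fg: "f \<in> (\<lambda>r y. r (G y)) ` R" "g \<in> (\<lambda>r y. r (G y)) ` R" for f g
    proof -
      obtain r r' where "r \<in> R" "r' \<in> R" "f = (\<lambda>y. r (G y))" "g = (\<lambda>y. r' (G y))" using fg by blast
      then show ?thesis using add[of r r'] by (intro image_eqI[of _ _ "\<lambda>x. r x + r' x"]) auto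
    qed
    show "(\<lambda>x. f x * g x) \<in> (\<lambda>r y. r (G y)) ` R" if fg: "f \<in> (\<lambda>r y. r (G y)) ` R" "g \<in> (\<lambda>r y. r (G y)) ` R" for f g
    proof -
      obtain r r' where "r \<in> R" "r' \<in> R" "f = (\<lambda>y. r (G y))" "g = (\<lambda>y. r' (G y))" using fg by blast
      then show ?thesis using mult[of r r'] by (intro image_eqI[of _ _ "\<lambda>x. r x * r' x"]) auto
    qed
    show "(\<lambda>_. c) \<in> (\<lambda>r y. r (G y)) ` R" for c using const[of c] by (intro image_eqI[of _ _ "\<lambda>x. c"]) auto
    show "\<exists>f\<in>(\<lambda>r y. r (G y)) ` R. f x \<noteq> f y" if xy: "x \<in> S" "y \<in> S" "x \<noteq> y" for x y
      using sep[OF GT[OF xy(1)] GT[OF xy(2)]] G(3)[OF xy(1)] G(3)[OF xy(2)] xy(3) by force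
  qed (use S cG c in auto)
  obtain F where "F \<in> (\<lambda>r y. r (G y)) ` R" "\<forall>y\<in>S. \<bar>f (G y) - F y\<bar> < e"
    using Stone_Weierstrass_basic[OF cG[OF f] e] by blast
  then obtain r where "r \<in> R" "\<forall>y\<in>S. \<bar>f (G y) - r (G y)\<bar> < e" by blast
  then show ?thesis using G(2) by (intro bexI[of _ r]) (auto simp: S_def)
qed

section \<open>Density\<close>

context lch_action
begin

interpretation ZK: lch_action Z \<kappa> by (rule KS_lch_action)

lemma Jf_tilde: "\<tau> \<in> KS_tilde X \<theta> \<Longrightarrow> Jf s f \<tau> = hv f (\<tau> (s\<^sup>\<star> * s))"
proof (cases "\<tau> \<in> topspace Z")
  case False
  assume "\<tau> \<in> KS_tilde X \<theta>"
  then have "\<tau> (s\<^sup>\<star> * s) = None" using False star_mult_idem(1) by (auto simp: Z_iff)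
  then show ?thesis using False by (simp add: Jf_def)
qed (simp add: Jf_def)

lemma evl_off: "\<tau> \<notin> topspace Z \<Longrightarrow> evl a \<tau> = 0"
  by (simp add: evl_def Jf_def)

text \<open>\<open>Z\<close> together with the point \<open>KS_infinity\<close>: the compact
  Hausdorff space on which the approximation theorem is applied, with compactly supported functions
  on \<open>Z\<close> extended by 0 (\<open>Fn_ZT\<close>).\<close>

definition ZT where "ZT = subtopology (KS_product X \<theta>) (KS_tilde X \<theta>)"

lemma topspace_ZT: "topspace ZT = KS_tilde X \<theta>"
  using KS_tilde_sub by (auto simp: ZT_def)

lemma compact_ZT: "compact_space ZT"
  using compactin_KS_tilde by (simp add: ZT_def compact_space_subtopology)

lemma Hausdorff_ZT: "Hausdorff_space ZT"
  by (simp add: ZT_def Hausdorff_space_subtopology Hausdorff_KS_product)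

lemma sub_ZT: "subtopology ZT (topspace Z) = Z"
proof -
  have "KS_tilde X \<theta> \<inter> (KS_tilde X \<theta> - {KS_infinity}) = KS_tilde X \<theta> - {KS_infinity}" by blast
  then show ?thesis unfolding topspace_Z ZT_def subtopology_subtopology by (simp only: KS_space_def)
qed

lemma openin_ZT: "openin ZT (topspace Z)"
  unfolding topspace_Z using Hausdorff_imp_t1_space[OF Hausdorff_ZT] topspace_ZT
  by (metis openin_topspace t1_space_openin_delete_alt)

lemma Fn_ZT: assumes h: "h \<in> Fn True Z (topspace Z)" shows "continuous_map ZT euclidean h"
proof (rule vanish_continuous[OF Hausdorff_ZT openin_ZT])
  show "continuous_map (subtopology ZT (topspace Z)) euclidean h" by (simp add: sub_ZT Fn_cont[OF h])
  obtain K where K: "compactin Z K" "K \<subseteq> topspace Z" "\<And>x. x \<notin> K \<Longrightarrow> h x = 0" using h Fn_True_support by metis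
  then have "compactin ZT K" by (metis compactin_subtopology sub_ZT)
  then show "vanish True ZT (topspace Z) h" using K by (auto simp: vanish_def)
qed

lemma KS_infinity_tilde: "KS_infinity \<in> KS_tilde X \<theta>"
  unfolding KS_tilde_iff by (simp add: KS_infinity_def)

lemma KS_infinity_not_Z: "KS_infinity \<notin> topspace Z"
  by (simp add: topspace_Z)

lemma sub_idem_mult: "a \<in> sub idempotents \<Longrightarrow> b \<in> sub idempotents \<Longrightarrow> amult (KS_algebraic X \<theta>) a b \<in> sub idempotents"
  by (rule sub_mult[OF _ _ idem_mult_closed])

lemma evl_dense_real:
  assumes h: "continuous_map ZT euclideanreal h" "h KS_infinity = 0" and d: "\<delta> > 0"
  shows "\<exists>b\<in>sub idempotents. \<forall>\<tau>\<in>topspace Z. cmod (evl b \<tau> - of_real (h \<tau>)) \<le> \<delta>"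
proof -
  define R where "R = {r. \<exists>b c. b \<in> sub idempotents \<and> (\<forall>\<tau>. evl b \<tau> \<in> \<real>) \<and> r = (\<lambda>\<tau>. c + Re (evl b \<tau>))}"
  have "\<exists>r\<in>R. \<forall>x\<in>topspace ZT. \<bar>h x - r x\<bar> < \<delta> / 2"
  proof (rule Stone_Weierstrass_compact_space[OF compact_ZT _ _ _ _ _ h(1)])
    show "continuous_map ZT euclideanreal r" if "r \<in> R" for r
    proof -
      obtain b c where b: "b \<in> sub idempotents" "r = (\<lambda>\<tau>. c + Re (evl b \<tau>))" using \<open>r \<in> R\<close> unfolding R_def by blast
      have "continuous_on UNIV (\<lambda>z. c + Re z)" by (intro continuous_intros)
      from continuous_map_comp_cont[OF Fn_ZT[OF evl_Fn_Z[OF sub_carr[OF b(1)]]] this] show ?thesis by (simp add: b(2))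
    qed
    show "(\<lambda>x. f x + g x) \<in> R" if fg: "f \<in> R" "g \<in> R" for f g
    proof -
      obtain b c where b: "b \<in> sub idempotents" "\<forall>\<tau>. evl b \<tau> \<in> \<real>" "f = (\<lambda>\<tau>. c + Re (evl b \<tau>))" using fg unfolding R_def by blast
      obtain b' c' where b': "b' \<in> sub idempotents" "\<forall>\<tau>. evl b' \<tau> \<in> \<real>" "g = (\<lambda>\<tau>. c' + Re (evl b' \<tau>))" using fg unfolding R_def by blast
      have "evl (\<lambda>s x. b s x + b' s x) \<tau> = evl b \<tau> + evl b' \<tau>" for \<tau> using evl_add b(1) b'(1) sub_carr by blast
      then show ?thesis unfolding R_def using b b'
        by (intro CollectI exI[of _ "\<lambda>s x. b s x + b' s x"] exI[of _ "c + c'"]) (auto simp: sub_add)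
    qed
    show "(\<lambda>x. f x * g x) \<in> R" if fg: "f \<in> R" "g \<in> R" for f g
    proof -
      obtain b c where b: "b \<in> sub idempotents" "\<forall>\<tau>. evl b \<tau> \<in> \<real>" "f = (\<lambda>\<tau>. c + Re (evl b \<tau>))" using fg unfolding R_def by blast
      obtain b' c' where b': "b' \<in> sub idempotents" "\<forall>\<tau>. evl b' \<tau> \<in> \<real>" "g = (\<lambda>\<tau>. c' + Re (evl b' \<tau>))" using fg unfolding R_def by blast
      let ?m = "amult (KS_algebraic X \<theta>) b b'"
      \<comment> \<open>Represents \<open>(c + evl b) * (c' + evl b')\<close> without its constant
        term \<open>c * c'\<close>.\<close>
      let ?k = "\<lambda>s x. (of_real c * b' s x + of_real c' * b s x) + ?m s x"
      have m: "?m \<in> sub idempotents" by (rule sub_idem_mult[OF b(1) b'(1)])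
      have k: "?k \<in> sub idempotents" by (intro sub_add sub_scale b(1) b'(1) m)
      have ek: "evl ?k \<tau> = of_real c * evl b' \<tau> + of_real c' * evl b \<tau> + evl b \<tau> * evl b' \<tau>" for \<tau>
        using evl_mult[OF sub_carr[OF b(1)] b'(1)] b(1) b'(1) m
        by (simp add: evl_add[of _ True] evl_scale[of _ True] sub_carr carr_add carr_scale)
      have "Re (evl b \<tau> * evl b' \<tau>) = Re (evl b \<tau>) * Re (evl b' \<tau>)" for \<tau>
        using b(2) by (simp add: complex_is_Real_iff)
      then have "f x * g x = c * c' + Re (evl ?k x)" for x
        unfolding ek b(3) b'(3) by (simp add: algebra_simps)
      moreover have "evl ?k \<tau> \<in> \<real>" for \<tau> unfolding ek using b(2) b'(2) by (intro Reals_add Reals_mult Reals_of_real) auto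
      ultimately show ?thesis unfolding R_def using k
        by (intro CollectI exI[of _ ?k] exI[of _ "c * c'"]) auto
    qed
    show "(\<lambda>x. c) \<in> R" for c unfolding R_def
      by (intro CollectI exI[of _ "\<lambda>s x. 0"] exI[of _ c]) auto
    have sep: "\<exists>r\<in>R. r \<tau> \<noteq> r \<sigma>" if ts: "\<tau> \<in> KS_tilde X \<theta>" "\<sigma> \<in> KS_tilde X \<theta>" "e \<in> idempotents" "\<tau> e = Some x" "\<sigma> e \<noteq> Some x" for \<tau> \<sigma> e x
    proof -
      \<comment> \<open>The value of \<open>\<sigma>\<close> is removed from \<open>dm e\<close>, so
        a bump in \<open>U\<close> that is 1 at \<open>x\<close> vanishes at
        \<open>\<sigma>\<close>, whether \<open>\<sigma> e\<close> is finite or not.\<close>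
      define U where "U = dm e - {y. \<sigma> e = Some y}"
      have xU: "x \<in> U" using tilde_dm[OF ts(1,3,4)] ts(5) by (simp add: U_def)
      have Uo: "openin X U"
      proof (cases "\<sigma> e")
        case (Some y)
        have "closedin X {y}" using Haus Some tilde_dm[OF ts(2,3)] dm_sub
          by (meson Hausdorff_imp_t1_space closedin_t1_singleton subsetD)
        then show ?thesis using Some openin_dm by (simp add: U_def openin_diff)
      qed (simp add: U_def openin_dm)
      obtain g :: "'x \<Rightarrow> real" where g: "(\<lambda>x. complex_of_real (g x)) \<in> Fn True X U" "g x = 1"
        using Urysohn_bump[OF LC Haus Uo, of "{x}"] xU openin_subset[OF Uo] by auto
      let ?g = "\<lambda>x. complex_of_real (g x)"
      have gd: "?g \<in> Fn True X (dm e)" using Fn_mono[OF g(1)] by (auto simp: U_def)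
      have "Jf e ?g \<rho> \<in> \<real>" for \<rho> by (cases "\<rho> (e\<^sup>\<star> * e)") (auto simp: Jf_def)
      then have "(\<lambda>\<tau>. 0 + Re (evl (delta e ?g) \<tau>)) \<in> R"
        unfolding R_def using sub_delta[OF gd ts(3)] by (intro CollectI exI[of _ "delta e ?g"] exI[of _ 0]) simp
      moreover have "Jf e ?g \<tau> = 1" using Jf_tilde[OF ts(1)] ts g by (simp add: idem_inv_star idem_self)
      moreover have "Jf e ?g \<sigma> = 0"
        using Jf_tilde[OF ts(2), of e ?g] ts(3) Fn_zero[OF g(1)] by (cases "\<sigma> e") (auto simp: idem_inv_star idem_self U_def)
      ultimately show ?thesis by (intro bexI[of _ "\<lambda>\<tau>. 0 + Re (evl (delta e ?g) \<tau>)"]) simp_all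
    qed
    show "\<exists>r\<in>R. r \<tau> \<noteq> r \<sigma>" if ts: "\<tau> \<in> topspace ZT" "\<sigma> \<in> topspace ZT" "\<tau> \<noteq> \<sigma>" for \<tau> \<sigma>
    proof -
      have T: "\<tau> \<in> KS_tilde X \<theta>" "\<sigma> \<in> KS_tilde X \<theta>" using ts by (auto simp: topspace_ZT)
      obtain e where e: "e \<in> idempotents" "\<tau> e \<noteq> \<sigma> e"
      proof -
        have "\<tau> \<in> extensional idempotents" "\<sigma> \<in> extensional idempotents" using T unfolding KS_tilde_iff by blast+
        then show ?thesis using that ts(3) extensionalityI by metis
      qed
      show ?thesis
      proof (cases "\<tau> e")
        case (Some x)
        then show ?thesis using sep[OF T e(1) Some] e(2) by auto
      next
        case None
        then obtain y where y: "\<sigma> e = Some y" using e(2) by (cases "\<sigma> e") auto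
        obtain r where "r \<in> R" "r \<sigma> \<noteq> r \<tau>" using sep[OF T(2,1) e(1) y] None by auto
        then show ?thesis by metis
      qed
    qed
  qed (use d in simp)
  then obtain b c where b: "b \<in> sub idempotents" "\<forall>\<tau>. evl b \<tau> \<in> \<real>"
    and bh: "\<And>\<tau>. \<tau> \<in> KS_tilde X \<theta> \<Longrightarrow> \<bar>h \<tau> - (c + Re (evl b \<tau>))\<bar> < \<delta> / 2"
    unfolding R_def topspace_ZT by auto
  have "\<bar>c\<bar> < \<delta> / 2" using bh[OF KS_infinity_tilde] h(2) evl_off[OF KS_infinity_not_Z] by simp
  then have r: "\<bar>Re (evl b \<tau>) - h \<tau>\<bar> \<le> \<delta>" if "\<tau> \<in> topspace Z" for \<tau> using bh[OF Z_tilde[OF that]] by linarith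
  have "cmod (evl b \<tau> - of_real (h \<tau>)) \<le> \<delta>" if "\<tau> \<in> topspace Z" for \<tau>
  proof -
    have "evl b \<tau> - of_real (h \<tau>) = of_real (Re (evl b \<tau>) - h \<tau>)" using b(2) by (simp add: complex_eq_iff complex_is_Real_iff)
    then show ?thesis using r[OF that] by (simp only: norm_of_real)
  qed
  then show ?thesis using b(1) by blast
qed

lemma evl_dense:
  assumes h: "h \<in> Fn True Z (topspace Z)" and d: "\<delta> > 0"
  shows "\<exists>b\<in>sub idempotents. \<forall>\<tau>. cmod (evl b \<tau> - h \<tau>) \<le> \<delta>"
proof -
  have d2: "\<delta> / 2 > 0" using d by simp
  have hc: "continuous_map ZT euclidean h" by (rule Fn_ZT[OF h])
  have h0: "h KS_infinity = 0" by (rule Fn_zero[OF h KS_infinity_not_Z])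
  have R: "continuous_map ZT euclideanreal (\<lambda>\<tau>. Re (h \<tau>))"
    by (rule continuous_map_comp_cont[OF hc]) (intro continuous_intros)
  have I: "continuous_map ZT euclideanreal (\<lambda>\<tau>. Im (h \<tau>))"
    by (rule continuous_map_comp_cont[OF hc]) (intro continuous_intros)
  obtain b where b: "b \<in> sub idempotents" "\<And>\<tau>. \<tau> \<in> topspace Z \<Longrightarrow> cmod (evl b \<tau> - of_real (Re (h \<tau>))) \<le> \<delta> / 2"
    using evl_dense_real[OF R _ d2] h0 by auto
  obtain b' where b': "b' \<in> sub idempotents" "\<And>\<tau>. \<tau> \<in> topspace Z \<Longrightarrow> cmod (evl b' \<tau> - of_real (Im (h \<tau>))) \<le> \<delta> / 2"
    using evl_dense_real[OF I _ d2] h0 by auto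
  let ?b = "\<lambda>s x. b s x + \<i> * b' s x"
  have "?b \<in> sub idempotents" by (intro sub_add sub_scale b b')
  moreover have "cmod (evl ?b \<tau> - h \<tau>) \<le> \<delta>" for \<tau>
  proof (cases "\<tau> \<in> topspace Z")
    case True
    have eb: "evl ?b \<tau> = evl b \<tau> + \<i> * evl b' \<tau>"
      using evl_add[OF sub_carr[OF b(1)] carr_scale[OF sub_carr[OF b'(1)]]] evl_scale[OF sub_carr[OF b'(1)]] by simp
    have "evl ?b \<tau> - h \<tau> = (evl b \<tau> - of_real (Re (h \<tau>))) + \<i> * (evl b' \<tau> - of_real (Im (h \<tau>)))"
      using complex_eq[of "h \<tau>"] unfolding eb by (simp add: algebra_simps)
    also have "cmod \<dots> \<le> \<delta> / 2 + \<delta> / 2"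
      by (rule order_trans[OF norm_triangle_ineq]) (use b(2)[OF True] b'(2)[OF True] in \<open>simp add: norm_mult\<close>)
    finally show ?thesis by simp
  qed (use evl_off Fn_zero[OF h] d in simp)
  ultimately show ?thesis by blast
qed

lemma cont_the: assumes e: "e \<in> idempotents" shows "continuous_map (subtopology Z (KS_dom X \<theta> e)) X (\<lambda>\<tau>. the (\<tau> e))"
  unfolding continuous_map_def
proof (intro conjI allI impI)
  have td: "\<tau> e = Some (the (\<tau> e)) \<and> the (\<tau> e) \<in> dm e" if "\<tau> \<in> topspace (subtopology Z (KS_dom X \<theta> e))" for \<tau>
    using that tilde_dm[OF Z_tilde e] by (auto simp: KS_dom_iff)
  then show "(\<lambda>\<tau>. the (\<tau> e)) \<in> topspace (subtopology Z (KS_dom X \<theta> e)) \<rightarrow> topspace X" using dm_sub by blast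
  fix U assume U: "openin X U"
  have "continuous_map (KS_product X \<theta>) (Alexandroff_compactification (subtopology X (dm e))) (\<lambda>\<tau>. \<tau> e)"
    unfolding KS_product_def act_dom_sub[OF e, symmetric] by (rule continuous_map_product_projection[OF e])
  then have "continuous_map (subtopology Z (KS_dom X \<theta> e)) (Alexandroff_compactification (subtopology X (dm e))) (\<lambda>\<tau>. \<tau> e)"
    unfolding KS_space_def by (intro continuous_map_from_subtopology)
  moreover have "openin (Alexandroff_compactification (subtopology X (dm e))) (Some ` (U \<inter> dm e))"
    using U by (simp add: openin_subtopology_Int)
  ultimately have "openin (subtopology Z (KS_dom X \<theta> e)) {\<tau> \<in> topspace (subtopology Z (KS_dom X \<theta> e)). \<tau> e \<in> Some ` (U \<inter> dm e)}"
    by (rule openin_continuous_map_preimage)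
  moreover have "{\<tau> \<in> topspace (subtopology Z (KS_dom X \<theta> e)). \<tau> e \<in> Some ` (U \<inter> dm e)}
      = {\<tau> \<in> topspace (subtopology Z (KS_dom X \<theta> e)). the (\<tau> e) \<in> U}"
  proof (intro Collect_cong conj_cong refl)
    fix \<tau> assume "\<tau> \<in> topspace (subtopology Z (KS_dom X \<theta> e))"
    from td[OF this] obtain x where "\<tau> e = Some x" "x \<in> dm e" by auto
    then show "\<tau> e \<in> Some ` (U \<inter> dm e) \<longleftrightarrow> the (\<tau> e) \<in> U" by auto
  qed
  ultimately show "openin (subtopology Z (KS_dom X \<theta> e)) {\<tau> \<in> topspace (subtopology Z (KS_dom X \<theta> e)). the (\<tau> e) \<in> U}" by simp
qed

text \<open>An approximant \<open>b\<close> on idempotents is brought below \<open>t\<close> by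
  multiplying with \<open>delta t g\<close>, where \<open>g = 1\<close> on the values at
  \<open>t\<^sup>\<star> * t\<close> of the points in the support of \<open>h\<close>. This factor
  fixes \<open>h\<close>, and the error does not grow because
  \<open>0 \<le> g \<le> 1\<close>.\<close>

lemma down_dense:
  assumes h: "h \<in> Fn True Z (ZK.dm t)" and d: "\<delta> > 0"
  shows "\<exists>b\<in>sub (down t). \<forall>\<tau>. cmod (evl b \<tau> - h \<tau>) \<le> \<delta>"
proof -
  obtain K where K: "compactin Z K" "K \<subseteq> ZK.dm t" "\<And>\<tau>. \<tau> \<notin> K \<Longrightarrow> h \<tau> = 0" using h Fn_True_support by metis
  let ?L = "(\<lambda>\<tau>. the (\<tau> (t\<^sup>\<star> * t))) ` K"
  have "compactin (subtopology Z (KS_dom X \<theta> (t\<^sup>\<star> * t))) K" using K by (simp add: compactin_subtopology ZK_dm)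
  then have L: "compactin X ?L" using image_compactin cont_the[OF star_mult_idem(1)] by blast
  have Ld: "?L \<subseteq> dm t"
  proof
    fix x assume "x \<in> ?L"
    then obtain \<tau> where t: "\<tau> \<in> ZK.dm t" "x = the (\<tau> (t\<^sup>\<star> * t))" using K(2) by blast
    then have "\<tau> (t\<^sup>\<star> * t) = Some x" "\<tau> \<in> KS_tilde X \<theta>" by (auto simp: ZK_dm_iff Z_tilde)
    then show "x \<in> dm t" using tilde_dm[of \<tau> "t\<^sup>\<star> * t" x] dm_star_self[of t] by simp
  qed
  obtain g :: "'x \<Rightarrow> real" where g: "(\<lambda>x. complex_of_real (g x)) \<in> Fn True X (dm t)" "\<And>x. 0 \<le> g x \<and> g x \<le> 1" "\<And>x. x \<in> ?L \<Longrightarrow> g x = 1"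
    using Urysohn_bump[OF LC Haus openin_dm L Ld] by blast
  let ?g = "\<lambda>x. complex_of_real (g x)"
  have hZ: "h \<in> Fn True Z (topspace Z)" using Fn_mono[OF h] ZK.dm_sub by blast
  obtain b where b: "b \<in> sub idempotents" "\<And>\<tau>. cmod (evl b \<tau> - h \<tau>) \<le> \<delta>" using evl_dense[OF hZ d] by blast
  let ?b = "amult (KS_algebraic X \<theta>) (delta t ?g) b"
  have dg: "delta t ?g \<in> sub {t}" by (rule sub_delta[OF g(1)]) simp
  have "?b \<in> sub (down t)" by (rule sub_mult[OF dg b(1)]) (auto simp: down_def natural_le_mult_idem)
  moreover have "cmod (evl ?b \<tau> - h \<tau>) \<le> \<delta>" for \<tau>
  proof -
    have eb: "evl ?b \<tau> = Jf t ?g \<tau> * evl b \<tau>" using evl_mult[OF sub_carr[OF dg] b(1)] by simp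
    have "Jf t ?g \<tau> * h \<tau> = h \<tau>"
    proof (cases "\<tau> \<in> K")
      case True
      then have "\<tau> \<in> ZK.dm t" using K(2) by blast
      then obtain x where x: "\<tau> (t\<^sup>\<star> * t) = Some x" "\<tau> \<in> topspace Z" by (auto simp: ZK_dm_iff)
      then have "g x = 1" using g(3) True by force
      then show ?thesis using x by (simp add: Jf_def)
    qed (use K(3) in simp)
    then have "evl ?b \<tau> - h \<tau> = Jf t ?g \<tau> * (evl b \<tau> - h \<tau>)" unfolding eb by (simp add: algebra_simps)
    moreover have "cmod (Jf t ?g \<tau>) \<le> 1" using Jf_le[OF g(1), of 1] g(2) by simp
    ultimately show ?thesis using b(2)[of \<tau>] mult_mono[of "cmod (Jf t ?g \<tau>)" 1 "cmod (evl b \<tau> - h \<tau>)" \<delta>] d by (simp add: norm_mult)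
  qed
  ultimately show ?thesis by blast
qed

section \<open>Seminorms read off from the groupoid, and density of the image\<close>

lemma approx_family:
  assumes c: "c \<in> ZK.carr True" and d: "\<delta> > 0"
  shows "\<exists>b. \<forall>t. b t \<in> sub (down t) \<and> (\<forall>\<tau>. cmod (evl (b t) \<tau> - c t \<tau>) \<le> \<delta>)"
  using down_dense[OF ZK.carr_Fn[OF c] d] by metis

lemma Qm_phi_diff_le:
  assumes b: "b \<in> sub (down t)" and h: "\<And>\<tau>. cmod (evl b \<tau> - h \<tau>) \<le> \<delta>" shows "cmod (ZK.br t h \<gamma> - phi b \<gamma>) \<le> \<delta>"
proof (cases "\<gamma> \<in> ZK.arr")
  case True
  then obtain u \<tau> where u: "\<tau> \<in> ZK.dm u" "\<gamma> = germ \<kappa> u \<tau>" by (rule ZK.arr_cases)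
  show ?thesis using h[of \<tau>] order_trans[OF norm_ge_zero h[of \<tau>]]
    by (simp add: u(2) phi_down[OF b u(1)] ZK.br_germ[OF u(1)] norm_minus_commute)
qed (use order_trans[OF norm_ge_zero h] in \<open>simp add: phi_off ZK.br_off\<close>)

text \<open>The components of \<open>c\<close> are approximated within \<open>\<delta>\<close> by
  elements \<open>b t\<close> below \<open>t\<close>. By \<open>seminorm_down\<close> the sum of the
  \<open>b t\<close> has seminorm at most \<open>nsum c\<close> plus a multiple of
  \<open>\<delta>\<close>. The difference of \<open>a\<close> and this sum is uniformly small under
  \<open>phi\<close>, so \<open>seminorm_sum_down\<close> bounds it by another multiple of
  \<open>\<delta>\<close>. Neither factor depends on \<open>\<delta>\<close>.\<close>

lemma seminorm_le_nsum_phi: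
  assumes p: "cstar_seminorm (Al True) p" and a: "a \<in> carr True" and c: "c \<in> ZK.carr True" and ac: "phi a = ZK.Qm c"
  shows "p a \<le> nsum c"
proof -
  interpret seminormed_star_algebra "Al True" p
    using alg_star_algebra p by (simp add: seminormed_star_algebra_def seminormed_star_algebra_axioms_def)
  \<comment> \<open>Both supports are included, so that \<open>a\<close> and \<open>c\<close> can be
    compared index by index.\<close>
  let ?T = "{s. a s \<noteq> (\<lambda>x. 0)} \<union> {s. c s \<noteq> (\<lambda>x. 0)}"
  have T: "finite ?T" using carr_fin[OF a] ZK.carr_fin[OF c] by blast
  let ?n = "real (card ?T)"
  obtain C where C: "C \<ge> 0" "\<And>a M. M > 0 \<Longrightarrow> (\<And>t. t \<in> ?T \<Longrightarrow> a t \<in> sub (down t)) \<Longrightarrow>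
      (\<And>\<gamma>. cmod (\<Sum>t\<in>?T. phi (a t) \<gamma>) \<le> M) \<Longrightarrow> p (\<lambda>s x. \<Sum>t\<in>?T. a t s x) \<le> C * M"
    using seminorm_sum_down[OF p T] by blast
  have "p a \<le> nsum c + (?n + C * (?n + 1)) * \<delta>" if d: "\<delta> > 0" for \<delta>
  proof -
    obtain b where b: "\<And>t. b t \<in> sub (down t)" "\<And>t \<tau>. cmod (evl (b t) \<tau> - c t \<tau>) \<le> \<delta>"
      using approx_family[OF c d] by blast
    have at: "delta t (a t) \<in> sub (down t)" for t
      by (rule sub_delta[OF carr_Fn[OF a]]) (simp add: down_def natural_le_refl)
    let ?d = "\<lambda>t s x. delta t (a t) s x - b t s x"
    have dt: "?d t \<in> sub (down t)" for t by (rule sub_diff[OF at b(1)])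
    have asum: "(\<lambda>s x. \<Sum>t\<in>?T. delta t (a t) s x) = a"
    proof (intro ext)
      fix s x
      have "(\<Sum>t\<in>?T. delta t (a t) s x) = (\<Sum>t\<in>?T. if t = s then a s x else 0)"
        by (rule sum.cong) (auto simp: delta_def)
      also have "\<dots> = a s x" using T by (auto simp: fun_eq_iff)
      finally show "(\<Sum>t\<in>?T. delta t (a t) s x) = a s x" .
    qed
    have bs: "(\<lambda>s x. \<Sum>t\<in>?T. b t s x) \<in> carr True" using b(1) sub_carr T by (intro carr_sum) auto
    have ds: "(\<lambda>s x. \<Sum>t\<in>?T. ?d t s x) = (\<lambda>s x. a s x - (\<Sum>t\<in>?T. b t s x))"
      using asum by (simp add: sum_subtractf fun_eq_iff)
    \<comment> \<open>The factor \<open>?n + 1\<close> instead of \<open>?n\<close> keeps the bound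
      positive when \<open>?T\<close> is empty, as \<open>C(2)\<close> requires.\<close>
    have "cmod (\<Sum>t\<in>?T. phi (?d t) \<gamma>) \<le> (?n + 1) * \<delta>" for \<gamma>
    proof -
      have "(\<Sum>t\<in>?T. phi (?d t) \<gamma>) = phi (\<lambda>s x. \<Sum>t\<in>?T. ?d t s x) \<gamma>"
        using phi_sum[OF T, of ?d, OF sub_carr[OF dt]] by simp
      also have "\<dots> = phi a \<gamma> - (\<Sum>t\<in>?T. phi (b t) \<gamma>)"
      proof -
        have "phi (\<lambda>s x. (a s x - (\<Sum>t\<in>?T. b t s x)) + (\<Sum>t\<in>?T. b t s x)) \<gamma> =
            phi (\<lambda>s x. a s x - (\<Sum>t\<in>?T. b t s x)) \<gamma> + phi (\<lambda>s x. \<Sum>t\<in>?T. b t s x) \<gamma>"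
          using phi_add[OF carr_diff[OF a bs] bs] by simp
        then show ?thesis unfolding ds using phi_sum[OF T, of b, OF sub_carr[OF b(1)]] by simp
      qed
      also have "phi a \<gamma> = (\<Sum>t\<in>?T. ZK.br t (c t) \<gamma>)" unfolding ac by (rule ZK.Qm_eq[OF T]) blast
      also have "\<dots> - (\<Sum>t\<in>?T. phi (b t) \<gamma>) = (\<Sum>t\<in>?T. ZK.br t (c t) \<gamma> - phi (b t) \<gamma>)" by (simp add: sum_subtractf)
      also have "cmod \<dots> \<le> (\<Sum>t\<in>?T. \<delta>)" by (rule sum_norm_le) (rule Qm_phi_diff_le[OF b])
      finally show ?thesis using d by (simp add: algebra_simps)
    qed
    then have 1: "p (\<lambda>s x. a s x - (\<Sum>t\<in>?T. b t s x)) \<le> C * ((?n + 1) * \<delta>)"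
      using C(2)[of "(?n + 1) * \<delta>" ?d] dt d unfolding ds by simp
    have "p (\<lambda>s x. \<Sum>t\<in>F. b t s x) \<le> (\<Sum>t\<in>F. snorm (c t) + \<delta>)" if "finite F" for F
      using that
    proof (induction F rule: finite_induct)
      case (insert t F)
      have "p (b t) \<le> snorm (c t) + \<delta>"
      proof (rule seminorm_down[OF p b(1)])
        fix \<tau> show "cmod (evl (b t) \<tau>) \<le> snorm (c t) + \<delta>"
          using norm_triangle_sub[of "evl (b t) \<tau>" "c t \<tau>"] b(2)[of t \<tau>] snorm_upper[OF ZK.carr_Fn[OF c], of t \<tau>] by linarith
      qed
      moreover have "(\<lambda>s x. \<Sum>t\<in>F. b t s x) \<in> carr True" using b(1) sub_carr insert by (intro carr_sum) auto
      ultimately show ?case using q_add[OF sub_carr[OF b(1)], of "\<lambda>s x. \<Sum>t\<in>F. b t s x" t] insert by simp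
    qed (use q_zero in simp)
    from this[OF T] have 2: "p (\<lambda>s x. \<Sum>t\<in>?T. b t s x) \<le> nsum c + ?n * \<delta>"
      using nsum_eq[OF T, of c] by (simp add: sum.distrib)
    have "p a \<le> p (\<lambda>s x. a s x - (\<Sum>t\<in>?T. b t s x)) + p (\<lambda>s x. \<Sum>t\<in>?T. b t s x)"
      using q_add[OF carr_diff[OF a bs] bs] by simp
    then show ?thesis using 1 2 by (simp add: algebra_simps)
  qed
  note le = this
  show ?thesis
  proof (rule field_le_epsilon)
    fix \<epsilon> :: real assume e: "\<epsilon> > 0"
    let ?A = "?n + C * (?n + 1)"
    have A: "?A \<ge> 0" using C(1) by simp
    have "?A * (\<epsilon> / (?A + 1)) \<le> \<epsilon>" using A e by (simp add: field_simps)
    moreover have "p a \<le> nsum c + ?A * (\<epsilon> / (?A + 1))" using le[of "\<epsilon> / (?A + 1)"] e A by simp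
    ultimately show "p a \<le> nsum c + \<epsilon>" by linarith
  qed
qed

text \<open>\<open>phi (b t)\<close> is the function on the bisection of \<open>t\<close> with
  coefficient \<open>evl (b t)\<close>, so the error is represented by the components
  \<open>c t - evl (b t)\<close> and is small in the sum of the sup norms, not only
  uniformly.\<close>

lemma phi_dense:
  assumes c: "c \<in> ZK.carr True" and e: "\<epsilon> > 0"
  shows "\<exists>a\<in>carr True. \<exists>d\<in>ZK.carr True. nsum d \<le> \<epsilon> \<and> ZK.Qm d = (\<lambda>\<gamma>. ZK.Qm c \<gamma> - phi a \<gamma>)"
proof -
  let ?T = "{s. c s \<noteq> (\<lambda>x. 0)}"
  have T: "finite ?T" using ZK.carr_fin[OF c] .
  let ?n = "real (card ?T)"
  define \<delta> where "\<delta> = \<epsilon> / (?n + 1)"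
  have d: "\<delta> > 0" using e by (simp add: \<delta>_def add_nonneg_pos)
  obtain b where b: "\<And>t. b t \<in> sub (down t)" "\<And>t \<tau>. cmod (evl (b t) \<tau> - c t \<tau>) \<le> \<delta>"
    using approx_family[OF c d] by blast
  define g where "g t = (if t \<in> ?T then (\<lambda>\<tau>. c t \<tau> - evl (b t) \<tau>) else (\<lambda>\<tau>. 0))" for t
  have eb: "evl (b t) \<in> Fn True Z (ZK.dm t)" for t
    by (rule evl_Fn[OF b(1)]) (use ZK.natural_le_dm in \<open>auto simp: down_def\<close>)
  have gT: "{t. g t \<noteq> (\<lambda>\<tau>. 0)} \<subseteq> ?T" by (auto simp: g_def)
  have gc: "g \<in> ZK.carr True"
    unfolding ZK.carr_iff using finite_subset[OF gT T] Fn_diff[OF ZK.carr_Fn[OF c] eb] by (auto simp: g_def)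
  have "nsum g = (\<Sum>t\<in>?T. snorm (g t))" by (rule nsum_eq[OF T gT])
  also have "\<dots> \<le> (\<Sum>t\<in>?T. \<delta>)"
    using b(2) by (intro sum_mono snorm_least) (simp add: g_def norm_minus_commute)
  also have "\<dots> \<le> \<epsilon>" using e by (simp add: \<delta>_def field_simps)
  finally have 1: "nsum g \<le> \<epsilon>" .
  have a: "(\<lambda>s x. \<Sum>t\<in>?T. b t s x) \<in> carr True" using b(1) sub_carr T by (intro carr_sum) auto
  have "ZK.Qm g \<gamma> = ZK.Qm c \<gamma> - phi (\<lambda>s x. \<Sum>t\<in>?T. b t s x) \<gamma>" for \<gamma>
  proof -
    have ph: "phi (b t) \<gamma> = ZK.br t (evl (b t)) \<gamma>" for t
    proof (cases "\<gamma> \<in> ZK.arr")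
      case True
      then obtain u \<tau> where u: "\<tau> \<in> ZK.dm u" "\<gamma> = germ \<kappa> u \<tau>" by (rule ZK.arr_cases)
      then show ?thesis by (simp add: phi_down[OF b(1)] ZK.br_germ)
    qed (simp add: phi_off ZK.br_off)
    have "ZK.Qm g \<gamma> = (\<Sum>t\<in>?T. ZK.br t (g t) \<gamma>)" by (rule ZK.Qm_eq[OF T gT])
    also have "\<dots> = (\<Sum>t\<in>?T. ZK.br t (c t) \<gamma> - phi (b t) \<gamma>)"
      by (rule sum.cong) (auto simp: g_def ZK.br_def ph)
    also have "\<dots> = ZK.Qm c \<gamma> - phi (\<lambda>s x. \<Sum>t\<in>?T. b t s x) \<gamma>"
      using phi_sum[OF T, of b, OF sub_carr[OF b(1)]] by (simp add: sum_subtractf ZK.Qm_def)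
    finally show ?thesis .
  qed
  then show ?thesis using 1 a gc by blast
qed

text \<open>Off the compact \<open>K\<close> where the bump \<open>g\<close> is 1, \<open>f\<close>
  is below \<open>\<epsilon>\<close>, and so is its product with \<open>1 - g\<close>; on
  \<open>K\<close> nothing is lost.\<close>

lemma Cc_dense_C0:
  assumes "a \<in> carr False" and e: "\<epsilon> > 0" shows "\<exists>b\<in>carr True. nsum (\<lambda>s x. a s x - b s x) \<le> \<epsilon>"
proof -
  have "\<forall>\<epsilon>>0. \<exists>b\<in>carr True. nsum (\<lambda>s x. a s x - b s x) \<le> \<epsilon>"
    using assms(1)
  proof (induction rule: alg_induct)
    case zero
    show ?case by (auto intro!: bexI[of _ "\<lambda>s x. 0"])
  next
    case (add a a')
    show ?case
    proof (intro allI impI)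
      fix \<epsilon> :: real assume "\<epsilon> > 0"
      then have e: "\<epsilon> / 2 > 0" by simp
      obtain b where b: "b \<in> carr True" "nsum (\<lambda>s x. a s x - b s x) \<le> \<epsilon> / 2" using add e by blast
      obtain b' where b': "b' \<in> carr True" "nsum (\<lambda>s x. a' s x - b' s x) \<le> \<epsilon> / 2" using add e by blast
      have "(\<lambda>s x. (a s x + a' s x) - (b s x + b' s x)) = (\<lambda>s x. (a s x - b s x) + (a' s x - b' s x))"
        by (simp add: fun_eq_iff algebra_simps)
      then have "nsum (\<lambda>s x. (a s x + a' s x) - (b s x + b' s x)) \<le> \<epsilon>"
        using nsum_add[OF carr_diff[OF add(1) carr_True[OF b(1)]] carr_diff[OF add(2) carr_True[OF b'(1)]]] b(2) b'(2) by simp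
      then show "\<exists>b\<in>carr True. nsum (\<lambda>s x. (a s x + a' s x) - b s x) \<le> \<epsilon>" by (intro bexI[OF _ carr_add[OF b(1) b'(1)]])
    qed
  next
    case (delta s f)
    show ?case
    proof (intro allI impI)
      fix \<epsilon> :: real assume e: "\<epsilon> > 0"
      obtain K where K: "compactin X K" "K \<subseteq> dm s" "\<And>x. x \<notin> K \<Longrightarrow> cmod (f x) < \<epsilon>" using FnD[OF delta e] by auto
      obtain g :: "'x \<Rightarrow> real" where g: "(\<lambda>x. complex_of_real (g x)) \<in> Fn True X (dm s)" "\<And>x. 0 \<le> g x \<and> g x \<le> 1" "\<And>x. x \<in> K \<Longrightarrow> g x = 1"
        using Urysohn_bump[OF LC Haus openin_dm K(1,2)] by blast
      obtain M where M: "\<And>x. cmod (f x) \<le> M" using Fn_bounded[OF delta] by blast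
      have "(\<lambda>x. f x * of_real (g x)) \<in> Fn True X (dm s)" by (rule Fn_mult_bounded[OF g(1) Fn_cont[OF delta] M])
      then have b: "delta s (\<lambda>x. f x * of_real (g x)) \<in> carr True" by (rule delta_carr)
      have "cmod (f x - f x * of_real (g x)) \<le> \<epsilon>" for x
      proof (cases "x \<in> K")
        case False
        have "f x - f x * of_real (g x) = f x * of_real (1 - g x)" by (simp add: algebra_simps)
        then have "cmod (f x - f x * of_real (g x)) = cmod (f x) * \<bar>1 - g x\<bar>" by (simp only: norm_mult norm_of_real)
        also have "\<dots> \<le> \<epsilon> * 1" using K(3)[OF False] g(2)[of x] e by (intro mult_mono) auto
        finally show ?thesis by simp
      qed (use g(3) e in simp)
      then have "snorm (\<lambda>x. f x - f x * of_real (g x)) \<le> \<epsilon>" by (rule snorm_least)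
      moreover have "(\<lambda>t x. delta s f t x - delta s (\<lambda>x. f x * of_real (g x)) t x) = delta s (\<lambda>x. f x - f x * of_real (g x))"
        by (auto simp: delta_def fun_eq_iff)
      ultimately show "\<exists>b\<in>carr True. nsum (\<lambda>t x. delta s f t x - b t x) \<le> \<epsilon>" using b by (auto simp: nsum_delta intro!: bexI[OF _ b])
    qed
  qed
  then show ?thesis using e by blast
qed

end

section \<open>Extending homomorphisms by continuity\<close>

lemma star_hom_comp: "star_hom A B f \<Longrightarrow> star_hom B C g \<Longrightarrow> star_hom A C (\<lambda>a. g (f a))"
  by (simp add: star_hom_def)

lemma star_hom_diff: "star_hom A B f \<Longrightarrow> star_algebra A \<Longrightarrow> a \<in> acarrier A \<Longrightarrow> b \<in> acarrier A \<Longrightarrow> f (adiff A a b) = adiff B (f a) (f b)"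
  by (simp add: star_hom_def adiff_def star_algebra.scale_closed)

text \<open>\<open>sm b r\<close> expresses that \<open>\<parallel>b\<parallel> \<le> r\<close> for a submultiplicative seminorm that need not be a C*-seminorm;
  a relation is used because the seminorm of interest is a quotient seminorm.\<close>

locale dense_hom =
  A: star_algebra A + B: star_algebra B + D: cstar_algebra D
  for A :: "('a, 'k) star_alg_scheme" and B :: "('b, 'm) star_alg_scheme" and D :: "('d, 'n) cstar_alg_scheme" +
  fixes j :: "'a \<Rightarrow> 'b" and sm :: "'b \<Rightarrow> real \<Rightarrow> bool"
  assumes j: "star_hom A B j"
    and sm_ex: "b \<in> acarrier B \<Longrightarrow> \<exists>r. sm b r"
    and sm_nonneg: "b \<in> acarrier B \<Longrightarrow> sm b r \<Longrightarrow> 0 \<le> r"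
    and sm_add: "b \<in> acarrier B \<Longrightarrow> b' \<in> acarrier B \<Longrightarrow> sm b r \<Longrightarrow> sm b' r' \<Longrightarrow> sm (aadd B b b') (r + r')"
    and sm_mult: "b \<in> acarrier B \<Longrightarrow> b' \<in> acarrier B \<Longrightarrow> sm b r \<Longrightarrow> sm b' r' \<Longrightarrow> sm (amult B b b') (r * r')"
    and sm_scale: "b \<in> acarrier B \<Longrightarrow> sm b r \<Longrightarrow> sm (ascale B k b) (cmod k * r)"
    and sm_star: "b \<in> acarrier B \<Longrightarrow> sm b r \<Longrightarrow> sm (astar B b) r"
    and dense: "b \<in> acarrier B \<Longrightarrow> \<epsilon> > 0 \<Longrightarrow> \<exists>a\<in>acarrier A. sm (adiff B b (j a)) \<epsilon>"
begin

sublocale DN: seminormed_star_algebra D "anorm D"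
  by unfold_locales (rule D.norm_seminorm)

lemma jc: "a \<in> acarrier A \<Longrightarrow> j a \<in> acarrier B"
  using j by (simp add: star_hom_def)

lemma sm_diff: "b \<in> acarrier B \<Longrightarrow> b' \<in> acarrier B \<Longrightarrow> sm b r \<Longrightarrow> sm b' r' \<Longrightarrow> sm (adiff B b b') (r + r')"
  using sm_add[of b "ascale B (-1) b'" r r'] sm_scale[of b' r' "-1"] by (simp add: adiff_def B.scale_closed)

lemma D_eqI: assumes "x \<in> acarrier D" "y \<in> acarrier D" "\<And>\<epsilon>. \<epsilon> > 0 \<Longrightarrow> anorm D (adiff D x y) \<le> \<epsilon>" shows "x = y"
proof -
  have "anorm D (adiff D x y) \<le> 0" by (rule field_le_epsilon) (use assms(3) in simp)
  then have "adiff D x y = azero D"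
    using assms DN.q_nonneg[of "adiff D x y"] by (intro D.norm_eq_zero) (auto simp: D.diff_closed)
  then show ?thesis using assms D.diff_zero_iff by blast
qed

lemma hom_unique:
  assumes r: "star_hom B D \<rho>" "\<And>b r. b \<in> acarrier B \<Longrightarrow> sm b r \<Longrightarrow> anorm D (\<rho> b) \<le> r"
    and r': "star_hom B D \<rho>'" "\<And>b r. b \<in> acarrier B \<Longrightarrow> sm b r \<Longrightarrow> anorm D (\<rho>' b) \<le> r"
    and eq: "\<And>a. a \<in> acarrier A \<Longrightarrow> \<rho> (j a) = \<rho>' (j a)" and b: "b \<in> acarrier B"
  shows "\<rho> b = \<rho>' b"
proof (rule D_eqI)
  show c: "\<rho> b \<in> acarrier D" "\<rho>' b \<in> acarrier D" using r(1) r'(1) b by (auto simp: star_hom_def)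
  fix \<epsilon> :: real assume "\<epsilon> > 0"
  then have e: "\<epsilon> / 2 > 0" by simp
  obtain a where a: "a \<in> acarrier A" "sm (adiff B b (j a)) (\<epsilon> / 2)" using dense[OF b e] by blast
  have ja: "j a \<in> acarrier B" using jc a by blast
  have d: "adiff B b (j a) \<in> acarrier B" using b ja B.diff_closed by blast
  have cj: "\<rho>' (j a) \<in> acarrier D" using r'(1) ja by (auto simp: star_hom_def)
  have "anorm D (adiff D (\<rho> b) (\<rho>' (j a))) \<le> \<epsilon> / 2"
    using r(2)[OF d a(2)] star_hom_diff[OF r(1) B.star_algebra_axioms b ja] eq[OF a(1)] by simp
  moreover have "anorm D (adiff D (\<rho>' b) (\<rho>' (j a))) \<le> \<epsilon> / 2"
    using r'(2)[OF d a(2)] star_hom_diff[OF r'(1) B.star_algebra_axioms b ja] by simp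
  ultimately show "anorm D (adiff D (\<rho> b) (\<rho>' b)) \<le> \<epsilon>"
    using DN.q_trans[OF c(1) cj c(2)] DN.q_swap[OF c(2) cj] by linarith
qed

text \<open>The value at \<open>b\<close> is characterized by \<open>lim\<close>: its distance to
  \<open>\<pi> a\<close> is at most every bound of \<open>b - j a\<close>. Each algebraic law then
  follows by approximating the arguments, since both of its sides are close to the same
  \<open>\<pi> a\<close>.\<close>

lemma hom_extend:
  assumes p: "star_hom A D \<pi>" and le: "\<And>a r. a \<in> acarrier A \<Longrightarrow> sm (j a) r \<Longrightarrow> anorm D (\<pi> a) \<le> r"
  shows "\<exists>\<rho>. star_hom B D \<rho> \<and> (\<forall>a\<in>acarrier A. \<rho> (j a) = \<pi> a) \<and> (\<forall>b\<in>acarrier B. \<forall>r. sm b r \<longrightarrow> anorm D (\<rho> b) \<le> r)"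
proof -
  have pc: "\<pi> a \<in> acarrier D" if "a \<in> acarrier A" for a using p that by (simp add: star_hom_def)
  have dist: "anorm D (adiff D (\<pi> a) (\<pi> a')) \<le> r" if a: "a \<in> acarrier A" "a' \<in> acarrier A" and s: "sm (adiff B (j a) (j a')) r" for a a' r
    using le[OF A.diff_closed[OF a], of r] s star_hom_diff[OF p A.star_algebra_axioms a] star_hom_diff[OF j A.star_algebra_axioms a] by simp
  have dist2: "anorm D (adiff D (\<pi> a) (\<pi> a')) \<le> r + r'"
    if b: "b \<in> acarrier B" and a: "a \<in> acarrier A" "a' \<in> acarrier A"
      and s: "sm (adiff B b (j a)) r" "sm (adiff B b (j a')) r'" for a a' b r r'
  proof (rule dist[OF a])
    have c: "j a \<in> acarrier B" "j a' \<in> acarrier B" using jc a by blast+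
    have "sm (adiff B (adiff B b (j a')) (adiff B b (j a))) (r' + r)"
      using sm_diff[OF _ _ s(2,1)] B.diff_closed b c by blast
    moreover have "adiff B (adiff B b (j a')) (adiff B b (j a)) = adiff B (j a) (j a')"
    proof -
      have "adiff B (adiff B b (j a')) (adiff B b (j a)) = aadd B (adiff B b (j a')) (adiff B (j a) b)"
        using B.diff_swap[OF b c(1)] by (simp add: adiff_def[of B "adiff B b (j a')"])
      also have "\<dots> = aadd B (adiff B (j a) b) (adiff B b (j a'))" by (rule B.add_commute) (auto simp: B.diff_closed b c)
      also have "\<dots> = adiff B (j a) (j a')" using B.diff_trans[OF c(1) b c(2)] by simp
      finally show ?thesis .
    qed
    ultimately show "sm (adiff B (j a) (j a')) (r + r')" by (simp add: add.commute)
  qed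
  define lim where "lim b d \<longleftrightarrow> d \<in> acarrier D \<and> (\<forall>a\<in>acarrier A. \<forall>r. sm (adiff B b (j a)) r \<longrightarrow> anorm D (adiff D d (\<pi> a)) \<le> r)" for b d
  have ex: "\<exists>d. lim b d" if b: "b \<in> acarrier B" for b
  proof -
    have "\<forall>n. \<exists>a\<in>acarrier A. sm (adiff B b (j a)) (inverse (real (Suc n)))" using dense[OF b] by simp
    then obtain \<sigma> where s: "\<And>n. \<sigma> n \<in> acarrier A" "\<And>n. sm (adiff B b (j (\<sigma> n))) (inverse (real (Suc n)))" by metis
    have "Cauchy_in D (anorm D) (\<lambda>n. \<pi> (\<sigma> n))"
      unfolding Cauchy_in_def
    proof (intro conjI allI impI pc s)
      fix \<epsilon> :: real assume "\<epsilon> > 0"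
      then obtain N where N: "inverse (real (Suc N)) < \<epsilon> / 2" using reals_Archimedean[of "\<epsilon> / 2"] by auto
      have "anorm D (adiff D (\<pi> (\<sigma> m)) (\<pi> (\<sigma> n))) < \<epsilon>" if "m \<ge> N" "n \<ge> N" for m n
      proof -
        have "inverse (real (Suc m)) \<le> inverse (real (Suc N))" "inverse (real (Suc n)) \<le> inverse (real (Suc N))"
          using that by (auto intro!: le_imp_inverse_le)
        then show ?thesis using dist2[OF b s(1) s(1) s(2) s(2), of m n] N by linarith
      qed
      then show "\<exists>N. \<forall>m\<ge>N. \<forall>n\<ge>N. anorm D (adiff D (\<pi> (\<sigma> m)) (\<pi> (\<sigma> n))) < \<epsilon>" by blast
    qed
    from D.complete[OF this] obtain d where d: "d \<in> acarrier D" "(\<lambda>n. anorm D (adiff D (\<pi> (\<sigma> n)) d)) \<longlonglongrightarrow> 0" by blast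
    have "anorm D (adiff D d (\<pi> a)) \<le> r" if a: "a \<in> acarrier A" and r: "sm (adiff B b (j a)) r" for a r
    proof -
      have "(\<lambda>n. anorm D (adiff D (\<pi> (\<sigma> n)) d) + (inverse (real (Suc n)) + r)) \<longlonglongrightarrow> 0 + (0 + r)"
        by (intro tendsto_add d LIMSEQ_inverse_real_of_nat tendsto_const)
      moreover have "anorm D (adiff D d (\<pi> a)) \<le> anorm D (adiff D (\<pi> (\<sigma> n)) d) + (inverse (real (Suc n)) + r)" for n
        using DN.q_trans[OF d(1) pc[OF s(1)[of n]] pc[OF a]] DN.q_swap[OF d(1) pc[OF s(1)[of n]]] dist2[OF b s(1) a s(2) r, of n]
        by linarith
      ultimately show ?thesis using LIMSEQ_le_const[of _ "0 + (0 + r)"] by auto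
    qed
    then show ?thesis using d(1) unfolding lim_def by blast
  qed
  define \<rho> where "\<rho> b = (SOME d. lim b d)" for b
  have \<rho>: "lim b (\<rho> b)" if "b \<in> acarrier B" for b unfolding \<rho>_def using someI_ex[OF ex[OF that]] .
  have \<rho>c: "\<rho> b \<in> acarrier D" if "b \<in> acarrier B" for b using \<rho>[OF that] by (simp add: lim_def)
  have \<rho>l: "anorm D (adiff D (\<rho> b) (\<pi> a)) \<le> r" if "b \<in> acarrier B" "a \<in> acarrier A" "sm (adiff B b (j a)) r" for a b r
    using \<rho>[OF that(1)] that by (simp add: lim_def)
  have jh: "j (aadd A a a') = aadd B (j a) (j a')" "j (amult A a a') = amult B (j a) (j a')" "j (ascale A k a) = ascale B k (j a)"
    "j (astar A a) = astar B (j a)" if "a \<in> acarrier A" "a' \<in> acarrier A" for a a' k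
    using j that by (auto simp: star_hom_def)
  have ph: "\<pi> (aadd A a a') = aadd D (\<pi> a) (\<pi> a')" "\<pi> (amult A a a') = amult D (\<pi> a) (\<pi> a')" "\<pi> (ascale A k a) = ascale D k (\<pi> a)"
    "\<pi> (astar A a) = astar D (\<pi> a)" if "a \<in> acarrier A" "a' \<in> acarrier A" for a a' k
    using p that by (auto simp: star_hom_def)
  have near: "anorm D (adiff D (\<rho> b) d) \<le> r + r'"
    if "b \<in> acarrier B" "a \<in> acarrier A" "sm (adiff B b (j a)) r" "d \<in> acarrier D" "anorm D (adiff D d (\<pi> a)) \<le> r'" for a b d r r'
    using DN.q_trans[OF \<rho>c[OF that(1)] pc[OF that(2)] that(4)] \<rho>l[OF that(1-3)] DN.q_swap[OF that(4) pc[OF that(2)]] that(5) by linarith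
  have bound: "anorm D (\<rho> b) \<le> r" if b: "b \<in> acarrier B" and r: "sm b r" for b r
  proof -
    let ?z = "azero A"
    have z: "j ?z = azero B" "\<pi> ?z = azero D"
      using jh(3)[OF A.zero_closed A.zero_closed, of 0] ph(3)[OF A.zero_closed A.zero_closed, of 0]
      by (simp_all add: A.scale_0 B.scale_0 D.scale_0 A.closed jc pc)
    then show ?thesis using \<rho>l[OF b A.zero_closed, of r] r B.diff_zero[OF b] D.diff_zero[OF \<rho>c[OF b]] by simp
  qed
  have "star_hom B D \<rho>"
    unfolding star_hom_def
  proof (intro conjI ballI allI)
    fix b assume b: "b \<in> acarrier B"
    note cb = \<rho>c[OF b]
    show "\<rho> b \<in> acarrier D" by (rule cb)
    show "\<rho> (ascale B k b) = ascale D k (\<rho> b)" for k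
    proof (rule D_eqI)
      fix \<epsilon> :: real assume e: "\<epsilon> > 0"
      define \<delta> where "\<delta> = \<epsilon> / (2 * (cmod k + 1))"
      have d: "\<delta> > 0" using e unfolding \<delta>_def by (simp add: add_nonneg_pos)
      obtain a where a: "a \<in> acarrier A" "sm (adiff B b (j a)) \<delta>" using dense[OF b d] by blast
      have s: "sm (adiff B (ascale B k b) (j (ascale A k a))) (cmod k * \<delta>)"
        using sm_scale[OF _ a(2), of k] by (simp add: jh[OF a(1) a(1)] B.diff_scale b jc a B.diff_closed)
      have "anorm D (adiff D (ascale D k (\<rho> b)) (\<pi> (ascale A k a))) \<le> cmod k * \<delta>"
        using \<rho>l[OF b a] by (simp add: ph[OF a(1) a(1)] DN.q_scale_diff cb pc a mult_left_mono)
      from near[OF _ _ s _ this] have "anorm D (adiff D (\<rho> (ascale B k b)) (ascale D k (\<rho> b))) \<le> cmod k * \<delta> + cmod k * \<delta>"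
        using b a cb by (simp add: B.closed A.closed D.closed)
      also have "\<dots> \<le> 2 * (cmod k + 1) * \<delta>" using d by (simp add: algebra_simps)
      also have "\<dots> = \<epsilon>" unfolding \<delta>_def using norm_ge_zero[of k] by (simp add: field_simps add_nonneg_eq_0_iff)
      finally show "anorm D (adiff D (\<rho> (ascale B k b)) (ascale D k (\<rho> b))) \<le> \<epsilon>" .
    qed (use b cb \<rho>c in \<open>auto simp: B.closed D.closed\<close>)
    show "\<rho> (astar B b) = astar D (\<rho> b)"
    proof (rule D_eqI)
      fix \<epsilon> :: real assume "\<epsilon> > 0"
      then have d: "\<epsilon> / 2 > 0" by simp
      obtain a where a: "a \<in> acarrier A" "sm (adiff B b (j a)) (\<epsilon> / 2)" using dense[OF b d] by blast
      have s: "sm (adiff B (astar B b) (j (astar A a))) (\<epsilon> / 2)"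
        using sm_star[OF _ a(2)] by (simp add: jh[OF a(1) a(1)] B.diff_star b jc a B.diff_closed)
      have "anorm D (adiff D (astar D (\<rho> b)) (\<pi> (astar A a))) \<le> \<epsilon> / 2"
        using \<rho>l[OF b a] by (simp add: ph[OF a(1) a(1)] DN.q_star_diff cb pc a)
      from near[OF _ _ s _ this] show "anorm D (adiff D (\<rho> (astar B b)) (astar D (\<rho> b))) \<le> \<epsilon>"
        using b a cb by (simp add: B.closed A.closed D.closed)
    qed (use b cb \<rho>c in \<open>auto simp: B.closed D.closed\<close>)
    fix b' assume b': "b' \<in> acarrier B"
    note cb' = \<rho>c[OF b']
    show "\<rho> (aadd B b b') = aadd D (\<rho> b) (\<rho> b')"
    proof (rule D_eqI)
      fix \<epsilon> :: real assume "\<epsilon> > 0"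
      then have d: "\<epsilon> / 4 > 0" by simp
      obtain a where a: "a \<in> acarrier A" "sm (adiff B b (j a)) (\<epsilon> / 4)" using dense[OF b d] by blast
      obtain a' where a': "a' \<in> acarrier A" "sm (adiff B b' (j a')) (\<epsilon> / 4)" using dense[OF b' d] by blast
      have s: "sm (adiff B (aadd B b b') (j (aadd A a a'))) (\<epsilon> / 4 + \<epsilon> / 4)"
        using sm_add[OF _ _ a(2) a'(2)] by (simp add: jh[OF a(1) a'(1)] B.diff_add_add b b' jc a a' B.diff_closed)
      have "anorm D (adiff D (aadd D (\<rho> b) (\<rho> b')) (\<pi> (aadd A a a'))) \<le> \<epsilon> / 4 + \<epsilon> / 4"
        using \<rho>l[OF b a] \<rho>l[OF b' a'] DN.q_add_diff[OF cb cb' pc[OF a(1)] pc[OF a'(1)]] by (simp add: ph[OF a(1) a'(1)])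
      from near[OF _ _ s _ this] show "anorm D (adiff D (\<rho> (aadd B b b')) (aadd D (\<rho> b) (\<rho> b'))) \<le> \<epsilon>"
        using b b' a a' cb cb' by (simp add: B.closed A.closed D.closed)
    qed (use b b' cb cb' \<rho>c in \<open>auto simp: B.closed D.closed\<close>)
    show "\<rho> (amult B b b') = amult D (\<rho> b) (\<rho> b')"
    proof (rule D_eqI)
      fix \<epsilon> :: real assume e: "\<epsilon> > 0"
      obtain N N' where N: "sm b N" "sm b' N'" using sm_ex b b' by blast
      have N0: "N \<ge> 0" "N' \<ge> 0" using sm_nonneg N b b' by blast+
      \<comment> \<open>The final error is
        \<open>2 * (\<delta> * N' + (N + \<delta>) * \<delta>)\<close>, and
        \<open>\<delta> \<le> 1\<close> makes this at most
        \<open>\<delta> * (2 * (N' + N + 1))\<close>.\<close>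
      define \<delta> where "\<delta> = min 1 (\<epsilon> / (2 * (N' + N + 1)))"
      have W: "2 * (N' + N + 1) > 0" using N0 by simp
      have "\<delta> \<le> \<epsilon> / (2 * (N' + N + 1))" by (simp only: \<delta>_def min.cobounded2)
      then have d: "\<delta> > 0" "\<delta> \<le> 1" "\<delta> * (2 * (N' + N + 1)) \<le> \<epsilon>"
        using e W by (simp_all only: pos_le_divide_eq[OF W]) (simp_all add: \<delta>_def)
      obtain a where a: "a \<in> acarrier A" "sm (adiff B b (j a)) \<delta>" using dense[OF b d(1)] by blast
      obtain a' where a': "a' \<in> acarrier A" "sm (adiff B b' (j a')) \<delta>" using dense[OF b' d(1)] by blast
      have ja: "j a \<in> acarrier B" "j a' \<in> acarrier B" using jc a a' by blast+
      \<comment> \<open>The bound for \<open>j a\<close> is obtained by writing it as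
        \<open>b - (b - j a)\<close>.\<close>
      have "sm (adiff B b (adiff B b (j a))) (N + \<delta>)" using sm_diff[OF b _ N(1) a(2)] B.diff_closed b ja by blast
      moreover have "adiff B b (adiff B b (j a)) = j a"
        by (metis B.add_commute B.diff_add_cancel B.diff_closed B.diff_swap B.diff_trans B.diff_zero B.zero_closed B.diff_self B.add_zero adiff_def b ja(1))
      ultimately have sa: "sm (j a) (N + \<delta>)" by simp
      have s: "sm (adiff B (amult B b b') (j (amult A a a'))) (\<delta> * N' + (N + \<delta>) * \<delta>)"
        unfolding jh(2)[OF a(1) a'(1)] B.diff_mult[OF b b' ja]
        by (intro sm_add sm_mult N a a' sa) (auto simp: B.closed B.diff_closed b b' ja)
      have pa: "anorm D (\<pi> a) \<le> N + \<delta>" by (rule le[OF a(1) sa])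
      have "anorm D (adiff D (amult D (\<rho> b) (\<rho> b')) (\<pi> (amult A a a'))) \<le>
          anorm D (adiff D (\<rho> b) (\<pi> a)) * anorm D (\<rho> b') + anorm D (\<pi> a) * anorm D (adiff D (\<rho> b') (\<pi> a'))"
        using DN.q_mult_diff[OF cb cb' pc[OF a(1)] pc[OF a'(1)]] by (simp add: ph[OF a(1) a'(1)])
      also have "\<dots> \<le> \<delta> * N' + (N + \<delta>) * \<delta>"
        using \<rho>l[OF b a] \<rho>l[OF b' a'] bound[OF b' N(2)] pa d N0
        by (intro add_mono mult_mono) (auto simp: DN.q_nonneg D.diff_closed cb cb' pc a a')
      finally have q: "anorm D (adiff D (amult D (\<rho> b) (\<rho> b')) (\<pi> (amult A a a'))) \<le> \<delta> * N' + (N + \<delta>) * \<delta>" .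
      have "anorm D (adiff D (\<rho> (amult B b b')) (amult D (\<rho> b) (\<rho> b'))) \<le> (\<delta> * N' + (N + \<delta>) * \<delta>) + (\<delta> * N' + (N + \<delta>) * \<delta>)"
        using near[OF _ _ s _ q] b b' a a' cb cb' by (simp add: B.closed A.closed D.closed)
      also have "\<dots> \<le> \<delta> * (2 * (N' + N + 1))"
      proof -
        have "\<delta> * \<delta> \<le> \<delta> * 1" using d by (intro mult_left_mono) auto
        then show ?thesis by (simp add: algebra_simps)
      qed
      finally show "anorm D (adiff D (\<rho> (amult B b b')) (amult D (\<rho> b) (\<rho> b'))) \<le> \<epsilon>" using d(3) by simp
    qed (use b b' cb cb' \<rho>c in \<open>auto simp: B.closed D.closed\<close>)
  qed
  moreover have "\<rho> (j a) = \<pi> a" if a: "a \<in> acarrier A" for a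
  proof (rule D_eqI)
    \<comment> \<open>Zero has some bound, and scaling by 0 turns it into the bound 0.\<close>
    have z: "sm (azero B) 0"
    proof -
      obtain r where "sm (azero B) r" using sm_ex B.zero_closed by blast
      from sm_scale[OF B.zero_closed this, of 0] show ?thesis by (simp add: B.scale_0 B.zero_closed)
    qed
    fix \<epsilon> :: real assume e: "\<epsilon> > 0"
    have "anorm D (adiff D (\<rho> (j a)) (\<pi> a)) \<le> 0" using \<rho>l[OF jc[OF a] a, of 0] z by (simp add: B.diff_self jc a)
    then show "anorm D (adiff D (\<rho> (j a)) (\<pi> a)) \<le> \<epsilon>" using e by simp
  qed (use a in \<open>auto simp: \<rho>c jc pc\<close>)
  ultimately show ?thesis using bound by blast
qed

end

section \<open>The isomorphism\<close>

context lch_action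
begin

interpretation ZK: lch_action Z \<kappa> by (rule KS_lch_action)

lemma KS_groupoid_GG: "KS_groupoid X \<theta> = ZK.GG"
  by (simp add: KS_groupoid_def)

text \<open>\<open>\<rho>\<close> extends \<open>phi\<close> from compact supports to C_0, and
  \<open>\<psi>\<close> extends the inverse of \<open>phi\<close> from its image to the whole
  algebra of the groupoid; the universal property turns them into \<open>P\<close> and
  \<open>R\<close>. These are mutually inverse because they are so on dense subalgebras.\<close>

lemma isomorphism:
  "\<exists>\<Phi>. cstar_isomorphism (enveloping (Al False)) (enveloping (groupoid_algebra ZK.GG)) \<Phi> \<and>
    (\<forall>a\<in>carr True. \<Phi> (env_map (Al False) a) = env_map (groupoid_algebra ZK.GG) (phi a))"
proof -
  let ?C = "Al True" and ?A = "Al False" and ?B = "groupoid_algebra ZK.GG"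
  interpret A: bounded_star_algebra ?A by (rule alg_bounded)
  interpret B: bounded_star_algebra ?B by (rule ZK.groupoid_bounded)
  interpret A0: star_algebra ?C by (rule alg_star_algebra)
  have sub: "carr True \<subseteq> carr False" using carr_True by blast
  have id: "star_hom ?C ?A (\<lambda>a. a)" using sub by (auto simp: star_hom_def)
  define smA where "smA a r \<longleftrightarrow> nsum a \<le> r" for a :: "'s \<Rightarrow> 'x \<Rightarrow> complex" and r
  \<comment> \<open>The quotient seminorm of \<open>nsum\<close> along \<open>ZK.Qm\<close>, stated
    through the bounds that some representing family satisfies.\<close>
  define smB where "smB b r \<longleftrightarrow> (\<exists>c\<in>ZK.carr True. ZK.Qm c = b \<and> nsum c \<le> r)" for b r
  have B_ops: "aadd ?B = (\<lambda>f g \<gamma>. f \<gamma> + g \<gamma>)" "ascale ?B = (\<lambda>k f \<gamma>. k * f \<gamma>)" "adiff ?B = (\<lambda>f g \<gamma>. f \<gamma> - g \<gamma>)"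
    by (auto simp: groupoid_algebra_def adiff_def fun_eq_iff)
  have dA: "dense_hom ?C ?A D (\<lambda>a. a) smA" if D: "cstar_algebra D" for D :: "('d, 'n) cstar_alg_scheme"
  proof -
    show ?thesis
    proof (intro dense_hom.intro dense_hom_axioms.intro alg_star_algebra D, unfold smA_def)
      show "star_hom ?C ?A (\<lambda>a. a)" by (rule id)
      fix a b and r r' :: real and k assume a: "a \<in> carr False"
      show "\<exists>r. nsum a \<le> r" by blast
      show "0 \<le> r" if "nsum a \<le> r" using nsum_nonneg[OF a] that by simp
      show "nsum (ascale ?A k a) \<le> cmod k * r" if "nsum a \<le> r"
        using nsum_scale[OF a, of k] mult_left_mono[OF that norm_ge_zero[of k]] by simp
      show "nsum (astar ?A a) \<le> r" if "nsum a \<le> r" using nsum_star[OF a] that by simp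
      assume b: "b \<in> carr False" and l: "nsum a \<le> r" "nsum b \<le> r'"
      show "nsum (aadd ?A a b) \<le> r + r'" using nsum_add[OF a b] l by simp
      show "nsum (amult ?A a b) \<le> r * r'"
        using nsum_mult[OF a b] mult_mono[OF l _ nsum_nonneg[OF b]] nsum_nonneg[OF a] l by simp
    next
      fix a and \<epsilon> :: real assume "a \<in> carr False" "\<epsilon> > 0"
      then show "\<exists>b\<in>carr True. nsum (adiff ?A a b) \<le> \<epsilon>" using Cc_dense_C0 by simp
    qed
  qed
  have dB: "dense_hom ?C ?B D phi smB" if D: "cstar_algebra D" for D :: "('d, 'n) cstar_alg_scheme"
  proof -
    interpret D: cstar_algebra D by fact
    note QC = ZK.groupoid_carrier
    show ?thesis
    proof (unfold_locales, unfold smB_def)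
      show "star_hom ?C ?B phi" by (rule phi_hom)
      fix b b' and r r' :: real and k assume b: "b \<in> acarrier ?B"
      show "\<exists>r. \<exists>c\<in>ZK.carr True. ZK.Qm c = b \<and> nsum c \<le> r" using b unfolding QC by blast
      show "0 \<le> r" if "\<exists>c\<in>ZK.carr True. ZK.Qm c = b \<and> nsum c \<le> r" using that ZK.nsum_nonneg order_trans by blast
      show "\<exists>c\<in>ZK.carr True. ZK.Qm c = ascale ?B k b \<and> nsum c \<le> cmod k * r" if r: "\<exists>c\<in>ZK.carr True. ZK.Qm c = b \<and> nsum c \<le> r"
      proof -
        obtain c where c: "c \<in> ZK.carr True" "ZK.Qm c = b" "nsum c \<le> r" using r by blast
        have "nsum (\<lambda>s x. k * c s x) \<le> cmod k * r"
          using ZK.nsum_scale[OF c(1), of k] mult_left_mono[OF c(3) norm_ge_zero[of k]] by simp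
        then show ?thesis using ZK.carr_scale[OF c(1)] ZK.Qm_scale[OF c(1)] c(2) unfolding B_ops by blast
      qed
      show "\<exists>c\<in>ZK.carr True. ZK.Qm c = astar ?B b \<and> nsum c \<le> r" if r: "\<exists>c\<in>ZK.carr True. ZK.Qm c = b \<and> nsum c \<le> r"
      proof -
        obtain c where c: "c \<in> ZK.carr True" "ZK.Qm c = b" "nsum c \<le> r" using r by blast
        show ?thesis using ZK.carr_star[OF c(1)] ZK.Qm_star[OF c(1)] ZK.nsum_star[OF c(1)] c(2,3) order_trans by blast
      qed
      assume l: "\<exists>c\<in>ZK.carr True. ZK.Qm c = b \<and> nsum c \<le> r" "\<exists>c\<in>ZK.carr True. ZK.Qm c = b' \<and> nsum c \<le> r'"
      then obtain c c' where c: "c \<in> ZK.carr True" "ZK.Qm c = b" "nsum c \<le> r" and c': "c' \<in> ZK.carr True" "ZK.Qm c' = b'" "nsum c' \<le> r'" by blast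
      have "nsum (\<lambda>s x. c s x + c' s x) \<le> r + r'" using ZK.nsum_add[OF c(1) c'(1)] c(3) c'(3) by simp
      then show "\<exists>c\<in>ZK.carr True. ZK.Qm c = aadd ?B b b' \<and> nsum c \<le> r + r'"
        using ZK.carr_add[OF c(1) c'(1)] ZK.Qm_add[OF c(1) c'(1)] c(2) c'(2) unfolding B_ops by blast
      have "nsum (amult (KS_algebraic Z \<kappa>) c c') \<le> r * r'"
        using ZK.nsum_mult[OF c(1) c'(1)] mult_mono[OF c(3) c'(3) _ ZK.nsum_nonneg[OF c'(1)]] ZK.nsum_nonneg[OF c(1)] c(3) by simp
      then show "\<exists>c\<in>ZK.carr True. ZK.Qm c = amult ?B b b' \<and> nsum c \<le> r * r'"
        using ZK.carr_mult[OF c(1) c'(1)] ZK.Qm_mult[OF c(1) c'(1)] c(2) c'(2) by blast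
    next
      fix b and \<epsilon> :: real assume "b \<in> acarrier ?B" "\<epsilon> > 0"
      then show "\<exists>a\<in>carr True. \<exists>c\<in>ZK.carr True. ZK.Qm c = adiff ?B b (phi a) \<and> nsum c \<le> \<epsilon>"
        unfolding QC B_ops using phi_dense by blast
    qed
  qed
  have nA: "env_norm ?A a \<le> r" if "a \<in> carr False" "smA a r" for a r
  proof (rule A.env_norm_least)
    fix p assume "cstar_seminorm ?A p"
    then show "p a \<le> r" using seminorm_le_nsum[OF _ that(1)] that(2) order_trans unfolding smA_def by blast
  qed
  have nB: "env_norm ?B b \<le> r" if br: "smB b r" for b r
  proof (rule B.env_norm_least)
    fix p assume p: "cstar_seminorm ?B p"
    obtain c where c: "c \<in> ZK.carr True" "ZK.Qm c = b" "nsum c \<le> r" using br unfolding smB_def by blast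
    have "cstar_seminorm (alg True Z \<kappa>) (\<lambda>a. p (ZK.Qm a))"
      by (rule cstar_seminorm_comp[OF ZK.alg_star_algebra ZK.Qm_hom p])
    from ZK.seminorm_le_nsum[OF this c(1)] show "p b \<le> r" using c(2,3) by simp
  qed
  have nphi: "env_norm ?B (phi a) \<le> r" if a: "a \<in> carr True" and r: "smA a r" for a r
  proof (rule B.env_norm_least)
    fix p assume p: "cstar_seminorm ?B p"
    have "cstar_seminorm ?C (\<lambda>a. p (phi a))" by (rule cstar_seminorm_comp[OF alg_star_algebra phi_hom p])
    from seminorm_le_nsum[OF this a] show "p (phi a) \<le> r" using r unfolding smA_def by simp
  qed
  \<comment> \<open>Restricted to compact supports, the enveloping seminorm of \<open>?A\<close> is
    a C*-seminorm of \<open>?C\<close>, so the estimate \<open>seminorm_le_nsum_phi\<close> applies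
    to it. This is the boundedness of the inverse of \<open>phi\<close>.\<close>
  have nsub: "env_norm ?A a \<le> r" if a: "a \<in> carr True" and r: "smB (phi a) r" for a r
  proof -
    obtain c where c: "c \<in> ZK.carr True" "ZK.Qm c = phi a" "nsum c \<le> r" using r unfolding smB_def by blast
    have "cstar_seminorm ?C (env_norm ?A)" using cstar_seminorm_comp[OF alg_star_algebra id A.env_norm_seminorm] .
    from seminorm_le_nsum_phi[OF this a c(1)] show ?thesis using c(2,3) by simp
  qed
  note CA = A.env_cstar_algebra and CB = B.env_cstar_algebra
  \<comment> \<open>\<open>AB\<close> and \<open>BA\<close> serve for the existence of the two
    extensions, \<open>AA\<close> and \<open>BB\<close> for the uniqueness that makes them mutually
    inverse.\<close>
  interpret AB: dense_hom ?C ?A "enveloping ?B" "\<lambda>a. a" smA by (rule dA[OF CB])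
  interpret AA: dense_hom ?C ?A "enveloping ?A" "\<lambda>a. a" smA by (rule dA[OF CA])
  interpret BA: dense_hom ?C ?B "enveloping ?A" phi smB by (rule dB[OF CA])
  interpret BB: dense_hom ?C ?B "enveloping ?B" phi smB by (rule dB[OF CB])
  have phc: "phi a \<in> acarrier ?B" if "a \<in> carr True" for a using phi_hom that by (auto simp: star_hom_def)
  have h1: "star_hom ?C (enveloping ?B) (\<lambda>a. env_map ?B (phi a))" by (rule star_hom_comp[OF phi_hom B.env_map_hom])
  have "anorm (enveloping ?B) (env_map ?B (phi a)) \<le> r" if "a \<in> carr True" "smA a r" for a r
    using nphi[OF that] B.env_map_norm[OF phc[OF that(1)]] by simp
  from AB.hom_extend[OF h1 this] obtain \<rho> where \<rho>: "star_hom ?A (enveloping ?B) \<rho>"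
    "\<And>a. a \<in> carr True \<Longrightarrow> \<rho> a = env_map ?B (phi a)"
    "\<And>a r. a \<in> carr False \<Longrightarrow> smA a r \<Longrightarrow> anorm (enveloping ?B) (\<rho> a) \<le> r" by blast
  have h2: "star_hom ?C (enveloping ?A) (env_map ?A)" using star_hom_comp[OF id A.env_map_hom] by simp
  have "anorm (enveloping ?A) (env_map ?A a) \<le> r" if "a \<in> carr True" "smB (phi a) r" for a r
    using nsub[OF that] A.env_map_norm[of a] sub that(1) by auto
  from BA.hom_extend[OF h2 this] obtain \<psi> where \<psi>: "star_hom ?B (enveloping ?A) \<psi>"
    "\<And>a. a \<in> carr True \<Longrightarrow> \<psi> (phi a) = env_map ?A a"
    "\<And>b r. b \<in> acarrier ?B \<Longrightarrow> smB b r \<Longrightarrow> anorm (enveloping ?A) (\<psi> b) \<le> r" by blast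
  obtain P where P: "star_hom (enveloping ?A) (enveloping ?B) P"
    "\<And>u. u \<in> acarrier (enveloping ?A) \<Longrightarrow> anorm (enveloping ?B) (P u) \<le> anorm (enveloping ?A) u"
    "\<And>a. a \<in> carr False \<Longrightarrow> P (env_map ?A a) = \<rho> a" using A.env_universal[OF CB \<rho>(1)] by blast
  obtain R where R: "star_hom (enveloping ?B) (enveloping ?A) R"
    "\<And>u. u \<in> acarrier (enveloping ?B) \<Longrightarrow> anorm (enveloping ?A) (R u) \<le> anorm (enveloping ?B) u"
    "\<And>b. b \<in> acarrier ?B \<Longrightarrow> R (env_map ?B b) = \<psi> b" using B.env_universal[OF CA \<psi>(1)] by blast
  have Pc: "P u \<in> acarrier (enveloping ?B)" if "u \<in> acarrier (enveloping ?A)" for u using P(1) that by (auto simp: star_hom_def)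
  have Rc: "R u \<in> acarrier (enveloping ?A)" if "u \<in> acarrier (enveloping ?B)" for u using R(1) that by (auto simp: star_hom_def)
  have \<rho>c: "\<rho> a \<in> acarrier (enveloping ?B)" if "a \<in> carr False" for a using \<rho>(1) that by (auto simp: star_hom_def)
  have \<psi>c: "\<psi> b \<in> acarrier (enveloping ?A)" if "b \<in> acarrier ?B" for b using \<psi>(1) that by (auto simp: star_hom_def)
  \<comment> \<open>Both sides are bounded by \<open>nsum\<close> and agree on compactly supported
    families, hence everywhere by density.\<close>
  have RP0: "R (\<rho> a) = env_map ?A a" if "a \<in> carr False" for a
  proof (rule AA.hom_unique[of "\<lambda>a. R (\<rho> a)" "env_map ?A"])
    show "star_hom ?A (enveloping ?A) (\<lambda>a. R (\<rho> a))" by (rule star_hom_comp[OF \<rho>(1) R(1)])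
    show "star_hom ?A (enveloping ?A) (env_map ?A)" by (rule A.env_map_hom)
    show "anorm (enveloping ?A) (R (\<rho> b)) \<le> r" if "b \<in> carr False" "smA b r" for b r
      using R(2)[OF \<rho>c[OF that(1)]] \<rho>(3)[OF that] by simp
    show "anorm (enveloping ?A) (env_map ?A b) \<le> r" if "b \<in> carr False" "smA b r" for b r
      using nA[OF that] A.env_map_norm[OF that(1)] by simp
    show "R (\<rho> b) = env_map ?A b" if "b \<in> carr True" for b using \<rho>(2) R(3) \<psi>(2) phc that by simp
  qed (rule that)
  have PR0: "P (\<psi> b) = env_map ?B b" if "b \<in> acarrier ?B" for b
  proof (rule BB.hom_unique[of "\<lambda>b. P (\<psi> b)" "env_map ?B"])
    show "star_hom ?B (enveloping ?B) (\<lambda>b. P (\<psi> b))" by (rule star_hom_comp[OF \<psi>(1) P(1)])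
    show "star_hom ?B (enveloping ?B) (env_map ?B)" by (rule B.env_map_hom)
    show "anorm (enveloping ?B) (P (\<psi> b)) \<le> r" if "b \<in> acarrier ?B" "smB b r" for b r
      using P(2)[OF \<psi>c[OF that(1)]] \<psi>(3)[OF that] by simp
    show "anorm (enveloping ?B) (env_map ?B b) \<le> r" if "b \<in> acarrier ?B" "smB b r" for b r
      using nB[OF that(2)] B.env_map_norm[OF that(1)] by simp
    show "P (\<psi> (phi a)) = env_map ?B (phi a)" if "a \<in> carr True" for a using \<psi>(2) P(3) \<rho>(2) sub that by auto
  qed (rule that)
  have ids: "star_hom E E (\<lambda>u. u)" for E :: "('e, 'm) star_alg_scheme" by (simp add: star_hom_def)
  have RP: "R (P u) = u" if u: "u \<in> acarrier (enveloping ?A)" for u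
  proof (rule A.env_universal_unique[OF CA star_hom_comp[OF P(1) R(1)] _ ids _ _ u])
    show "\<forall>u\<in>acarrier (enveloping ?A). anorm (enveloping ?A) (R (P u)) \<le> anorm (enveloping ?A) u"
      using R(2) P(2) Pc order_trans by blast
  qed (use P(3) RP0 in auto)
  have PR: "P (R u) = u" if u: "u \<in> acarrier (enveloping ?B)" for u
  proof (rule B.env_universal_unique[OF CB star_hom_comp[OF R(1) P(1)] _ ids _ _ u])
    show "\<forall>u\<in>acarrier (enveloping ?B). anorm (enveloping ?B) (P (R u)) \<le> anorm (enveloping ?B) u"
      using R(2) P(2) Rc order_trans by blast
  qed (use R(3) PR0 in auto)
  have "bij_betw P (acarrier (enveloping ?A)) (acarrier (enveloping ?B))"
    by (rule bij_betw_byWitness[where f' = R]) (use RP PR Pc Rc in auto)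
  then have "cstar_isomorphism (enveloping ?A) (enveloping ?B) P" using CA CB P(1) by (simp add: cstar_isomorphism_def)
  moreover have "P (env_map ?A a) = env_map ?B (phi a)" if "a \<in> carr True" for a using P(3) \<rho>(2) sub that by auto
  ultimately show ?thesis by blast
qed

lemma phi_delta_Cc:
  assumes f: "f \<in> Cc (subtopology X (act_dom \<theta> (s\<^sup>\<star> * s)))"
  shows "delta s f \<in> carr True"
    "phi (delta s f) \<in> Cc (subtopology (gtop ZK.GG) (germ \<kappa> s ` KS_dom X \<theta> (s\<^sup>\<star> * s)))"
    "\<And>\<tau>. \<tau> \<in> KS_dom X \<theta> (s\<^sup>\<star> * s) \<Longrightarrow> phi (delta s f) (germ \<kappa> s \<tau>) = f (the (\<tau> (s\<^sup>\<star> * s)))"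
proof -
  have F: "f \<in> Fn True X (dm s)" using f Fn_True_eq_Cc[OF Haus openin_dm, of s] by (simp add: dm_def)
  then show "delta s f \<in> carr True" by (rule delta_carr)
  show "phi (delta s f) \<in> Cc (subtopology (gtop ZK.GG) (germ \<kappa> s ` KS_dom X \<theta> (s\<^sup>\<star> * s)))"
    using ZK.br_Cc[OF Jf_ZK[OF F]] by (simp add: phi_delta ZK_dm)
  fix \<tau> assume t: "\<tau> \<in> KS_dom X \<theta> (s\<^sup>\<star> * s)"
  then have "\<tau> \<in> ZK.dm s" by (simp add: ZK_dm)
  then show "phi (delta s f) (germ \<kappa> s \<tau>) = f (the (\<tau> (s\<^sup>\<star> * s)))"
    using t ZK.same_germ_refl by (auto simp: phi_delta ZK.br_germ Jf_def KS_dom_iff)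
qed

end

theorem mainTheorem2:
  fixes X :: "'x topology" and \<theta> :: "'s::inverse_semigroup \<Rightarrow> 'x \<rightharpoonup> 'x"
  assumes "locally_compact_space X" and "Hausdorff_space X" and "is_action X \<theta>"
  shows "\<exists>\<Phi>. cstar_isomorphism (KS_crossed_product X \<theta>) (groupoid_cstar_algebra (KS_groupoid X \<theta>)) \<Phi> \<and>
    (\<forall>s. \<forall>f \<in> Cc (subtopology X (act_dom \<theta> (s\<^sup>\<star> * s))).
      \<exists>h. h \<in> Cc (subtopology (gtop (KS_groupoid X \<theta>))
                    (germ (KS_action X \<theta>) s ` KS_dom X \<theta> (s\<^sup>\<star> * s))) \<and>
          h \<in> acarrier (groupoid_algebra (KS_groupoid X \<theta>)) \<and>
          (\<forall>\<tau> \<in> KS_dom X \<theta> (s\<^sup>\<star> * s).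
            h (germ (KS_action X \<theta>) s \<tau>) = f (the (\<tau> (s\<^sup>\<star> * s)))) \<and>
          \<Phi> (env_map (KS_algebraic X \<theta>) (delta s f)) =
            env_map (groupoid_algebra (KS_groupoid X \<theta>)) h)"
proof -
  interpret lch_action X \<theta> using assms by (simp add: lch_action_def)
  obtain \<Phi> where \<Phi>: "cstar_isomorphism (enveloping (Al False)) (enveloping (groupoid_algebra (KS_groupoid X \<theta>))) \<Phi>"
    "\<And>a. a \<in> carr True \<Longrightarrow> \<Phi> (env_map (Al False) a) = env_map (groupoid_algebra (KS_groupoid X \<theta>)) (phi a)"
    using isomorphism unfolding KS_groupoid_GG by blast
  have "phi a \<in> acarrier (groupoid_algebra (KS_groupoid X \<theta>))" if "a \<in> carr True" for a
    using phi_hom that unfolding KS_groupoid_GG by (auto simp: star_hom_def)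
  then show ?thesis
    using \<Phi> phi_delta_Cc
    unfolding KS_crossed_product_def groupoid_cstar_algebra_def alg_False[symmetric] KS_groupoid_GG
    by blast
qed

end
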